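(* Let $\alpha$ be a positive function on $\Omega$ that is constant on each subdomain $\Omega_j$. For all $v\in X(\Omega,\alpha)\cap PH^1(\Omega,\mathscr P)$ the following identity holds: $$\sum_{j=1}^m\int_{\Omega_j}\alpha|\nabla v|^2\,dx=\int_\Omega\left(\alpha|\nabla\times v|^2+\alpha^{-1}|\nabla\cdot(\alpha v)|^2\right)dx.$$
   Context: $\Omega\subset\mathbb R^3$ is a bounded polyhedral domain with Lipschitz boundary, partitioned into polyhedral subdomains $\mathscr P=\{\Omega_j\}_{j=1}^m$. $H_0(\mathrm{curl};\Omega)=\{v\in L^2(\Omega)^3:\nabla\times v\in L^2(\Omega)^3,\ v\times n=0\text{ on }\partial\Omega\}$. $X(\Omega,\alpha)=\{v\in H_0(\mathrm{curl};\Omega):\nabla\cdot(\alpha v)\in L^2(\Omega)\}$. $PH^1(\Omega,\mathscr P)=\{v\in L^2(\Omega)^3: v|_{\Omega_j}\in H^1(\Omega_j)^3,\ j=1,\dots,m\}$. $|\nabla v|$ is the Frobenius norm of the Jacobian matrix of $v$ taken on each $\Omega_j$. *)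

theory Defs
  imports "HOL-Analysis.Analysis"
begin

section \<open>Polyhedral Lipschitz domains and their partitions\<close>

text \<open>The boundary consists of finitely many plane polygons; nonconvex faces are unions of
  convex ones.\<close>

definition polyhedral_domain :: "(real^3) set \<Rightarrow> bool" where
  "polyhedral_domain U \<longleftrightarrow>
     open U \<and> connected U \<and> bounded U \<and> U \<noteq> {} \<and>
     (\<exists>\<F>. finite \<F> \<and> (\<forall>F\<in>\<F>. polytope F \<and> aff_dim F = 2) \<and> frontier U = \<Union>\<F>)"

text \<open>Near each boundary point, \<open>U\<close> is the strict subgraph, in some direction \<open>e\<close>, of a Lipschitz
  function on the hyperplane orthogonal to \<open>e\<close>.\<close>

definition lipschitz_boundary :: "(real^3) set \<Rightarrow> bool" where
  "lipschitz_boundary U \<longleftrightarrow>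
     (\<forall>x\<in>frontier U. \<exists>e r L \<gamma>. norm e = 1 \<and> r > 0 \<and> L-lipschitz_on {z. orthogonal z e} \<gamma> \<and>
        U \<inter> ball x r = {y \<in> ball x r. y \<bullet> e < \<gamma> (y - (y \<bullet> e) *\<^sub>R e)})"

definition polyhedral_partition :: "(real^3) set \<Rightarrow> nat \<Rightarrow> (nat \<Rightarrow> (real^3) set) \<Rightarrow> bool" where
  "polyhedral_partition U m \<P> \<longleftrightarrow>
     (\<forall>j\<in>{1..m}. polyhedral_domain (\<P> j) \<and> \<P> j \<subseteq> U) \<and>
     disjoint_family_on \<P> {1..m} \<and>
     closure U = (\<Union>j\<in>{1..m}. closure (\<P> j))"

section \<open>Test functions\<close>

definition partial :: "3 \<Rightarrow> (real^3 \<Rightarrow> real) \<Rightarrow> real^3 \<Rightarrow> real" where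
  "partial k f x = frechet_derivative f (at x) (axis k 1)"

primrec C_k :: "nat \<Rightarrow> (real^3 \<Rightarrow> real) \<Rightarrow> bool" where
  "C_k 0 f \<longleftrightarrow> continuous_on UNIV f"
| "C_k (Suc n) f \<longleftrightarrow> (\<forall>x. f differentiable at x) \<and> (\<forall>k. C_k n (partial k f))"

definition test_functions :: "(real^3) set \<Rightarrow> (real^3 \<Rightarrow> real) set" where
  "test_functions U =
     {\<phi>. (\<forall>n. C_k n \<phi>) \<and> compact (closure {x. \<phi> x \<noteq> 0}) \<and> closure {x. \<phi> x \<noteq> 0} \<subseteq> U}"

definition test_fields :: "(real^3) set \<Rightarrow> (real^3 \<Rightarrow> real^3) set" where
  "test_fields U = {\<phi>. \<forall>i. (\<lambda>x. \<phi> x $ i) \<in> test_functions U}"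

definition grad :: "(real^3 \<Rightarrow> real) \<Rightarrow> real^3 \<Rightarrow> real^3" where
  "grad f x = (\<chi> k. partial k f x)"

definition curl :: "(real^3 \<Rightarrow> real^3) \<Rightarrow> real^3 \<Rightarrow> real^3" where
  "curl F x =
     vector [partial 2 (\<lambda>y. F y $ 3) x - partial 3 (\<lambda>y. F y $ 2) x,
             partial 3 (\<lambda>y. F y $ 1) x - partial 1 (\<lambda>y. F y $ 3) x,
             partial 1 (\<lambda>y. F y $ 2) x - partial 2 (\<lambda>y. F y $ 1) x]"

section \<open>Weak differential operators on square integrable functions\<close>

definition L2 :: "(real^3) set \<Rightarrow> (real^3 \<Rightarrow> 'b::euclidean_space) set" where
  "L2 U = {f. f \<in> borel_measurable (lebesgue_on U) \<and>
              integrable (lebesgue_on U) (\<lambda>x. (norm (f x))\<^sup>2)}"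

definition has_weak_grad ::
    "(real^3) set \<Rightarrow> (real^3 \<Rightarrow> real) \<Rightarrow> (real^3 \<Rightarrow> real^3) \<Rightarrow> bool" where
  "has_weak_grad U u g \<longleftrightarrow> u \<in> L2 U \<and> g \<in> L2 U \<and>
     (\<forall>\<phi>\<in>test_functions U.
        (LINT x|lebesgue_on U. u x *\<^sub>R grad \<phi> x) = - (LINT x|lebesgue_on U. \<phi> x *\<^sub>R g x))"

definition has_weak_curl ::
    "(real^3) set \<Rightarrow> (real^3 \<Rightarrow> real^3) \<Rightarrow> (real^3 \<Rightarrow> real^3) \<Rightarrow> bool" where
  "has_weak_curl U v w \<longleftrightarrow> v \<in> L2 U \<and> w \<in> L2 U \<and>
     (\<forall>\<phi>\<in>test_fields U.
        (LINT x|lebesgue_on U. v x \<bullet> curl \<phi> x) = (LINT x|lebesgue_on U. w x \<bullet> \<phi> x))"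

definition has_weak_div ::
    "(real^3) set \<Rightarrow> (real^3 \<Rightarrow> real^3) \<Rightarrow> (real^3 \<Rightarrow> real) \<Rightarrow> bool" where
  "has_weak_div U v d \<longleftrightarrow> v \<in> L2 U \<and> d \<in> L2 U \<and>
     (\<forall>\<phi>\<in>test_functions U.
        (LINT x|lebesgue_on U. v x \<bullet> grad \<phi> x) = - (LINT x|lebesgue_on U. d x * \<phi> x))"

text \<open>Weak derivatives on an open set are unique up to null sets, so the choices below do not
  affect any integral.\<close>

definition weak_grad :: "(real^3) set \<Rightarrow> (real^3 \<Rightarrow> real) \<Rightarrow> real^3 \<Rightarrow> real^3" where
  "weak_grad U u = (SOME g. has_weak_grad U u g)"

definition weak_curl :: "(real^3) set \<Rightarrow> (real^3 \<Rightarrow> real^3) \<Rightarrow> real^3 \<Rightarrow> real^3" where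
  "weak_curl U v = (SOME w. has_weak_curl U v w)"

definition weak_div :: "(real^3) set \<Rightarrow> (real^3 \<Rightarrow> real^3) \<Rightarrow> real^3 \<Rightarrow> real" where
  "weak_div U v = (SOME d. has_weak_div U v d)"

definition weak_jacobian :: "(real^3) set \<Rightarrow> (real^3 \<Rightarrow> real^3) \<Rightarrow> real^3 \<Rightarrow> real^3^3" where
  "weak_jacobian U v x = (\<chi> i. weak_grad U (\<lambda>y. v y $ i) x)"

lemma norm_matrix_frobenius: "(norm (A :: real^3^3))\<^sup>2 = (\<Sum>i\<in>UNIV. \<Sum>k\<in>UNIV. (A $ i $ k)\<^sup>2)"
  by (simp add: norm_vec_def L2_set_def sum_nonneg)

section \<open>Function spaces\<close>

definition H1 :: "(real^3) set \<Rightarrow> (real^3 \<Rightarrow> real) set" where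
  "H1 U = {u. \<exists>g. has_weak_grad U u g}"

definition H1_fields :: "(real^3) set \<Rightarrow> (real^3 \<Rightarrow> real^3) set" where
  "H1_fields U = {v. \<forall>i. (\<lambda>x. v x $ i) \<in> H1 U}"

definition H_curl :: "(real^3) set \<Rightarrow> (real^3 \<Rightarrow> real^3) set" where
  "H_curl U = {v. \<exists>w. has_weak_curl U v w}"

text \<open>The tangential trace \<open>v \<times> n\<close> of \<open>v \<in> H(curl; U)\<close> is the functional on (traces of) \<open>H\<^sup>1\<close> fields
  given by Green's formula; for \<open>v\<close> smooth up to the boundary it is the integral of
  \<open>(v \<times> n) \<bullet> \<phi>\<close> over the boundary of \<open>U\<close>.\<close>

definition tangential_trace ::
    "(real^3) set \<Rightarrow> (real^3 \<Rightarrow> real^3) \<Rightarrow> (real^3 \<Rightarrow> real^3) \<Rightarrow> real" where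
  "tangential_trace U v \<phi> =
     (LINT x|lebesgue_on U. v x \<bullet> weak_curl U \<phi> x - weak_curl U v x \<bullet> \<phi> x)"

definition H0_curl :: "(real^3) set \<Rightarrow> (real^3 \<Rightarrow> real^3) set" where
  "H0_curl U = {v \<in> H_curl U. \<forall>\<phi>\<in>H1_fields U. tangential_trace U v \<phi> = 0}"

definition X_space :: "(real^3) set \<Rightarrow> (real^3 \<Rightarrow> real) \<Rightarrow> (real^3 \<Rightarrow> real^3) set" where
  "X_space U \<alpha> = {v \<in> H0_curl U. \<exists>d. has_weak_div U (\<lambda>x. \<alpha> x *\<^sub>R v x) d}"

definition PH1 :: "(real^3) set \<Rightarrow> nat \<Rightarrow> (nat \<Rightarrow> (real^3) set) \<Rightarrow> (real^3 \<Rightarrow> real^3) set" where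
  "PH1 U m \<P> = {v \<in> L2 U. \<forall>j\<in>{1..m}. v \<in> H1_fields (\<P> j)}"

end

theory Submission
  imports Defs
begin

text \<open>For \<open>J = \<nabla>v\<close> one has \<open>|J|\<^sup>2 = |curl v|\<^sup>2 + (div v)\<^sup>2 + N(J)\<close>, where \<open>N(J) = tr J\<^sup>2 - (tr J)\<^sup>2\<close> is a null
  Lagrangian: it is the divergence of the flux \<open>J v - (tr J) v\<close>. Hence the claim is that \<open>\<alpha> (J v - (tr J) v)\<close>,
  extended by zero, has the distributional divergence \<open>\<alpha> N(J)\<close> in all of space. At an interior point of a
  face with normal \<open>n\<close> the normal flux pairs \<open>\<alpha> v \<bullet> n\<close> with the tangential derivatives of \<open>v \<times> n\<close>, and
  conversely. The tangential components have weak tangential derivatives across the face because \<open>curl v\<close> is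
  square integrable, and \<open>\<alpha> v \<bullet> n\<close> because \<open>div (\<alpha> v)\<close> is (at the outer boundary only the former holds, and
  one-sided mollification of the vanishing tangential components suffices). The remaining edges and
  vertices lie on finitely many lines and points. There a logarithmic cutoff \<open>\<eta>\<close> removes them: its gradient is
  dominated by the weight of a critical Hardy inequality, so that \<open>|J| |v| |\<nabla>\<eta>|\<close> is integrable although
  \<open>v\<close> need not be bounded.\<close>

section \<open>Smooth functions with compact support\<close>

text \<open>The null Lagrangian is a sum over pairs of directions, and in each pair one component of
  \<alpha> v is integrated against a mollification of another component of v. If the normal
  component always takes the factor \<alpha>, then only derivatives that are controlled across the
  face occur. At the outer boundary \<alpha> v . n has a weak derivative inside only, so the
  mollified tangential component, which is 0 outside, is shifted inwards until its product with the
  cutoff is an admissible test function there. A line has codimension two, where the weight 1/r^2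
  just fails in Hardy's inequality; this is the origin of the logarithms. Moreover v jumps across
  the planes through the line. Hardy's inequality survives the jumps because its proof integrates
  the divergence of a radial field, which is tangent to every plane through the line; points are
  treated in the same way. The Lipschitz condition excludes cracks, that is faces of the boundary
  with \<Omega> on both sides, across which the divergence would not be controlled.\<close>

definition C1 :: "(real^3 \<Rightarrow> real) \<Rightarrow> bool" where
  "C1 f \<longleftrightarrow> (\<forall>x. (f has_derivative (\<lambda>h. grad f x \<bullet> h)) (at x)) \<and> continuous_on UNIV (grad f)"

lemma partial_eqI:
  assumes "(f has_derivative f') (at x)"
  shows "partial k f x = f' (axis k 1)"
  using frechet_derivative_at[OF assms] by (simp add: partial_def)

lemma grad_eqI:
  assumes "(f has_derivative (\<lambda>h. g \<bullet> h)) (at x)"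
  shows "grad f x = g"
  by (simp add: grad_def vec_eq_iff partial_eqI[OF assms] inner_axis)

lemma partial_eq_grad: "partial k f x = grad f x $ k"
  by (simp add: grad_def)

lemma C1I:
  assumes "\<And>x. (f has_derivative (\<lambda>h. g x \<bullet> h)) (at x)" and "continuous_on UNIV g"
  shows "C1 f" and "grad f = g"
proof -
  show g: "grad f = g" using grad_eqI[OF assms(1)] by auto
  show "C1 f" using assms by (simp add: C1_def g)
qed

lemma C1I2:
  assumes "\<And>x. (f has_derivative D x) (at x)" and "\<And>x h. D x h = g x \<bullet> h" and "continuous_on UNIV g"
  shows "C1 f \<and> grad f = g"
proof -
  have "D x = (\<lambda>h. g x \<bullet> h)" for x using assms(2) by blast
  then have "(f has_derivative (\<lambda>h. g x \<bullet> h)) (at x)" for x using assms(1)[of x] by simp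
  then show ?thesis using C1I assms(3) by blast
qed

lemma differentiable_grad:
  assumes "f differentiable at x"
  shows "(f has_derivative (\<lambda>h. grad f x \<bullet> h)) (at x)"
proof -
  let ?f' = "frechet_derivative f (at x)"
  have d: "(f has_derivative ?f') (at x)" using assms frechet_derivative_works by blast
  then interpret bounded_linear ?f' by (rule has_derivative_bounded_linear)
  have "?f' h = grad f x \<bullet> h" for h
  proof -
    have "h = (\<Sum>k\<in>UNIV. h $ k *\<^sub>R axis k 1)"
      by (simp add: basis_expansion scalar_mult_eq_scaleR[symmetric])
    then have "?f' h = ?f' (\<Sum>k\<in>UNIV. h $ k *\<^sub>R axis k 1)" by simp
    also have "\<dots> = (\<Sum>k\<in>UNIV. h $ k * ?f' (axis k 1))" by (simp add: sum scaleR)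
    finally show ?thesis by (simp add: grad_def partial_def inner_vec_def mult.commute)
  qed
  then have "?f' = (\<lambda>h. grad f x \<bullet> h)" by blast
  with d show ?thesis by metis
qed

lemma C_k_1_iff: "C_k (Suc 0) f \<longleftrightarrow> C1 f"
proof
  assume L: "C_k (Suc 0) f"
  have "continuous_on UNIV (grad f)"
    unfolding grad_def using L by (auto intro!: continuous_on_vec_lambda)
  then show "C1 f" using L by (auto simp: C1_def differentiable_grad)
next
  assume R: "C1 f"
  have "partial k f = (\<lambda>x. grad f x $ k)" for k by (auto simp: partial_eq_grad)
  moreover have "continuous_on UNIV (\<lambda>x. grad f x $ k)" for k
    using R by (intro continuous_intros) (simp add: C1_def)
  ultimately show "C_k (Suc 0) f" using R by (auto simp: C1_def differentiable_def)
qed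

lemma C1_has_derivative: "C1 f \<Longrightarrow> (f has_derivative (\<lambda>h. grad f x \<bullet> h)) (at x)"
  by (simp add: C1_def)

lemma C1_continuous_grad: "C1 f \<Longrightarrow> continuous_on UNIV (grad f)"
  by (simp add: C1_def)

lemma C1_continuous: "C1 f \<Longrightarrow> continuous_on UNIV f"
  by (meson C1_has_derivative continuous_at_imp_continuous_on has_derivative_continuous)

lemma C_k_SucD: "C_k (Suc n) f \<Longrightarrow> C_k n f"
proof (induction n arbitrary: f)
  case 0
  then show ?case using C1_continuous C_k_1_iff by auto
next
  case (Suc n)
  have "f differentiable at x" for x using Suc.prems by (subst (asm) C_k.simps) blast
  moreover have "C_k n (partial k f)" for k using Suc.prems by (intro Suc.IH) (subst (asm) C_k.simps, blast)
  ultimately show ?case by simp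
qed

lemma C1_const: "C1 (\<lambda>x. c)" and grad_const: "grad (\<lambda>x. c) = (\<lambda>x. 0)"
  using C1I2[of "\<lambda>x. c" "\<lambda>_ _. 0" "\<lambda>x. 0"] by auto

lemma C1_add:
  assumes "C1 f" "C1 g"
  shows "C1 (\<lambda>x. f x + g x)" and "grad (\<lambda>x. f x + g x) = (\<lambda>x. grad f x + grad g x)"
  using C1I2[OF has_derivative_add[OF assms[THEN C1_has_derivative]], of "\<lambda>x. grad f x + grad g x"]
  by (auto simp: inner_add_left intro!: continuous_intros assms[THEN C1_continuous_grad])

lemma C1_diff:
  assumes "C1 f" "C1 g"
  shows "C1 (\<lambda>x. f x - g x)" and "grad (\<lambda>x. f x - g x) = (\<lambda>x. grad f x - grad g x)"
  using C1I2[OF has_derivative_diff[OF assms[THEN C1_has_derivative]], of "\<lambda>x. grad f x - grad g x"]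
  by (auto simp: inner_diff_left intro!: continuous_intros assms[THEN C1_continuous_grad])

lemma C1_mult:
  assumes "C1 f" "C1 g"
  shows "C1 (\<lambda>x. f x * g x)"
    and "grad (\<lambda>x. f x * g x) = (\<lambda>x. f x *\<^sub>R grad g x + g x *\<^sub>R grad f x)"
proof -
  have "continuous_on UNIV (\<lambda>x. f x *\<^sub>R grad g x + g x *\<^sub>R grad f x)"
    by (intro continuous_intros C1_continuous_grad C1_continuous assms)
  with C1I2[OF has_derivative_mult[OF assms[THEN C1_has_derivative]], of "\<lambda>x. f x *\<^sub>R grad g x + g x *\<^sub>R grad f x"]
  show "C1 (\<lambda>x. f x * g x)" "grad (\<lambda>x. f x * g x) = (\<lambda>x. f x *\<^sub>R grad g x + g x *\<^sub>R grad f x)"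
    by (auto simp: inner_add_left)
qed

lemma C1_cmult:
  assumes "C1 f"
  shows "C1 (\<lambda>x. c * f x)" and "grad (\<lambda>x. c * f x) = (\<lambda>x. c *\<^sub>R grad f x)"
  using C1_mult[OF C1_const assms, of c] by (auto simp: grad_const)

lemma C1_compose:
  assumes "C1 f" "\<And>t. (h has_real_derivative h' t) (at t)" "continuous_on UNIV h'"
  shows "C1 (\<lambda>x. h (f x))"
    and "grad (\<lambda>x. h (f x)) = (\<lambda>x. h' (f x) *\<^sub>R grad f x)"
proof -
  have d: "((\<lambda>x. h (f x)) has_derivative (\<lambda>v. (h' (f x) *\<^sub>R grad f x) \<bullet> v)) (at x)" for x
    using has_derivative_compose[OF C1_has_derivative[OF assms(1)] assms(2)[unfolded has_field_derivative_def]]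
    by (rule has_derivative_eq_rhs) auto
  have c: "continuous_on UNIV (\<lambda>x. h' (f x) *\<^sub>R grad f x)"
    by (intro continuous_intros C1_continuous_grad assms continuous_on_compose2[OF assms(3)] C1_continuous) auto
  show "C1 (\<lambda>x. h (f x))" and "grad (\<lambda>x. h (f x)) = (\<lambda>x. h' (f x) *\<^sub>R grad f x)"
    using C1I[OF d c] by auto
qed

lemma C1_affine: "C1 (\<lambda>x. a \<bullet> x + b)" and grad_affine: "grad (\<lambda>x. a \<bullet> x + b) = (\<lambda>x. a)"
proof -
  have "((\<lambda>x. a \<bullet> x + b) has_derivative (\<lambda>h. a \<bullet> h)) (at x)" for x by (auto intro!: derivative_eq_intros)
  from C1I2[OF this, of "\<lambda>x. a"] show "C1 (\<lambda>x. a \<bullet> x + b)" "grad (\<lambda>x. a \<bullet> x + b) = (\<lambda>x. a)" by auto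
qed

text \<open>Symmetry of the second derivatives is carried along because the cancellation behind the
  null Lagrangian rests on it. It is read off explicit formulas for the bump functions and inherited
  by products and mollifications.\<close>

definition smooth :: "(real^3 \<Rightarrow> real) \<Rightarrow> bool" where
  "smooth f \<longleftrightarrow> (\<forall>n. C_k n f) \<and> (\<forall>i j x. partial i (partial j f) x = partial j (partial i f) x)"

lemma smooth_C1: "smooth f \<Longrightarrow> C1 f"
  using C_k_1_iff smooth_def by blast

lemma C_k_C1: "(\<And>n. C_k n f) \<Longrightarrow> C1 f"
  using C_k_1_iff by blast

lemma C_k_partial: "(\<And>n. C_k n f) \<Longrightarrow> C_k n (partial k f)"
  by (metis C_k.simps(2))

lemma C_k_cong_partial: "(\<And>x. (f has_derivative (\<lambda>h. G x \<bullet> h)) (at x)) \<Longrightarrow> (\<And>k. C_k n (\<lambda>x. G x $ k)) \<Longrightarrow> C_k (Suc n) f"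
proof -
  assume d: "\<And>x. (f has_derivative (\<lambda>h. G x \<bullet> h)) (at x)" and c: "\<And>k. C_k n (\<lambda>x. G x $ k)"
  have "grad f = G" using grad_eqI[OF d] by blast
  then show ?thesis using c d by (auto simp: differentiable_def partial_eq_grad[abs_def])
qed

lemma C_k_const: "C_k n (\<lambda>x. c)"
  by (induction n arbitrary: c) (auto intro!: derivative_eq_intros C_k_cong_partial[where G="\<lambda>x. 0"] simp del: C_k.simps(2))

lemma C_k_add: "C_k n f \<Longrightarrow> C_k n g \<Longrightarrow> C_k n (\<lambda>x. f x + g x)"
proof (induction n arbitrary: f g)
  case (Suc n)
  have "C_k n (\<lambda>x. (grad f x + grad g x) $ k)" for k
    using Suc.prems Suc.IH[of "partial k f" "partial k g"] by (simp add: partial_eq_grad[abs_def])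
  then show ?case
    using Suc.prems by (intro C_k_cong_partial[where G="\<lambda>x. grad f x + grad g x"])
      (auto intro!: derivative_eq_intros differentiable_grad simp: inner_add_left)
qed (auto intro: continuous_intros)

lemma C_k_mult: "C_k n f \<Longrightarrow> C_k n g \<Longrightarrow> C_k n (\<lambda>x. f x * g x)"
proof (induction n arbitrary: f g)
  case (Suc n)
  have "C_k n f" "C_k n g" using Suc.prems C_k_SucD by blast+
  then have "C_k n (\<lambda>x. (f x *\<^sub>R grad g x + g x *\<^sub>R grad f x) $ k)" for k
    using Suc.prems Suc.IH[of f "partial k g"] Suc.IH[of g "partial k f"]
      C_k_add[of n "\<lambda>x. f x * partial k g x" "\<lambda>x. g x * partial k f x"]
    by (simp add: partial_eq_grad[abs_def])
  then show ?case
    using Suc.prems by (intro C_k_cong_partial[where G="\<lambda>x. f x *\<^sub>R grad g x + g x *\<^sub>R grad f x"])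
      (auto intro!: derivative_eq_intros differentiable_grad simp: inner_add_left)
qed (auto intro: continuous_intros)

lemma partial_add:
  assumes "f differentiable at x" "g differentiable at x"
  shows "partial k (\<lambda>x. f x + g x) x = partial k f x + partial k g x"
  using partial_eqI[OF has_derivative_add[OF differentiable_grad[OF assms(1)] differentiable_grad[OF assms(2)]]]
  by (simp add: partial_eq_grad inner_axis)

lemma partial_mult:
  assumes "f differentiable at x" "g differentiable at x"
  shows "partial k (\<lambda>x. f x * g x) x = f x * partial k g x + partial k f x * g x"
  using partial_eqI[OF has_derivative_mult[OF differentiable_grad[OF assms(1)] differentiable_grad[OF assms(2)]]]
  by (simp add: partial_eq_grad inner_axis)

lemma smooth_differentiable: "smooth f \<Longrightarrow> f differentiable at x"
  by (meson C1_has_derivative differentiable_def smooth_C1)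

lemma smooth_partial_differentiable: "smooth f \<Longrightarrow> partial k f differentiable at x"
  unfolding smooth_def by (metis C_k.simps(2))

lemma smooth_const: "smooth (\<lambda>x. c)"
proof -
  have "partial k (\<lambda>x. c) = (\<lambda>x. 0)" for k and c :: real by (auto simp: partial_def)
  then show ?thesis by (simp add: smooth_def C_k_const)
qed

lemma smooth_mult: assumes "smooth f" "smooth g" shows "smooth (\<lambda>x. f x * g x)"
proof -
  have p: "partial k (\<lambda>x. f x * g x) = (\<lambda>x. f x * partial k g x + partial k f x * g x)" for k
    using partial_mult smooth_differentiable assms by blast
  have "partial i (partial j (\<lambda>x. f x * g x)) x = partial j (partial i (\<lambda>x. f x * g x)) x" for i j x
  proof -
    have sy: "partial i (partial j f) x = partial j (partial i f) x" "partial i (partial j g) x = partial j (partial i g) x"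
      using assms by (auto simp: smooth_def)
    show ?thesis unfolding p
      using assms sy by (simp add: partial_add partial_mult smooth_partial_differentiable smooth_differentiable differentiable_mult algebra_simps)
  qed
  then show ?thesis using assms by (auto simp: smooth_def C_k_mult)
qed

lemma smooth_prod: "finite I \<Longrightarrow> (\<And>i. i \<in> I \<Longrightarrow> smooth (f i)) \<Longrightarrow> smooth (\<lambda>x. \<Prod>i\<in>I. f i x)"
  by (induction rule: finite_induct) (auto intro: smooth_const smooth_mult)

text \<open>Expanding both sides in coordinates turns the claim into a swap of a double sum. General
  directions are required since the faces are not aligned with the axes.\<close>

lemma smooth_grad_symmetric:
  assumes "smooth f"
  shows "grad (\<lambda>y. grad f y \<bullet> a) x \<bullet> b = grad (\<lambda>y. grad f y \<bullet> b) x \<bullet> a"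
    and "C1 (\<lambda>y. grad f y \<bullet> a)"
proof -
  have c: "C1 (partial k f)" for k using assms C_k_C1 C_k_partial smooth_def by metis
  have *: "grad (\<lambda>y. grad f y \<bullet> a) = (\<lambda>x. \<Sum>k\<in>UNIV. a $ k *\<^sub>R grad (partial k f) x) \<and> C1 (\<lambda>y. grad f y \<bullet> a)" for a
  proof -
    have e: "(\<lambda>y. grad f y \<bullet> a) = (\<lambda>y. \<Sum>k\<in>UNIV. a $ k * partial k f y)"
      by (simp add: inner_vec_def partial_eq_grad mult.commute)
    have "C1 (\<lambda>y. \<Sum>k\<in>S. a $ k * partial k f y) \<and> grad (\<lambda>y. \<Sum>k\<in>S. a $ k * partial k f y)
      = (\<lambda>x. \<Sum>k\<in>S. a $ k *\<^sub>R grad (partial k f) x)" if "finite S" for S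
      using that by induction (auto simp: C1_const grad_const C1_add C1_cmult c)
    then show ?thesis unfolding e by auto
  qed
  have "grad (\<lambda>y. grad f y \<bullet> a) x \<bullet> b = (\<Sum>k\<in>UNIV. \<Sum>l\<in>UNIV. a $ k * (b $ l * partial l (partial k f) x))" for a b
    by (simp only: *[of a, THEN conjunct1] inner_sum_left inner_scaleR_left inner_vec_def[of "grad (partial _ f) _"]
        inner_real_def partial_eq_grad[of _ "partial _ f"] sum_distrib_left mult.commute[of _ "b $ _"])
  then have "grad (\<lambda>y. grad f y \<bullet> a) x \<bullet> b = (\<Sum>k\<in>UNIV. \<Sum>l\<in>UNIV. a $ k * (b $ l * partial l (partial k f) x))"
    "grad (\<lambda>y. grad f y \<bullet> b) x \<bullet> a = (\<Sum>k\<in>UNIV. \<Sum>l\<in>UNIV. b $ k * (a $ l * partial k (partial l f) x))"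
    using assms by (auto simp: smooth_def)
  then show "grad (\<lambda>y. grad f y \<bullet> a) x \<bullet> b = grad (\<lambda>y. grad f y \<bullet> b) x \<bullet> a"
    by (subst (asm) (2) sum.swap) (simp add: mult.left_commute)
  show "C1 (\<lambda>y. grad f y \<bullet> a)" using * by blast
qed

section \<open>The bump function exp(-1/t) and its derivatives\<close>

definition bumpr :: "nat \<Rightarrow> real \<Rightarrow> real" where
  "bumpr k t = (if t > 0 then exp (- 1 / t) / t ^ k else 0)"

lemma bumpr_tendsto_0: "((\<lambda>t. bumpr k t) \<longlongrightarrow> 0) (at 0)"
proof -
  have "((\<lambda>t. exp (- 1 / t) / t ^ k) \<longlongrightarrow> 0) (at_right (0::real))"
  proof -
    have "((\<lambda>s. s ^ k / exp s) \<longlongrightarrow> 0) (at_top :: real filter)" by (rule tendsto_power_div_exp_0)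
    then have "((\<lambda>t. inverse t ^ k / exp (inverse t)) \<longlongrightarrow> 0) (at_right (0::real))"
      by (rule filterlim_compose[OF _ filterlim_inverse_at_top_right])
    then show ?thesis by (simp add: exp_minus field_simps)
  qed
  then have "((\<lambda>t. bumpr k t) \<longlongrightarrow> 0) (at_right 0)"
    by (rule Lim_transform_eventually) (auto simp: bumpr_def eventually_at_right_less eventually_at_filter)
  moreover have "((\<lambda>t. bumpr k t) \<longlongrightarrow> 0) (at_left 0)"
    by (rule Lim_transform_eventually[OF tendsto_const]) (auto simp: bumpr_def eventually_at_filter)
  ultimately show ?thesis by (simp add: filterlim_at_split)
qed

text \<open>The power \<open>t ^ k\<close> in the denominator makes the family closed under
  differentiation up to linear combinations, so that an induction for all \<open>k\<close> at once
  gives smoothness.\<close>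

lemma bumpr_deriv: "(bumpr k has_real_derivative bumpr (k + 2) t - k * bumpr (k + 1) t) (at t)"
proof -
  consider "t > 0" | "t < 0" | "t = 0" by linarith
  then show ?thesis
  proof cases
    case 1
    have "((\<lambda>t. exp (- 1 / t) / t ^ k) has_real_derivative bumpr (k + 2) t - k * bumpr (k + 1) t) (at t)"
      using 1 by (auto intro!: derivative_eq_intros simp: bumpr_def field_simps power_add power2_eq_square)
        (cases k; simp add: field_simps)
    moreover have "\<forall>\<^sub>F x in nhds t. exp (- 1 / x) / x ^ k = bumpr k x"
      using eventually_nhds_in_open[OF open_greaterThan, of t 0] 1 by (auto simp: bumpr_def elim!: eventually_mono)
    ultimately show ?thesis by (subst DERIV_cong_ev[symmetric, OF refl _ refl])
  next
    case 2
    have "((\<lambda>t. 0) has_real_derivative bumpr (k + 2) t - k * bumpr (k + 1) t) (at t)"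
      using 2 by (auto simp: bumpr_def)
    moreover have "\<forall>\<^sub>F x in nhds t. 0 = bumpr k x"
      using eventually_nhds_in_open[OF open_lessThan, of t 0] 2 by (auto simp: bumpr_def elim!: eventually_mono)
    ultimately show ?thesis by (subst DERIV_cong_ev[symmetric, OF refl _ refl])
  next
    case 3
    \<comment> \<open>The difference quotient at 0 is the next member of the family,
      \<open>bumpr (Suc k)\<close>, which tends to 0.\<close>
    have "((\<lambda>h. bumpr k h / h) \<longlongrightarrow> 0) (at 0)"
      by (rule Lim_transform_eventually[OF bumpr_tendsto_0[of "Suc k"]])
        (auto simp: bumpr_def eventually_at_filter)
    then show ?thesis using 3 by (simp add: DERIV_def bumpr_def)
  qed
qed

lemma C_k_bumpr: "C_k n (\<lambda>x. bumpr k (a \<bullet> x + b))"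
proof (induction n arbitrary: k)
  case 0
  have "continuous_on UNIV (bumpr k)"
    using bumpr_deriv DERIV_isCont continuous_at_imp_continuous_on by blast
  then have "continuous_on UNIV (\<lambda>x. bumpr k (a \<bullet> x + b))"
    by (rule continuous_on_compose2) (auto intro!: continuous_intros)
  then show ?case by simp
next
  case (Suc n)
  let ?G = "\<lambda>x. (bumpr (k + 2) (a \<bullet> x + b) - k * bumpr (k + 1) (a \<bullet> x + b)) *\<^sub>R a"
  have "((\<lambda>x. bumpr k (a \<bullet> x + b)) has_derivative (\<lambda>h. ?G x \<bullet> h)) (at x)" for x
  proof -
    have "((\<lambda>x. a \<bullet> x + b) has_derivative (\<lambda>h. a \<bullet> h)) (at x)" by (auto intro!: derivative_eq_intros)
    from has_derivative_compose[OF this bumpr_deriv[of k, unfolded has_field_derivative_def]]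
    show ?thesis by (rule has_derivative_eq_rhs) auto
  qed
  moreover have "C_k n (\<lambda>x. ?G x $ i)" for i
  proof -
    have "(\<lambda>x. ?G x $ i) = (\<lambda>x. a $ i * bumpr (k+2) (a \<bullet> x + b) + (- (k * a $ i)) * bumpr (k+1) (a \<bullet> x + b))"
      by (auto simp: algebra_simps)
    then show ?thesis using Suc by (simp only:) (intro C_k_add C_k_mult C_k_const)
  qed
  ultimately show ?case by (rule C_k_cong_partial)
qed

lemma smooth_bumpr: "smooth (\<lambda>x. bumpr k (a \<bullet> x + b))"
proof -
  have p: "partial i (\<lambda>x. bumpr k (a \<bullet> x + b)) =
      (\<lambda>x. a $ i * bumpr (k+2) (a \<bullet> x + b) + (- (k * a $ i)) * bumpr (k+1) (a \<bullet> x + b))" for i k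
  proof
    fix x
    have "((\<lambda>x. a \<bullet> x + b) has_derivative (\<lambda>h. a \<bullet> h)) (at x)" by (auto intro!: derivative_eq_intros)
    from has_derivative_compose[OF this bumpr_deriv[of k, unfolded has_field_derivative_def]]
    show "partial i (\<lambda>x. bumpr k (a \<bullet> x + b)) x = a $ i * bumpr (k+2) (a \<bullet> x + b) + (- (k * a $ i)) * bumpr (k+1) (a \<bullet> x + b)"
      by (subst partial_eqI, assumption) (simp add: inner_axis algebra_simps)
  qed
  have d: "(\<lambda>x. bumpr k (a \<bullet> x + b)) differentiable at x" for k x
    using C_k_bumpr[of "Suc 0"] by simp
  have m: "partial j (\<lambda>x. c * f x) x = c * partial j f x" if "f differentiable at x"
    for j c x and f :: "real^3 \<Rightarrow> real"
    using partial_mult[of "\<lambda>x. c" x f j] that by (simp add: partial_def)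
  have q: "partial j (\<lambda>x. c * bumpr k (a \<bullet> x + b) + d * bumpr l (a \<bullet> x + b)) x =
    c * partial j (\<lambda>x. bumpr k (a \<bullet> x + b)) x + d * partial j (\<lambda>x. bumpr l (a \<bullet> x + b)) x" for c d k l j x
    by (simp only: partial_add m d differentiable_mult differentiable_const)
  have "partial i (partial j (\<lambda>x. bumpr k (a \<bullet> x + b))) x = partial j (partial i (\<lambda>x. bumpr k (a \<bullet> x + b))) x" for i j x
    unfolding p q by (simp add: algebra_simps)
  then show ?thesis by (simp add: smooth_def C_k_bumpr)
qed

section \<open>Compactly supported functions\<close>

definition zero_off :: "(real^3) set \<Rightarrow> (real^3 \<Rightarrow> real) \<Rightarrow> bool" where
  "zero_off K f \<longleftrightarrow> compact K \<and> (\<forall>x. x \<notin> K \<longrightarrow> f x = 0)"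

definition tests :: "(real^3) set \<Rightarrow> (real^3 \<Rightarrow> real) set" where
  "tests U = {\<phi>. smooth \<phi> \<and> (\<exists>K\<subseteq>U. zero_off K \<phi>)}"

text \<open>The larger of the two classes of test functions: it is closed under multiplication by
  \<open>C1\<close> functions, hence under the cutoffs used below, which are only once
  differentiable.\<close>

definition C1c :: "(real^3) set \<Rightarrow> (real^3 \<Rightarrow> real) set" where
  "C1c U = {\<phi>. C1 \<phi> \<and> (\<exists>K\<subseteq>U. zero_off K \<phi>)}"

lemma zero_off_closure:
  assumes "zero_off K f" shows "compact (closure {x. f x \<noteq> 0})" "closure {x. f x \<noteq> 0} \<subseteq> K"
proof -
  have "{x. f x \<noteq> 0} \<subseteq> K" "compact K" using assms by (auto simp: zero_off_def)
  then show "closure {x. f x \<noteq> 0} \<subseteq> K" "compact (closure {x. f x \<noteq> 0})"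
    by (auto simp: closure_minimal compact_imp_closed compact_closure intro: bounded_subset compact_imp_bounded)
qed

lemma zero_off_closureI: "compact (closure {x. f x \<noteq> 0}) \<Longrightarrow> zero_off (closure {x. f x \<noteq> 0}) f"
  using closure_subset[of "{x. f x \<noteq> 0}"] by (auto simp: zero_off_def)

lemma tests_subset: "tests U \<subseteq> test_functions U"
  unfolding tests_def test_functions_def smooth_def using zero_off_closure by blast

lemma test_functions_C1c: "test_functions U \<subseteq> C1c U"
  unfolding test_functions_def C1c_def using zero_off_closureI C_k_C1 by blast

lemma tests_C1c: "tests U \<subseteq> C1c U"
  using tests_subset test_functions_C1c by blast

lemma zero_off_grad:
  assumes "zero_off K f" "x \<notin> K" shows "grad f x = 0"
proof -
  have "open (- K)" using assms compact_imp_closed by (auto simp: zero_off_def)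
  have "(f has_derivative (\<lambda>h. 0)) (at x)"
    by (rule has_derivative_transform_within_open[OF _ \<open>open (- K)\<close>, where f="\<lambda>x. 0"])
      (use assms in \<open>auto simp: zero_off_def\<close>)
  then show ?thesis by (intro grad_eqI) simp
qed

lemma exists_bump:
  fixes a :: "real^3"
  assumes "r > 0"
  shows "\<exists>\<rho>\<in>tests (ball a r). (\<forall>x. \<rho> x \<ge> 0) \<and> (\<integral>x. \<rho> x \<partial>lborel) = 1"
proof -
  \<comment> \<open>Points of the cube of half-side \<open>s\<close> are within \<open>3 * s\<close>
    of \<open>a\<close>, by the l1 bound on the norm; a quarter of \<open>r\<close> puts the cube
    inside the ball.\<close>
  define s where "s = r / 4"
  have s: "s > 0" using assms by (simp add: s_def)
  define f :: "real^3 \<Rightarrow> real" where "f x = (\<Prod>i\<in>UNIV. bumpr 0 (axis i 1 \<bullet> x + (s - a $ i)) * bumpr 0 ((- axis i 1) \<bullet> x + (s + a $ i)))" for x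
  have sm: "smooth f" unfolding f_def by (intro smooth_prod smooth_mult smooth_bumpr) auto
  have nn: "f x \<ge> 0" for x unfolding f_def by (intro prod_nonneg) (auto simp: bumpr_def)
  have fa: "f a > 0" unfolding f_def using s by (intro prod_pos) (auto simp: bumpr_def inner_axis')
  let ?K = "cbox (a - (\<chi> i. s)) (a + (\<chi> i. s))"
  have z: "f x = 0" if nK: "x \<notin> ?K" for x
  proof -
    obtain i where i: "x $ i < a $ i - s \<or> x $ i > a $ i + s" using nK
      by (auto simp: mem_box_cart not_le)
    then have "bumpr 0 (axis i 1 \<bullet> x + (s - a $ i)) * bumpr 0 ((- axis i 1) \<bullet> x + (s + a $ i)) = 0"
      by (auto simp: bumpr_def inner_axis')
    then show ?thesis unfolding f_def by (intro prod_zero bexI[of _ i]) auto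
  qed
  have zo: "zero_off ?K f" using z by (auto simp: zero_off_def)
  have Kb: "?K \<subseteq> ball a r"
  proof
    fix x assume "x \<in> ?K"
    then have *: "\<bar>(x - a) $ i\<bar> \<le> s" for i by (auto simp: mem_box_cart abs_le_iff algebra_simps)
    have "norm (x - a) \<le> \<bar>(x - a) $ 1\<bar> + \<bar>(x - a) $ 2\<bar> + \<bar>(x - a) $ 3\<bar>"
      using norm_le_l1_cart[of "x - a"] by (simp add: sum_3)
    then have "norm (x - a) \<le> 3 * s" using *[of 1] *[of 2] *[of 3] by linarith
    then show "x \<in> ball a r" using s by (simp add: dist_norm norm_minus_commute s_def)
  qed
  have cont: "continuous_on UNIV f" using sm smooth_C1 C1_continuous by blast
  have "integrable lborel (\<lambda>x. indicator ?K x *\<^sub>R f x)"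
    by (rule borel_integrable_compact) (auto intro: continuous_on_subset[OF cont])
  moreover have "(\<lambda>x. indicator ?K x *\<^sub>R f x) = f"
  proof
    show "indicator ?K x *\<^sub>R f x = f x" for x using z[of x] by (cases "x \<in> ?K") auto
  qed
  ultimately have int: "integrable lborel f" by simp
  \<comment> \<open>If the integral of the nonnegative continuous \<open>f\<close> were 0, the open
    set where \<open>f\<close> differs from 0 would be negligible, but it contains
    \<open>a\<close>.\<close>
  have pos: "(\<integral>x. f x \<partial>lborel) > 0"
  proof (rule ccontr)
    assume "\<not> ?thesis"
    moreover have "(\<integral>x. f x \<partial>lborel) \<ge> 0" by (rule Bochner_Integration.integral_nonneg) (rule nn)
    ultimately have "(\<integral>x. f x \<partial>lborel) = 0" by linarith
    then have "AE x in lborel. f x = 0" using integral_nonneg_eq_0_iff_AE[OF int] nn by blast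
    then obtain N where "N \<in> null_sets lborel" "{x. f x \<noteq> 0} \<subseteq> N" by (auto simp: eventually_ae_filter)
    then have "negligible {x. f x \<noteq> 0}"
      by (meson negligible_iff_null_sets negligible_subset null_sets_completionI)
    moreover have "open {x. f x \<noteq> 0}" using open_Collect_neq[OF cont continuous_on_const] by simp
    moreover have "{x. f x \<noteq> 0} \<noteq> {}" using fa by (metis (mono_tags) empty_iff less_irrefl mem_Collect_eq)
    ultimately show False using open_not_negligible by blast
  qed
  define c where "c = 1 / (\<integral>x. f x \<partial>lborel)"
  have z2: "zero_off ?K (\<lambda>x. c * f x)" using zo by (simp add: zero_off_def)
  show ?thesis
  proof (intro bexI[of _ "\<lambda>x. c * f x"] conjI allI)
    show "(\<lambda>x. c * f x) \<in> tests (ball a r)"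
      unfolding tests_def using smooth_mult[OF smooth_const sm] z2 Kb by blast
    show "(\<integral>x. c * f x \<partial>lborel) = 1" using pos by (simp add: c_def)
    show "c * f x \<ge> 0" for x using nn[of x] pos by (simp add: c_def)
  qed
qed

section \<open>Uniform estimates for compactly supported functions\<close>

lemma compact_support_uniform:
  fixes f :: "'a::heine_borel \<Rightarrow> 'b::real_normed_vector"
  assumes "continuous_on UNIV f" "compact K" "\<And>x. x \<notin> K \<Longrightarrow> f x = 0"
  shows "\<exists>B. \<forall>x. norm (f x) \<le> B" and "e > 0 \<Longrightarrow> \<exists>d>0. \<forall>x y. dist x y < d \<longrightarrow> dist (f x) (f y) < e"
proof -
  have "bounded (f ` K)"
    using assms by (intro compact_imp_bounded compact_continuous_image) (auto intro: continuous_on_subset)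
  then obtain B where B: "\<And>x. x \<in> K \<Longrightarrow> norm (f x) \<le> B" by (auto simp: bounded_iff)
  have "norm (f x) \<le> \<bar>B\<bar>" for x
    using B[of x] assms(3)[of x] by (cases "x \<in> K") auto
  then show "\<exists>B. \<forall>x. norm (f x) \<le> B" by blast
next
  assume e: "e > 0"
  fix a :: 'a
  obtain R where "K \<subseteq> ball a R"
    using bounded_subset_ballD[OF compact_imp_bounded[OF assms(2)]] by metis
  then have R: "K \<subseteq> cball a R" using ball_subset_cball order_trans by metis
  \<comment> \<open>The margin 1 settles the points outside: if two points closer than 1 do not both
    lie in the larger ball, then neither lies in \<open>K\<close>.\<close>
  have "uniformly_continuous_on (cball a (R + 1)) f"
    by (intro compact_uniformly_continuous compact_cball continuous_on_subset[OF assms(1)]) auto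
  then obtain d where d: "d > 0" "\<And>x y. x \<in> cball a (R + 1) \<Longrightarrow> y \<in> cball a (R + 1) \<Longrightarrow> dist y x < d \<Longrightarrow> dist (f y) (f x) < e"
    unfolding uniformly_continuous_on_def using e by metis
  have "dist (f x) (f y) < e" if xy: "dist x y < min d 1" for x y
  proof (cases "x \<in> cball a (R + 1) \<and> y \<in> cball a (R + 1)")
    case True then show ?thesis using d(2)[of y x] xy by auto
  next
    case False
    have "dist a y \<le> dist a x + dist x y" "dist a x \<le> dist a y + dist x y"
      by (metis dist_triangle dist_commute)+
    then have "x \<notin> cball a R" "y \<notin> cball a R" using False xy by auto
    then have "x \<notin> K" "y \<notin> K" using R by auto
    then show ?thesis using assms(3) e by simp
  qed
  then show "\<exists>d>0. \<forall>x y. dist x y < d \<longrightarrow> dist (f x) (f y) < e"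
    using d(1) by (intro exI[of _ "min d 1"]) auto
qed

lemma C1c_uniform:
  assumes "\<phi> \<in> C1c U"
  shows "\<exists>B. \<forall>x. \<bar>\<phi> x\<bar> \<le> B" "\<exists>B. \<forall>x. norm (grad \<phi> x) \<le> B"
    "e > 0 \<Longrightarrow> \<exists>d>0. \<forall>x y. dist x y < d \<longrightarrow> dist (\<phi> x) (\<phi> y) < e"
    "e > 0 \<Longrightarrow> \<exists>d>0. \<forall>x y. dist x y < d \<longrightarrow> dist (grad \<phi> x) (grad \<phi> y) < e"
proof -
  obtain K where K: "zero_off K \<phi>" "C1 \<phi>" using assms by (auto simp: C1c_def)
  then have c: "compact K" "\<And>x. x \<notin> K \<Longrightarrow> \<phi> x = 0" "\<And>x. x \<notin> K \<Longrightarrow> grad \<phi> x = 0"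
    using zero_off_grad by (auto simp: zero_off_def)
  note * = compact_support_uniform[OF C1_continuous[OF K(2)] c(1,2)]
    compact_support_uniform[OF C1_continuous_grad[OF K(2)] c(1,3)]
  show "\<exists>B. \<forall>x. \<bar>\<phi> x\<bar> \<le> B" using *(1) by simp
  show "\<exists>B. \<forall>x. norm (grad \<phi> x) \<le> B" using *(3) .
  show "e > 0 \<Longrightarrow> \<exists>d>0. \<forall>x y. dist x y < d \<longrightarrow> dist (\<phi> x) (\<phi> y) < e" using *(2) .
  show "e > 0 \<Longrightarrow> \<exists>d>0. \<forall>x y. dist x y < d \<longrightarrow> dist (grad \<phi> x) (grad \<phi> y) < e" using *(4) .
qed

lemma C1c_borel [measurable]:
  assumes "C1 \<phi>" shows "\<phi> \<in> borel_measurable borel" "grad \<phi> \<in> borel_measurable borel"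
  by (rule borel_measurable_continuous_onI, rule C1_continuous C1_continuous_grad, rule assms)+

lemma integrable_scaleR_bounded:
  fixes f :: "'a \<Rightarrow> real" and G :: "'a \<Rightarrow> 'b::{banach, second_countable_topology}"
  assumes "integrable M f" "G \<in> borel_measurable M" "\<And>x. norm (G x) \<le> B"
  shows "integrable M (\<lambda>x. f x *\<^sub>R G x)"
proof (rule Bochner_Integration.integrable_bound[of M "\<lambda>x. B * f x"])
  show "integrable M (\<lambda>x. B * f x)" using assms by simp
  show "(\<lambda>x. f x *\<^sub>R G x) \<in> borel_measurable M" using assms(1,2) by measurable
  have "\<bar>f x\<bar> * norm (G x) \<le> \<bar>B\<bar> * \<bar>f x\<bar>" for x
    by (subst mult.commute, rule mult_right_mono) (use assms(3)[of x] in auto)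
  then show "AE x in M. norm (f x *\<^sub>R G x) \<le> norm (B * f x)" by (simp add: abs_mult)
qed

lemma integrable_mult_bounded:
  fixes f g :: "'a \<Rightarrow> real"
  assumes "integrable M f" "g \<in> borel_measurable M" "\<And>x. \<bar>g x\<bar> \<le> B"
  shows "integrable M (\<lambda>x. f x * g x)"
  using integrable_scaleR_bounded[OF assms(1,2), of B] assms(3) unfolding real_norm_def real_scaleR_def by blast

lemma integrable_inner_bounded:
  fixes f g :: "'a \<Rightarrow> 'b::euclidean_space"
  assumes "integrable M f" "g \<in> borel_measurable M" "\<And>x. norm (g x) \<le> B"
  shows "integrable M (\<lambda>x. f x \<bullet> g x)"
proof (rule Bochner_Integration.integrable_bound[of M "\<lambda>x. B * norm (f x)"])
  show "integrable M (\<lambda>x. B * norm (f x))" using assms by simp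
  show "(\<lambda>x. f x \<bullet> g x) \<in> borel_measurable M" using assms(1,2) by measurable
  have "\<bar>f x \<bullet> g x\<bar> \<le> \<bar>B\<bar> * norm (f x)" for x
  proof -
    have "\<bar>f x \<bullet> g x\<bar> \<le> norm (f x) * norm (g x)" by (rule Cauchy_Schwarz_ineq2)
    also have "\<dots> \<le> norm (f x) * \<bar>B\<bar>" using assms(3)[of x] by (intro mult_left_mono) auto
    finally show ?thesis by (simp add: mult.commute)
  qed
  then show "AE x in M. norm (f x \<bullet> g x) \<le> norm (B * norm (f x))" by (simp add: abs_mult)
qed

lemma integral_scaleR_diff_le:
  fixes f :: "real^3 \<Rightarrow> real" and G H :: "real^3 \<Rightarrow> 'b::{banach, second_countable_topology}"
  assumes "integrable lborel f" "G \<in> borel_measurable borel" "H \<in> borel_measurable borel"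
    "\<And>x. norm (G x) \<le> B" "\<And>x. norm (H x) \<le> C" "\<And>x. f x \<noteq> 0 \<Longrightarrow> norm (G x - H x) \<le> e" "e \<ge> 0"
  shows "norm ((\<integral>x. f x *\<^sub>R G x \<partial>lborel) - (\<integral>x. f x *\<^sub>R H x \<partial>lborel)) \<le> e * (\<integral>x. \<bar>f x\<bar> \<partial>lborel)"
proof -
  have i: "integrable lborel (\<lambda>x. f x *\<^sub>R G x)" "integrable lborel (\<lambda>x. f x *\<^sub>R H x)"
    using assms by (intro integrable_scaleR_bounded; auto)+
  have le: "norm (f x *\<^sub>R G x - f x *\<^sub>R H x) \<le> \<bar>f x\<bar> * e" for x
  proof (cases "f x = 0")
    case False
    have "norm (f x *\<^sub>R G x - f x *\<^sub>R H x) = \<bar>f x\<bar> * norm (G x - H x)"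
      by (simp add: scaleR_diff_right[symmetric])
    then show ?thesis using assms(6)[OF False] by (simp add: mult_left_mono)
  qed simp
  have "norm ((\<integral>x. f x *\<^sub>R G x \<partial>lborel) - (\<integral>x. f x *\<^sub>R H x \<partial>lborel)) = norm (\<integral>x. f x *\<^sub>R G x - f x *\<^sub>R H x \<partial>lborel)"
    using i by simp
  also have "\<dots> \<le> (\<integral>x. norm (f x *\<^sub>R G x - f x *\<^sub>R H x) \<partial>lborel)" by simp
  also have "\<dots> \<le> (\<integral>x. \<bar>f x\<bar> * e \<partial>lborel)"
    using i assms le by (intro integral_mono) auto
  finally show ?thesis by (simp add: mult.commute)
qed

section \<open>Mollification\<close>

definition mol :: "(real^3 \<Rightarrow> real) \<Rightarrow> (real^3 \<Rightarrow> real) \<Rightarrow> real^3 \<Rightarrow> real" where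
  "mol f \<rho> x = (\<integral>y. f y * \<rho> (x - y) \<partial>lborel)"

text \<open>The kernel \<open>G\<close> is uniformly continuous, so its translates are uniformly
  close, and the integrals differ by at most a small multiple of the L1 norm of
  \<open>f\<close>.\<close>

lemma continuous_convolution:
  fixes f :: "real^3 \<Rightarrow> real" and G :: "real^3 \<Rightarrow> 'b::{banach, second_countable_topology}"
  assumes f: "integrable lborel f" and G: "continuous_on UNIV G" "compact K" "\<And>x. x \<notin> K \<Longrightarrow> G x = 0"
  shows "continuous_on UNIV (\<lambda>x. \<integral>y. f y *\<^sub>R G (x - y) \<partial>lborel)"
proof (rule continuous_at_imp_continuous_on, rule ballI)
  fix x
  obtain B where B: "\<And>x. norm (G x) \<le> B" using compact_support_uniform(1)[OF G] by blast
  let ?I = "\<integral>y. \<bar>f y\<bar> \<partial>lborel"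
  have I: "?I \<ge> 0" by simp
  have m: "(\<lambda>y. G (z - y)) \<in> borel_measurable borel" for z
    using borel_measurable_continuous_onI[OF G(1)] by measurable
  show "isCont (\<lambda>x. \<integral>y. f y *\<^sub>R G (x - y) \<partial>lborel) x"
    unfolding continuous_at_eps_delta
  proof (intro allI impI)
    fix e :: real assume e: "e > 0"
    \<comment> \<open>Adding 1 keeps the denominator positive when \<open>f\<close> vanishes almost
      everywhere.\<close>
    define e' where "e' = e / (?I + 1)"
    have e': "e' > 0" using e I by (auto simp: e'_def intro!: divide_pos_pos add_nonneg_pos)
    obtain d where d: "d > 0" "\<And>x y. dist x y < d \<Longrightarrow> dist (G x) (G y) < e'"
      using compact_support_uniform(2)[OF G e'] by blast
    have "dist (\<integral>y. f y *\<^sub>R G (x' - y) \<partial>lborel) (\<integral>y. f y *\<^sub>R G (x - y) \<partial>lborel) < e" if "dist x' x < d" for x'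
    proof -
      have "norm (G (x' - y) - G (x - y)) \<le> e'" for y
        using d(2)[of "x' - y" "x - y"] that by (simp add: dist_norm)
      then have "dist (\<integral>y. f y *\<^sub>R G (x' - y) \<partial>lborel) (\<integral>y. f y *\<^sub>R G (x - y) \<partial>lborel) \<le> e' * ?I"
        unfolding dist_norm using e' by (intro integral_scaleR_diff_le[OF f m m B B]) auto
      also have "\<dots> < e' * (?I + 1)" using e' by simp
      also have "\<dots> = e" using I unfolding e'_def by (intro nonzero_eq_divide_eq[THEN iffD1, rotated, OF refl]) linarith
      finally show ?thesis .
    qed
    then show "\<exists>d>0. \<forall>x'. dist x' x < d \<longrightarrow> dist (\<integral>y. f y *\<^sub>R G (x' - y) \<partial>lborel) (\<integral>y. f y *\<^sub>R G (x - y) \<partial>lborel) < e"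
      using d(1) by blast
  qed
qed

text \<open>The mean value inequality is applied to \<open>\<phi>\<close> minus its linear part at
  \<open>x\<close>. The radius does not depend on \<open>x\<close>, which permits differentiation
  under an integral over all translates.\<close>

lemma uniform_linearization:
  assumes "\<phi> \<in> C1c U" "e > 0"
  shows "\<exists>d>0. \<forall>x h. norm h < d \<longrightarrow> \<bar>\<phi> (x + h) - \<phi> x - grad \<phi> x \<bullet> h\<bar> \<le> e * norm h"
proof -
  have C: "C1 \<phi>" using assms by (simp add: C1c_def)
  obtain d where d: "d > 0" "\<And>x y. dist x y < d \<Longrightarrow> dist (grad \<phi> x) (grad \<phi> y) < e"
    using C1c_uniform(4)[OF assms] by blast
  have "\<bar>\<phi> (x + h) - \<phi> x - grad \<phi> x \<bullet> h\<bar> \<le> e * norm h" if h: "norm h < d" for x h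
  proof -
    define g where "g y = \<phi> y - grad \<phi> x \<bullet> y" for y
    have g: "(g has_derivative (\<lambda>v. grad \<phi> y \<bullet> v - grad \<phi> x \<bullet> v)) (at y within ball x d)" for y
      unfolding g_def by (auto intro!: derivative_eq_intros has_derivative_at_withinI[OF C1_has_derivative[OF C]])
    have "norm (g (x + h) - g x) \<le> e * norm (x + h - x)"
    proof (rule differentiable_bound[OF convex_ball g])
      fix y assume y: "y \<in> ball x d"
      have "\<bar>grad \<phi> y \<bullet> v - grad \<phi> x \<bullet> v\<bar> \<le> e * norm v" for v
      proof -
        have "\<bar>grad \<phi> y \<bullet> v - grad \<phi> x \<bullet> v\<bar> = \<bar>(grad \<phi> y - grad \<phi> x) \<bullet> v\<bar>" by (simp add: inner_diff_left)
        also have "\<dots> \<le> norm (grad \<phi> y - grad \<phi> x) * norm v" by (rule Cauchy_Schwarz_ineq2)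
        also have "\<dots> \<le> e * norm v" using d(2)[of x y] y by (intro mult_right_mono) (auto simp: dist_norm norm_minus_commute)
        finally show ?thesis .
      qed
      then show "onorm (\<lambda>v. grad \<phi> y \<bullet> v - grad \<phi> x \<bullet> v) \<le> e" by (intro onorm_bound) (use assms in auto)
    qed (use h d in \<open>auto simp: dist_norm\<close>)
    then show ?thesis by (simp add: g_def inner_add_right algebra_simps)
  qed
  then show ?thesis using d(1) by blast
qed

lemma mol_derivative:
  assumes f: "integrable lborel f" and \<rho>: "\<rho> \<in> C1c UNIV"
  shows "C1 (mol f \<rho>)" and "grad (mol f \<rho>) = (\<lambda>x. \<integral>y. f y *\<^sub>R grad \<rho> (x - y) \<partial>lborel)"
proof -
  let ?g = "\<lambda>x. \<integral>y. f y *\<^sub>R grad \<rho> (x - y) \<partial>lborel"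
  obtain K where K: "zero_off K \<rho>" and C: "C1 \<rho>" using \<rho> by (auto simp: C1c_def)
  have cont: "continuous_on UNIV ?g"
    by (rule continuous_convolution[OF f C1_continuous_grad[OF C], of K])
      (use K zero_off_grad in \<open>auto simp: zero_off_def\<close>)
  obtain B where B: "\<And>x. \<bar>\<rho> x\<bar> \<le> B" using C1c_uniform(1)[OF \<rho>] by blast
  obtain B' where B': "\<And>x. norm (grad \<rho> x) \<le> B'" using C1c_uniform(2)[OF \<rho>] by blast
  note [measurable] = C1c_borel[OF C]
  let ?I = "\<integral>y. \<bar>f y\<bar> \<partial>lborel"
  have I: "?I \<ge> 0" by simp
  have i1: "integrable lborel (\<lambda>y. f y * \<rho> (x - y))" for x
    using B by (intro integrable_mult_bounded[OF f, of _ B]) auto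
  have i2: "integrable lborel (\<lambda>y. f y *\<^sub>R grad \<rho> (x - y))" for x
    using B' by (intro integrable_scaleR_bounded[OF f, of _ B']) auto
  have d: "(mol f \<rho> has_derivative (\<lambda>h. ?g x \<bullet> h)) (at x)" for x
    unfolding has_derivative_at_alt
  proof (intro conjI allI impI)
    show "bounded_linear (\<lambda>h. ?g x \<bullet> h)" by (rule bounded_linear_inner_right)
    fix e :: real assume e: "e > 0"
    define e' where "e' = e / (?I + 1)"
    have e': "e' > 0" using e I by (auto simp: e'_def intro!: divide_pos_pos add_nonneg_pos)
    obtain d where d: "d > 0" "\<And>x h. norm h < d \<Longrightarrow> \<bar>\<rho> (x + h) - \<rho> x - grad \<rho> x \<bullet> h\<bar> \<le> e' * norm h"
      using uniform_linearization[OF \<rho> e'] by blast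
    have "norm (mol f \<rho> x' - mol f \<rho> x - ?g x \<bullet> (x' - x)) \<le> e * norm (x' - x)" if x': "norm (x' - x) < d" for x'
    proof -
      let ?h = "x' - x"
      have i3: "integrable lborel (\<lambda>y. (f y *\<^sub>R grad \<rho> (x - y)) \<bullet> ?h)"
        by (rule integrable_inner_left[OF i2])
      have "mol f \<rho> x' - mol f \<rho> x - ?g x \<bullet> ?h =
        (\<integral>y. f y * \<rho> (x' - y) - f y * \<rho> (x - y) - (f y *\<^sub>R grad \<rho> (x - y)) \<bullet> ?h \<partial>lborel)"
        unfolding mol_def using i1 i2 by (simp add: integral_inner_left[symmetric] del: integral_inner_left inner_scaleR_left)
      then have "norm (mol f \<rho> x' - mol f \<rho> x - ?g x \<bullet> ?h) \<le> (\<integral>y. \<bar>f y * \<rho> (x' - y) - f y * \<rho> (x - y) - (f y *\<^sub>R grad \<rho> (x - y)) \<bullet> ?h\<bar> \<partial>lborel)"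
        using integral_norm_bound[of lborel "\<lambda>y. f y * \<rho> (x' - y) - f y * \<rho> (x - y) - (f y *\<^sub>R grad \<rho> (x - y)) \<bullet> ?h"]
        by (simp only: real_norm_def)
      also have "\<dots> \<le> (\<integral>y. \<bar>f y\<bar> * (e' * norm ?h) \<partial>lborel)"
      proof (intro integral_mono)
        show "integrable lborel (\<lambda>y. \<bar>f y * \<rho> (x' - y) - f y * \<rho> (x - y) - (f y *\<^sub>R grad \<rho> (x - y)) \<bullet> ?h\<bar>)"
          by (rule integrable_abs[OF Bochner_Integration.integrable_diff[OF Bochner_Integration.integrable_diff[OF i1 i1] i3]])
        show "integrable lborel (\<lambda>y. \<bar>f y\<bar> * (e' * norm ?h))" using f by simp
        fix y
        have "x - y + ?h = x' - y" by simp
        then have "\<bar>f y * \<rho> (x' - y) - f y * \<rho> (x - y) - (f y *\<^sub>R grad \<rho> (x - y)) \<bullet> ?h\<bar> =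
          \<bar>f y\<bar> * \<bar>\<rho> ((x - y) + ?h) - \<rho> (x - y) - grad \<rho> (x - y) \<bullet> ?h\<bar>"
          unfolding abs_mult[symmetric] by (simp add: right_diff_distrib)
        also have "\<dots> \<le> \<bar>f y\<bar> * (e' * norm ?h)" by (rule mult_left_mono[OF d(2)[OF x']]) simp
        finally show "\<bar>f y * \<rho> (x' - y) - f y * \<rho> (x - y) - (f y *\<^sub>R grad \<rho> (x - y)) \<bullet> ?h\<bar> \<le> \<bar>f y\<bar> * (e' * norm ?h)" .
      qed
      also have "\<dots> = (e' * ?I) * norm ?h" by simp
      also have "\<dots> \<le> e * norm ?h"
      proof (rule mult_right_mono)
        have "e' * ?I \<le> e' * (?I + 1)" using e' by simp
        also have "\<dots> = e" using I unfolding e'_def by (intro nonzero_eq_divide_eq[THEN iffD1, rotated, OF refl]) linarith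
        finally show "e' * ?I \<le> e" .
      qed simp
      finally show ?thesis .
    qed
    then show "\<exists>d>0. \<forall>x'. norm (x' - x) < d \<longrightarrow> norm (mol f \<rho> x' - mol f \<rho> x - ?g x \<bullet> (x' - x)) \<le> e * norm (x' - x)"
      using d(1) by blast
  qed
  show "C1 (mol f \<rho>)" "grad (mol f \<rho>) = ?g" using C1I[OF d cont] by auto
qed

lemma partial_mol:
  assumes f: "integrable lborel f" and \<rho>: "\<rho> \<in> C1c UNIV"
  shows "partial k (mol f \<rho>) = mol f (partial k \<rho>)"
proof
  fix x
  obtain B' where B': "\<And>x. norm (grad \<rho> x) \<le> B'" using C1c_uniform(2)[OF \<rho>] by blast
  have C: "C1 \<rho>" using \<rho> by (simp add: C1c_def)
  note [measurable] = C1c_borel[OF C]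
  have "integrable lborel (\<lambda>y. f y *\<^sub>R grad \<rho> (x - y))"
    using B' by (intro integrable_scaleR_bounded[OF f, of _ B']) auto
  then have "(\<integral>y. f y *\<^sub>R grad \<rho> (x - y) \<partial>lborel) \<bullet> axis k 1 = (\<integral>y. (f y *\<^sub>R grad \<rho> (x - y)) \<bullet> axis k 1 \<partial>lborel)"
    by (intro integral_inner_left[symmetric])
  then show "partial k (mol f \<rho>) x = mol f (partial k \<rho>) x"
    by (simp add: partial_eq_grad mol_derivative(2)[OF assms] mol_def inner_axis)
qed

lemma grad_mol_inner:
  assumes f: "integrable lborel f" and \<rho>: "\<rho> \<in> C1c UNIV"
  shows "grad (mol f \<rho>) x \<bullet> a = (\<integral>y. f y * (grad \<rho> (x - y) \<bullet> a) \<partial>lborel)"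
proof -
  obtain B' where B': "\<And>x. norm (grad \<rho> x) \<le> B'" using C1c_uniform(2)[OF \<rho>] by blast
  have C: "C1 \<rho>" using \<rho> by (simp add: C1c_def)
  note [measurable] = C1c_borel[OF C]
  have "integrable lborel (\<lambda>y. f y *\<^sub>R grad \<rho> (x - y))"
    using B' by (intro integrable_scaleR_bounded[OF f, of _ B']) auto
  then have "(\<integral>y. f y *\<^sub>R grad \<rho> (x - y) \<partial>lborel) \<bullet> a = (\<integral>y. (f y *\<^sub>R grad \<rho> (x - y)) \<bullet> a \<partial>lborel)"
    by (intro integral_inner_left[symmetric])
  then show ?thesis by (simp add: mol_derivative(2)[OF assms])
qed

lemma zero_off_partial: "zero_off K f \<Longrightarrow> zero_off K (partial k f)"
  using zero_off_grad by (auto simp: zero_off_def partial_eq_grad)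

lemma C_k_1: "C_k (Suc n) f \<Longrightarrow> C_k (Suc 0) f"
proof (induction n)
  case (Suc n)
  show ?case by (rule Suc.IH[OF C_k_SucD[OF Suc.prems]])
qed

lemma C_k_mol:
  assumes f: "integrable lborel f"
  shows "C_k n \<rho> \<Longrightarrow> zero_off K \<rho> \<Longrightarrow> C_k n (mol f \<rho>)"
proof (induction n arbitrary: \<rho>)
  case 0
  then show ?case using continuous_convolution[OF f, of \<rho> K] by (simp add: mol_def[abs_def] zero_off_def)
next
  case (Suc n)
  have "C_k (Suc 0) \<rho>" by (rule C_k_1[OF Suc.prems(1)])
  then have \<rho>: "\<rho> \<in> C1c UNIV" using Suc.prems(2) unfolding C_k_1_iff C1c_def by blast
  have "mol f \<rho> differentiable at x" for x
    using mol_derivative(1)[OF f \<rho>] C1_has_derivative differentiable_def by blast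
  moreover have "C_k n (partial k (mol f \<rho>))" for k
    unfolding partial_mol[OF f \<rho>] using Suc.prems(1)
    by (intro Suc.IH zero_off_partial[OF Suc.prems(2)]) simp
  ultimately show ?case by simp
qed

text \<open>All derivatives fall on the kernel, hence the symmetry of its second derivatives passes
  to the mollification.\<close>

lemma smooth_mol:
  assumes f: "integrable lborel f" and \<rho>: "\<rho> \<in> tests UNIV"
  shows "smooth (mol f \<rho>)"
proof -
  obtain K where K: "zero_off K \<rho>" and s: "smooth \<rho>" using \<rho> by (auto simp: tests_def)
  have C: "\<rho> \<in> C1c UNIV" using \<rho> tests_C1c by blast
  have "C1 (partial k \<rho>)" for k using s C_k_C1 C_k_partial smooth_def by metis
  then have "partial k \<rho> \<in> C1c UNIV" for k using zero_off_partial[OF K] by (auto simp: C1c_def)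
  then have "partial i (partial j (mol f \<rho>)) = mol f (partial i (partial j \<rho>))" for i j
    using partial_mol f C by simp
  moreover have "partial i (partial j \<rho>) = partial j (partial i \<rho>)" for i j
    using s by (auto simp: smooth_def)
  moreover have "C_k n (mol f \<rho>)" for n using C_k_mol[OF f _ K] s by (simp add: smooth_def)
  ultimately show ?thesis by (auto simp: smooth_def)
qed

lemma mol_zero: "(\<And>y. f y = 0 \<or> \<rho> (x - y) = 0) \<Longrightarrow> mol f \<rho> x = 0"
  unfolding mol_def by (subst Bochner_Integration.integral_cong[OF refl, of _ _ "\<lambda>_. 0"]) auto

lemma lborel_reflect: "distr lborel borel (\<lambda>y. x - y) = (lborel :: 'a::euclidean_space measure)"
proof -
  have "lborel = density (distr lborel borel (\<lambda>y. x + (-1) *\<^sub>R y)) (\<lambda>_::'a. ennreal (\<bar>-1\<bar> ^ DIM('a)))"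
    by (rule lborel_affine) simp
  then show ?thesis by (simp add: density_1)
qed

lemma integral_reflect:
  fixes f :: "'a::euclidean_space \<Rightarrow> 'b::{banach, second_countable_topology}"
  shows "(\<integral>y. f (x - y) \<partial>lborel) = (\<integral>y. f y \<partial>lborel)"
    and "integrable lborel (\<lambda>y. f (x - y)) \<longleftrightarrow> integrable lborel f"
proof -
  have [simp]: "(\<lambda>y. x - (x - y)) = (\<lambda>y. y::'a)" by auto
  have *: "integrable lborel (\<lambda>y. f (x - y))" if "integrable lborel f" for f :: "'a \<Rightarrow> 'b"
  proof -
    have "integrable (distr lborel borel (\<lambda>y. x - y)) f" using that by (simp add: lborel_reflect)
    then show ?thesis by (subst (asm) integrable_distr_eq) (use that in auto)
  qed
  show i: "integrable lborel (\<lambda>y. f (x - y)) \<longleftrightarrow> integrable lborel f"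
    using *[of f] *[of "\<lambda>y. f (x - y)"] by auto
  show "(\<integral>y. f (x - y) \<partial>lborel) = (\<integral>y. f y \<partial>lborel)"
  proof (cases "integrable lborel f")
    case True
    have "(\<integral>y. f y \<partial>distr lborel borel (\<lambda>y. x - y)) = (\<integral>y. f (x - y) \<partial>lborel)"
      using True by (intro integral_distr) auto
    then show ?thesis by (simp add: lborel_reflect)
  next
    case False
    then show ?thesis using i by (simp add: not_integrable_integral_eq)
  qed
qed

lemma mol_commute: "mol f \<rho> = mol \<rho> f"
proof
  fix x
  show "mol f \<rho> x = mol \<rho> f x"
    unfolding mol_def using integral_reflect(1)[of "\<lambda>y. f y * \<rho> (x - y)" x] by (simp add: mult.commute)
qed

lemma C1c_integrable: assumes "\<phi> \<in> C1c U" shows "integrable lborel \<phi>"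
proof -
  obtain K where K: "zero_off K \<phi>" "C1 \<phi>" using assms by (auto simp: C1c_def)
  have "integrable lborel (\<lambda>x. indicator K x *\<^sub>R \<phi> x)"
    using K by (intro borel_integrable_compact) (auto simp: zero_off_def intro: continuous_on_subset[OF C1_continuous])
  moreover have "(\<lambda>x. indicator K x *\<^sub>R \<phi> x) = \<phi>"
    using K(1) by (auto simp: zero_off_def fun_eq_iff indicator_def)
  ultimately show ?thesis by simp
qed

text \<open>The support is confined to an arbitrary set rather than to a ball about 0: later it lies
  on one side of a plane.\<close>

definition mollifier :: "(real^3) set \<Rightarrow> (real^3 \<Rightarrow> real) \<Rightarrow> bool" where
  "mollifier S \<rho> \<longleftrightarrow> \<rho> \<in> tests S \<and> (\<forall>x. \<rho> x \<ge> 0) \<and> (\<integral>x. \<rho> x \<partial>lborel) = 1"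

lemma exists_mollifier:
  assumes "open S" "S \<noteq> {}" shows "\<exists>\<rho>. mollifier S \<rho>"
proof -
  obtain a r where "r > 0" "ball a r \<subseteq> S" using assms open_contains_ball by blast
  then show ?thesis using exists_bump[of r a] by (auto simp: mollifier_def tests_def) blast
qed

lemma mollifier_facts:
  assumes "mollifier S \<rho>"
  shows "\<rho> \<in> tests S" "\<rho> \<in> tests UNIV" "\<rho> \<in> C1c UNIV" "integrable lborel \<rho>" "\<rho> x \<ge> 0" "(\<integral>x. \<rho> x \<partial>lborel) = 1"
    "(\<integral>x. \<bar>\<rho> x\<bar> \<partial>lborel) = 1" "\<rho> x \<noteq> 0 \<Longrightarrow> x \<in> S" "\<exists>K\<subseteq>S. zero_off K \<rho>"
proof -
  show t: "\<rho> \<in> tests S" and nn: "\<rho> x \<ge> 0" and 1: "(\<integral>x. \<rho> x \<partial>lborel) = 1" for x using assms by (auto simp: mollifier_def)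
  then show "\<rho> \<in> tests UNIV" "\<exists>K\<subseteq>S. zero_off K \<rho>" "\<rho> x \<noteq> 0 \<Longrightarrow> x \<in> S" by (auto simp: tests_def zero_off_def)
  then show c: "\<rho> \<in> C1c UNIV" using tests_C1c by blast
  show "integrable lborel \<rho>" using C1c_integrable[OF c] .
  have "(\<lambda>x. \<bar>\<rho> x\<bar>) = \<rho>" using nn by auto
  then show "(\<integral>x. \<bar>\<rho> x\<bar> \<partial>lborel) = 1" using assms by (simp add: mollifier_def)
qed

text \<open>As \<open>mol\<close> is commutative, \<open>mol \<phi> \<rho>\<close> is an average of
  translates of \<open>\<phi>\<close>, and its gradient is one of translates of the gradient; both
  are uniformly continuous.\<close>

lemma mol_approx:
  assumes \<phi>: "\<phi> \<in> C1c U" and e: "e > 0"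
  shows "\<exists>d>0. \<forall>\<rho>. mollifier (ball 0 d) \<rho> \<longrightarrow>
    (\<forall>x. \<bar>mol \<phi> \<rho> x - \<phi> x\<bar> \<le> e \<and> norm (grad (mol \<phi> \<rho>) x - grad \<phi> x) \<le> e)"
proof -
  obtain d1 where d1: "d1 > 0" "\<And>x y. dist x y < d1 \<Longrightarrow> dist (\<phi> x) (\<phi> y) < e"
    using C1c_uniform(3)[OF \<phi> e] by blast
  obtain d2 where d2: "d2 > 0" "\<And>x y. dist x y < d2 \<Longrightarrow> dist (grad \<phi> x) (grad \<phi> y) < e"
    using C1c_uniform(4)[OF \<phi> e] by blast
  obtain B where B: "\<And>x. \<bar>\<phi> x\<bar> \<le> B" using C1c_uniform(1)[OF \<phi>] by blast
  obtain B' where B': "\<And>x. norm (grad \<phi> x) \<le> B'" using C1c_uniform(2)[OF \<phi>] by blast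
  have C: "C1 \<phi>" "\<phi> \<in> C1c UNIV" using \<phi> by (auto simp: C1c_def)
  note [measurable] = C1c_borel[OF C(1)]
  have "\<bar>mol \<phi> \<rho> x - \<phi> x\<bar> \<le> e \<and> norm (grad (mol \<phi> \<rho>) x - grad \<phi> x) \<le> e" if \<rho>: "mollifier (ball 0 (min d1 d2)) \<rho>" for \<rho> x
  proof
    note r = mollifier_facts[OF \<rho>]
    have "norm ((\<integral>y. \<rho> y *\<^sub>R \<phi> (x - y) \<partial>lborel) - (\<integral>y. \<rho> y *\<^sub>R \<phi> x \<partial>lborel)) \<le> e * (\<integral>y. \<bar>\<rho> y\<bar> \<partial>lborel)"
    proof (rule integral_scaleR_diff_le[OF r(4), of _ _ B B])
      fix y assume "\<rho> y \<noteq> 0"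
      then have "norm y < d1" using r(8) by auto
      then show "norm (\<phi> (x - y) - \<phi> x) \<le> e" using d1(2)[of "x - y" x] by (simp add: dist_norm)
    qed (use B e in auto)
    then show "\<bar>mol \<phi> \<rho> x - \<phi> x\<bar> \<le> e"
      using r(6,7) by (simp add: mol_commute[of \<phi>]) (simp add: mol_def)
    have "norm ((\<integral>y. \<rho> y *\<^sub>R grad \<phi> (x - y) \<partial>lborel) - (\<integral>y. \<rho> y *\<^sub>R grad \<phi> x \<partial>lborel)) \<le> e * (\<integral>y. \<bar>\<rho> y\<bar> \<partial>lborel)"
    proof (rule integral_scaleR_diff_le[OF r(4), of _ _ B' B'])
      fix y assume "\<rho> y \<noteq> 0"
      then have "norm y < d2" using r(8) by auto
      then show "norm (grad \<phi> (x - y) - grad \<phi> x) \<le> e" using d2(2)[of "x - y" x] by (simp add: dist_norm)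
    qed (use B' e in auto)
    then show "norm (grad (mol \<phi> \<rho>) x - grad \<phi> x) \<le> e"
      using r(4,6,7) by (simp add: mol_commute[of \<phi>] mol_derivative(2)[OF r(4) C(2)])
  qed
  then show ?thesis using d1(1) d2(1) by (intro exI[of _ "min d1 d2"]) auto
qed

section \<open>The divergence in the sense of distributions\<close>

text \<open>The equation \<open>div q = p\<close> on \<open>U\<close> in the sense of distributions.\<close>

definition wdiv :: "(real^3) set \<Rightarrow> (real^3 \<Rightarrow> real^3) \<Rightarrow> (real^3 \<Rightarrow> real) \<Rightarrow> bool" where
  "wdiv U q p \<longleftrightarrow> integrable lborel q \<and> integrable lborel p \<and>
     (\<forall>\<phi>\<in>C1c U. (\<integral>x. p x * \<phi> x + q x \<bullet> grad \<phi> x \<partial>lborel) = 0)"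

section \<open>Elementary calculus of the distributional divergence\<close>

lemma C1c_mono: "U \<subseteq> V \<Longrightarrow> C1c U \<subseteq> C1c V"
  by (auto simp: C1c_def)

lemma wdivD: "wdiv U q p \<Longrightarrow> integrable lborel q" "wdiv U q p \<Longrightarrow> integrable lborel p"
  "wdiv U q p \<Longrightarrow> \<phi> \<in> C1c U \<Longrightarrow> (\<integral>x. p x * \<phi> x + q x \<bullet> grad \<phi> x \<partial>lborel) = 0"
  by (auto simp: wdiv_def)

lemma wdiv_mono: "wdiv V q p \<Longrightarrow> U \<subseteq> V \<Longrightarrow> wdiv U q p"
  unfolding wdiv_def using C1c_mono[of U V] by (simp add: subset_iff)

lemma C1c_integrable_mult:
  assumes "\<phi> \<in> C1c U" "integrable lborel p"
  shows "integrable lborel (\<lambda>x. p x * \<phi> x)"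
proof -
  obtain B where B: "\<And>x. \<bar>\<phi> x\<bar> \<le> B" using C1c_uniform(1)[OF assms(1)] by blast
  show ?thesis
    by (rule integrable_mult_bounded[OF assms(2) _ B]) (use assms(1) in \<open>simp add: C1c_def C1c_borel\<close>)
qed

lemma C1c_integrable_inner:
  assumes "\<phi> \<in> C1c U" "integrable lborel q"
  shows "integrable lborel (\<lambda>x. q x \<bullet> grad \<phi> x)"
proof -
  obtain B where B: "\<And>x. norm (grad \<phi> x) \<le> B" using C1c_uniform(2)[OF assms(1)] by blast
  show ?thesis
    by (rule integrable_inner_bounded[OF assms(2) _ B]) (use assms(1) in \<open>simp add: C1c_def C1c_borel\<close>)
qed

lemma C1c_integrable_pair:
  assumes "\<phi> \<in> C1c U" "integrable lborel p" "integrable lborel q"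
  shows "integrable lborel (\<lambda>x. p x * \<phi> x + q x \<bullet> grad \<phi> x)"
  by (rule Bochner_Integration.integrable_add[OF C1c_integrable_mult[OF assms(1,2)] C1c_integrable_inner[OF assms(1,3)]])

lemma pair_diff_bound:
  assumes "\<phi> \<in> C1c U" "\<psi> \<in> C1c V" "integrable lborel p" "integrable lborel q"
    "\<And>x. \<bar>\<psi> x - \<phi> x\<bar> \<le> e" "\<And>x. norm (grad \<psi> x - grad \<phi> x) \<le> e"
  shows "\<bar>(\<integral>x. p x * \<psi> x + q x \<bullet> grad \<psi> x \<partial>lborel) - (\<integral>x. p x * \<phi> x + q x \<bullet> grad \<phi> x \<partial>lborel)\<bar>
    \<le> e * (\<integral>x. \<bar>p x\<bar> + norm (q x) \<partial>lborel)"
proof -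
  let ?F = "\<lambda>x. p x * \<psi> x + q x \<bullet> grad \<psi> x" and ?G = "\<lambda>x. p x * \<phi> x + q x \<bullet> grad \<phi> x"
  have i: "integrable lborel ?F" "integrable lborel ?G"
    using C1c_integrable_pair assms by blast+
  have le: "\<bar>?F x - ?G x\<bar> \<le> e * (\<bar>p x\<bar> + norm (q x))" for x
  proof -
    have "?F x - ?G x = p x * (\<psi> x - \<phi> x) + q x \<bullet> (grad \<psi> x - grad \<phi> x)"
      by (simp add: right_diff_distrib inner_diff_right)
    then have "\<bar>?F x - ?G x\<bar> \<le> \<bar>p x\<bar> * \<bar>\<psi> x - \<phi> x\<bar> + \<bar>q x \<bullet> (grad \<psi> x - grad \<phi> x)\<bar>"
      by (metis abs_mult abs_triangle_ineq)
    moreover have "\<bar>p x\<bar> * \<bar>\<psi> x - \<phi> x\<bar> \<le> \<bar>p x\<bar> * e" using assms(5) by (intro mult_left_mono) auto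
    moreover have "\<bar>q x \<bullet> (grad \<psi> x - grad \<phi> x)\<bar> \<le> norm (q x) * e"
      using Cauchy_Schwarz_ineq2[of "q x" "grad \<psi> x - grad \<phi> x"] mult_left_mono[OF assms(6)[of x] norm_ge_zero[of "q x"]] by linarith
    ultimately show ?thesis by (simp add: algebra_simps)
  qed
  have "\<bar>integral\<^sup>L lborel ?F - integral\<^sup>L lborel ?G\<bar> = \<bar>\<integral>x. ?F x - ?G x \<partial>lborel\<bar>"
    by (subst Bochner_Integration.integral_diff[OF i]) simp
  moreover have "\<bar>\<integral>x. ?F x - ?G x \<partial>lborel\<bar> \<le> (\<integral>x. \<bar>?F x - ?G x\<bar> \<partial>lborel)"
    by (rule integral_abs_bound)
  moreover have "(\<integral>x. \<bar>?F x - ?G x\<bar> \<partial>lborel) \<le> (\<integral>x. e * (\<bar>p x\<bar> + norm (q x)) \<partial>lborel)"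
    by (rule integral_mono[OF _ _ le]) (use i assms(3,4) in auto)
  moreover have "(\<integral>x. e * (\<bar>p x\<bar> + norm (q x)) \<partial>lborel) = e * (\<integral>x. \<bar>p x\<bar> + norm (q x) \<partial>lborel)"
    by simp
  ultimately show ?thesis by linarith
qed

text \<open>The support of a convolution lies in the sum of the two supports, which is
  compact.\<close>

lemma mol_tests:
  assumes f: "integrable lborel f" "compact K" "\<And>x. x \<notin> K \<Longrightarrow> f x = 0" and \<rho>: "\<rho> \<in> tests UNIV"
    and S: "zero_off S \<rho>" and KS: "\<And>x y. x \<in> K \<Longrightarrow> y \<in> S \<Longrightarrow> x + y \<in> U"
  shows "mol f \<rho> \<in> tests U"
proof -
  have "zero_off {x + y |x y. x \<in> K \<and> y \<in> S} (mol f \<rho>)"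
    unfolding zero_off_def
  proof (intro conjI allI impI)
    show "compact {x + y |x y. x \<in> K \<and> y \<in> S}" using compact_sums[OF f(2), of S] S by (simp add: zero_off_def)
    fix x assume x: "x \<notin> {x + y |x y. x \<in> K \<and> y \<in> S}"
    show "mol f \<rho> x = 0"
    proof (rule mol_zero)
      fix y
      have "y \<notin> K \<or> x - y \<notin> S"
      proof (rule ccontr)
        assume "\<not> ?thesis"
        moreover have "x = y + (x - y)" by simp
        ultimately show False using x by blast
      qed
      then show "f y = 0 \<or> \<rho> (x - y) = 0" using f(3) S by (auto simp: zero_off_def)
    qed
  qed
  moreover have "{x + y |x y. x \<in> K \<and> y \<in> S} \<subseteq> U" using KS by blast
  ultimately show ?thesis unfolding tests_def using smooth_mol[OF f(1) \<rho>] by blast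
qed

lemma compact_open_margin:
  fixes K :: "'a::heine_borel set"
  assumes "compact K" "open U" "K \<subseteq> U"
  shows "\<exists>d>0. \<forall>x\<in>K. \<forall>y. dist x y < d \<longrightarrow> y \<in> U"
proof -
  obtain d where "d > 0" "(\<Union>x\<in>K. ball x d) \<subseteq> U"
    using compact_subset_open_imp_ball_epsilon_subset[OF assms] by blast
  then show ?thesis by (intro exI[of _ d]) (auto simp: subset_iff)
qed

lemma mollifier_mono: "mollifier S \<rho> \<Longrightarrow> S \<subseteq> T \<Longrightarrow> mollifier T \<rho>"
  unfolding mollifier_def tests_def by blast

lemma zero_from_eps:
  fixes L M :: real
  assumes "\<And>e. e > 0 \<Longrightarrow> \<bar>L\<bar> \<le> e * M"
  shows "L = 0"
proof (rule ccontr)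
  assume "L \<noteq> 0"
  \<comment> \<open>This choice of \<open>e\<close> bounds \<bar>L\<bar> by half of itself.\<close>
  then have "\<bar>L\<bar> \<le> \<bar>L\<bar> / (2 * (\<bar>M\<bar> + 1)) * M" by (intro assms) auto
  also have "\<dots> \<le> \<bar>L\<bar> / (2 * (\<bar>M\<bar> + 1)) * (\<bar>M\<bar> + 1)" by (intro mult_left_mono) auto
  also have "\<dots> = \<bar>L\<bar> / 2" by (simp add: field_simps)
  finally show False using \<open>L \<noteq> 0\<close> by simp
qed

text \<open>Mollifying a \<open>C1c\<close> function gives elements of \<open>tests\<close> that
  converge uniformly together with their gradients, and for integrable \<open>p\<close> and
  \<open>q\<close> the pairing is continuous under this convergence.\<close>

lemma wdivI_tests:
  assumes U: "open U" and p: "integrable lborel p" and q: "integrable lborel q"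
    and eq: "\<And>\<phi>. \<phi> \<in> tests U \<Longrightarrow> (\<integral>x. p x * \<phi> x + q x \<bullet> grad \<phi> x \<partial>lborel) = 0"
  shows "wdiv U q p"
  unfolding wdiv_def
proof (intro conjI ballI p q)
  fix \<phi> assume \<phi>: "\<phi> \<in> C1c U"
  obtain K where K: "K \<subseteq> U" "zero_off K \<phi>" using \<phi> by (auto simp: C1c_def)
  obtain d where d: "d > 0" "\<And>x y. x \<in> K \<Longrightarrow> dist x y < d \<Longrightarrow> y \<in> U"
    using compact_open_margin[of K U] K U by (auto simp: zero_off_def)
  let ?L = "\<integral>x. p x * \<phi> x + q x \<bullet> grad \<phi> x \<partial>lborel" and ?M = "\<integral>x. \<bar>p x\<bar> + norm (q x) \<partial>lborel"
  have "\<bar>?L\<bar> \<le> e * ?M" if e: "e > 0" for e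
  proof -
    obtain d' where d': "d' > 0" "\<And>\<rho> x. mollifier (ball 0 d') \<rho> \<Longrightarrow>
      \<bar>mol \<phi> \<rho> x - \<phi> x\<bar> \<le> e \<and> norm (grad (mol \<phi> \<rho>) x - grad \<phi> x) \<le> e"
      using mol_approx[OF \<phi> e] by blast
    have "open (ball (0::real^3) (min d d'))" "ball (0::real^3) (min d d') \<noteq> {}" using d(1) d'(1) by auto
    then obtain \<rho> where \<rho>: "mollifier (ball 0 (min d d')) \<rho>" using exists_mollifier by blast
    note r = mollifier_facts[OF \<rho>]
    have \<rho>': "mollifier (ball 0 d') \<rho>" by (rule mollifier_mono[OF \<rho>]) auto
    obtain S where S: "S \<subseteq> ball 0 (min d d')" "zero_off S \<rho>" using r(9) by blast
    have t: "mol \<phi> \<rho> \<in> tests U"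
    proof (rule mol_tests[OF C1c_integrable[OF \<phi>] _ _ r(2) S(2)])
      show "compact K" "x \<notin> K \<Longrightarrow> \<phi> x = 0" for x using K(2) by (auto simp: zero_off_def)
      fix x y assume "x \<in> K" "y \<in> S"
      then show "x + y \<in> U" using S(1) by (intro d(2)[of x]) (auto simp: dist_norm)
    qed
    then have t': "mol \<phi> \<rho> \<in> C1c U" using tests_C1c by blast
    show ?thesis
      using pair_diff_bound[OF \<phi> t' p q, of e] d'(2)[OF \<rho>'] eq[OF t] by (simp add: abs_minus_commute)
  qed
  then show "?L = 0" by (rule zero_from_eps)
qed

lemma C1c_mult: "\<phi> \<in> C1c U \<Longrightarrow> C1 \<psi> \<Longrightarrow> (\<lambda>x. \<phi> x * \<psi> x) \<in> C1c U"
proof -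
  assume \<phi>: "\<phi> \<in> C1c U" and C: "C1 \<psi>"
  then obtain K where K: "K \<subseteq> U" "zero_off K \<phi>" "C1 \<phi>" by (auto simp: C1c_def)
  have "zero_off K (\<lambda>x. \<phi> x * \<psi> x)" using K(2) by (simp add: zero_off_def)
  then show "(\<lambda>x. \<phi> x * \<psi> x) \<in> C1c U" unfolding C1c_def using K(1) C1_mult(1)[OF K(3) C] by blast
qed

text \<open>The product rule: the equation for \<open>q\<close> is tested with \<open>\<phi>\<close>
  times \<open>\<psi>\<close>.\<close>

lemma wdiv_mult:
  assumes "wdiv U q p" "C1 \<psi>" "\<And>x. \<bar>\<psi> x\<bar> \<le> B" "\<And>x. norm (grad \<psi> x) \<le> B'"
  shows "wdiv U (\<lambda>x. \<psi> x *\<^sub>R q x) (\<lambda>x. \<psi> x * p x + q x \<bullet> grad \<psi> x)"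
  unfolding wdiv_def
proof (intro conjI ballI)
  have q: "integrable lborel q" and p: "integrable lborel p" using assms(1) by (auto simp: wdiv_def)
  show "integrable lborel (\<lambda>x. \<psi> x *\<^sub>R q x)"
  proof (rule Bochner_Integration.integrable_bound[of _ "\<lambda>x. B *\<^sub>R q x"])
    show "(\<lambda>x. \<psi> x *\<^sub>R q x) \<in> borel_measurable lborel"
      using q C1c_borel(1)[OF assms(2)] by measurable
    have "\<bar>\<psi> x\<bar> * norm (q x) \<le> \<bar>B\<bar> * norm (q x)" for x
      using assms(3)[of x] by (intro mult_right_mono) auto
    then show "AE x in lborel. norm (\<psi> x *\<^sub>R q x) \<le> norm (B *\<^sub>R q x)" by simp
  qed (use q in simp)
  show "integrable lborel (\<lambda>x. \<psi> x * p x + q x \<bullet> grad \<psi> x)"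
    using integrable_mult_bounded[OF p, of \<psi> B] integrable_inner_bounded[OF q, of "grad \<psi>" B'] assms(2-4)
    by (simp add: C1c_borel mult.commute)
  fix \<phi> assume \<phi>: "\<phi> \<in> C1c U"
  then have C: "C1 \<phi>" by (simp add: C1c_def)
  show "(\<integral>x. (\<psi> x * p x + q x \<bullet> grad \<psi> x) * \<phi> x + (\<psi> x *\<^sub>R q x) \<bullet> grad \<phi> x \<partial>lborel) = 0"
    using wdivD(3)[OF assms(1) C1c_mult[OF \<phi> assms(2)]]
    by (simp add: C1_mult(2)[OF C assms(2)] inner_add_right algebra_simps)
qed

lemma wdiv_mult_C1c:
  assumes "wdiv U q p" "\<psi> \<in> C1c V"
  shows "wdiv U (\<lambda>x. \<psi> x *\<^sub>R q x) (\<lambda>x. \<psi> x * p x + q x \<bullet> grad \<psi> x)"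
proof -
  obtain B B' where "\<And>x. \<bar>\<psi> x\<bar> \<le> B" "\<And>x. norm (grad \<psi> x) \<le> B'" using C1c_uniform(1,2)[OF assms(2)] by blast
  moreover have "C1 \<psi>" using assms(2) by (simp add: C1c_def)
  ultimately show ?thesis using wdiv_mult[OF assms(1), of \<psi> B B'] by blast
qed

lemma wdiv_add:
  assumes "wdiv U q p" "wdiv U q' p'"
  shows "wdiv U (\<lambda>x. q x + q' x) (\<lambda>x. p x + p' x)"
  unfolding wdiv_def
proof (intro conjI ballI)
  note i = wdivD(1,2)[OF assms(1)] wdivD(1,2)[OF assms(2)]
  show "integrable lborel (\<lambda>x. q x + q' x)" "integrable lborel (\<lambda>x. p x + p' x)" using i by auto
  fix \<phi> assume \<phi>: "\<phi> \<in> C1c U"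
  have "(\<integral>x. (p x + p' x) * \<phi> x + (q x + q' x) \<bullet> grad \<phi> x \<partial>lborel) =
    (\<integral>x. (p x * \<phi> x + q x \<bullet> grad \<phi> x) + (p' x * \<phi> x + q' x \<bullet> grad \<phi> x) \<partial>lborel)"
    by (simp add: algebra_simps)
  then show "(\<integral>x. (p x + p' x) * \<phi> x + (q x + q' x) \<bullet> grad \<phi> x \<partial>lborel) = 0"
    by (simp only: Bochner_Integration.integral_add[OF C1c_integrable_pair[OF \<phi> i(2,1)] C1c_integrable_pair[OF \<phi> i(4,3)]]
      wdivD(3)[OF assms(1) \<phi>] wdivD(3)[OF assms(2) \<phi>])
qed

lemma wdiv_scale:
  assumes "wdiv U q p" shows "wdiv U (\<lambda>x. c *\<^sub>R q x) (\<lambda>x. c * p x)"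
  unfolding wdiv_def
proof (intro conjI ballI)
  note i = wdivD(1,2)[OF assms(1)]
  show "integrable lborel (\<lambda>x. c *\<^sub>R q x)" "integrable lborel (\<lambda>x. c * p x)" using i by auto
  fix \<phi> assume \<phi>: "\<phi> \<in> C1c U"
  have "(\<integral>x. c * p x * \<phi> x + (c *\<^sub>R q x) \<bullet> grad \<phi> x \<partial>lborel) =
    (\<integral>x. c * (p x * \<phi> x + q x \<bullet> grad \<phi> x) \<partial>lborel)"
    by (simp add: algebra_simps)
  then show "(\<integral>x. c * p x * \<phi> x + (c *\<^sub>R q x) \<bullet> grad \<phi> x \<partial>lborel) = 0"
    by (simp only: Bochner_Integration.integral_mult_right_zero wdivD(3)[OF assms(1) \<phi>])
qed

lemma wdiv_zero: "wdiv U (\<lambda>x. 0) (\<lambda>x. 0)"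
  by (auto simp: wdiv_def)

lemma wdiv_sum:
  assumes "finite I" "\<And>i. i \<in> I \<Longrightarrow> wdiv U (q i) (p i)"
  shows "wdiv U (\<lambda>x. \<Sum>i\<in>I. q i x) (\<lambda>x. \<Sum>i\<in>I. p i x)"
  using assms
proof induction
  case empty then show ?case using wdiv_zero by simp
next
  case (insert i I)
  have "wdiv U (q i) (p i)" "wdiv U (\<lambda>x. \<Sum>i\<in>I. q i x) (\<lambda>x. \<Sum>i\<in>I. p i x)" using insert by auto
  then show ?case using wdiv_add insert.hyps by simp
qed

lemma wdiv_cong_AE:
  assumes "wdiv U q p" "integrable lborel q'" "integrable lborel p'"
    "AE x in lborel. x \<in> U \<longrightarrow> q x = q' x \<and> p x = p' x"
  shows "wdiv U q' p'"
  unfolding wdiv_def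
proof (intro conjI ballI assms(2,3))
  fix \<phi> assume \<phi>: "\<phi> \<in> C1c U"
  then obtain K where K: "K \<subseteq> U" "zero_off K \<phi>" by (auto simp: C1c_def)
  have "(\<integral>x. p' x * \<phi> x + q' x \<bullet> grad \<phi> x \<partial>lborel) = (\<integral>x. p x * \<phi> x + q x \<bullet> grad \<phi> x \<partial>lborel)"
  proof (rule integral_cong_AE)
    show "(\<lambda>x. p' x * \<phi> x + q' x \<bullet> grad \<phi> x) \<in> borel_measurable lborel"
      by (rule borel_measurable_integrable[OF C1c_integrable_pair[OF \<phi> assms(3,2)]])
    show "(\<lambda>x. p x * \<phi> x + q x \<bullet> grad \<phi> x) \<in> borel_measurable lborel"
      by (rule borel_measurable_integrable[OF C1c_integrable_pair[OF \<phi> wdivD(2,1)[OF assms(1)]]])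
    show "AE x in lborel. p' x * \<phi> x + q' x \<bullet> grad \<phi> x = p x * \<phi> x + q x \<bullet> grad \<phi> x"
      using assms(4)
    proof eventually_elim
      case (elim x)
      then have *: "x \<in> U \<Longrightarrow> q x = q' x \<and> p x = p' x" by simp
      show ?case
      proof (cases "x \<in> K")
        case True
        then show ?thesis using * K(1) by auto
      next
        case False
        then show ?thesis using K(2) zero_off_grad[OF K(2) False] by (simp add: zero_off_def)
      qed
    qed
  qed
  then show "(\<integral>x. p' x * \<phi> x + q' x \<bullet> grad \<phi> x \<partial>lborel) = 0" using wdivD(3)[OF assms(1) \<phi>] by simp
qed

text \<open>The indicator of a closed neighbourhood of \<open>K\<close> is mollified. The value 1 on
  an open \<open>V\<close>, not just on \<open>K\<close>, makes the gradient vanish on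
  \<open>K\<close> too.\<close>

lemma smooth_urysohn:
  fixes K :: "(real^3) set"
  assumes K: "compact K" "open U" "K \<subseteq> U"
  shows "\<exists>\<psi>\<in>tests U. \<exists>V. open V \<and> K \<subseteq> V \<and> (\<forall>x\<in>V. \<psi> x = 1)"
proof -
  obtain d where d: "d > 0" "\<And>x y. x \<in> K \<Longrightarrow> dist x y < d \<Longrightarrow> y \<in> U"
    using compact_open_margin[OF K] by blast
  \<comment> \<open>The indicator reaches \<open>2 * s\<close> from \<open>K\<close> and the
    mollifier \<open>s\<close> further, less than \<open>d\<close> in total; within \<open>s\<close>
    of \<open>K\<close> the average sees only the value 1.\<close>
  define s where "s = d / 4"
  have s: "s > 0" using d by (simp add: s_def)
  define L where "L = {x + y |x y. x \<in> K \<and> y \<in> cball 0 (2 * s)}"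
  have L: "compact L" unfolding L_def by (intro compact_sums K compact_cball)
  then have Lm: "L \<in> sets borel" by (intro borel_closed compact_imp_closed)
  define f :: "real^3 \<Rightarrow> real" where "f = indicator L"
  have f: "integrable lborel f"
    unfolding f_def by (rule integrable_real_indicator[OF _ emeasure_compact_finite[OF L]]) (simp add: Lm)
  obtain \<rho> where \<rho>: "mollifier (ball 0 s) \<rho>" using exists_mollifier[of "ball 0 s"] s by auto
  note r = mollifier_facts[OF \<rho>]
  obtain S where S: "S \<subseteq> ball 0 s" "zero_off S \<rho>" using r(9) by blast
  have t: "mol f \<rho> \<in> tests U"
  proof (rule mol_tests[OF f L _ r(2) S(2)])
    show "x \<notin> L \<Longrightarrow> f x = 0" for x by (simp add: f_def)
    fix x y assume "x \<in> L" "y \<in> S"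
    then obtain a b where ab: "x = a + b" "a \<in> K" "norm b \<le> 2 * s" "norm y < s" using S(1) unfolding L_def by auto
    then have "norm (b + y) < d" using norm_triangle_ineq[of b y] s by (simp add: s_def)
    then show "x + y \<in> U" using ab by (intro d(2)[of a]) (auto simp: dist_norm norm_minus_commute algebra_simps)
  qed
  have one: "mol f \<rho> x = 1" if x: "x \<in> (\<Union>a\<in>K. ball a s)" for x
  proof -
    obtain a where a: "a \<in> K" "dist a x < s" using x by auto
    have "f y * \<rho> (x - y) = \<rho> (x - y)" for y
    proof (cases "\<rho> (x - y) = 0")
      case False
      then have "norm (x - y) < s" using r(8) by auto
      then have "norm (y - a) \<le> 2 * s"
        using a(2) norm_triangle_ineq[of "y - x" "x - a"] by (simp add: dist_norm norm_minus_commute)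
      then have "y \<in> L" unfolding L_def using a(1)
        by (intro CollectI exI[of _ a] exI[of _ "y - a"]) simp
      then show ?thesis by (simp add: f_def)
    qed simp
    then show ?thesis unfolding mol_def using integral_reflect(1)[of \<rho> x] r(6) by presburger
  qed
  have "K \<subseteq> (\<Union>a\<in>K. ball a s)" using s by auto
  moreover have "open (\<Union>a\<in>K. ball a s)" by blast
  ultimately show ?thesis using t one by blast
qed

text \<open>A partition of unity: \<open>\<psi>\<close> is 1 near the part of the support outside
  \<open>O2\<close>, so \<open>\<psi>\<close> times \<open>\<phi>\<close> is supported in
  \<open>O1\<close> and the rest in \<open>O2\<close>.\<close>

lemma wdiv_Un:
  assumes O: "open O1" "open O2" and "wdiv O1 q p" "wdiv O2 q p"
  shows "wdiv (O1 \<union> O2) q p"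
  unfolding wdiv_def
proof (intro conjI ballI)
  show q: "integrable lborel q" and p: "integrable lborel p" using assms by (auto simp: wdiv_def)
  fix \<phi> assume \<phi>: "\<phi> \<in> C1c (O1 \<union> O2)"
  then obtain K where K: "K \<subseteq> O1 \<union> O2" "zero_off K \<phi>" and C: "C1 \<phi>" by (auto simp: C1c_def)
  have cK: "compact (K - O2)" "compact K" using K O by (auto simp: zero_off_def compact_diff)
  obtain \<psi> V where \<psi>: "\<psi> \<in> tests O1" "open V" "K - O2 \<subseteq> V" "\<And>x. x \<in> V \<Longrightarrow> \<psi> x = 1"
    using smooth_urysohn[OF cK(1) O(1)] K(1) by blast
  have C\<psi>: "C1 \<psi>" "\<psi> \<in> C1c O1" using \<psi>(1) smooth_C1 tests_C1c by (auto simp: tests_def)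
  have C1\<psi>: "C1 (\<lambda>x. 1 - \<psi> x)" using C1_diff(1)[OF C1_const C\<psi>(1)] .
  let ?a = "\<lambda>x. \<psi> x * \<phi> x" and ?b = "\<lambda>x. \<phi> x * (1 - \<psi> x)"
  have a: "?a \<in> C1c O1" by (rule C1c_mult[OF C\<psi>(2) C])
  have b: "?b \<in> C1c O2"
  proof -
    have "zero_off (K - V) ?b" using K(2) \<psi>(4) \<open>open V\<close> by (auto simp: zero_off_def compact_diff)
    moreover have "K - V \<subseteq> O2" using \<psi>(3) by blast
    ultimately show ?thesis unfolding C1c_def using C1_mult(1)[OF C C1\<psi>] by blast
  qed
  have e: "grad \<phi> x = grad ?a x + grad ?b x" for x
    using C1_add(2)[of ?a ?b] a b by (simp add: C1c_def algebra_simps)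
  have "(\<integral>x. p x * \<phi> x + q x \<bullet> grad \<phi> x \<partial>lborel) = (\<integral>x. (p x * ?a x + q x \<bullet> grad ?a x) + (p x * ?b x + q x \<bullet> grad ?b x) \<partial>lborel)"
    by (rule Bochner_Integration.integral_cong) (auto simp: e inner_add_right algebra_simps)
  then show "(\<integral>x. p x * \<phi> x + q x \<bullet> grad \<phi> x \<partial>lborel) = 0"
    by (simp only: Bochner_Integration.integral_add[OF C1c_integrable_pair[OF a p q] C1c_integrable_pair[OF b p q]]
      wdivD(3)[OF assms(3) a] wdivD(3)[OF assms(4) b])
qed

lemma wdiv_empty: "integrable lborel q \<Longrightarrow> integrable lborel p \<Longrightarrow> wdiv {} q p"
proof -
  have *: "\<phi> = (\<lambda>x. 0)" if "\<phi> \<in> C1c {}" for \<phi> using that by (auto simp: C1c_def zero_off_def)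
  then show "integrable lborel q \<Longrightarrow> integrable lborel p \<Longrightarrow> wdiv {} q p"
    by (auto simp: wdiv_def grad_const dest!: *)
qed

text \<open>The support is covered by finitely many balls, which are merged one at a time. Thanks to
  this, interior points, faces, edges and vertices can be treated separately.\<close>

lemma wdiv_local:
  assumes p: "integrable lborel p" and q: "integrable lborel q"
    and loc: "\<And>x. x \<in> U \<Longrightarrow> \<exists>r>0. wdiv (ball x r) q p"
  shows "wdiv U q p"
  unfolding wdiv_def
proof (intro conjI ballI p q)
  fix \<phi> assume \<phi>: "\<phi> \<in> C1c U"
  then obtain K where K: "K \<subseteq> U" "zero_off K \<phi>" and C: "C1 \<phi>" by (auto simp: C1c_def)
  obtain r where r: "\<And>x. x \<in> U \<Longrightarrow> r x > 0 \<and> wdiv (ball x (r x)) q p" using loc by metis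
  have "K \<subseteq> (\<Union>x\<in>K. ball x (r x))" using r K by force
  then obtain F where F: "F \<subseteq> K" "finite F" "K \<subseteq> (\<Union>x\<in>F. ball x (r x))"
    using compactE_image[of K K "\<lambda>x. ball x (r x)"] K by (auto simp: zero_off_def)
  have "wdiv (\<Union>x\<in>F. ball x (r x)) q p"
    using F(2) F(1)
  proof induction
    case empty then show ?case using wdiv_empty[OF q p] by simp
  next
    case (insert x F)
    then show ?case using wdiv_Un[of "ball x (r x)" "\<Union>x\<in>F. ball x (r x)"] r K(1) by auto
  qed
  moreover have "\<phi> \<in> C1c (\<Union>x\<in>F. ball x (r x))" using K F C by (auto simp: C1c_def)
  ultimately show "(\<integral>x. p x * \<phi> x + q x \<bullet> grad \<phi> x \<partial>lborel) = 0" by (rule wdivD(3))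
qed

text \<open>Near 0 the convolution of \<open>\<phi>\<close> with the indicator of a large ball is
  constant, so its gradient at 0, which is the integral of the reflected gradient, vanishes.\<close>

lemma integral_grad_zero:
  assumes \<phi>: "\<phi> \<in> C1c U"
  shows "(\<integral>x. grad \<phi> x \<bullet> a \<partial>lborel) = 0"
proof -
  obtain K where K: "zero_off K \<phi>" and C: "\<phi> \<in> C1c UNIV" "C1 \<phi>" using \<phi> by (auto simp: C1c_def)
  obtain R where R: "K \<subseteq> ball 0 R"
    using bounded_subset_ballD[OF compact_imp_bounded] K unfolding zero_off_def by metis
  define f :: "real^3 \<Rightarrow> real" where "f = indicator (cball 0 (R + 1))"
  have f: "integrable lborel f"
    unfolding f_def by (rule integrable_real_indicator[OF _ emeasure_compact_finite[OF compact_cball]]) simp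
  have f1: "f y = 1" if "x \<in> ball 0 1" "x - y \<in> K" for x y
  proof -
    have "norm (x - y) < R" using that R by auto
    then have "norm y \<le> R + 1" using norm_triangle_ineq4[of x "x - y"] that by simp
    then show ?thesis by (simp add: f_def)
  qed
  have "mol f \<phi> x = (\<integral>y. \<phi> y \<partial>lborel)" if x: "x \<in> ball 0 1" for x
  proof -
    have "f y * \<phi> (x - y) = \<phi> (x - y)" for y
      using f1[OF x, of y] K by (cases "x - y \<in> K") (auto simp: zero_off_def)
    then show ?thesis unfolding mol_def using integral_reflect(1)[of \<phi> x] by presburger
  qed
  then have "(mol f \<phi> has_derivative (\<lambda>h. 0 \<bullet> h)) (at 0)"
    using has_derivative_transform_within_open[of "\<lambda>x. \<integral>y. \<phi> y \<partial>lborel" "\<lambda>h. 0 \<bullet> h" 0 UNIV "ball 0 1" "mol f \<phi>"] by simp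
  then have "grad (mol f \<phi>) 0 \<bullet> a = 0" using grad_eqI by (metis inner_zero_left)
  then have "(\<integral>y. f y * (grad \<phi> (0 - y) \<bullet> a) \<partial>lborel) = 0" by (simp only: grad_mol_inner[OF f C(1)])
  moreover have "f y * (grad \<phi> (0 - y) \<bullet> a) = grad \<phi> (0 - y) \<bullet> a" for y
    using f1[of 0 y] zero_off_grad[OF K, of "0 - y"] by (cases "0 - y \<in> K") auto
  ultimately have "(\<integral>y. grad \<phi> (0 - y) \<bullet> a \<partial>lborel) = 0" by (simp only:)
  then show ?thesis using integral_reflect(1)[of "\<lambda>y. grad \<phi> y \<bullet> a" 0] by presburger
qed

lemma wdiv_classical:
  assumes \<phi>: "\<phi> \<in> C1c V"
  shows "wdiv U (\<lambda>x. \<phi> x *\<^sub>R a) (\<lambda>x. grad \<phi> x \<bullet> a)"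
  unfolding wdiv_def
proof (intro conjI ballI)
  have C: "C1 \<phi>" using \<phi> by (simp add: C1c_def)
  show "integrable lborel (\<lambda>x. \<phi> x *\<^sub>R a)" using C1c_integrable[OF \<phi>] by simp
  obtain K where K: "zero_off K \<phi>" using \<phi> by (auto simp: C1c_def)
  have "integrable lborel (\<lambda>x. indicator K x *\<^sub>R (grad \<phi> x \<bullet> a))"
    using K by (intro borel_integrable_compact) (auto simp: zero_off_def intro!: continuous_intros continuous_on_subset[OF C1_continuous_grad[OF C]])
  moreover have "(\<lambda>x. indicator K x *\<^sub>R (grad \<phi> x \<bullet> a)) = (\<lambda>x. grad \<phi> x \<bullet> a)"
    using zero_off_grad[OF K] by (auto simp: fun_eq_iff indicator_def)
  ultimately show "integrable lborel (\<lambda>x. grad \<phi> x \<bullet> a)" by simp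
  fix \<psi> assume "\<psi> \<in> C1c U"
  then have "C1 \<psi>" by (simp add: C1c_def)
  then show "(\<integral>x. grad \<phi> x \<bullet> a * \<psi> x + (\<phi> x *\<^sub>R a) \<bullet> grad \<psi> x \<partial>lborel) = 0"
    using integral_grad_zero[OF C1c_mult[OF \<phi>], of \<psi> a] by (simp add: C1_mult(2)[OF C] inner_add_left inner_commute algebra_simps)
qed

lemma C1_reflect:
  assumes "C1 \<phi>"
  shows "C1 (\<lambda>y. \<phi> (x - y))" and "grad (\<lambda>y. \<phi> (x - y)) = (\<lambda>y. - grad \<phi> (x - y))"
proof -
  have d: "((\<lambda>y. \<phi> (x - y)) has_derivative (\<lambda>h. grad \<phi> (x - y) \<bullet> (- h))) (at y)" for y
    by (rule has_derivative_compose[OF _ C1_has_derivative[OF assms]]) (auto intro!: derivative_eq_intros)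
  have c: "continuous_on UNIV (\<lambda>y. - grad \<phi> (x - y))"
    by (intro continuous_intros continuous_on_compose2[OF C1_continuous_grad[OF assms]]) auto
  show "C1 (\<lambda>y. \<phi> (x - y))" and "grad (\<lambda>y. \<phi> (x - y)) = (\<lambda>y. - grad \<phi> (x - y))"
    using C1I2[OF d, of "\<lambda>y. - grad \<phi> (x - y)"] c by auto
qed

text \<open>The equation is tested with the reflected kernel. Here and below
  \<open>wdiv U (\<lambda>y. u y *\<^sub>R e) g\<close> expresses that \<open>g\<close> is the weak
  derivative of \<open>u\<close> in the direction \<open>e\<close>.\<close>

lemma grad_mol_weak:
  assumes w: "wdiv U (\<lambda>y. u y *\<^sub>R e) g" and u: "integrable lborel u" and \<rho>: "\<rho> \<in> C1c UNIV" "zero_off S \<rho>"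
    and S: "\<And>z. z \<in> S \<Longrightarrow> x - z \<in> U"
  shows "grad (mol u \<rho>) x \<bullet> e = mol g \<rho> x"
proof -
  have C: "C1 \<rho>" using \<rho> by (simp add: C1c_def)
  let ?\<phi> = "\<lambda>y. \<rho> (x - y)"
  have "zero_off ((\<lambda>z. x - z) ` S) ?\<phi>"
    unfolding zero_off_def
  proof (intro conjI allI impI)
    show "compact ((\<lambda>z. x - z) ` S)" using \<rho>(2) by (intro compact_continuous_image continuous_intros) (auto simp: zero_off_def)
    fix y assume "y \<notin> (\<lambda>z. x - z) ` S"
    then have "x - y \<notin> S" by (metis add_diff_cancel_left' diff_add_cancel diff_diff_eq2 image_eqI)
    then show "\<rho> (x - y) = 0" using \<rho>(2) by (simp add: zero_off_def)
  qed
  moreover have "(\<lambda>z. x - z) ` S \<subseteq> U" using S by auto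
  ultimately have "?\<phi> \<in> C1c U" unfolding C1c_def using C1_reflect(1)[OF C] by blast
  note \<phi> = this
  have i1: "integrable lborel (\<lambda>y. g y * \<rho> (x - y))" by (rule C1c_integrable_mult[OF \<phi> wdivD(2)[OF w]])
  have "integrable lborel (\<lambda>y. (u y *\<^sub>R e) \<bullet> grad ?\<phi> y)" by (rule C1c_integrable_inner[OF \<phi> wdivD(1)[OF w]])
  then have i2: "integrable lborel (\<lambda>y. - (u y * (grad \<rho> (x - y) \<bullet> e)))"
    by (simp add: C1_reflect(2)[OF C] inner_commute)
  have "(\<integral>y. g y * \<rho> (x - y) + - (u y * (grad \<rho> (x - y) \<bullet> e)) \<partial>lborel) = 0"
    using wdivD(3)[OF w \<phi>] by (simp add: C1_reflect(2)[OF C] inner_commute)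
  then have "(\<integral>y. g y * \<rho> (x - y) \<partial>lborel) + (\<integral>y. - (u y * (grad \<rho> (x - y) \<bullet> e)) \<partial>lborel) = 0"
    by (simp only: Bochner_Integration.integral_add[OF i1 i2])
  then show ?thesis by (simp add: grad_mol_inner[OF u \<rho>(1)] mol_def)
qed

section \<open>Square integrable functions\<close>

text \<open>Mollification and \<open>wdiv\<close> ask for integrability, products for square
  integrability. On a bounded set the latter implies the former.\<close>

definition l12 :: "(real^3 \<Rightarrow> real) \<Rightarrow> bool" where
  "l12 f \<longleftrightarrow> integrable lborel f \<and> integrable lborel (\<lambda>x. (f x)\<^sup>2)"

lemma l12D: "l12 f \<Longrightarrow> integrable lborel f" "l12 f \<Longrightarrow> integrable lborel (\<lambda>x. (f x)\<^sup>2)"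
  "l12 f \<Longrightarrow> f \<in> borel_measurable borel"
  using borel_measurable_integrable[of lborel f] by (auto simp: l12_def)

lemma am_gm_mult: "t > 0 \<Longrightarrow> \<bar>a * b\<bar> \<le> t * a\<^sup>2 + b\<^sup>2 / t" for a b t :: real
proof -
  assume t: "t > 0"
  have "0 \<le> (t * \<bar>a\<bar> - \<bar>b\<bar>)\<^sup>2 + t\<^sup>2 * a\<^sup>2 + b\<^sup>2" by simp
  then have "t * \<bar>a * b\<bar> \<le> t\<^sup>2 * a\<^sup>2 + b\<^sup>2"
    by (simp add: power2_diff power_mult_distrib abs_mult algebra_simps)
  then show ?thesis using t by (simp add: field_simps power2_eq_square)
qed

lemma integrable_mult_sq:
  fixes f g :: "'a \<Rightarrow> real"
  assumes "f \<in> borel_measurable M" "g \<in> borel_measurable M"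
    "integrable M (\<lambda>x. (f x)\<^sup>2)" "integrable M (\<lambda>x. (g x)\<^sup>2)"
  shows "integrable M (\<lambda>x. f x * g x)"
proof (rule Bochner_Integration.integrable_bound[of _ "\<lambda>x. (f x)\<^sup>2 + (g x)\<^sup>2"])
  show "AE x in M. norm (f x * g x) \<le> norm ((f x)\<^sup>2 + (g x)\<^sup>2)"
    using am_gm_mult[of 1 "f _" "g _"] by (auto intro!: AE_I2 order_trans[OF _ abs_ge_self])
qed (use assms in auto)

lemma l12_mult: "l12 f \<Longrightarrow> l12 g \<Longrightarrow> integrable lborel (\<lambda>x. f x * g x)"
  by (rule integrable_mult_sq) (simp_all add: l12D)

lemma l12_add: assumes "l12 f" "l12 g" shows "l12 (\<lambda>x. f x + g x)"
proof -
  have "integrable lborel (\<lambda>x. (f x)\<^sup>2 + 2 * (f x * g x) + (g x)\<^sup>2)"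
    using assms by (intro Bochner_Integration.integrable_add integrable_mult_right l12D l12_mult)
  then show ?thesis using assms by (simp add: l12_def power2_sum algebra_simps)
qed

lemma l12_bounded_mult:
  assumes "l12 f" "h \<in> borel_measurable borel" "\<And>x. \<bar>h x\<bar> \<le> B"
  shows "l12 (\<lambda>x. h x * f x)"
proof -
  have "\<bar>(h x)\<^sup>2\<bar> \<le> B\<^sup>2" for x using power_mono[OF assms(3)[of x] abs_ge_zero, of 2] by simp
  then have "integrable lborel (\<lambda>x. (f x)\<^sup>2 * (h x)\<^sup>2)"
    by (intro integrable_mult_bounded[of _ _ _ "B\<^sup>2"] l12D assms(1)) (use assms(2) in auto)
  moreover have "integrable lborel (\<lambda>x. f x * h x)"
    by (intro integrable_mult_bounded[of _ _ _ "B"] l12D assms(1)) (use assms(2,3) in auto)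
  ultimately show ?thesis by (simp add: l12_def power_mult_distrib mult.commute)
qed

lemma l12_cmult: "l12 f \<Longrightarrow> l12 (\<lambda>x. c * f x)"
  by (simp add: l12_def power_mult_distrib)

lemma l12_zero: "l12 (\<lambda>x. 0)" by (simp add: l12_def)

lemma l12_sum: "(\<And>i. i \<in> I \<Longrightarrow> l12 (f i)) \<Longrightarrow> l12 (\<lambda>x. \<Sum>i\<in>I. f i x)"
  by (induction I rule: infinite_finite_induct) (simp_all add: l12_zero l12_add)

lemma l12_diff: assumes "l12 f" "l12 g" shows "l12 (\<lambda>x. f x - g x)"
  using l12_add[OF assms(1) l12_cmult[OF assms(2), of "-1"]] by simp

lemma C1c_l12_mult:
  assumes "\<phi> \<in> C1c U" "l12 f" shows "l12 (\<lambda>x. \<phi> x * f x)" "l12 (\<lambda>x. (grad \<phi> x \<bullet> a) * f x)"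
proof -
  have C: "C1 \<phi>" using assms by (simp add: C1c_def)
  obtain B where B: "\<And>x. \<bar>\<phi> x\<bar> \<le> B" using C1c_uniform(1)[OF assms(1)] by blast
  obtain B' where B': "\<And>x. norm (grad \<phi> x) \<le> B'" using C1c_uniform(2)[OF assms(1)] by blast
  have "\<bar>grad \<phi> x \<bullet> a\<bar> \<le> B' * norm a" for x
    using Cauchy_Schwarz_ineq2[of "grad \<phi> x" a] mult_right_mono[OF B'[of x] norm_ge_zero[of a]] by linarith
  note * = this
  note [measurable] = C1c_borel[OF C]
  show "l12 (\<lambda>x. \<phi> x * f x)" by (rule l12_bounded_mult[OF assms(2) _ B]) simp
  show "l12 (\<lambda>x. (grad \<phi> x \<bullet> a) * f x)" by (rule l12_bounded_mult[OF assms(2) _ *]) simp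
qed

section \<open>Continuity of translations in the square integrable norm\<close>

definition trans_cont :: "(real^3 \<Rightarrow> real) \<Rightarrow> bool" where
  "trans_cont g \<longleftrightarrow> (\<forall>Y. Y \<longlonglongrightarrow> 0 \<longrightarrow> (\<lambda>n. \<integral>x. (g (x - Y n) - g x)\<^sup>2 \<partial>lborel) \<longlonglongrightarrow> 0)"

lemma lborel_translate:
  fixes f :: "'a::euclidean_space \<Rightarrow> 'b::{banach, second_countable_topology}"
  shows "(\<integral>x. f (x - y) \<partial>lborel) = (\<integral>x. f x \<partial>lborel)"
    and "integrable lborel (\<lambda>x. f (x - y)) \<longleftrightarrow> integrable lborel f"
proof -
  show "(\<integral>x. f (x - y) \<partial>lborel) = (\<integral>x. f x \<partial>lborel)"
    using integral_reflect(1)[of "\<lambda>z. f (- z)" y] integral_reflect(1)[of f 0] by simp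
  show "integrable lborel (\<lambda>x. f (x - y)) \<longleftrightarrow> integrable lborel f"
    using integral_reflect(2)[of "\<lambda>z. f (- z)" y] integral_reflect(2)[of f 0] by simp
qed

lemma l12_translate: "l12 g \<Longrightarrow> l12 (\<lambda>x. g (x - y))"
  using lborel_translate(2)[of g y] lborel_translate(2)[of "\<lambda>x. (g x)\<^sup>2" y] by (simp add: l12_def)

lemma sq_sum3: "(a + b + c)\<^sup>2 \<le> 3 * (a\<^sup>2 + b\<^sup>2 + c\<^sup>2)" for a b c :: real
proof -
  have "0 \<le> (a - b)\<^sup>2 + (b - c)\<^sup>2 + (a - c)\<^sup>2" by simp
  then show ?thesis by (simp add: power2_eq_square algebra_simps)
qed

lemma trans_cont_limit:
  assumes g: "l12 g" and h: "\<And>e. e > 0 \<Longrightarrow> \<exists>h. l12 h \<and> trans_cont h \<and> (\<integral>x. (g x - h x)\<^sup>2 \<partial>lborel) \<le> e"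
  shows "trans_cont g"
  unfolding trans_cont_def
proof (intro allI impI)
  fix Y :: "nat \<Rightarrow> real^3" assume Y: "Y \<longlonglongrightarrow> 0"
  show "(\<lambda>n. \<integral>x. (g (x - Y n) - g x)\<^sup>2 \<partial>lborel) \<longlonglongrightarrow> 0"
  proof (rule LIMSEQ_I)
    fix e :: real assume e: "e > 0"
    \<comment> \<open>Each of three terms contributes at most \<open>e / 12\<close>; with the factor
      3 of \<open>sq_sum3\<close> the sum stays below \<open>e\<close>.\<close>
    obtain h where h: "l12 h" "trans_cont h" "(\<integral>x. (g x - h x)\<^sup>2 \<partial>lborel) \<le> e / 12" using h[of "e / 12"] e by auto
    have "(\<lambda>n. \<integral>x. (h (x - Y n) - h x)\<^sup>2 \<partial>lborel) \<longlonglongrightarrow> 0" using h(2) Y by (simp add: trans_cont_def)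
    then obtain N where N: "\<And>n. n \<ge> N \<Longrightarrow> norm ((\<integral>x. (h (x - Y n) - h x)\<^sup>2 \<partial>lborel) - 0) < e / 12"
      using LIMSEQ_D[of "\<lambda>n. \<integral>x. (h (x - Y n) - h x)\<^sup>2 \<partial>lborel" 0 "e / 12"] e by auto
    have "norm ((\<integral>x. (g (x - Y n) - g x)\<^sup>2 \<partial>lborel) - 0) < e" if n: "n \<ge> N" for n
    proof -
      let ?y = "Y n"
      have i: "integrable lborel (\<lambda>x. (g x - h x)\<^sup>2)" "integrable lborel (\<lambda>x. (h (x - ?y) - h x)\<^sup>2)"
        "integrable lborel (\<lambda>x. (g (x - ?y) - g x)\<^sup>2)" "integrable lborel (\<lambda>x. (g (x - ?y) - h (x - ?y))\<^sup>2)"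
        by (rule l12D(2)[OF l12_diff]; (intro l12_translate g h))+
      have e1: "(\<integral>x. (g (x - ?y) - h (x - ?y))\<^sup>2 \<partial>lborel) = (\<integral>x. (g x - h x)\<^sup>2 \<partial>lborel)"
        by (rule lborel_translate(1)[of "\<lambda>x. (g x - h x)\<^sup>2"])
      have "(\<integral>x. (g (x - ?y) - g x)\<^sup>2 \<partial>lborel) \<le> (\<integral>x. 3 * ((g (x - ?y) - h (x - ?y))\<^sup>2 + (h (x - ?y) - h x)\<^sup>2 + (g x - h x)\<^sup>2) \<partial>lborel)"
      proof (rule integral_mono)
        show "integrable lborel (\<lambda>x. 3 * ((g (x - ?y) - h (x - ?y))\<^sup>2 + (h (x - ?y) - h x)\<^sup>2 + (g x - h x)\<^sup>2))"
          using i by simp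
        fix x
        show "(g (x - ?y) - g x)\<^sup>2 \<le> 3 * ((g (x - ?y) - h (x - ?y))\<^sup>2 + (h (x - ?y) - h x)\<^sup>2 + (g x - h x)\<^sup>2)"
          using sq_sum3[of "g (x - ?y) - h (x - ?y)" "h (x - ?y) - h x" "h x - g x"]
          by (simp add: power2_commute)
      qed (use i in simp)
      moreover have "\<dots> = 3 * ((\<integral>x. (g (x - ?y) - h (x - ?y))\<^sup>2 \<partial>lborel) + (\<integral>x. (h (x - ?y) - h x)\<^sup>2 \<partial>lborel) + (\<integral>x. (g x - h x)\<^sup>2 \<partial>lborel))"
        using i by simp
      moreover have "(\<integral>x. (h (x - ?y) - h x)\<^sup>2 \<partial>lborel) < e / 12" using N[OF n] by simp
      moreover have "(\<integral>x. (g (x - ?y) - g x)\<^sup>2 \<partial>lborel) \<ge> 0" by simp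
      ultimately show ?thesis using h(3) e1 e unfolding real_norm_def by argo
    qed
    then show "\<exists>N. \<forall>n\<ge>N. norm ((\<integral>x. (g (x - Y n) - g x)\<^sup>2 \<partial>lborel) - 0) < e" by blast
  qed
qed

lemma trans_cont_zero: "trans_cont (\<lambda>x. 0)" by (simp add: trans_cont_def)

lemma trans_cont_cmult: assumes "trans_cont g" shows "trans_cont (\<lambda>x. c * g x)"
proof -
  have *: "(c * g (x - y) - c * g x)\<^sup>2 = c\<^sup>2 * (g (x - y) - g x)\<^sup>2" for x y
    by (simp add: power_mult_distrib[symmetric] algebra_simps)
  show ?thesis using assms unfolding trans_cont_def * integral_mult_right_zero
    by (auto intro!: tendsto_mult_right_zero)
qed

lemma trans_cont_add: assumes "l12 f" "l12 g" "trans_cont f" "trans_cont g" shows "trans_cont (\<lambda>x. f x + g x)"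
  unfolding trans_cont_def
proof (intro allI impI)
  fix Y :: "nat \<Rightarrow> real^3" assume Y: "Y \<longlonglongrightarrow> 0"
  let ?F = "\<lambda>n. 3 * ((\<integral>x. (f (x - Y n) - f x)\<^sup>2 \<partial>lborel) + (\<integral>x. (g (x - Y n) - g x)\<^sup>2 \<partial>lborel))"
  have "?F \<longlonglongrightarrow> 3 * (0 + 0)"
    using assms(3,4) Y unfolding trans_cont_def by (intro tendsto_intros) auto
  then have F: "?F \<longlonglongrightarrow> 0" by simp
  show "(\<lambda>n. \<integral>x. (f (x - Y n) + g (x - Y n) - (f x + g x))\<^sup>2 \<partial>lborel) \<longlonglongrightarrow> 0"
  proof (rule tendsto_sandwich[OF _ _ tendsto_const F])
    show "\<forall>\<^sub>F n in sequentially. 0 \<le> (\<integral>x. (f (x - Y n) + g (x - Y n) - (f x + g x))\<^sup>2 \<partial>lborel)" by simp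
    have "(\<integral>x. (f (x - Y n) + g (x - Y n) - (f x + g x))\<^sup>2 \<partial>lborel) \<le> ?F n" for n
    proof -
      let ?y = "Y n"
      have i: "integrable lborel (\<lambda>x. (f (x - ?y) - f x)\<^sup>2)" "integrable lborel (\<lambda>x. (g (x - ?y) - g x)\<^sup>2)"
        "integrable lborel (\<lambda>x. (f (x - ?y) + g (x - ?y) - (f x + g x))\<^sup>2)"
        by (rule l12D(2)[OF l12_diff]; (intro l12_translate l12_add assms(1,2))?)+
      have "(\<integral>x. (f (x - ?y) + g (x - ?y) - (f x + g x))\<^sup>2 \<partial>lborel) \<le> (\<integral>x. 3 * ((f (x - ?y) - f x)\<^sup>2 + (g (x - ?y) - g x)\<^sup>2) \<partial>lborel)"
      proof (rule integral_mono)
        show "(f (x - ?y) + g (x - ?y) - (f x + g x))\<^sup>2 \<le> 3 * ((f (x - ?y) - f x)\<^sup>2 + (g (x - ?y) - g x)\<^sup>2)" for x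
          using sq_sum3[of "f (x - ?y) - f x" "g (x - ?y) - g x" 0] by (simp add: algebra_simps)
      qed (use i in simp_all)
      then show ?thesis using i by simp
    qed
    then show "\<forall>\<^sub>F n in sequentially. (\<integral>x. (f (x - Y n) + g (x - Y n) - (f x + g x))\<^sup>2 \<partial>lborel) \<le> ?F n" by simp
  qed
qed

lemma trans_cont_sum:
  assumes "finite I" "\<And>i. i \<in> I \<Longrightarrow> l12 (f i) \<and> trans_cont (f i)"
  shows "trans_cont (\<lambda>x. \<Sum>i\<in>I. f i x)"
  using assms
proof induction
  case empty then show ?case by (simp add: trans_cont_zero)
next
  case (insert i I)
  have "l12 (\<lambda>x. \<Sum>i\<in>I. f i x)" using insert.prems by (intro l12_sum) auto
  then show ?case using insert trans_cont_add[of "f i" "\<lambda>x. \<Sum>i\<in>I. f i x"] by simp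
qed

lemma l12_indicator: "A \<in> sets borel \<Longrightarrow> emeasure lborel A < \<infinity> \<Longrightarrow> l12 (indicator A)"
proof -
  have [simp]: "(indicator A x)\<^sup>2 = (indicator A x :: real)" for x :: "real^3" by (simp add: indicator_def)
  show "A \<in> sets borel \<Longrightarrow> emeasure lborel A < \<infinity> \<Longrightarrow> l12 (indicator A)"
    unfolding l12_def by (auto intro!: integrable_real_indicator)
qed

text \<open>Expanding the square leaves twice the difference between the measure of \<open>U\<close>
  and that of its overlap with the translate. Openness gives pointwise convergence in
  \<open>U\<close>, and dominated convergence applies to sequences of translations.\<close>

lemma trans_cont_open:
  assumes U: "open U" "emeasure lborel U < \<infinity>"
  shows "trans_cont (indicator U)"
  unfolding trans_cont_def
proof (intro allI impI)
  fix Y :: "nat \<Rightarrow> real^3" assume Y: "Y \<longlonglongrightarrow> 0"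
  let ?f = "indicator U :: real^3 \<Rightarrow> real"
  have f: "l12 ?f" using U by (intro l12_indicator) auto
  have i: "integrable lborel ?f" "integrable lborel (\<lambda>x. ?f (x - y))" "integrable lborel (\<lambda>x. ?f (x - y) * ?f x)" for y
    by (intro l12D l12_mult l12_translate f)+
  have "(\<integral>x. (?f (x - y) - ?f x)\<^sup>2 \<partial>lborel) = 2 * ((\<integral>x. ?f x \<partial>lborel) - (\<integral>x. ?f (x - y) * ?f x \<partial>lborel))" for y
  proof -
    have "(?f (x - y) - ?f x)\<^sup>2 = (?f (x - y) + ?f x) - 2 * (?f (x - y) * ?f x)" for x
      by (auto simp: indicator_def)
    then have "(\<integral>x. (?f (x - y) - ?f x)\<^sup>2 \<partial>lborel) = (\<integral>x. (?f (x - y) + ?f x) - 2 * (?f (x - y) * ?f x) \<partial>lborel)" by presburger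
    then show ?thesis using i lborel_translate(1)[of ?f y] by simp
  qed
  note eq = this
  have lim: "(\<lambda>n. \<integral>x. ?f (x - Y n) * ?f x \<partial>lborel) \<longlonglongrightarrow> (\<integral>x. ?f x \<partial>lborel)"
  proof (rule integral_dominated_convergence[where w="?f"])
    have "(\<lambda>n. ?f (x - Y n) * ?f x) \<longlonglongrightarrow> ?f x" for x
    proof (cases "x \<in> U")
      case True
      have "(\<lambda>n. x - Y n) \<longlonglongrightarrow> x - 0" by (intro tendsto_intros Y)
      then have "\<forall>\<^sub>F n in sequentially. x - Y n \<in> U" using topological_tendstoD[of _ x sequentially U] U True by simp
      then have "\<forall>\<^sub>F n in sequentially. ?f (x - Y n) * ?f x = ?f x" by eventually_elim (simp add: True)
      then show ?thesis by (rule tendsto_eventually)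
    qed simp
    then show "AE x in lborel. (\<lambda>n. ?f (x - Y n) * ?f x) \<longlonglongrightarrow> ?f x" by simp
    show "AE x in lborel. norm (?f (x - Y n) * ?f x) \<le> ?f x" for n by (auto simp: indicator_def)
  qed (use i in auto)
  have "(\<lambda>n. 2 * ((\<integral>x. ?f x \<partial>lborel) - (\<integral>x. ?f (x - Y n) * ?f x \<partial>lborel))) \<longlonglongrightarrow> 2 * ((\<integral>x. ?f x \<partial>lborel) - (\<integral>x. ?f x \<partial>lborel))"
    by (intro tendsto_intros lim)
  then show "(\<lambda>n. \<integral>x. (?f (x - Y n) - ?f x)\<^sup>2 \<partial>lborel) \<longlonglongrightarrow> 0" unfolding eq by simp
qed

text \<open>Outer regularity approximates \<open>A\<close> in measure by open sets.\<close>

lemma trans_cont_indicator: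
  assumes A: "A \<in> sets borel" "emeasure lborel A < \<infinity>"
  shows "trans_cont (indicator A)"
proof (rule trans_cont_limit)
  show "l12 (indicator A)" using A by (rule l12_indicator)
  fix e :: real assume e: "e > 0"
  have "A \<in> sets lebesgue" using A(1) by simp
  from sets_lebesgue_outer_open[OF this e]
  obtain T where T: "open T" "A \<subseteq> T" "T - A \<in> lmeasurable" "emeasure lebesgue (T - A) < ennreal e" by blast
  have m: "T - A \<in> sets borel" "T \<in> sets borel" using T A by auto
  then have eT: "emeasure lborel (T - A) < ennreal e" using T(4) by simp
  have fT: "emeasure lborel T < \<infinity>"
  proof -
    have "(T - A) \<inter> A = {}" "(T - A) \<union> A = T" using T(2) by auto
    then have "emeasure lborel T = emeasure lborel (T - A) + emeasure lborel A"
      using plus_emeasure[of "T - A" lborel A] m A by simp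
    moreover have "emeasure lborel (T - A) < \<infinity>" using eT by (rule order_less_trans) simp
    ultimately show ?thesis using A(2) by simp
  qed
  have "(\<integral>x. (indicator A x - indicator T x :: real)\<^sup>2 \<partial>lborel) = (\<integral>x. (indicator (T - A) x :: real) \<partial>lborel)"
    using T(2) by (intro Bochner_Integration.integral_cong) (auto simp: indicator_def)
  also have "\<dots> = measure lborel (T - A)" by simp
  also have "\<dots> \<le> e" using eT e by (simp add: measure_def enn2real_leI less_imp_le)
  finally show "\<exists>h. l12 h \<and> trans_cont h \<and> (\<integral>x. (indicator A x - h x)\<^sup>2 \<partial>lborel) \<le> e"
    using trans_cont_open[OF T(1) fT] l12_indicator[OF m(2) fT] by blast
qed

text \<open>Simple functions bounded by twice \<bar>g\<bar> converge to \<open>g\<close> pointwise,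
  hence in the square norm by dominated convergence.\<close>

lemma trans_cont_l12:
  assumes g: "l12 g" shows "trans_cont g"
proof -
  have gm: "g \<in> borel_measurable lborel" using l12D(3)[OF g] by simp
  obtain F where F: "\<And>i. simple_function lborel (F i)" "\<And>x. (\<lambda>i. F i x) \<longlonglongrightarrow> g x"
     "\<And>i x. \<bar>F i x\<bar> \<le> 2 * \<bar>g x\<bar>"
    using borel_measurable_implies_sequence_metric[OF gm, of 0] by (auto simp: dist_norm)
  have Fm: "F i \<in> borel_measurable borel" for i using borel_measurable_simple_function[OF F(1)] by simp
  have Fsq: "(F i x)\<^sup>2 \<le> 4 * (g x)\<^sup>2" for i x
    using power_mono[OF F(3)[of i x] abs_ge_zero, of 2] by (simp add: power_mult_distrib)
  have Fl: "l12 (F i)" for i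
    unfolding l12_def
  proof
    show "integrable lborel (F i)"
      by (rule Bochner_Integration.integrable_bound[of _ "\<lambda>x. 2 * g x"]) (use l12D(1)[OF g] Fm F(3) in \<open>auto simp: abs_mult\<close>)
    show "integrable lborel (\<lambda>x. (F i x)\<^sup>2)"
      by (rule Bochner_Integration.integrable_bound[of _ "\<lambda>x. 4 * (g x)\<^sup>2"]) (use l12D(2)[OF g] Fm Fsq in auto)
  qed
  have Ft: "trans_cont (F i)" for i
  proof -
    let ?A = "\<lambda>c. F i -` {c}"
    have fin: "finite (range (F i))" using F(1)[of i] by (simp add: simple_function_def)
    \<comment> \<open>The value 0 is left out because its level set has infinite measure; the other
      level sets have finite measure by Markov's inequality.\<close>
    have rep: "F i = (\<lambda>x. \<Sum>c\<in>range (F i) - {0}. c * indicator (?A c) x)"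
    proof
      fix x
      have "(\<Sum>c\<in>range (F i) - {0}. c * indicator (?A c) x) = (\<Sum>c\<in>range (F i). c * indicator (?A c) x)"
        by (rule sum.mono_neutral_left) (use fin in auto)
      also have "\<dots> = (\<Sum>c\<in>{F i x}. c * indicator (?A c) x)"
        by (rule sum.mono_neutral_right) (use fin in \<open>auto simp: indicator_def\<close>)
      finally show "F i x = (\<Sum>c\<in>range (F i) - {0}. c * indicator (?A c) x)" by simp
    qed
    have "l12 (\<lambda>x. c * indicator (?A c) x) \<and> trans_cont (\<lambda>x. c * indicator (?A c) x)" if c: "c \<in> range (F i) - {0}" for c
    proof -
      have m: "?A c \<in> sets borel" using Fm[of i] by (simp add: measurable_sets_borel)
      let ?B = "{x \<in> space lborel. c\<^sup>2 \<le> (F i x)\<^sup>2}"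
      have "emeasure lborel ?B \<le> (1 / c\<^sup>2) * (\<integral>x. (F i x)\<^sup>2 \<partial>lborel)"
        by (rule integral_Markov_inequality[OF l12D(2)[OF Fl]]) (use c in auto)
      also have "\<dots> < \<infinity>" by simp
      finally have "emeasure lborel ?B < \<infinity>" .
      moreover have "?A c \<subseteq> ?B" by auto
      moreover have "?B \<in> sets lborel" using Fm[of i] by measurable
      ultimately have "emeasure lborel (?A c) < \<infinity>" by (meson emeasure_mono order_le_less_trans)
      then show ?thesis using l12_indicator[OF m] trans_cont_indicator[OF m] by (simp add: l12_cmult trans_cont_cmult)
    qed
    then show ?thesis by (subst rep) (intro trans_cont_sum, use fin in auto)
  qed
  have lim: "(\<lambda>i. \<integral>x. (g x - F i x)\<^sup>2 \<partial>lborel) \<longlonglongrightarrow> (\<integral>x. (0::real) \<partial>(lborel :: (real^3) measure))"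
  proof (rule integral_dominated_convergence[where w="\<lambda>x. 9 * (g x)\<^sup>2"])
    show "integrable lborel (\<lambda>x. 9 * (g x)\<^sup>2)" using l12D(2)[OF g] by simp
    have "(\<lambda>i. (g x - F i x)\<^sup>2) \<longlonglongrightarrow> (g x - g x)\<^sup>2" for x by (intro tendsto_intros F(2))
    then show "AE x in lborel. (\<lambda>i. (g x - F i x)\<^sup>2) \<longlonglongrightarrow> 0" by simp
    have "norm ((g x - F i x)\<^sup>2) \<le> 9 * (g x)\<^sup>2" for i x
    proof -
      have "\<bar>g x - F i x\<bar> \<le> 3 * \<bar>g x\<bar>" using F(3)[of i x] by linarith
      from power_mono[OF this abs_ge_zero, of 2] show ?thesis by (simp add: power_mult_distrib)
    qed
    then show "AE x in lborel. norm ((g x - F i x)\<^sup>2) \<le> 9 * (g x)\<^sup>2" for i by simp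
  qed (use gm Fm in auto)
  show ?thesis
  proof (rule trans_cont_limit[OF g])
    fix e :: real assume e: "e > 0"
    obtain i where "norm ((\<integral>x. (g x - F i x)\<^sup>2 \<partial>lborel) - (\<integral>x. (0::real) \<partial>(lborel :: (real^3) measure))) < e"
      using LIMSEQ_D[OF lim e] by blast
    then have "(\<integral>x. (g x - F i x)\<^sup>2 \<partial>lborel) \<le> e" by simp
    then show "\<exists>h. l12 h \<and> trans_cont h \<and> (\<integral>x. (g x - h x)\<^sup>2 \<partial>lborel) \<le> e" using Fl Ft by blast
  qed
qed

lemma translate_small:
  assumes g: "l12 g" and e: "e > 0"
  shows "\<exists>d>0. \<forall>y. norm y < d \<longrightarrow> (\<integral>x. (g (x - y) - g x)\<^sup>2 \<partial>lborel) < e"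
proof (rule ccontr)
  assume "\<not> ?thesis"
  then have *: "\<exists>y. norm y < d \<and> (\<integral>x. (g (x - y) - g x)\<^sup>2 \<partial>lborel) \<ge> e" if "d > 0" for d
    using that by (meson not_less)
  have "\<forall>n. \<exists>y. norm y < 1 / Suc n \<and> (\<integral>x. (g (x - y) - g x)\<^sup>2 \<partial>lborel) \<ge> e"
    by (rule allI, rule *) simp
  then obtain Y where Y: "\<And>n. norm (Y n) < 1 / Suc n" "\<And>n. (\<integral>x. (g (x - Y n) - g x)\<^sup>2 \<partial>lborel) \<ge> e" by metis
  have "Y \<longlonglongrightarrow> 0"
  proof (rule Lim_null_comparison[OF _ LIMSEQ_inverse_real_of_nat])
    show "\<forall>\<^sub>F n in sequentially. norm (Y n) \<le> inverse (real (Suc n))"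
      unfolding inverse_eq_divide by (intro always_eventually allI less_imp_le Y(1))
  qed
  then have "(\<lambda>n. \<integral>x. (g (x - Y n) - g x)\<^sup>2 \<partial>lborel) \<longlonglongrightarrow> 0" using trans_cont_l12[OF g] by (simp add: trans_cont_def)
  then have "e \<le> 0" by (rule LIMSEQ_le_const) (use Y(2) in blast)
  then show False using e by simp
qed

section \<open>Weak convergence of mollifications\<close>

lemma integrable_mol_mult:
  assumes f: "integrable lborel f" and g: "integrable lborel g" and \<rho>: "\<rho> \<in> C1c UNIV"
  shows "integrable lborel (\<lambda>x. f x * mol g \<rho> x)"
proof -
  obtain B where B: "\<And>x. \<bar>\<rho> x\<bar> \<le> B" using C1c_uniform(1)[OF \<rho>] by blast
  have C: "C1 \<rho>" using \<rho> by (simp add: C1c_def)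
  note [measurable] = C1c_borel[OF C]
  have "\<bar>mol g \<rho> x\<bar> \<le> B * (\<integral>y. \<bar>g y\<bar> \<partial>lborel)" for x
  proof -
    have i: "integrable lborel (\<lambda>y. g y * \<rho> (x - y))" by (rule integrable_mult_bounded[OF g _ B]) simp
    have "\<bar>mol g \<rho> x\<bar> \<le> (\<integral>y. \<bar>g y * \<rho> (x - y)\<bar> \<partial>lborel)" unfolding mol_def by (rule integral_abs_bound)
    also have "\<dots> \<le> (\<integral>y. B * \<bar>g y\<bar> \<partial>lborel)"
    proof (rule integral_mono)
      fix y
      have "\<bar>g y\<bar> * \<bar>\<rho> (x - y)\<bar> \<le> \<bar>g y\<bar> * B" by (rule mult_left_mono[OF B]) simp
      then show "\<bar>g y * \<rho> (x - y)\<bar> \<le> B * \<bar>g y\<bar>" by (simp add: abs_mult mult.commute)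
    qed (use i g in simp_all)
    finally show ?thesis by simp
  qed
  moreover have "mol g \<rho> \<in> borel_measurable borel" using mol_derivative(1)[OF g \<rho>] C1c_borel by blast
  ultimately show ?thesis by (intro integrable_mult_bounded[OF f]) auto
qed

text \<open>By Fubini the difference is an average over \<open>y\<close>, with weight
  \<open>\<rho> y\<close>, of the pairings of \<open>f\<close> with \<open>g (x - y) - g x\<close>.
  A weighted arithmetic-geometric inequality and the continuity of translations bound each
  pairing.\<close>

lemma mol_weak:
  assumes f: "l12 f" and g: "l12 g" and e: "e > 0"
  shows "\<exists>d>0. \<forall>\<rho>. mollifier (ball 0 d) \<rho> \<longrightarrow> \<bar>(\<integral>x. f x * mol g \<rho> x \<partial>lborel) - (\<integral>x. f x * g x \<partial>lborel)\<bar> \<le> e"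
proof -
  let ?If = "\<integral>x. (f x)\<^sup>2 \<partial>lborel"
  have If: "?If \<ge> 0" by simp
  \<comment> \<open>Chosen so that \<open>t * ?If\<close> is at most \<open>e / 2\<close>; the
    translation error, below \<open>t * (e / 2)\<close>, gives the other half after division by
    \<open>t\<close>.\<close>
  define t where "t = e / (2 * (?If + 1))"
  have If1: "?If + 1 > 0" using If by linarith
  then have t: "t > 0" using e unfolding t_def by (intro divide_pos_pos mult_pos_pos) auto
  obtain d where d: "d > 0" "\<And>y. norm y < d \<Longrightarrow> (\<integral>x. (g (x - y) - g x)\<^sup>2 \<partial>lborel) < t * (e / 2)"
    using translate_small[OF g, of "t * (e / 2)"] t e by auto
  have "\<bar>(\<integral>x. f x * mol g \<rho> x \<partial>lborel) - (\<integral>x. f x * g x \<partial>lborel)\<bar> \<le> e" if \<rho>: "mollifier (ball 0 d) \<rho>" for \<rho>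
  proof -
    note r = mollifier_facts[OF \<rho>]
    have [measurable]: "f \<in> borel_measurable borel" "g \<in> borel_measurable borel" "\<rho> \<in> borel_measurable borel"
      using f g r(3) by (auto simp: l12D C1c_def C1c_borel)
    define F where "F y x = \<rho> y * (f x * (g (x - y) - g x))" for y x
    have lg: "l12 (\<lambda>x. g (x - y) - g x)" for y by (intro l12_diff l12_translate g)
    have ix: "integrable lborel (\<lambda>x. f x * (g (x - y) - g x))" for y by (rule l12_mult[OF f lg])
    have bd: "(\<integral>x. \<bar>f x * (g (x - y) - g x)\<bar> \<partial>lborel) \<le> t * ?If + (\<integral>x. (g (x - y) - g x)\<^sup>2 \<partial>lborel) / t" for y
    proof -
      have "(\<integral>x. \<bar>f x * (g (x - y) - g x)\<bar> \<partial>lborel) \<le> (\<integral>x. t * (f x)\<^sup>2 + (g (x - y) - g x)\<^sup>2 / t \<partial>lborel)"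
        by (rule integral_mono[OF _ _ am_gm_mult[OF t]]) (use ix l12D(2)[OF f] l12D(2)[OF lg] in auto)
      also have "\<dots> = t * ?If + (\<integral>x. (g (x - y) - g x)\<^sup>2 \<partial>lborel) / t"
        using l12D(2)[OF f] l12D(2)[OF lg] by simp
      finally show ?thesis .
    qed
    have bd2: "(\<integral>x. \<bar>f x * (g (x - y) - g x)\<bar> \<partial>lborel) \<le> e" if "\<rho> y \<noteq> 0" for y
    proof -
      have "norm y < d" using r(8)[OF that] by simp
      have "(\<integral>x. (g (x - y) - g x)\<^sup>2 \<partial>lborel) / t \<le> t * (e / 2) / t"
        using d(2)[OF \<open>norm y < d\<close>] t by (intro divide_right_mono) auto
      moreover have "t * ?If \<le> t * (?If + 1)" using t by (intro mult_left_mono) auto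
      moreover have "t * (?If + 1) = e / 2" using If1 unfolding t_def by (simp add: field_simps)
      moreover have "t * (e / 2) / t = e / 2" using t by simp
      ultimately show ?thesis using bd[of y] by linarith
    qed
    have nF: "(\<integral>x. norm (F y x) \<partial>lborel) = \<rho> y * (\<integral>x. \<bar>f x * (g (x - y) - g x)\<bar> \<partial>lborel)" for y
      using r(5)[of y] unfolding F_def by (simp add: abs_mult)
    have nF2: "(\<integral>x. norm (F y x) \<partial>lborel) \<le> e * \<rho> y" for y
      using bd2[of y] r(5)[of y] unfolding nF by (cases "\<rho> y = 0") (auto simp: mult.commute)
    have iF: "integrable (lborel \<Otimes>\<^sub>M lborel) (case_prod F)"
    proof (rule lborel_pair.Fubini_integrable)
      show m: "case_prod F \<in> borel_measurable (lborel \<Otimes>\<^sub>M lborel)" unfolding F_def by measurable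
      show "integrable lborel (\<lambda>y. \<integral>x. norm (case (y, x) of (y, x) \<Rightarrow> F y x) \<partial>lborel)"
      proof (rule Bochner_Integration.integrable_bound[of _ "\<lambda>y. e * \<rho> y"])
        show "(\<lambda>y. \<integral>x. norm (case (y, x) of (y, x) \<Rightarrow> F y x) \<partial>lborel) \<in> borel_measurable lborel"
          using m by measurable
        show "AE y in lborel. norm (\<integral>x. norm (case (y, x) of (y, x) \<Rightarrow> F y x) \<partial>lborel) \<le> norm (e * \<rho> y)"
          using nF2 r(5) e by auto
      qed (use r(4) in simp)
      show "AE y in lborel. integrable lborel (\<lambda>x. case (y, x) of (y, x) \<Rightarrow> F y x)"
        using ix by (simp add: F_def)
    qed
    have iy: "(\<integral>y. F y x \<partial>lborel) = f x * mol g \<rho> x - f x * g x" for x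
    proof -
      obtain B where B: "\<And>x. \<bar>\<rho> x\<bar> \<le> B" using C1c_uniform(1)[OF r(3)] by blast
      have "integrable lborel (\<lambda>y. g (x - y))" using integral_reflect(2)[of g x] l12D(1)[OF g] by simp
      from integrable_mult_bounded[OF this _ B] have i: "integrable lborel (\<lambda>y. g (x - y) * \<rho> y)" by simp
      have "F y x = f x * (g (x - y) * \<rho> y) - f x * g x * \<rho> y" for y by (simp add: F_def algebra_simps)
      then have "(\<integral>y. F y x \<partial>lborel) = (\<integral>y. f x * (g (x - y) * \<rho> y) - f x * g x * \<rho> y \<partial>lborel)" by presburger
      also have "\<dots> = f x * (\<integral>y. g (x - y) * \<rho> y \<partial>lborel) - f x * g x * (\<integral>y. \<rho> y \<partial>lborel)"
        using i r(4) by simp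
      finally show ?thesis unfolding mol_commute[of g] using r(6) by (simp add: mol_def mult.commute)
    qed
    have "(\<integral>x. f x * mol g \<rho> x \<partial>lborel) - (\<integral>x. f x * g x \<partial>lborel) = (\<integral>x. (\<integral>y. F y x \<partial>lborel) \<partial>lborel)"
      unfolding iy using integrable_mol_mult[OF l12D(1)[OF f] l12D(1)[OF g] r(3)] l12_mult[OF f g] by simp
    then have "\<bar>(\<integral>x. f x * mol g \<rho> x \<partial>lborel) - (\<integral>x. f x * g x \<partial>lborel)\<bar> = \<bar>\<integral>y. (\<integral>x. F y x \<partial>lborel) \<partial>lborel\<bar>"
      using lborel_pair.Fubini_integral[OF iF] by simp
    also have "\<dots> \<le> (\<integral>y. \<bar>\<integral>x. F y x \<partial>lborel\<bar> \<partial>lborel)" by (rule integral_abs_bound)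
    also have "\<dots> \<le> (\<integral>y. e * \<rho> y \<partial>lborel)"
    proof (rule integral_mono)
      show "integrable lborel (\<lambda>y. \<bar>\<integral>x. F y x \<partial>lborel\<bar>)" using lborel_pair.integrable_fst'[OF iF] by simp
      show "integrable lborel (\<lambda>y. e * \<rho> y)" using r(4) by simp
      show "\<bar>\<integral>x. F y x \<partial>lborel\<bar> \<le> e * \<rho> y" for y
        by (rule order_trans[OF integral_abs_bound]) (use nF2[of y] in simp)
    qed
    finally show ?thesis using r(6) by simp
  qed
  then show ?thesis using d(1) by blast
qed

text \<open>The set \<open>H\<close> prescribes the side from which the kernels shrink to 0; it may
  be a half space.\<close>

definition mollifier_seq :: "(real^3) set \<Rightarrow> (nat \<Rightarrow> real^3 \<Rightarrow> real) \<Rightarrow> bool" where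
  "mollifier_seq H \<rho> \<longleftrightarrow> (\<forall>n. mollifier (H \<inter> ball 0 (1 / Suc n)) (\<rho> n))"

lemma exists_mollifier_seq:
  assumes "open H" "\<And>d. d > 0 \<Longrightarrow> H \<inter> ball 0 d \<noteq> {}"
  shows "\<exists>\<rho>. mollifier_seq H \<rho>"
proof -
  have "\<exists>\<rho>. mollifier (H \<inter> ball 0 (1 / Suc n)) \<rho>" for n
    by (rule exists_mollifier) (use assms in auto)
  then show ?thesis unfolding mollifier_seq_def by metis
qed

lemma mollifier_seq_eventually:
  assumes "mollifier_seq H \<rho>" "d > 0"
  shows "\<forall>\<^sub>F n in sequentially. mollifier (H \<inter> ball 0 d) (\<rho> n)"
proof -
  obtain N where N: "1 / Suc N < d" using nat_approx_posE[OF assms(2)] .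
  have "mollifier (H \<inter> ball 0 d) (\<rho> n)" if "n \<ge> N" for n
  proof (rule mollifier_mono)
    show "mollifier (H \<inter> ball 0 (1 / Suc n)) (\<rho> n)" using assms(1) by (simp add: mollifier_seq_def)
    have "1 / real (Suc n) \<le> 1 / real (Suc N)" using that by (simp add: frac_le)
    then have "1 / real (Suc n) \<le> d" using N by linarith
    then show "H \<inter> ball 0 (1 / Suc n) \<subseteq> H \<inter> ball 0 d" using subset_ball by blast
  qed
  then show ?thesis using eventually_sequentially by blast
qed

lemma mol_weak_seq:
  assumes f: "l12 f" and g: "l12 g" and \<rho>: "mollifier_seq H \<rho>"
  shows "(\<lambda>n. \<integral>x. f x * mol g (\<rho> n) x \<partial>lborel) \<longlonglongrightarrow> (\<integral>x. f x * g x \<partial>lborel)"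
proof (rule tendstoI)
  fix e :: real assume "e > 0"
  then obtain d where d: "d > 0" "\<And>\<rho>. mollifier (ball 0 d) \<rho> \<Longrightarrow> \<bar>(\<integral>x. f x * mol g \<rho> x \<partial>lborel) - (\<integral>x. f x * g x \<partial>lborel)\<bar> \<le> e / 2"
    using mol_weak[OF f g, of "e / 2"] by auto
  show "\<forall>\<^sub>F n in sequentially. dist (\<integral>x. f x * mol g (\<rho> n) x \<partial>lborel) (\<integral>x. f x * g x \<partial>lborel) < e"
    using mollifier_seq_eventually[OF \<rho> d(1)]
  proof eventually_elim
    case (elim n)
    have "mollifier (ball 0 d) (\<rho> n)" by (rule mollifier_mono[OF elim]) simp
    from d(2)[OF this] \<open>e > 0\<close> show ?case by (simp add: dist_real_def)
  qed
qed

text \<open>Testing with mollifications of \<open>f\<close> cut off to a compact \<open>K\<close>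
  shows in the limit that the square of \<open>f\<close> has integral 0 over
  \<open>K\<close>.\<close>

lemma weak_zero_imp_AE:
  assumes f: "l12 f" and U: "open U" and z: "\<And>\<phi>. \<phi> \<in> tests U \<Longrightarrow> (\<integral>x. f x * \<phi> x \<partial>lborel) = 0"
  shows "AE x in lborel. x \<in> U \<longrightarrow> f x = 0"
proof -
  have *: "AE x in lborel. x \<in> K \<longrightarrow> f x = 0" if K: "compact K" "K \<subseteq> U" for K
  proof -
    have Km: "K \<in> sets borel" using K(1) by (intro borel_closed compact_imp_closed)
    let ?g = "\<lambda>x. indicator K x * f x"
    have g: "l12 ?g" by (rule l12_bounded_mult[OF f, of _ 1]) (use Km in \<open>auto simp: indicator_def\<close>)
    obtain \<rho> where \<rho>: "mollifier_seq UNIV \<rho>" using exists_mollifier_seq[of UNIV] by auto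
    obtain d where d: "d > 0" "\<And>x y. x \<in> K \<Longrightarrow> dist x y < d \<Longrightarrow> y \<in> U"
      using compact_open_margin[OF K(1) U K(2)] by blast
    have "\<forall>\<^sub>F n in sequentially. (\<integral>x. f x * mol ?g (\<rho> n) x \<partial>lborel) = 0"
      using mollifier_seq_eventually[OF \<rho> d(1)]
    proof eventually_elim
      case (elim n)
      note r = mollifier_facts[OF elim]
      obtain S where S: "S \<subseteq> UNIV \<inter> ball 0 d" "zero_off S (\<rho> n)" using r(9) by blast
      have "mol ?g (\<rho> n) \<in> tests U"
      proof (rule mol_tests[OF l12D(1)[OF g] K(1) _ r(2) S(2)])
        show "x \<notin> K \<Longrightarrow> ?g x = 0" for x by simp
        show "x + y \<in> U" if "x \<in> K" "y \<in> S" for x y using that S(1) by (intro d(2)[of x]) (auto simp: dist_norm)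
      qed
      then show ?case by (rule z)
    qed
    then have "(\<lambda>n. \<integral>x. f x * mol ?g (\<rho> n) x \<partial>lborel) \<longlonglongrightarrow> 0" by (rule tendsto_eventually)
    with mol_weak_seq[OF f g \<rho>] have "(\<integral>x. f x * ?g x \<partial>lborel) = 0" using LIMSEQ_unique by blast
    moreover have "f x * ?g x = (?g x)\<^sup>2" for x by (simp add: indicator_def power2_eq_square)
    ultimately have "(\<integral>x. (?g x)\<^sup>2 \<partial>lborel) = 0" by (simp only:)
    then have "AE x in lborel. (?g x)\<^sup>2 = 0"
      using integral_nonneg_eq_0_iff_AE[OF l12D(2)[OF g]] by simp
    then show ?thesis by eventually_elim (auto simp: indicator_def)
  qed
  obtain C :: "nat \<Rightarrow> (real^3) set" where C: "\<And>n. compact (C n)" "\<And>n. C n \<subseteq> U" "\<Union>(range C) = U"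
    using open_Union_compact_subsets[OF U] by (smt (verit, best))
  have "AE x in lborel. \<forall>n::nat. x \<in> C n \<longrightarrow> f x = 0"
    unfolding AE_all_countable using *[OF C(1,2)] by blast
  then show ?thesis by eventually_elim (use C(3) in blast)
qed

lemma wdiv_unique:
  assumes "wdiv U q p" "wdiv U q p'" "open U" "l12 p" "l12 p'"
  shows "AE x in lborel. x \<in> U \<longrightarrow> p x = p' x"
proof -
  have "AE x in lborel. x \<in> U \<longrightarrow> p x - p' x = 0"
  proof (rule weak_zero_imp_AE[OF l12_diff[OF assms(4,5)] assms(3)])
    fix \<phi> assume "\<phi> \<in> tests U"
    then have \<phi>: "\<phi> \<in> C1c U" using tests_C1c by blast
    have "(p x - p' x) * \<phi> x = (p x * \<phi> x + q x \<bullet> grad \<phi> x) - (p' x * \<phi> x + q x \<bullet> grad \<phi> x)" for x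
      by (simp add: algebra_simps)
    then have "(\<integral>x. (p x - p' x) * \<phi> x \<partial>lborel) =
      (\<integral>x. (p x * \<phi> x + q x \<bullet> grad \<phi> x) - (p' x * \<phi> x + q x \<bullet> grad \<phi> x) \<partial>lborel)" by presburger
    also have "\<dots> = 0"
      by (simp only: Bochner_Integration.integral_diff[OF C1c_integrable_pair[OF \<phi> wdivD(2,1)[OF assms(1)]] C1c_integrable_pair[OF \<phi> wdivD(2,1)[OF assms(2)]]]
        wdivD(3)[OF assms(1) \<phi>] wdivD(3)[OF assms(2) \<phi>])
    finally show "(\<integral>x. (p x - p' x) * \<phi> x \<partial>lborel) = 0" .
  qed
  then show ?thesis by eventually_elim auto
qed

section \<open>Chain rule and null Lagrangian for weak derivatives\<close>

lemma C1c_mult': "\<phi> \<in> C1c U \<Longrightarrow> C1 \<psi> \<Longrightarrow> (\<lambda>x. \<psi> x * \<phi> x) \<in> C1c U"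
  using C1c_mult[of \<phi> U \<psi>] by (simp add: mult.commute)

text \<open>The equation for \<open>u\<close> is tested with \<open>\<phi>\<close> times the
  mollification of \<open>u\<close>, whose derivative on the support of \<open>\<phi>\<close> is the
  mollification of \<open>g\<close>; then the mollifier is removed in the limit.\<close>

lemma wdiv_square:
  assumes u: "l12 u" and g: "l12 g" and U: "open U" and w: "wdiv U (\<lambda>x. u x *\<^sub>R e) g"
  shows "wdiv U (\<lambda>x. (u x)\<^sup>2 *\<^sub>R e) (\<lambda>x. 2 * u x * g x)"
proof (rule wdivI_tests[OF U])
  show "integrable lborel (\<lambda>x. (u x)\<^sup>2 *\<^sub>R e)" using l12D(2)[OF u] by simp
  show "integrable lborel (\<lambda>x. 2 * u x * g x)" using l12_mult[OF u g] by (simp add: mult.assoc)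
  fix \<phi> assume "\<phi> \<in> tests U"
  then have \<phi>: "\<phi> \<in> C1c U" using tests_C1c by blast
  then obtain K where K: "K \<subseteq> U" "zero_off K \<phi>" and C: "C1 \<phi>" by (auto simp: C1c_def)
  obtain \<rho> where \<rho>: "mollifier_seq UNIV \<rho>" using exists_mollifier_seq[of UNIV] by auto
  obtain d where d: "d > 0" "\<And>x y. x \<in> K \<Longrightarrow> dist x y < d \<Longrightarrow> y \<in> U"
    using compact_open_margin[of K U] U K by (auto simp: zero_off_def)
  \<comment> \<open>\<open>P\<close> and \<open>R\<close> collect the factors of the mollified
    \<open>u\<close> and of the mollified \<open>g\<close>.\<close>
  define P where "P x = \<phi> x * g x + (grad \<phi> x \<bullet> e) * u x" for x
  define R where "R x = \<phi> x * u x" for x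
  have P: "l12 P" unfolding P_def by (intro l12_add C1c_l12_mult[OF \<phi>] g u)
  have R: "l12 R" unfolding R_def by (intro C1c_l12_mult[OF \<phi>] u)
  have "\<forall>\<^sub>F n in sequentially. (\<integral>x. P x * mol u (\<rho> n) x \<partial>lborel) + (\<integral>x. R x * mol g (\<rho> n) x \<partial>lborel) = 0"
    using mollifier_seq_eventually[OF \<rho> d(1)]
  proof eventually_elim
    case (elim n)
    note r = mollifier_facts[OF elim]
    obtain S where S: "S \<subseteq> UNIV \<inter> ball 0 d" "zero_off S (\<rho> n)" using r(9) by blast
    let ?u = "mol u (\<rho> n)"
    have Cu: "C1 ?u" by (rule mol_derivative(1)[OF l12D(1)[OF u] r(3)])
    have gr: "grad ?u x \<bullet> e = mol g (\<rho> n) x" if "x \<in> K" for x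
      by (rule grad_mol_weak[OF w l12D(1)[OF u] r(3) S(2)]) (use d(2)[OF that] S(1) in \<open>auto simp: dist_norm\<close>)
    have pt: "g x * (?u x * \<phi> x) + (u x *\<^sub>R e) \<bullet> grad (\<lambda>x. ?u x * \<phi> x) x = P x * ?u x + R x * mol g (\<rho> n) x" for x
    proof (cases "x \<in> K")
      case True
      then show ?thesis using gr[OF True]
        by (simp add: C1_mult(2)[OF C Cu] C1_mult(2)[OF Cu C] P_def R_def inner_add_right inner_commute[of e] algebra_simps)
    next
      case False
      then show ?thesis using K(2) zero_off_grad[OF K(2) False]
        by (simp add: C1_mult(2)[OF C Cu] C1_mult(2)[OF Cu C] P_def R_def zero_off_def)
    qed
    have "(\<integral>x. P x * ?u x + R x * mol g (\<rho> n) x \<partial>lborel) = 0"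
      using wdivD(3)[OF w C1c_mult'[OF \<phi> Cu]] unfolding pt .
    then show ?case
      by (simp only: Bochner_Integration.integral_add[OF integrable_mol_mult[OF l12D(1)[OF P] l12D(1)[OF u] r(3)]
        integrable_mol_mult[OF l12D(1)[OF R] l12D(1)[OF g] r(3)]])
  qed
  then have "(\<lambda>n. (\<integral>x. P x * mol u (\<rho> n) x \<partial>lborel) + (\<integral>x. R x * mol g (\<rho> n) x \<partial>lborel)) \<longlonglongrightarrow> 0"
    by (rule tendsto_eventually)
  moreover have "(\<lambda>n. (\<integral>x. P x * mol u (\<rho> n) x \<partial>lborel) + (\<integral>x. R x * mol g (\<rho> n) x \<partial>lborel)) \<longlonglongrightarrow>
    (\<integral>x. P x * u x \<partial>lborel) + (\<integral>x. R x * g x \<partial>lborel)"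
    by (intro tendsto_add mol_weak_seq[OF P u \<rho>] mol_weak_seq[OF R g \<rho>])
  ultimately have "(\<integral>x. P x * u x \<partial>lborel) + (\<integral>x. R x * g x \<partial>lborel) = 0" using LIMSEQ_unique by blast
  then have "(\<integral>x. P x * u x + R x * g x \<partial>lborel) = 0"
    by (simp only: Bochner_Integration.integral_add[OF l12_mult[OF P u] l12_mult[OF R g]])
  moreover have "2 * u x * g x * \<phi> x + ((u x)\<^sup>2 *\<^sub>R e) \<bullet> grad \<phi> x = P x * u x + R x * g x" for x
    by (simp add: P_def R_def power2_eq_square inner_commute[of e] algebra_simps)
  ultimately show "(\<integral>x. 2 * u x * g x * \<phi> x + ((u x)\<^sup>2 *\<^sub>R e) \<bullet> grad \<phi> x \<partial>lborel) = 0" by (simp only:)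
qed

text \<open>The mollification of \<open>b\<close> is one-sided, into \<open>H\<close>, so that it vanishes near the part of the boundary
  of \<open>U\<close> inside \<open>B\<close>, where \<open>a\<close> has no weak derivative.\<close>

lemma null_lagrangian:
  assumes l: "l12 a" "l12 ae" "l12 af" "l12 b" "l12 be" "l12 bf"
    and B: "open B" and a: "wdiv U (\<lambda>x. a x *\<^sub>R e) ae" "wdiv U (\<lambda>x. a x *\<^sub>R f) af"
    and b: "wdiv B (\<lambda>x. b x *\<^sub>R e) be" "wdiv B (\<lambda>x. b x *\<^sub>R f) bf"
    and \<eta>: "\<eta> \<in> tests B"
    and H: "open H" "\<And>d. d > 0 \<Longrightarrow> H \<inter> ball 0 d \<noteq> {}" and d0: "d0 > 0"
    and adm: "\<And>S. compact S \<Longrightarrow> S \<subseteq> H \<inter> ball 0 d0 \<Longrightarrow>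
      \<exists>K. compact K \<and> K \<subseteq> U \<and> (\<forall>x z. \<eta> x \<noteq> 0 \<longrightarrow> x \<notin> K \<longrightarrow> z \<in> S \<longrightarrow> b (x - z) = 0)"
  shows "(\<integral>x. (2 * \<eta> x * ae x + (grad \<eta> x \<bullet> e) * a x) * bf x - (2 * \<eta> x * af x + (grad \<eta> x \<bullet> f) * a x) * be x
    + ((grad \<eta> x \<bullet> f) * ae x - (grad \<eta> x \<bullet> e) * af x) * b x \<partial>lborel) = 0"
proof -
  have \<eta>c: "\<eta> \<in> C1c B" "smooth \<eta>" "C1 \<eta>" using \<eta> tests_C1c smooth_C1 by (auto simp: tests_def)
  obtain K0 where K0: "K0 \<subseteq> B" "zero_off K0 \<eta>" using \<eta> by (auto simp: tests_def)
  obtain d1 where d1: "d1 > 0" "\<And>x y. x \<in> K0 \<Longrightarrow> dist x y < d1 \<Longrightarrow> y \<in> B"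
    using compact_open_margin[of K0 B] B K0 by (auto simp: zero_off_def)
  obtain \<rho> where \<rho>: "mollifier_seq H \<rho>" using exists_mollifier_seq[OF H] by blast
  \<comment> \<open>The factors of the mollifications of \<open>bf\<close>, \<open>be\<close> and
    \<open>b\<close> in the final identity, up to the sign of \<open>R\<close>.\<close>
  define P where "P x = 2 * (\<eta> x * ae x) + (grad \<eta> x \<bullet> e) * a x" for x
  define R where "R x = 2 * (\<eta> x * af x) + (grad \<eta> x \<bullet> f) * a x" for x
  define Z where "Z x = (grad \<eta> x \<bullet> f) * ae x - (grad \<eta> x \<bullet> e) * af x" for x
  have P: "l12 P" and R: "l12 R" and Z: "l12 Z"
    unfolding P_def R_def Z_def by (intro l12_add l12_diff l12_cmult C1c_l12_mult[OF \<eta>c(1)] l)+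
  have "\<forall>\<^sub>F n in sequentially. (\<integral>x. P x * mol bf (\<rho> n) x \<partial>lborel) - (\<integral>x. R x * mol be (\<rho> n) x \<partial>lborel)
    + (\<integral>x. Z x * mol b (\<rho> n) x \<partial>lborel) = 0"
    using mollifier_seq_eventually[OF \<rho> d0] mollifier_seq_eventually[OF \<rho> d1(1)]
  proof eventually_elim
    case (elim n)
    note r = mollifier_facts[OF elim(1)]
    note r' = mollifier_facts[OF elim(2)]
    obtain S0 where S0: "S0 \<subseteq> H \<inter> ball 0 d0" "zero_off S0 (\<rho> n)" using r(9) by blast
    obtain S1 where S1: "S1 \<subseteq> H \<inter> ball 0 d1" "zero_off S1 (\<rho> n)" using r'(9) by blast
    have S0c: "compact S0" using S0(2) by (simp add: zero_off_def)
    obtain K where K: "compact K" "K \<subseteq> U" "\<And>x z. \<eta> x \<noteq> 0 \<Longrightarrow> x \<notin> K \<Longrightarrow> z \<in> S0 \<Longrightarrow> b (x - z) = 0"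
      using adm[OF S0c S0(1)] by blast
    let ?b = "mol b (\<rho> n)"
    have sb: "smooth ?b" by (rule smooth_mol[OF l12D(1)[OF l(4)] r(2)])
    have Cb: "C1 ?b" using smooth_C1[OF sb] .
    have be: "grad ?b x \<bullet> e = mol be (\<rho> n) x" if "x \<in> K0" for x
      by (rule grad_mol_weak[OF b(1) l12D(1)[OF l(4)] r(3) S1(2)]) (use d1(2)[OF that] S1(1) in \<open>auto simp: dist_norm\<close>)
    have bf: "grad ?b x \<bullet> f = mol bf (\<rho> n) x" if "x \<in> K0" for x
      by (rule grad_mol_weak[OF b(2) l12D(1)[OF l(4)] r(3) S1(2)]) (use d1(2)[OF that] S1(1) in \<open>auto simp: dist_norm\<close>)
    \<comment> \<open>Where the one-sided average sees only zeros of \<open>b\<close>, the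
      mollification vanishes with its gradient. So its products with \<open>\<eta>\<close> have
      compact support in \<open>U\<close> and may test the equations for \<open>a\<close>.\<close>
    have bz: "?b x = 0 \<and> grad ?b x = 0" if x: "\<eta> x \<noteq> 0" "x \<notin> K" for x
    proof
      have *: "b y = 0 \<or> x - y \<notin> S0" for y using K(3)[OF x, of "x - y"] by auto
      then show "?b x = 0" using S0(2) by (intro mol_zero) (auto simp: zero_off_def)
      have "b y *\<^sub>R grad (\<rho> n) (x - y) = 0" for y using *[of y] zero_off_grad[OF S0(2), of "x - y"] by auto
      then have "(\<lambda>y. b y *\<^sub>R grad (\<rho> n) (x - y)) = (\<lambda>y. 0)" by blast
      then show "grad ?b x = 0" unfolding mol_derivative(2)[OF l12D(1)[OF l(4)] r(3)] by (simp only: Bochner_Integration.integral_zero)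
    qed
    have c: "(\<lambda>x. \<eta> x * h x) \<in> C1c U" if h: "C1 h" "\<And>x. \<eta> x \<noteq> 0 \<Longrightarrow> x \<notin> K \<Longrightarrow> h x = 0" for h
    proof -
      have "zero_off (K0 \<inter> K) (\<lambda>x. \<eta> x * h x)"
        using K0(2) K(1) h(2) by (auto simp: zero_off_def compact_Int)
      then show ?thesis unfolding C1c_def using K(2) C1_mult(1)[OF \<eta>c(3) h(1)] by blast
    qed
    have C: "C1 (\<lambda>y. grad ?b y \<bullet> v)" for v by (rule smooth_grad_symmetric(2)[OF sb])
    have t1: "(\<lambda>x. \<eta> x * (grad ?b x \<bullet> v)) \<in> C1c U" for v by (rule c[OF C]) (use bz in simp)
    have t0: "(\<lambda>x. \<eta> x * ?b x) \<in> C1c U" by (rule c[OF Cb]) (use bz in simp)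
    have s2: "smooth (\<lambda>x. \<eta> x * ?b x)" by (rule smooth_mult[OF \<eta>c(2) sb])
    have t2: "(\<lambda>x. grad (\<lambda>y. \<eta> y * ?b y) x \<bullet> v) \<in> C1c U" for v
    proof -
      obtain K' where K': "K' \<subseteq> U" "zero_off K' (\<lambda>y. \<eta> y * ?b y)" using t0 by (auto simp: C1c_def)
      have "zero_off K' (\<lambda>x. grad (\<lambda>y. \<eta> y * ?b y) x \<bullet> v)"
        using K'(2) zero_off_grad[OF K'(2)] by (auto simp: zero_off_def)
      then show ?thesis unfolding C1c_def using K'(1) smooth_grad_symmetric(2)[OF s2] by blast
    qed
    \<comment> \<open>The test functions are \<open>\<eta>\<close> times derivatives of the
      mollified \<open>b\<close> in \<open>T1\<close> and \<open>T2\<close>, and derivatives of its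
      product with \<open>\<eta>\<close> in \<open>T3\<close> and \<open>T4\<close>. In
      \<open>T1 - T2\<close> and in \<open>T3 - T4\<close> the second derivatives cancel by
      symmetry. Adding both differences treats \<open>a\<close> and \<open>b\<close> alike, as the
      flux \<open>J v - (tr J) v\<close> requires.\<close>
    note T1 = wdivD(3)[OF a(1) t1[of f]] and T2 = wdivD(3)[OF a(2) t1[of e]]
      and T3 = wdivD(3)[OF a(1) t2[of f]] and T4 = wdivD(3)[OF a(2) t2[of e]]
    note I1 = C1c_integrable_pair[OF t1[of f] wdivD(2,1)[OF a(1)]] and I2 = C1c_integrable_pair[OF t1[of e] wdivD(2,1)[OF a(2)]]
      and I3 = C1c_integrable_pair[OF t2[of f] wdivD(2,1)[OF a(1)]] and I4 = C1c_integrable_pair[OF t2[of e] wdivD(2,1)[OF a(2)]]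
    have pt: "P x * mol bf (\<rho> n) x - R x * mol be (\<rho> n) x + Z x * ?b x =
      ((ae x * (\<eta> x * (grad ?b x \<bullet> f)) + (a x *\<^sub>R e) \<bullet> grad (\<lambda>x. \<eta> x * (grad ?b x \<bullet> f)) x)
      - (af x * (\<eta> x * (grad ?b x \<bullet> e)) + (a x *\<^sub>R f) \<bullet> grad (\<lambda>x. \<eta> x * (grad ?b x \<bullet> e)) x))
      + ((ae x * (grad (\<lambda>y. \<eta> y * ?b y) x \<bullet> f) + (a x *\<^sub>R e) \<bullet> grad (\<lambda>x. grad (\<lambda>y. \<eta> y * ?b y) x \<bullet> f) x)
      - (af x * (grad (\<lambda>y. \<eta> y * ?b y) x \<bullet> e) + (a x *\<^sub>R f) \<bullet> grad (\<lambda>x. grad (\<lambda>y. \<eta> y * ?b y) x \<bullet> e) x))" (is "?L = ?Q") for x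
    proof -
      have s1: "e \<bullet> grad (\<lambda>x. grad ?b x \<bullet> f) x = f \<bullet> grad (\<lambda>x. grad ?b x \<bullet> e) x"
        using smooth_grad_symmetric(1)[OF sb, of f x e] by (simp add: inner_commute)
      have s2: "e \<bullet> grad (\<lambda>x. grad (\<lambda>y. \<eta> y * ?b y) x \<bullet> f) x = f \<bullet> grad (\<lambda>x. grad (\<lambda>y. \<eta> y * ?b y) x \<bullet> e) x"
        using smooth_grad_symmetric(1)[OF s2, of f x e] by (simp add: inner_commute)
      have "?Q = ae x * (\<eta> x * (grad ?b x \<bullet> f)) + a x * ((grad ?b x \<bullet> f) * (grad \<eta> x \<bullet> e))
        - af x * (\<eta> x * (grad ?b x \<bullet> e)) - a x * ((grad ?b x \<bullet> e) * (grad \<eta> x \<bullet> f))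
        + ae x * (\<eta> x * (grad ?b x \<bullet> f) + ?b x * (grad \<eta> x \<bullet> f)) - af x * (\<eta> x * (grad ?b x \<bullet> e) + ?b x * (grad \<eta> x \<bullet> e))"
        by (simp only: inner_scaleR_left s2)
           (simp add: C1_mult(2)[OF \<eta>c(3) C] C1_mult(2)[OF \<eta>c(3) Cb] inner_add_left inner_add_right s1
              inner_commute[of e "grad \<eta> x"] inner_commute[of f "grad \<eta> x"] distrib_left)
      also have "\<dots> = ?L"
      proof (cases "x \<in> K0")
        case True
        then show ?thesis by (simp add: be bf P_def R_def Z_def algebra_simps)
      next
        case False
        then show ?thesis using zero_off_grad[OF K0(2) False] K0(2) by (simp add: P_def R_def Z_def zero_off_def)
      qed
      finally show ?thesis by simp
    qed
    have "(\<integral>x. P x * mol bf (\<rho> n) x - R x * mol be (\<rho> n) x + Z x * ?b x \<partial>lborel) = 0"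
      unfolding pt
      by (simp only: Bochner_Integration.integral_add[OF Bochner_Integration.integrable_diff[OF I1 I2] Bochner_Integration.integrable_diff[OF I3 I4]]
        Bochner_Integration.integral_diff[OF I1 I2] Bochner_Integration.integral_diff[OF I3 I4] T1 T2 T3 T4)
    then show ?case
      using integrable_mol_mult[OF l12D(1)[OF P] l12D(1)[OF l(6)] r(3)] integrable_mol_mult[OF l12D(1)[OF R] l12D(1)[OF l(5)] r(3)]
        integrable_mol_mult[OF l12D(1)[OF Z] l12D(1)[OF l(4)] r(3)] by simp
  qed
  then have "(\<lambda>n. (\<integral>x. P x * mol bf (\<rho> n) x \<partial>lborel) - (\<integral>x. R x * mol be (\<rho> n) x \<partial>lborel)
    + (\<integral>x. Z x * mol b (\<rho> n) x \<partial>lborel)) \<longlonglongrightarrow> 0" by (rule tendsto_eventually)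
  moreover have "(\<lambda>n. (\<integral>x. P x * mol bf (\<rho> n) x \<partial>lborel) - (\<integral>x. R x * mol be (\<rho> n) x \<partial>lborel)
    + (\<integral>x. Z x * mol b (\<rho> n) x \<partial>lborel)) \<longlonglongrightarrow> (\<integral>x. P x * bf x \<partial>lborel) - (\<integral>x. R x * be x \<partial>lborel) + (\<integral>x. Z x * b x \<partial>lborel)"
    by (intro tendsto_add tendsto_diff mol_weak_seq[OF P l(6) \<rho>] mol_weak_seq[OF R l(5) \<rho>] mol_weak_seq[OF Z l(4) \<rho>])
  ultimately have "(\<integral>x. P x * bf x \<partial>lborel) - (\<integral>x. R x * be x \<partial>lborel) + (\<integral>x. Z x * b x \<partial>lborel) = 0" using LIMSEQ_unique by blast
  then have "(\<integral>x. P x * bf x - R x * be x + Z x * b x \<partial>lborel) = 0"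
    using l12_mult[OF P l(6)] l12_mult[OF R l(5)] l12_mult[OF Z l(4)] by simp
  then show ?thesis unfolding P_def R_def Z_def by (simp only: mult.assoc)
qed

section \<open>Fluxes through planes\<close>

lemma C1_compose_on:
  assumes "C1 f" "\<And>x. (h has_real_derivative h' (f x)) (at (f x))" "continuous_on T h'" "\<And>x. f x \<in> T"
  shows "C1 (\<lambda>x. h (f x))" and "grad (\<lambda>x. h (f x)) = (\<lambda>x. h' (f x) *\<^sub>R grad f x)"
proof -
  have d: "((\<lambda>x. h (f x)) has_derivative (\<lambda>v. (h' (f x) *\<^sub>R grad f x) \<bullet> v)) (at x)" for x
    using has_derivative_compose[OF C1_has_derivative[OF assms(1)] assms(2)[unfolded has_field_derivative_def]]
    by (rule has_derivative_eq_rhs) auto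
  have c: "continuous_on UNIV (\<lambda>x. h' (f x) *\<^sub>R grad f x)"
    by (intro continuous_intros C1_continuous_grad assms continuous_on_compose2[OF assms(3)] C1_continuous) (use assms(4) in auto)
  show "C1 (\<lambda>x. h (f x))" and "grad (\<lambda>x. h (f x)) = (\<lambda>x. h' (f x) *\<^sub>R grad f x)"
    using C1I[OF d c] by auto
qed

text \<open>A continuously differentiable substitute for the positive part: composed with a
  \<open>C1\<close> function it gives a cutoff that vanishes where that function is at most
  0.\<close>

definition ramp :: "real \<Rightarrow> real" where "ramp t = (max 0 t)\<^sup>2"

lemma ramp_deriv: "(ramp has_real_derivative 2 * max 0 t) (at t)"
proof -
  consider "t > 0" | "t < 0" | "t = 0" by linarith
  then show ?thesis
  proof cases
    case 1
    have "((\<lambda>t. t\<^sup>2) has_real_derivative 2 * max 0 t) (at t)" using 1 by (auto intro!: derivative_eq_intros)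
    moreover have "\<forall>\<^sub>F x in nhds t. x\<^sup>2 = ramp x"
      using eventually_nhds_in_open[OF open_greaterThan, of t 0] 1 by (auto simp: ramp_def elim!: eventually_mono)
    ultimately show ?thesis by (subst DERIV_cong_ev[symmetric, OF refl _ refl])
  next
    case 2
    have "((\<lambda>t. 0) has_real_derivative 2 * max 0 t) (at t)" using 2 by auto
    moreover have "\<forall>\<^sub>F x in nhds t. 0 = ramp x"
      using eventually_nhds_in_open[OF open_lessThan, of t 0] 2 by (auto simp: ramp_def elim!: eventually_mono)
    ultimately show ?thesis by (subst DERIV_cong_ev[symmetric, OF refl _ refl])
  next
    case 3
    have "((\<lambda>h. max 0 h) \<longlongrightarrow> max 0 (0::real)) (at 0)" by (intro tendsto_intros)
    moreover have "\<forall>\<^sub>F h in at 0. max 0 h = ramp h / h"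
      by (auto simp: ramp_def eventually_at_filter max_def power2_eq_square)
    ultimately have "((\<lambda>h. ramp h / h) \<longlongrightarrow> max 0 0) (at 0)" by (rule Lim_transform_eventually)
    then show ?thesis using 3 by (simp add: DERIV_def ramp_def)
  qed
qed

lemma C1_ramp:
  assumes "C1 f" shows "C1 (\<lambda>x. ramp (f x))" "grad (\<lambda>x. ramp (f x)) = (\<lambda>x. (2 * max 0 (f x)) *\<^sub>R grad f x)"
proof -
  have "continuous_on UNIV (\<lambda>t. 2 * max 0 t :: real)"
    by (intro continuous_on_mult continuous_on_const continuous_on_max continuous_on_id)
  from C1_compose[OF assms ramp_deriv this] show "C1 (\<lambda>x. ramp (f x))" "grad (\<lambda>x. ramp (f x)) = (\<lambda>x. (2 * max 0 (f x)) *\<^sub>R grad f x)"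
    by auto
qed

lemma ramp_bounds: "ramp t \<ge> 0" "t \<le> 1 \<Longrightarrow> ramp t \<le> 1"
  by (auto simp: ramp_def power_le_one)

lemma AE_not_hyperplane:
  fixes n :: "real^3"
  assumes "n \<noteq> 0" shows "AE x in lborel. n \<bullet> x \<noteq> c"
proof -
  have "{x. n \<bullet> x = c} \<in> null_sets lebesgue" using negligible_hyperplane[of n c] assms negligible_iff_null_sets by blast
  then have "{x. n \<bullet> x = c} \<in> null_sets lborel" by (subst (asm) null_sets_completion_iff) auto
  then show ?thesis using AE_not_in by fastforce
qed

lemma abs_add_le: "\<bar>a\<bar> \<le> a' \<Longrightarrow> \<bar>b\<bar> \<le> b' \<Longrightarrow> \<bar>a + b\<bar> \<le> a' + b'" for a b :: real
  by linarith

text \<open>Cutoffs that vanish near the plane have gradients along \<open>n\<close>, bounded by a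
  multiple of the inverse of \<bar>n \<bullet> x - c\<bar>. A normal component of \<open>q\<close>
  that vanishes linearly on the plane compensates this; \<open>h = 0\<close> covers fields tangent
  to the plane.\<close>

lemma wdiv_remove_plane:
  assumes w: "wdiv (U - {x. n \<bullet> x = c}) q p" and n: "n \<noteq> 0"
    and h: "integrable lborel h" "\<And>x. \<bar>q x \<bullet> n\<bar> \<le> \<bar>n \<bullet> x - c\<bar> * h x"
  shows "wdiv U q p"
  unfolding wdiv_def
proof (intro conjI ballI)
  note qp = wdivD(1,2)[OF w]
  show "integrable lborel q" "integrable lborel p" using qp by auto
  fix \<phi> assume \<phi>: "\<phi> \<in> C1c U"
  obtain K where K: "K \<subseteq> U" "zero_off K \<phi>" and C: "C1 \<phi>" using \<phi> by (auto simp: C1c_def)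
  define l where "l x = n \<bullet> x + (- c)" for x
  have Cl: "C1 l" "grad l = (\<lambda>x. n)" unfolding l_def by (rule C1_affine grad_affine)+
  define e where "e k = inverse (real (Suc k))" for k
  have e: "e k > 0" for k by (simp add: e_def)
  \<comment> \<open>Negative exactly for \<bar>t\<bar> below \<open>e k\<close>, and tending to 1
    with \<open>e k\<close> for fixed nonzero \<open>t\<close>. It depends on the ratio of
    \<open>t\<close> and \<open>e k\<close> only, whence the bound on \<bar>t\<bar> * \<bar>r' k
    t\<bar> uniform in \<open>k\<close>.\<close>
  define r where "r k t = (t\<^sup>2 - (e k)\<^sup>2) / (t\<^sup>2 + (e k)\<^sup>2)" for k and t :: real
  define r' where "r' k t = 4 * t * (e k)\<^sup>2 / (t\<^sup>2 + (e k)\<^sup>2)\<^sup>2" for k and t :: real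
  have den: "t\<^sup>2 + (e k)\<^sup>2 > 0" for t k using e[of k] by (simp add: add_nonneg_pos)
  have r: "(r k has_real_derivative r' k t) (at t)" for k t
    unfolding r_def r'_def using den[of t k]
    by (auto intro!: derivative_eq_intros simp: field_simps power2_eq_square)
  have r'c: "continuous_on UNIV (r' k)" for k
    unfolding r'_def using den by (intro continuous_intros) (metis less_irrefl power_eq_0_iff)
  have rl: "C1 (\<lambda>x. r k (l x))" "grad (\<lambda>x. r k (l x)) = (\<lambda>x. r' k (l x) *\<^sub>R n)" for k
    using C1_compose[OF Cl(1) r r'c] Cl(2) by auto
  define \<kappa> where "\<kappa> k x = ramp (r k (l x))" for k x
  have \<kappa>: "C1 (\<kappa> k)" "grad (\<kappa> k) = (\<lambda>x. (2 * max 0 (r k (l x)) * r' k (l x)) *\<^sub>R n)" for k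
    unfolding \<kappa>_def using C1_ramp[OF rl(1)] rl(2) by auto
  have t: "(\<lambda>x. \<phi> x * \<kappa> k x) \<in> C1c (U - {x. n \<bullet> x = c})" for k
  proof -
    have cl: "closed {x. e k \<le> \<bar>l x\<bar>}" unfolding l_def by (intro closed_Collect_le continuous_intros)
    have "\<kappa> k x = 0" if "\<bar>l x\<bar> < e k" for x
    proof -
      have "(l x)\<^sup>2 < (e k)\<^sup>2" using that power_strict_mono[of "\<bar>l x\<bar>" "e k" 2] by simp
      then have "r k (l x) \<le> 0" unfolding r_def using den by (simp add: divide_nonpos_pos less_imp_le)
      then show ?thesis by (simp add: \<kappa>_def ramp_def)
    qed
    then have "zero_off (K \<inter> {x. e k \<le> \<bar>l x\<bar>}) (\<lambda>x. \<phi> x * \<kappa> k x)"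
      using K(2) cl by (auto simp: zero_off_def compact_Int_closed not_le)
    moreover have "K \<inter> {x. e k \<le> \<bar>l x\<bar>} \<subseteq> U - {x. n \<bullet> x = c}"
      using K(1) e[of k] by (auto simp: l_def)
    ultimately show ?thesis unfolding C1c_def using C1_mult(1)[OF C \<kappa>(1)] by blast
  qed
  have r1: "\<bar>r k t\<bar> \<le> 1" for k t
    using den[of t k] unfolding r_def by (simp add: abs_le_iff divide_le_eq le_divide_eq)
  have \<kappa>1: "0 \<le> \<kappa> k x" "\<kappa> k x \<le> 1" for k x
    using r1[of k "l x"] ramp_bounds by (auto simp: \<kappa>_def)
  have r'1: "\<bar>t\<bar> * \<bar>r' k t\<bar> \<le> 1" for k t
  proof -
    have "0 \<le> (t\<^sup>2 - (e k)\<^sup>2)\<^sup>2" by simp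
    then have "4 * t\<^sup>2 * (e k)\<^sup>2 \<le> (t\<^sup>2 + (e k)\<^sup>2)\<^sup>2" by (simp add: power2_eq_square algebra_simps)
    then have "4 * t\<^sup>2 * (e k)\<^sup>2 / (t\<^sup>2 + (e k)\<^sup>2)\<^sup>2 \<le> 1" using den[of t k] by (simp add: divide_le_eq)
    moreover have "\<bar>t\<bar> * \<bar>r' k t\<bar> = 4 * t\<^sup>2 * (e k)\<^sup>2 / (t\<^sup>2 + (e k)\<^sup>2)\<^sup>2"
      unfolding r'_def by (simp add: abs_mult power2_eq_square)
    ultimately show ?thesis by simp
  qed
  let ?c = "\<lambda>k x. 2 * max 0 (r k (l x)) * r' k (l x)"
  \<comment> \<open>The factor \<bar>l x\<bar> in the normal component of \<open>q\<close> meets the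
    derivative of the cutoff, and the product is bounded by \<open>r'1\<close>.\<close>
  have qn: "\<bar>?c k x * (q x \<bullet> n)\<bar> \<le> 2 * \<bar>h x\<bar>" for k x
  proof -
    have "max 0 (r k (l x)) \<le> 1" using r1[of k "l x"] by auto
    then have "\<bar>?c k x\<bar> \<le> 2 * 1 * \<bar>r' k (l x)\<bar>"
      unfolding abs_mult by (intro mult_right_mono mult_mono) auto
    moreover have "\<bar>q x \<bullet> n\<bar> \<le> \<bar>l x\<bar> * \<bar>h x\<bar>"
      using h(2)[of x] mult_left_mono[OF abs_ge_self[of "h x"], of "\<bar>l x\<bar>"] by (simp add: l_def)
    ultimately have "\<bar>?c k x\<bar> * \<bar>q x \<bullet> n\<bar> \<le> (2 * 1 * \<bar>r' k (l x)\<bar>) * (\<bar>l x\<bar> * \<bar>h x\<bar>)"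
      by (intro mult_mono) auto
    also have "\<dots> = 2 * (\<bar>l x\<bar> * \<bar>r' k (l x)\<bar>) * \<bar>h x\<bar>" by simp
    also have "\<dots> \<le> 2 * 1 * \<bar>h x\<bar>" using r'1[of "l x" k] by (intro mult_right_mono mult_left_mono) auto
    finally show ?thesis by (simp add: abs_mult)
  qed
  let ?F = "\<lambda>x. p x * \<phi> x + q x \<bullet> grad \<phi> x"
  let ?S = "\<lambda>k x. p x * (\<phi> x * \<kappa> k x) + q x \<bullet> grad (\<lambda>x. \<phi> x * \<kappa> k x) x"
  have S: "?S k x = \<kappa> k x * ?F x + \<phi> x * (?c k x * (q x \<bullet> n))" for k x
    by (simp add: C1_mult(2)[OF C \<kappa>(1)] \<kappa>(2) inner_add_right algebra_simps)
  have e0: "e \<longlonglongrightarrow> 0" unfolding e_def by (rule LIMSEQ_inverse_real_of_nat)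
  have lim: "(\<lambda>k. integral\<^sup>L lborel (?S k)) \<longlonglongrightarrow> integral\<^sup>L lborel ?F"
  proof (rule integral_dominated_convergence[where w="\<lambda>x. \<bar>?F x\<bar> + 2 * \<bar>h x * \<phi> x\<bar>"])
    show "integrable lborel (\<lambda>x. \<bar>?F x\<bar> + 2 * \<bar>h x * \<phi> x\<bar>)"
      using C1c_integrable_pair[OF \<phi> qp(2,1)] C1c_integrable_mult[OF \<phi> h(1)] by simp
    show "?F \<in> borel_measurable lborel" using C1c_integrable_pair[OF \<phi> qp(2,1)] by simp
    show "?S k \<in> borel_measurable lborel" for k using C1c_integrable_pair[OF t qp(2,1)] by simp
    show "AE x in lborel. (\<lambda>k. ?S k x) \<longlonglongrightarrow> ?F x"
      using AE_not_hyperplane[OF n, of c]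
    proof eventually_elim
      case (elim x)
      then have lx: "(l x)\<^sup>2 + 0\<^sup>2 \<noteq> 0" by (simp add: l_def)
      have "(\<lambda>k. r k (l x)) \<longlonglongrightarrow> ((l x)\<^sup>2 - 0\<^sup>2) / ((l x)\<^sup>2 + 0\<^sup>2)"
        unfolding r_def by (intro tendsto_intros e0 lx)
      then have 1: "(\<lambda>k. r k (l x)) \<longlonglongrightarrow> 1" using lx by simp
      have "(\<lambda>k. r' k (l x)) \<longlonglongrightarrow> 4 * l x * 0\<^sup>2 / ((l x)\<^sup>2 + 0\<^sup>2)\<^sup>2"
        unfolding r'_def using lx by (intro tendsto_intros e0) simp
      then have 2: "(\<lambda>k. r' k (l x)) \<longlonglongrightarrow> 0" by simp
      have 3: "(\<lambda>k. \<kappa> k x) \<longlonglongrightarrow> (max 0 1)\<^sup>2" unfolding \<kappa>_def ramp_def by (intro tendsto_intros 1)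
      have "(\<lambda>k. \<kappa> k x * ?F x + \<phi> x * (?c k x * (q x \<bullet> n))) \<longlonglongrightarrow> (max 0 1)\<^sup>2 * ?F x + \<phi> x * ((2 * max 0 1 * 0) * (q x \<bullet> n))"
        by (intro tendsto_intros 1 2 3)
      then show ?case unfolding S by simp
    qed
    show "AE x in lborel. norm (?S k x) \<le> \<bar>?F x\<bar> + 2 * \<bar>h x * \<phi> x\<bar>" for k
    proof (intro AE_I2)
      fix x
      have "\<bar>\<kappa> k x * ?F x\<bar> \<le> 1 * \<bar>?F x\<bar>" unfolding abs_mult using \<kappa>1[of k x] by (intro mult_right_mono) auto
      moreover have "\<bar>\<phi> x * (?c k x * (q x \<bullet> n))\<bar> \<le> \<bar>\<phi> x\<bar> * (2 * \<bar>h x\<bar>)"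
        unfolding abs_mult[of "\<phi> x"] using qn by (intro mult_left_mono) auto
      ultimately have "\<bar>\<kappa> k x * ?F x + \<phi> x * (?c k x * (q x \<bullet> n))\<bar> \<le> 1 * \<bar>?F x\<bar> + \<bar>\<phi> x\<bar> * (2 * \<bar>h x\<bar>)" by (rule abs_add_le)
      then show "norm (?S k x) \<le> \<bar>?F x\<bar> + 2 * \<bar>h x * \<phi> x\<bar>" unfolding S by (simp add: abs_mult mult.commute mult.left_commute)
    qed
  qed
  have "(\<lambda>k. integral\<^sup>L lborel (?S k)) = (\<lambda>k. 0)" by (rule ext, rule wdivD(3)[OF w t])
  then show "integral\<^sup>L lborel ?F = 0" using lim LIMSEQ_unique[OF _ tendsto_const] by simp
qed

lemma wdiv_remove_planes:
  assumes "finite PL" and "wdiv (U - (\<Union>(n, c)\<in>PL. {x. n \<bullet> x = c})) q p"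
    and "\<And>n c. (n, c) \<in> PL \<Longrightarrow> n \<noteq> 0 \<and> (\<exists>h. integrable lborel h \<and> (\<forall>x. \<bar>q x \<bullet> n\<bar> \<le> \<bar>n \<bullet> x - c\<bar> * h x))"
  shows "wdiv U q p"
  using assms
proof (induction arbitrary: U rule: finite_induct)
  case empty then show ?case by simp
next
  case (insert nc PL)
  obtain n c where nc: "nc = (n, c)" by (cases nc)
  have "U - (\<Union>(n, c)\<in>insert nc PL. {x. n \<bullet> x = c}) = (U - {x. n \<bullet> x = c}) - (\<Union>(n, c)\<in>PL. {x. n \<bullet> x = c})"
    unfolding nc by auto
  then have "wdiv ((U - {x. n \<bullet> x = c}) - (\<Union>(n, c)\<in>PL. {x. n \<bullet> x = c})) q p" using insert.prems(1) by metis
  then have 1: "wdiv (U - {x. n \<bullet> x = c}) q p"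
    by (rule insert.IH) (rule insert.prems(2), simp)
  obtain h where "n \<noteq> 0" "integrable lborel h" "\<And>x. \<bar>q x \<bullet> n\<bar> \<le> \<bar>n \<bullet> x - c\<bar> * h x"
    using insert.prems(2)[of n c] nc by auto
  then show ?case using wdiv_remove_plane[OF 1] by blast
qed

section \<open>Fluxes through lines and points\<close>

text \<open>It behaves like the logarithm of 1/s near 0, but is at least 1 for all
  \<open>s > 0\<close>, so that its own logarithm is nonnegative.\<close>

definition logw :: "real \<Rightarrow> real" where "logw s = 1 + ln (1 + 1 / s)"

lemma logw_ge_1: "s > 0 \<Longrightarrow> logw s \<ge> 1" by (simp add: logw_def)

lemma logw_deriv: "s > 0 \<Longrightarrow> (logw has_real_derivative - 1 / (s * (s + 1))) (at s)"
proof -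
  assume s: "s > 0"
  have p: "1 + 1 / s > 0" using s by (simp add: add_pos_pos)
  have "((\<lambda>s. 1 + 1 / s) has_real_derivative - 1 / (s * s)) (at s)"
    using s by (auto intro!: derivative_eq_intros)
  from DERIV_chain2[OF DERIV_ln_divide[OF p] this]
  have "((\<lambda>s. 1 + ln (1 + 1 / s)) has_real_derivative 0 + 1 / (1 + 1 / s) * (- 1 / (s * s))) (at s)"
    by (intro DERIV_add DERIV_const)
  moreover have "0 + 1 / (1 + 1 / s) * (- 1 / (s * s)) = - 1 / (s * (s + 1))" using s by (simp add: field_simps)
  ultimately show ?thesis unfolding logw_def[abs_def] by (rule DERIV_cong)
qed

lemma logw_continuous: "continuous_on {0<..} logw"
  by (meson DERIV_isCont continuous_at_imp_continuous_on greaterThan_iff logw_deriv)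

text \<open>The distance to the flat through \<open>x0\<close> with direction \<open>d\<close>, which is a line if \<open>norm d = 1\<close> and the
  point \<open>x0\<close> if \<open>d = 0\<close>.\<close>

definition perp :: "real^3 \<Rightarrow> real^3 \<Rightarrow> real^3 \<Rightarrow> real^3" where
  "perp x0 d x = (x - x0) - ((x - x0) \<bullet> d) *\<^sub>R d"

text \<open>The squared distance, regularised by \<open>\<delta>\<close>: weights and cutoffs built
  from it are continuously differentiable even on the flat, and the constant in Hardy's inequality
  does not depend on \<open>\<delta>\<close>.\<close>

definition sdist :: "real \<Rightarrow> real^3 \<Rightarrow> real^3 \<Rightarrow> real^3 \<Rightarrow> real" where
  "sdist \<delta> x0 d x = (norm (perp x0 d x))\<^sup>2 + \<delta>\<^sup>2"

lemma perp_facts: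
  assumes "norm d = 1 \<or> d = 0"
  shows "(norm (perp x0 d x))\<^sup>2 = (norm (x - x0))\<^sup>2 - ((x - x0) \<bullet> d)\<^sup>2"
    and "norm (perp x0 d x) \<le> norm (x - x0)"
    and "n \<bullet> d = 0 \<Longrightarrow> perp x0 d x \<bullet> n = n \<bullet> x - n \<bullet> x0"
proof -
  have dd: "d \<bullet> d = 1 \<or> d = 0" using assms by (auto simp: norm_eq_1)
  have "(y - (y \<bullet> d) *\<^sub>R d) \<bullet> (y - (y \<bullet> d) *\<^sub>R d) = y \<bullet> y - 2 * (y \<bullet> d)\<^sup>2 + (y \<bullet> d)\<^sup>2 * (d \<bullet> d)" for y
    by (simp add: inner_diff_left inner_diff_right inner_commute[of d y] power2_eq_square right_diff_distrib)
  then have "(norm (perp x0 d x))\<^sup>2 = (x - x0) \<bullet> (x - x0) - 2 * ((x - x0) \<bullet> d)\<^sup>2 + ((x - x0) \<bullet> d)\<^sup>2 * (d \<bullet> d)"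
    unfolding power2_norm_eq_inner perp_def .
  also have "\<dots> = (norm (x - x0))\<^sup>2 - ((x - x0) \<bullet> d)\<^sup>2" using dd by (auto simp: power2_norm_eq_inner)
  finally show *: "(norm (perp x0 d x))\<^sup>2 = (norm (x - x0))\<^sup>2 - ((x - x0) \<bullet> d)\<^sup>2" .
  show "norm (perp x0 d x) \<le> norm (x - x0)" by (rule power2_le_imp_le) (simp_all add: *)
  show "n \<bullet> d = 0 \<Longrightarrow> perp x0 d x \<bullet> n = n \<bullet> x - n \<bullet> x0"
    by (simp add: perp_def inner_diff_left inner_diff_right inner_commute)
qed

lemma C1_perp_component:
  "C1 (\<lambda>x. perp x0 d x $ i)" "grad (\<lambda>x. perp x0 d x $ i) = (\<lambda>x. axis i 1 - d $ i *\<^sub>R d)"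
proof -
  have "(\<lambda>x. perp x0 d x $ i) = (\<lambda>x. (axis i 1 - d $ i *\<^sub>R d) \<bullet> x + (- ((axis i 1 - d $ i *\<^sub>R d) \<bullet> x0)))"
    by (auto simp: perp_def inner_diff_left inner_diff_right inner_axis inner_axis' inner_commute algebra_simps fun_eq_iff)
  then show "C1 (\<lambda>x. perp x0 d x $ i)" "grad (\<lambda>x. perp x0 d x $ i) = (\<lambda>x. axis i 1 - d $ i *\<^sub>R d)"
    using C1_affine[of "axis i 1 - d $ i *\<^sub>R d" "- ((axis i 1 - d $ i *\<^sub>R d) \<bullet> x0)"]
      grad_affine[of "axis i 1 - d $ i *\<^sub>R d" "- ((axis i 1 - d $ i *\<^sub>R d) \<bullet> x0)"] by auto
qed

lemma C1_sdist:
  assumes "norm d = 1 \<or> d = 0"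
  shows "C1 (sdist \<delta> x0 d)" "grad (sdist \<delta> x0 d) = (\<lambda>x. 2 *\<^sub>R perp x0 d x)"
proof -
  have eq: "sdist \<delta> x0 d = (\<lambda>x. (norm (x - x0))\<^sup>2 - ((x - x0) \<bullet> d)\<^sup>2 + \<delta>\<^sup>2)"
    by (auto simp: sdist_def perp_facts(1)[OF assms])
  have d: "(sdist \<delta> x0 d has_derivative (\<lambda>h. 2 * ((x - x0) \<bullet> h) - 2 * ((x - x0) \<bullet> d) * (h \<bullet> d))) (at x)" for x
    unfolding eq power2_norm_eq_inner by (auto intro!: derivative_eq_intros simp: inner_commute algebra_simps)
  have "continuous_on UNIV (\<lambda>x. 2 *\<^sub>R perp x0 d x)" unfolding perp_def by (intro continuous_intros)
  from C1I2[OF d _ this] show "C1 (sdist \<delta> x0 d)" "grad (sdist \<delta> x0 d) = (\<lambda>x. 2 *\<^sub>R perp x0 d x)"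
    by (auto simp: perp_def inner_diff_left inner_commute algebra_simps)
qed

lemma sdist_pos: "\<delta> > 0 \<Longrightarrow> sdist \<delta> x0 d x > 0"
  by (simp add: sdist_def add_nonneg_pos)

text \<open>For regularised squared distance \<open>s\<close> at most 1, the radial field
  \<open>hw s *\<^sub>R perp x0 d x\<close> has divergence at least the Hardy weight
  \<open>1 / (s * (logw s)\<^sup>2)\<close>, and its squared length is at most that weight.\<close>

definition hw :: "real \<Rightarrow> real" where "hw s = 1 / (s * logw s)"

definition hw' :: "real \<Rightarrow> real" where "hw' s = - (logw s - 1 / (s + 1)) / (s * logw s)\<^sup>2"

lemma hw_deriv: "s > 0 \<Longrightarrow> (hw has_real_derivative hw' s) (at s)"
proof -
  assume s: "s > 0"
  have nz: "s * logw s \<noteq> 0" using s logw_ge_1[OF s] by auto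
  have "((\<lambda>s. s * logw s) has_real_derivative 1 * logw s + (- 1 / (s * (s + 1))) * s) (at s)"
    by (rule DERIV_mult[OF DERIV_ident logw_deriv[OF s]])
  from DERIV_inverse_fun[OF this nz]
  have "((\<lambda>s. inverse (s * logw s)) has_real_derivative - ((1 * logw s + (- 1 / (s * (s + 1))) * s) * inverse ((s * logw s) ^ Suc (Suc 0)))) (at s)" .
  moreover have "- ((1 * logw s + (- 1 / (s * (s + 1))) * s) * inverse ((s * logw s) ^ Suc (Suc 0))) = hw' s"
  proof -
    have "1 * logw s + (- 1 / (s * (s + 1))) * s = logw s - 1 / (s + 1)" using s by (simp add: divide_simps)
    then show ?thesis by (simp only: hw'_def) (simp add: divide_inverse numeral_2_eq_2 left_diff_distrib)
  qed
  ultimately show ?thesis by (simp add: hw_def[abs_def] inverse_eq_divide)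
qed

lemma hw'_continuous: "continuous_on {0<..} hw'"
proof -
  have "s * logw s \<noteq> 0" if "s > 0" for s using that logw_ge_1[OF that] by auto
  then show ?thesis unfolding hw'_def[abs_def]
    by (intro continuous_intros logw_continuous) (auto simp: )
qed

lemma hw_bounds:
  assumes "s > 0" shows "hw s > 0" "\<delta> > 0 \<Longrightarrow> \<delta>\<^sup>2 \<le> s \<Longrightarrow> hw s \<le> 1 / \<delta>\<^sup>2"
    "0 \<le> r \<Longrightarrow> r \<le> s \<Longrightarrow> (hw s)\<^sup>2 * r \<le> 1 / (s * (logw s)\<^sup>2)"
proof -
  note L = logw_ge_1[OF assms]
  show "hw s > 0" using assms L by (simp add: hw_def)
  show "hw s \<le> 1 / \<delta>\<^sup>2" if \<delta>: "\<delta> > 0" "\<delta>\<^sup>2 \<le> s"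
  proof -
    have "\<delta>\<^sup>2 * 1 \<le> s * logw s" by (rule mult_mono[OF \<delta>(2) L]) (use assms in auto)
    then show ?thesis unfolding hw_def using \<delta>(1) by (intro divide_left_mono) (use assms L in auto)
  qed
  show "(hw s)\<^sup>2 * r \<le> 1 / (s * (logw s)\<^sup>2)" if "0 \<le> r" "r \<le> s"
  proof -
    have "(hw s)\<^sup>2 * r \<le> (hw s)\<^sup>2 * s" using that by (intro mult_left_mono) auto
    also have "\<dots> = 1 / (s * (logw s)\<^sup>2)" using assms L by (simp add: hw_def field_simps power2_eq_square)
    finally show ?thesis .
  qed
qed

text \<open>Here \<open>r\<close> is the squared distance and \<open>k\<close> the codimension of
  the flat. In the critical case \<open>k = 2\<close> the leading terms cancel up to the
  regularisation, and the derivative of the logarithm leaves the weight. The bound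
  \<open>s \<le> 1\<close> makes that remainder, \<open>2 * r / (s + 1)\<close>, at least
  \<open>r\<close>.\<close>

lemma divergence_bound:
  assumes "0 \<le> r" "\<delta> > 0" "s = r + \<delta>\<^sup>2" "s \<le> 1" "k \<ge> 2"
  shows "hw s * k + 2 * hw' s * r \<ge> 1 / (s * (logw s)\<^sup>2)"
proof -
  have s: "s > 0" using assms by (simp add: add_nonneg_pos)
  note L = logw_ge_1[OF s]
  let ?L = "logw s" and ?D = "s\<^sup>2 * (logw s)\<^sup>2"
  have D: "?D > 0" using s L by simp
  have 1: "hw s * 2 \<le> hw s * k" using hw_bounds(1)[OF s] assms(5) by (intro mult_left_mono) auto
  have 2: "hw s * 2 + 2 * hw' s * r = (2 * s * ?L - 2 * r * ?L + 2 * r / (s + 1)) / ?D"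
  proof -
    have "hw s * 2 = 2 * s * ?L / ?D" unfolding hw_def using s L by (simp add: field_simps power2_eq_square)
    moreover have "2 * hw' s * r = (2 * r / (s + 1) - 2 * r * ?L) / ?D"
      unfolding hw'_def by (simp add: power_mult_distrib algebra_simps)
    ultimately show ?thesis by (simp only: add_divide_distrib[symmetric]) (simp add: algebra_simps)
  qed
  have 3: "2 * s * ?L - 2 * r * ?L = 2 * (\<delta>\<^sup>2 * ?L)" using assms(3) by (simp add: algebra_simps)
  have 4: "\<delta>\<^sup>2 * ?L \<ge> \<delta>\<^sup>2" using mult_left_mono[OF L, of "\<delta>\<^sup>2"] by simp
  have "r * (s + 1) \<le> r * 2" using assms by (intro mult_left_mono) auto
  then have 5: "2 * r / (s + 1) \<ge> r" using s by (simp add: pos_le_divide_eq)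
  have 6: "s \<le> 2 * s * ?L - 2 * r * ?L + 2 * r / (s + 1)"
    using 3 4 5 assms(3) zero_le_power2[of \<delta>] by linarith
  have "s / ?D \<le> (2 * s * ?L - 2 * r * ?L + 2 * r / (s + 1)) / ?D"
    by (rule divide_right_mono[OF 6]) (use D in simp)
  moreover have "s / ?D = 1 / (s * ?L\<^sup>2)" using s L by (simp add: field_simps power2_eq_square)
  ultimately show ?thesis using 1 2 by linarith
qed

text \<open>The divergence of \<open>(g x)\<^sup>2\<close> times the radial field of
  \<open>hw\<close> has integral 0 although \<open>g\<close> may jump across the planes in
  \<open>PL\<close>: they contain the flat, so the field is tangent to them. This divergence
  dominates the weighted square of \<open>g\<close> up to a cross term with \<open>G\<close>, which
  is absorbed.\<close>

lemma hardy:
  assumes d: "norm d = 1 \<or> d = 0" and R: "R \<le> 1/2" and \<delta>: "0 < \<delta>" "\<delta> \<le> 1/2"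
    and K: "compact K" "K \<subseteq> ball x0 R"
    and g: "l12 g" "\<And>x. x \<notin> K \<Longrightarrow> g x = 0"
    and G: "\<And>e. l12 (\<lambda>x. G x \<bullet> e)"
    and PL: "finite PL" "\<And>n c. (n, c) \<in> PL \<Longrightarrow> n \<noteq> 0 \<and> n \<bullet> x0 = c \<and> n \<bullet> d = 0"
    and w: "\<And>e. wdiv (ball x0 R - (\<Union>(n, c)\<in>PL. {x. n \<bullet> x = c})) (\<lambda>x. g x *\<^sub>R e) (\<lambda>x. G x \<bullet> e)"
  shows "integrable lborel (\<lambda>x. (g x)\<^sup>2 / (sdist \<delta> x0 d x * (logw (sdist \<delta> x0 d x))\<^sup>2))"
    and "(\<integral>x. (g x)\<^sup>2 / (sdist \<delta> x0 d x * (logw (sdist \<delta> x0 d x))\<^sup>2) \<partial>lborel) \<le> 4 * (\<integral>x. (norm (G x))\<^sup>2 \<partial>lborel)"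
    and "integrable lborel (\<lambda>x. (norm (G x))\<^sup>2)"
proof -
  let ?W = "ball x0 R - (\<Union>(n, c)\<in>PL. {x. n \<bullet> x = c})"
  have W: "open ?W"
    by (intro open_Diff open_ball closed_UN PL(1)) (auto intro!: closed_hyperplane)
  define s where "s = sdist \<delta> x0 d"
  have sp: "s x > 0" for x unfolding s_def by (rule sdist_pos[OF \<delta>(1)])
  note Cs = C1_sdist[OF d, of \<delta> x0, folded s_def]
  define F where "F x = hw (s x)" for x
  have CF: "C1 F" "grad F = (\<lambda>x. (2 * hw' (s x)) *\<^sub>R perp x0 d x)"
    unfolding F_def using C1_compose_on[OF Cs(1) hw_deriv[OF sp] hw'_continuous] sp Cs(2) by (auto simp: mult.commute)
  \<comment> \<open>Multiplication by \<open>\<psi>\<close> gives the radial field compactly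
    supported components, as \<open>wdiv_mult_C1c\<close> asks, without changing it on the support
    of \<open>g\<close>.\<close>
  obtain \<psi> V where \<psi>: "\<psi> \<in> tests (ball x0 R)" "open V" "K \<subseteq> V" "\<And>x. x \<in> V \<Longrightarrow> \<psi> x = 1"
    using smooth_urysohn[OF K(1) open_ball K(2)] by blast
  have \<psi>c: "\<psi> \<in> C1c (ball x0 R)" using \<psi>(1) tests_C1c by blast
  have C\<psi>: "C1 \<psi>" using \<psi>c by (simp add: C1c_def)
  have g\<psi>: "grad \<psi> x = 0" if "x \<in> V" for x
  proof -
    have "(\<psi> has_derivative (\<lambda>h. 0 \<bullet> h)) (at x)"
      using has_derivative_transform_within_open[of "\<lambda>x. 1" "\<lambda>h. 0 \<bullet> h" x UNIV V \<psi>] \<psi> that by simp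
    then show ?thesis by (rule grad_eqI)
  qed
  define P where "P i x = F x * perp x0 d x $ i" for i x
  have CP: "C1 (P i)" "grad (P i) = (\<lambda>x. F x *\<^sub>R (axis i 1 - d $ i *\<^sub>R d) + perp x0 d x $ i *\<^sub>R grad F x)" for i
    unfolding P_def using C1_mult[OF CF(1) C1_perp_component(1)] C1_perp_component(2) by auto
  have P\<psi>: "(\<lambda>x. \<psi> x * P i x) \<in> C1c (ball x0 R)" for i by (rule C1c_mult[OF \<psi>c CP(1)])
  define q where "q x = ((g x)\<^sup>2 * F x) *\<^sub>R perp x0 d x" for x
  \<comment> \<open>The divergence of the radial field; \<open>3 - d \<bullet> d\<close> is the
    codimension of the flat, 2 for a line and 3 for a point.\<close>
  define D where "D x = F x * (3 - d \<bullet> d) + 2 * hw' (s x) * (norm (perp x0 d x))\<^sup>2" for x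
  define p where "p x = 2 * g x * (F x * (G x \<bullet> perp x0 d x)) + (g x)\<^sup>2 * D x" for x
  have vec: "y = (\<Sum>i\<in>UNIV. (y $ i) *\<^sub>R axis i 1)" for y :: "real^3"
    by (simp add: basis_expansion scalar_mult_eq_scaleR[symmetric])
  have wq: "wdiv ?W q p"
  proof -
    have "wdiv ?W (\<lambda>x. \<Sum>i\<in>UNIV. (\<psi> x * P i x) *\<^sub>R ((g x)\<^sup>2 *\<^sub>R axis i 1))
      (\<lambda>x. \<Sum>i\<in>UNIV. (\<psi> x * P i x) * (2 * g x * (G x \<bullet> axis i 1)) + ((g x)\<^sup>2 *\<^sub>R axis i 1) \<bullet> grad (\<lambda>x. \<psi> x * P i x) x)"
      by (intro wdiv_sum wdiv_mult_C1c[OF wdiv_square[OF g(1) G W w] P\<psi>]) simp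
    moreover have "(\<Sum>i\<in>UNIV. (\<psi> x * P i x) *\<^sub>R ((g x)\<^sup>2 *\<^sub>R axis i 1)) = q x" for x
    proof (cases "g x = 0")
      case False
      then have "\<psi> x = 1" using g(2) \<psi> by blast
      then have "(\<Sum>i\<in>UNIV. (\<psi> x * P i x) *\<^sub>R ((g x)\<^sup>2 *\<^sub>R axis i 1)) = (\<Sum>i\<in>UNIV. (q x $ i) *\<^sub>R axis i 1)"
        by (simp add: P_def q_def mult_ac)
      also have "\<dots> = q x" by (rule vec[symmetric])
      finally show ?thesis .
    qed (simp add: q_def)
    moreover have "(\<Sum>i\<in>UNIV. (\<psi> x * P i x) * (2 * g x * (G x \<bullet> axis i 1)) + ((g x)\<^sup>2 *\<^sub>R axis i 1) \<bullet> grad (\<lambda>x. \<psi> x * P i x) x) = p x" for x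
    proof (cases "g x = 0")
      case False
      then have "x \<in> V" using g(2) \<psi> by blast
      then have 1: "\<psi> x = 1" "grad \<psi> x = 0" using \<psi>(4) g\<psi> by auto
      have gp: "grad (\<lambda>x. \<psi> x * P i x) x = grad (P i) x" for i
        by (simp add: C1_mult(2)[OF C\<psi> CP(1)] 1)
      have "(\<Sum>i\<in>UNIV. (\<psi> x * P i x) * (2 * g x * (G x \<bullet> axis i 1)) + ((g x)\<^sup>2 *\<^sub>R axis i 1) \<bullet> grad (\<lambda>x. \<psi> x * P i x) x)
        = (\<Sum>i\<in>UNIV. 2 * g x * F x * (G x $ i * perp x0 d x $ i) + (g x)\<^sup>2 * (F x * (1 - d $ i * d $ i) + 2 * hw' (s x) * (perp x0 d x $ i * perp x0 d x $ i)))"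
        by (rule sum.cong[OF refl])
          (simp only: gp, simp add: 1 CP(2) CF(2) P_def inner_axis inner_axis' algebra_simps)
      also have "\<dots> = 2 * g x * F x * (G x \<bullet> perp x0 d x) + (g x)\<^sup>2 * (F x * (3 - d \<bullet> d) + 2 * hw' (s x) * (perp x0 d x \<bullet> perp x0 d x))"
        by (simp add: sum_3 inner_vec_def algebra_simps)
      finally show ?thesis by (simp add: p_def D_def power2_norm_eq_inner)
    qed (simp add: p_def)
    ultimately show ?thesis by simp
  qed
  have wB: "wdiv (ball x0 R) q p"
  proof (rule wdiv_remove_planes[OF PL(1) wq])
    fix n c assume nc: "(n, c) \<in> PL"
    \<comment> \<open>The normal component carries the factor \<open>n \<bullet> x - c\<close>; for
      fixed \<open>\<delta>\<close> the rest is bounded by a multiple of the square of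
      \<open>g\<close>.\<close>
    have "\<bar>q x \<bullet> n\<bar> \<le> \<bar>n \<bullet> x - c\<bar> * ((1 / \<delta>\<^sup>2) * (g x)\<^sup>2)" for x
    proof -
      have "q x \<bullet> n = (g x)\<^sup>2 * F x * (n \<bullet> x - c)" using PL(2)[OF nc] perp_facts(3)[OF d] by (simp add: q_def)
      moreover have "0 \<le> F x" "F x \<le> 1 / \<delta>\<^sup>2"
        unfolding F_def using hw_bounds(1)[OF sp] hw_bounds(2)[OF sp \<delta>(1)] by (auto simp: s_def sdist_def less_imp_le)
      moreover have "(g x)\<^sup>2 * F x \<le> (g x)\<^sup>2 * (1 / \<delta>\<^sup>2)" using calculation by (intro mult_left_mono) auto
      ultimately have "\<bar>q x \<bullet> n\<bar> \<le> ((g x)\<^sup>2 * (1 / \<delta>\<^sup>2)) * \<bar>n \<bullet> x - c\<bar>"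
        using mult_right_mono[of "(g x)\<^sup>2 * F x" "(g x)\<^sup>2 * (1 / \<delta>\<^sup>2)" "\<bar>n \<bullet> x - c\<bar>"] by (simp only: abs_mult abs_ge_zero abs_power2 abs_of_nonneg)
      then show ?thesis by (simp add: mult_ac)
    qed
    moreover have "integrable lborel (\<lambda>x. (1 / \<delta>\<^sup>2) * (g x)\<^sup>2)" using l12D(2)[OF g(1)] by simp
    ultimately show "n \<noteq> 0 \<and> (\<exists>h. integrable lborel h \<and> (\<forall>x. \<bar>q x \<bullet> n\<bar> \<le> \<bar>n \<bullet> x - c\<bar> * h x))"
      using PL(2)[OF nc] by blast
  qed
  have p0: "(\<integral>x. p x \<partial>lborel) = 0"
  proof -
    have "p x * \<psi> x + q x \<bullet> grad \<psi> x = p x" for x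
    proof (cases "g x = 0")
      case False
      then have "x \<in> V" using g(2) \<psi> by blast
      then show ?thesis using \<psi>(4) g\<psi> by simp
    qed (simp add: p_def q_def)
    then show ?thesis using wdivD(3)[OF wB \<psi>c] by simp
  qed
  have ip: "integrable lborel p" using wB by (rule wdivD)
  have nG: "(norm (G x))\<^sup>2 = (\<Sum>i\<in>UNIV. (G x \<bullet> axis i 1)\<^sup>2)" for x
    unfolding power2_norm_eq_inner by (simp add: inner_axis inner_vec_def[of "G x" "G x"] power2_eq_square)
  show iG: "integrable lborel (\<lambda>x. (norm (G x))\<^sup>2)"
    unfolding nG by (intro Bochner_Integration.integrable_sum l12D(2)[OF G])
  let ?H = "\<lambda>x. (g x)\<^sup>2 / (s x * (logw (s x))\<^sup>2)"
  have cs: "continuous_on UNIV s" using C1_continuous[OF Cs(1)] .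
  have cl: "continuous_on UNIV (\<lambda>x. logw (s x))"
    by (rule continuous_on_compose2[OF logw_continuous cs]) (use sp in auto)
  have [measurable]: "s \<in> borel_measurable borel" "(\<lambda>x. logw (s x)) \<in> borel_measurable borel" "g \<in> borel_measurable borel"
    using borel_measurable_continuous_onI[OF cs] borel_measurable_continuous_onI[OF cl] l12D(3)[OF g(1)] by auto
  have iH: "integrable lborel ?H"
  proof (rule Bochner_Integration.integrable_bound[of _ "\<lambda>x. (1 / \<delta>\<^sup>2) * (g x)\<^sup>2"])
    show "integrable lborel (\<lambda>x. (1 / \<delta>\<^sup>2) * (g x)\<^sup>2)" using l12D(2)[OF g(1)] by simp
    have "?H x \<le> (1 / \<delta>\<^sup>2) * (g x)\<^sup>2" for x
    proof -
      have "1 \<le> (logw (s x))\<^sup>2" using logw_ge_1[OF sp] by (simp add: one_le_power)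
      moreover have "\<delta>\<^sup>2 \<le> s x" by (simp add: s_def sdist_def)
      ultimately have "\<delta>\<^sup>2 * 1 \<le> s x * (logw (s x))\<^sup>2" by (intro mult_mono) (use sp[of x] in auto)
      then have "(g x)\<^sup>2 / (s x * (logw (s x))\<^sup>2) \<le> (g x)\<^sup>2 / (\<delta>\<^sup>2 * 1)"
        using \<delta> sp[of x] logw_ge_1[OF sp, of x] by (intro divide_left_mono) auto
      then show ?thesis by simp
    qed
    moreover have "0 \<le> ?H x" for x using sp[of x] by simp
    ultimately show "AE x in lborel. norm (?H x) \<le> norm ((1 / \<delta>\<^sup>2) * (g x)\<^sup>2)"
      unfolding real_norm_def by (intro AE_I2) (metis abs_ge_self abs_of_nonneg order_trans)
  qed measurable
  \<comment> \<open>The cross term absorbs half of the weighted square. The other half stays on the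
    left, which turns the factor 2 into the constant 4.\<close>
  have pt: "(1/2) * ?H x \<le> p x + 2 * (norm (G x))\<^sup>2" for x
  proof (cases "g x = 0")
    case False
    then have "x \<in> ball x0 R" using g(2) K(2) by blast
    then have "norm (x - x0) \<le> 1/2" using R by (simp add: dist_norm norm_minus_commute)
    then have np: "norm (perp x0 d x) \<le> 1/2" using perp_facts(2)[OF d, of x0 x] by linarith
    let ?r = "(norm (perp x0 d x))\<^sup>2"
    have "?r \<le> (1/2)\<^sup>2" "\<delta>\<^sup>2 \<le> (1/2)\<^sup>2" using np \<delta> by (intro power_mono; simp)+
    then have s1: "s x \<le> 1" by (simp add: s_def sdist_def power2_eq_square)
    have "3 - d \<bullet> d \<ge> 2" using d by (auto simp: norm_eq_1)
    from divergence_bound[OF _ \<delta>(1) _ s1 this, of ?r]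
    have D: "1 / (s x * (logw (s x))\<^sup>2) \<le> D x" unfolding D_def F_def by (simp add: s_def sdist_def)
    have "(g x)\<^sup>2 * (1 / (s x * (logw (s x))\<^sup>2)) \<le> (g x)\<^sup>2 * D x" by (rule mult_left_mono[OF D]) simp
    then have 1: "?H x \<le> (g x)\<^sup>2 * D x" by simp
    have 2: "(F x)\<^sup>2 * ?r \<le> 1 / (s x * (logw (s x))\<^sup>2)"
      unfolding F_def by (rule hw_bounds(3)[OF sp]) (auto simp: s_def sdist_def)
    have "(g x)\<^sup>2 * ((F x)\<^sup>2 * ?r) \<le> (g x)\<^sup>2 * (1 / (s x * (logw (s x))\<^sup>2))" by (rule mult_left_mono[OF 2]) simp
    then have 3: "(g x * F x * norm (perp x0 d x))\<^sup>2 \<le> ?H x" by (simp add: power_mult_distrib mult.assoc)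
    have "\<bar>g x * F x\<bar> * \<bar>G x \<bullet> perp x0 d x\<bar> \<le> \<bar>g x * F x\<bar> * (norm (G x) * norm (perp x0 d x))"
      by (intro mult_left_mono Cauchy_Schwarz_ineq2) simp
    also have "\<dots> = \<bar>(g x * F x * norm (perp x0 d x)) * norm (G x)\<bar>" by (simp add: abs_mult mult_ac)
    also have "\<dots> \<le> 1/4 * (g x * F x * norm (perp x0 d x))\<^sup>2 + (norm (G x))\<^sup>2"
    proof -
      have "\<bar>a * b\<bar> \<le> 1/4 * a\<^sup>2 + b\<^sup>2" for a b :: real
      proof -
        have "0 \<le> (1/2 * \<bar>a\<bar> - \<bar>b\<bar>)\<^sup>2" by simp
        also have "\<dots> = 1/4 * \<bar>a\<bar>\<^sup>2 + \<bar>b\<bar>\<^sup>2 - \<bar>a\<bar> * \<bar>b\<bar>" by (simp only: power2_eq_square) (simp add: algebra_simps)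
        finally show ?thesis by (simp add: abs_mult)
      qed
      then show ?thesis .
    qed
    finally have "\<bar>2 * g x * (F x * (G x \<bullet> perp x0 d x))\<bar> \<le> 1/2 * ?H x + 2 * (norm (G x))\<^sup>2"
      using 3 by (simp add: abs_mult)
    then show ?thesis using 1 unfolding p_def by linarith
  qed (simp add: p_def)
  have "(\<integral>x. (1/2) * ?H x \<partial>lborel) \<le> (\<integral>x. p x + 2 * (norm (G x))\<^sup>2 \<partial>lborel)"
  proof (rule integral_mono[OF _ _ pt])
    show "integrable lborel (\<lambda>x. (1/2) * ?H x)" by (rule integrable_mult_right[OF iH])
  qed (use ip iG in simp)
  also have "\<dots> = 2 * (\<integral>x. (norm (G x))\<^sup>2 \<partial>lborel)" using ip iG p0 by simp
  finally show "(\<integral>x. (g x)\<^sup>2 / (sdist \<delta> x0 d x * (logw (sdist \<delta> x0 d x))\<^sup>2) \<partial>lborel) \<le> 4 * (\<integral>x. (norm (G x))\<^sup>2 \<partial>lborel)"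
    unfolding s_def[symmetric] using integral_mult_right_zero[of lborel "1/2" ?H] by linarith
  show "integrable lborel (\<lambda>x. (g x)\<^sup>2 / (sdist \<delta> x0 d x * (logw (sdist \<delta> x0 d x))\<^sup>2))"
    using iH unfolding s_def .
qed

section \<open>Logarithmic cutoffs near a line or a point\<close>

lemma exists_small_delta:
  assumes "\<epsilon> > 0" shows "\<exists>\<delta>>0. \<delta> \<le> 1/2 \<and> 1 < \<epsilon> * ln (logw (\<delta>\<^sup>2))"
proof -
  \<comment> \<open>The cutoff contains a double logarithm, so \<open>\<delta>\<close> has to be
    doubly exponentially small in terms of \<open>1 / \<epsilon>\<close>.\<close>
  define E where "E = exp (exp (1 / \<epsilon>))"
  define \<delta> where "\<delta> = min (1/2) (1 / sqrt E)"
  have E: "E > 0" by (simp add: E_def)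
  have \<delta>: "\<delta> > 0" using E by (simp add: \<delta>_def)
  have "\<delta> \<le> 1 / sqrt E" by (simp add: \<delta>_def)
  then have "\<delta>\<^sup>2 \<le> (1 / sqrt E)\<^sup>2" using \<delta> by (intro power_mono) auto
  then have "\<delta>\<^sup>2 \<le> 1 / E" using E by (simp add: power_divide)
  then have "E \<le> 1 / \<delta>\<^sup>2" using \<delta> E by (simp add: field_simps)
  then have "ln E \<le> ln (1 + 1 / \<delta>\<^sup>2)" using E by (intro ln_mono) auto
  then have "exp (1 / \<epsilon>) < logw (\<delta>\<^sup>2)" by (simp add: E_def logw_def)
  then have "ln (exp (1 / \<epsilon>)) < ln (logw (\<delta>\<^sup>2))" by (intro ln_less_cancel_iff[THEN iffD2]) (auto intro: order_less_trans[OF exp_gt_zero])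
  then have "1 / \<epsilon> < ln (logw (\<delta>\<^sup>2))" by simp
  then have "1 < \<epsilon> * ln (logw (\<delta>\<^sup>2))" using assms by (simp add: field_simps)
  then show ?thesis using \<delta> by (intro exI[of _ \<delta>]) (simp add: \<delta>_def)
qed

lemma logw_antimono: "0 < a \<Longrightarrow> a \<le> b \<Longrightarrow> logw b \<le> logw a"
  by (auto simp: logw_def frac_le add_pos_nonneg)

text \<open>The logarithmic cutoffs have gradients controlled by the weight of Hardy's inequality.\<close>

lemma wdiv_remove_flat:
  assumes d: "norm d = 1 \<or> d = 0" and R: "R \<le> 1/2"
    and PL: "finite PL" "\<And>n c. (n, c) \<in> PL \<Longrightarrow> n \<noteq> 0 \<and> n \<bullet> x0 = c \<and> n \<bullet> d = 0"
    and V: "\<And>i. l12 (\<lambda>x. V x $ i)" and J: "\<And>i e. l12 (\<lambda>x. J x $ i \<bullet> e)"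
    and w: "\<And>i e. wdiv (ball x0 R - (\<Union>(n, c)\<in>PL. {x. n \<bullet> x = c})) (\<lambda>x. V x $ i *\<^sub>R e) (\<lambda>x. J x $ i \<bullet> e)"
    and N: "\<And>x. N x \<ge> 0" "integrable lborel (\<lambda>x. (N x)\<^sup>2)" "\<And>x. norm (q x) \<le> N x * norm (V x)"
    and qp: "wdiv (ball x0 R - {x. perp x0 d x = 0}) q p"
  shows "wdiv (ball x0 R) q p"
  unfolding wdiv_def
proof (intro conjI ballI)
  show q: "integrable lborel q" and p: "integrable lborel p" using wdivD[OF qp] by auto
  fix \<phi> assume \<phi>: "\<phi> \<in> C1c (ball x0 R)"
  then obtain K where K: "K \<subseteq> ball x0 R" "zero_off K \<phi>" and C: "C1 \<phi>" by (auto simp: C1c_def)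
  have Kc: "compact K" using K(2) by (simp add: zero_off_def)
  \<comment> \<open>Hardy's inequality is applied to each component of \<open>V\<close>, cut off by
    \<open>\<phi>\<close>; \<open>G\<close> is its gradient off the planes.\<close>
  define g where "g i x = \<phi> x * V x $ i" for i x
  define G where "G i x = \<phi> x *\<^sub>R J x $ i + V x $ i *\<^sub>R grad \<phi> x" for i x
  have g: "l12 (g i)" for i unfolding g_def by (rule C1c_l12_mult[OF \<phi> V])
  have G: "l12 (\<lambda>x. G i x \<bullet> e)" for i e
  proof -
    have "(\<lambda>x. G i x \<bullet> e) = (\<lambda>x. \<phi> x * (J x $ i \<bullet> e) + (grad \<phi> x \<bullet> e) * V x $ i)"
      by (auto simp: G_def inner_add_left)
    then show ?thesis using l12_add[OF C1c_l12_mult(1)[OF \<phi> J] C1c_l12_mult(2)[OF \<phi> V]] by simp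
  qed
  have gw: "wdiv (ball x0 R - (\<Union>(n, c)\<in>PL. {x. n \<bullet> x = c})) (\<lambda>x. g i x *\<^sub>R e) (\<lambda>x. G i x \<bullet> e)" for i e
    using wdiv_mult_C1c[OF w[of i e] \<phi>] by (simp add: g_def G_def inner_add_left inner_commute[of e])
  define H where "H \<delta> i x = (g i x)\<^sup>2 / (sdist \<delta> x0 d x * (logw (sdist \<delta> x0 d x))\<^sup>2)" for \<delta> i x
  have H: "integrable lborel (H \<delta> i)" "(\<integral>x. H \<delta> i x \<partial>lborel) \<le> 4 * (\<integral>x. (norm (G i x))\<^sup>2 \<partial>lborel)"
    if \<delta>: "0 < \<delta>" "\<delta> \<le> 1/2" for \<delta> i
    unfolding H_def using hardy(1,2)[OF d R \<delta> Kc K(1) g _ G PL gw] K(2) by (auto simp: g_def zero_off_def)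
  define M where "M = (\<integral>x. (N x)\<^sup>2 \<partial>lborel) + (\<Sum>i\<in>UNIV. 4 * (\<integral>x. (norm (G i x))\<^sup>2 \<partial>lborel))"
  let ?F = "\<lambda>x. p x * \<phi> x + q x \<bullet> grad \<phi> x"
  have iF: "integrable lborel ?F" by (rule C1c_integrable_pair[OF \<phi> p q])
  \<comment> \<open>It is 0 near the flat for small \<open>\<delta>\<close> and tends to 1 elsewhere
    as \<open>\<epsilon>\<close> tends to 0. The length of its gradient is at most
    \<open>4 * \<epsilon>\<close> times the square root of the Hardy weight.\<close>
  define cut where "cut \<epsilon> \<delta> x = ramp (1 - \<epsilon> * ln (logw (sdist \<delta> x0 d x)))" for \<epsilon> \<delta> x
  have cut: "\<exists>\<delta>. 0 < \<delta> \<and> C1 (cut \<epsilon> \<delta>) \<and> \<bar>\<integral>x. cut \<epsilon> \<delta> x * ?F x \<partial>lborel\<bar> \<le> 4 * \<epsilon> * M"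
    if \<epsilon>: "\<epsilon> > 0" for \<epsilon>
  proof -
    obtain \<delta> where \<delta>: "0 < \<delta>" "\<delta> \<le> 1/2" "1 < \<epsilon> * ln (logw (\<delta>\<^sup>2))" using exists_small_delta[OF \<epsilon>] by blast
    define s where "s = sdist \<delta> x0 d"
    have sp: "s x > 0" for x unfolding s_def by (rule sdist_pos[OF \<delta>(1)])
    note L = logw_ge_1[OF sp]
    note Cs = C1_sdist[OF d, of \<delta> x0, folded s_def]
    define lw where "lw t = ln (logw t)" for t
    define lw' where "lw' t = (1 / logw t) * (- 1 / (t * (t + 1)))" for t
    have lw: "(lw has_real_derivative lw' t) (at t)" if "t > 0" for t
      unfolding lw_def[abs_def] lw'_def using logw_ge_1[OF that] by (intro DERIV_chain2[OF DERIV_ln_divide logw_deriv] that) simp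
    have lwc: "continuous_on {0<..} lw'"
    proof -
      have "logw t \<noteq> 0" if "t > 0" for t using logw_ge_1[OF that] by simp
      then show ?thesis unfolding lw'_def[abs_def] by (intro continuous_intros logw_continuous) auto
    qed
    have lws: "C1 (\<lambda>x. lw (s x))" "grad (\<lambda>x. lw (s x)) = (\<lambda>x. lw' (s x) *\<^sub>R (2 *\<^sub>R perp x0 d x))"
      using C1_compose_on[OF Cs(1) lw[OF sp] lwc] sp Cs(2) by auto
    define f where "f x = 1 - \<epsilon> * lw (s x)" for x
    have f: "C1 f" "grad f = (\<lambda>x. - (\<epsilon> *\<^sub>R (lw' (s x) *\<^sub>R (2 *\<^sub>R perp x0 d x))))"
      unfolding f_def using C1_diff[OF C1_const C1_cmult(1)[OF lws(1)], of 1 \<epsilon>] C1_cmult(2)[OF lws(1), of \<epsilon>]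
      by (auto simp: grad_const lws(2))
    define \<kappa> where "\<kappa> x = ramp (f x)" for x
    have \<kappa>: "C1 \<kappa>" "grad \<kappa> = (\<lambda>x. (2 * max 0 (f x)) *\<^sub>R grad f x)" unfolding \<kappa>_def using C1_ramp[OF f(1)] by auto
    have f1: "f x \<le> 1" for x using L[of x] \<epsilon> by (simp add: f_def lw_def)
    have t: "(\<lambda>x. \<phi> x * \<kappa> x) \<in> C1c (ball x0 R - {x. perp x0 d x = 0})"
    proof -
      have cl: "closed {x. 0 \<le> f x}" by (intro closed_Collect_le continuous_intros C1_continuous[OF f(1)])
      have "zero_off (K \<inter> {x. 0 \<le> f x}) (\<lambda>x. \<phi> x * \<kappa> x)"
        using K(2) cl by (auto simp: zero_off_def compact_Int_closed \<kappa>_def ramp_def)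
      \<comment> \<open>On the flat \<open>s\<close> equals \<open>\<delta>\<^sup>2\<close>, the
        value for which \<open>\<delta>\<close> was chosen.\<close>
      moreover have "f x < 0" if "perp x0 d x = 0" for x
        using that \<delta>(3) by (simp add: f_def lw_def s_def sdist_def)
      then have "K \<inter> {x. 0 \<le> f x} \<subseteq> ball x0 R - {x. perp x0 d x = 0}" using K(1) by force
      ultimately show ?thesis unfolding C1c_def using C1_mult(1)[OF C \<kappa>(1)] by blast
    qed
    let ?S = "\<lambda>x. p x * (\<phi> x * \<kappa> x) + q x \<bullet> grad (\<lambda>x. \<phi> x * \<kappa> x) x"
    have S: "?S x = \<kappa> x * ?F x + \<phi> x * (q x \<bullet> grad \<kappa> x)" for x
      by (simp add: C1_mult(2)[OF C \<kappa>(1)] C1_mult(2)[OF \<kappa>(1) C] inner_add_right algebra_simps)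
    have iS: "integrable lborel ?S" by (rule C1c_integrable_pair[OF t p q])
    have \<kappa>1: "\<bar>\<kappa> x\<bar> \<le> 1" for x using ramp_bounds(1)[of "f x"] ramp_bounds(2)[OF f1] by (simp add: \<kappa>_def)
    have i\<kappa>: "integrable lborel (\<lambda>x. \<kappa> x * ?F x)"
      using integrable_mult_bounded[OF iF _ \<kappa>1] C1c_borel(1)[OF \<kappa>(1)] by (simp add: mult.commute)
    have iE: "integrable lborel (\<lambda>x. \<phi> x * (q x \<bullet> grad \<kappa> x))"
      using Bochner_Integration.integrable_diff[OF iS i\<kappa>] unfolding S by simp
    \<comment> \<open>The arithmetic-geometric inequality splits the product into the square of
      \<open>N\<close> and the Hardy-weighted squares of the components of \<open>V\<close>; both
      have integrals bounded independently of \<open>\<delta>\<close>.\<close>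
    have pt: "\<bar>\<phi> x * (q x \<bullet> grad \<kappa> x)\<bar> \<le> 4 * \<epsilon> * ((N x)\<^sup>2 + (\<Sum>i\<in>UNIV. H \<delta> i x))" for x
    proof -
      let ?n = "norm (perp x0 d x)" and ?s = "s x"
      have lw'b: "\<bar>lw' ?s\<bar> \<le> hw ?s"
      proof -
        have "?s * logw ?s * 1 \<le> ?s * logw ?s * (?s + 1)" using sp[of x] L[of x] by (intro mult_left_mono) auto
        then have "1 / (?s * logw ?s * (?s + 1)) \<le> 1 / (?s * logw ?s * 1)"
          using sp[of x] L[of x] by (intro divide_left_mono) auto
        then show ?thesis using sp[of x] L[of x] by (simp add: lw'_def hw_def abs_mult mult_ac)
      qed
      have "norm (grad \<kappa> x) = 2 * max 0 (f x) * (\<epsilon> * (\<bar>lw' ?s\<bar> * (2 * ?n)))"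
        unfolding \<kappa>(2) f(2) using \<epsilon> by (simp add: abs_mult)
      also have "\<dots> \<le> 2 * 1 * (\<epsilon> * (hw ?s * (2 * ?n)))"
        using f1[of x] lw'b \<epsilon> by (intro mult_mono mult_right_mono mult_left_mono) auto
      finally have gk: "norm (grad \<kappa> x) \<le> 4 * \<epsilon> * (hw ?s * ?n)" by simp
      have "\<bar>q x \<bullet> grad \<kappa> x\<bar> \<le> norm (q x) * norm (grad \<kappa> x)" by (rule Cauchy_Schwarz_ineq2)
      also have "\<dots> \<le> (N x * norm (V x)) * (4 * \<epsilon> * (hw ?s * ?n))"
        using N(1)[of x] by (intro mult_mono N(3) gk) auto
      finally have "\<bar>\<phi> x\<bar> * \<bar>q x \<bullet> grad \<kappa> x\<bar> \<le> \<bar>\<phi> x\<bar> * ((N x * norm (V x)) * (4 * \<epsilon> * (hw ?s * ?n)))" by (intro mult_left_mono) auto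
      also have "\<dots> = 4 * \<epsilon> * (N x * (\<bar>\<phi> x\<bar> * norm (V x) * (hw ?s * ?n)))" by simp
      also have "\<dots> \<le> 4 * \<epsilon> * (1 * (N x)\<^sup>2 + (\<bar>\<phi> x\<bar> * norm (V x) * (hw ?s * ?n))\<^sup>2 / 1)"
        using \<epsilon> by (intro mult_left_mono order_trans[OF abs_ge_self am_gm_mult]) auto
      also have "(\<bar>\<phi> x\<bar> * norm (V x) * (hw ?s * ?n))\<^sup>2 / 1 \<le> (\<Sum>i\<in>UNIV. H \<delta> i x)"
      proof -
        have "(\<bar>\<phi> x\<bar> * norm (V x) * (hw ?s * ?n))\<^sup>2 / 1 = (\<phi> x)\<^sup>2 * (norm (V x))\<^sup>2 * ((hw ?s)\<^sup>2 * ?n\<^sup>2)"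
          by (simp add: power_mult_distrib)
        also have "\<dots> \<le> (\<phi> x)\<^sup>2 * (norm (V x))\<^sup>2 * (1 / (?s * (logw ?s)\<^sup>2))"
          by (intro mult_left_mono hw_bounds(3)[OF sp]) (auto simp: s_def sdist_def)
        also have "\<dots> = (\<Sum>i\<in>UNIV. H \<delta> i x)"
          unfolding H_def g_def s_def power2_norm_eq_inner inner_vec_def
          by (simp add: sum_divide_distrib sum_distrib_left power2_eq_square mult_ac)
        finally show ?thesis .
      qed
      finally show ?thesis using \<epsilon> by (simp add: abs_mult)
    qed
    have iR: "integrable lborel (\<lambda>x. 4 * \<epsilon> * ((N x)\<^sup>2 + (\<Sum>i\<in>UNIV. H \<delta> i x)))"
      using N(2) H(1)[OF \<delta>(1,2)] by simp
    have "(\<integral>x. \<kappa> x * ?F x + \<phi> x * (q x \<bullet> grad \<kappa> x) \<partial>lborel) = 0"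
      using wdivD(3)[OF qp t] unfolding S .
    then have "(\<integral>x. \<kappa> x * ?F x \<partial>lborel) = - (\<integral>x. \<phi> x * (q x \<bullet> grad \<kappa> x) \<partial>lborel)"
      by (simp only: Bochner_Integration.integral_add[OF i\<kappa> iE])
    then have "\<bar>\<integral>x. \<kappa> x * ?F x \<partial>lborel\<bar> = \<bar>\<integral>x. \<phi> x * (q x \<bullet> grad \<kappa> x) \<partial>lborel\<bar>" by simp
    also have "\<dots> \<le> (\<integral>x. \<bar>\<phi> x * (q x \<bullet> grad \<kappa> x)\<bar> \<partial>lborel)" by (rule integral_abs_bound)
    also have "\<dots> \<le> (\<integral>x. 4 * \<epsilon> * ((N x)\<^sup>2 + (\<Sum>i\<in>UNIV. H \<delta> i x)) \<partial>lborel)"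
      by (rule integral_mono[OF integrable_abs[OF iE] iR pt])
    also have "\<dots> = 4 * \<epsilon> * ((\<integral>x. (N x)\<^sup>2 \<partial>lborel) + (\<Sum>i\<in>UNIV. \<integral>x. H \<delta> i x \<partial>lborel))"
      using N(2) H(1)[OF \<delta>(1,2)] by simp
    also have "\<dots> \<le> 4 * \<epsilon> * M"
      unfolding M_def using \<epsilon> by (intro mult_left_mono add_left_mono sum_mono H(2)[OF \<delta>(1,2)]) auto
    finally have "\<bar>\<integral>x. \<kappa> x * ?F x \<partial>lborel\<bar> \<le> 4 * \<epsilon> * M" .
    moreover have "\<kappa> = cut \<epsilon> \<delta>"
      by (auto simp: cut_def \<kappa>_def f_def lw_def s_def)
    ultimately show ?thesis using \<delta>(1) \<kappa>(1) by (intro exI[of _ \<delta>]) simp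
  qed
  define e where "e k = inverse (real (Suc k))" for k
  have e: "e k > 0" for k by (simp add: e_def)
  have e0: "e \<longlonglongrightarrow> 0" unfolding e_def by (rule LIMSEQ_inverse_real_of_nat)
  have "\<exists>\<delta>. \<forall>k. 0 < \<delta> k \<and> C1 (cut (e k) (\<delta> k)) \<and> \<bar>\<integral>x. cut (e k) (\<delta> k) x * ?F x \<partial>lborel\<bar> \<le> 4 * e k * M"
    by (intro choice allI cut e)
  then obtain \<delta> where \<delta>: "\<forall>k. 0 < \<delta> k \<and> C1 (cut (e k) (\<delta> k)) \<and> \<bar>\<integral>x. cut (e k) (\<delta> k) x * ?F x \<partial>lborel\<bar> \<le> 4 * e k * M" ..
  define \<kappa> where "\<kappa> k = cut (e k) (\<delta> k)" for k
  have \<kappa>: "0 < \<delta> k" "\<kappa> k = (\<lambda>x. ramp (1 - e k * ln (logw (sdist (\<delta> k) x0 d x))))"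
    "C1 (\<kappa> k)" "\<bar>\<integral>x. \<kappa> k x * ?F x \<partial>lborel\<bar> \<le> 4 * e k * M" for k
    using \<delta> by (auto simp: \<kappa>_def cut_def[abs_def])
  \<comment> \<open>\<open>a\<close> is normal to a plane through the flat. The plane is a null set,
    and off it the distance to the flat is positive.\<close>
  obtain a where a: "a \<noteq> 0" "orthogonal d a" using orthogonal_to_vector_exists[of d] by auto
  have lim: "(\<lambda>k. \<integral>x. \<kappa> k x * ?F x \<partial>lborel) \<longlonglongrightarrow> (\<integral>x. ?F x \<partial>lborel)"
  proof (rule integral_dominated_convergence[where w="\<lambda>x. \<bar>?F x\<bar>"])
    show "AE x in lborel. (\<lambda>k. \<kappa> k x * ?F x) \<longlonglongrightarrow> ?F x"
      using AE_not_hyperplane[OF a(1), of "a \<bullet> x0"]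
    proof eventually_elim
      case (elim x)
      have "a \<bullet> d = 0" using a(2) by (simp add: orthogonal_def inner_commute)
      then have "perp x0 d x \<bullet> a \<noteq> 0" using elim perp_facts(3)[OF d, of a x0 x] by simp
      then have r: "(norm (perp x0 d x))\<^sup>2 > 0" by auto
      let ?u = "\<lambda>k. e k * ln (logw (sdist (\<delta> k) x0 d x))"
      \<comment> \<open>Nothing is known about the speed of \<open>\<delta> k\<close>; the logarithm
        is bounded by its value without regularisation, and the factor \<open>e k\<close> makes it
        small.\<close>
      have "?u \<longlonglongrightarrow> 0"
      proof (rule tendsto_sandwich[OF _ _ tendsto_const])
        have pos: "sdist (\<delta> k) x0 d x > 0" for k by (rule sdist_pos[OF \<kappa>(1)])
        show "\<forall>\<^sub>F k in sequentially. 0 \<le> ?u k"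
          by (intro always_eventually allI mult_nonneg_nonneg less_imp_le[OF e] ln_ge_zero logw_ge_1[OF pos])
        have "logw (sdist (\<delta> k) x0 d x) \<le> logw ((norm (perp x0 d x))\<^sup>2)" for k
          by (rule logw_antimono[OF r]) (simp add: sdist_def)
        moreover have "logw (sdist (\<delta> k) x0 d x) > 0" for k using logw_ge_1[OF pos, of k] by linarith
        ultimately have "ln (logw (sdist (\<delta> k) x0 d x)) \<le> ln (logw ((norm (perp x0 d x))\<^sup>2))" for k
          by (intro ln_mono)
        then show "\<forall>\<^sub>F k in sequentially. ?u k \<le> e k * ln (logw ((norm (perp x0 d x))\<^sup>2))"
          by (intro always_eventually allI mult_left_mono less_imp_le[OF e])
        show "(\<lambda>k. e k * ln (logw ((norm (perp x0 d x))\<^sup>2))) \<longlonglongrightarrow> 0" by (rule tendsto_mult_left_zero[OF e0])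
      qed
      then have "(\<lambda>k. (max 0 (1 - ?u k))\<^sup>2 * ?F x) \<longlonglongrightarrow> (max 0 (1 - 0))\<^sup>2 * ?F x" by (intro tendsto_intros)
      then show ?case by (simp add: \<kappa>(2) ramp_def)
    qed
    show "AE x in lborel. norm (\<kappa> k x * ?F x) \<le> \<bar>?F x\<bar>" for k
    proof (intro AE_I2)
      fix x
      have "sdist (\<delta> k) x0 d x > 0" by (rule sdist_pos[OF \<kappa>(1)])
      then have "1 - e k * ln (logw (sdist (\<delta> k) x0 d x)) \<le> 1" using logw_ge_1 less_imp_le[OF e] by simp
      then have "\<bar>\<kappa> k x\<bar> \<le> 1" using ramp_bounds unfolding \<kappa>(2) by simp
      then show "norm (\<kappa> k x * ?F x) \<le> \<bar>?F x\<bar>" using mult_right_mono[of "\<bar>\<kappa> k x\<bar>" 1 "\<bar>?F x\<bar>"] by (simp add: abs_mult)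
    qed
    show "(\<lambda>x. \<kappa> k x * ?F x) \<in> borel_measurable lborel" for k
      using C1c_borel(1)[OF \<kappa>(3)] borel_measurable_integrable[OF iF] by measurable
  qed (use iF in auto)
  have "(\<lambda>k. \<integral>x. \<kappa> k x * ?F x \<partial>lborel) \<longlonglongrightarrow> 0"
  proof (rule Lim_null_comparison[OF always_eventually])
    show "\<forall>k. norm (\<integral>x. \<kappa> k x * ?F x \<partial>lborel) \<le> e k * (4 * M)" using \<kappa>(4) by (simp add: mult_ac)
    show "(\<lambda>k. e k * (4 * M)) \<longlonglongrightarrow> 0" by (rule tendsto_mult_left_zero[OF e0])
  qed
  with lim show "(\<integral>x. ?F x \<partial>lborel) = 0" using LIMSEQ_unique by blast
qed

section \<open>The null Lagrangian of the gradient\<close>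

definition curl_of :: "real^3^3 \<Rightarrow> real^3" where
  "curl_of J = vector [J$3$2 - J$2$3, J$1$3 - J$3$1, J$2$1 - J$1$2]"

definition nullq :: "real^3^3 \<Rightarrow> real" where
  "nullq J = trace (J ** J) - (trace J)\<^sup>2"

definition flux :: "real^3^3 \<Rightarrow> real^3 \<Rightarrow> real^3" where
  "flux J v = J *v v - trace J *\<^sub>R v"

lemma frobenius_split: "(norm J)\<^sup>2 = (norm (curl_of J))\<^sup>2 + (trace J)\<^sup>2 + nullq J"
  unfolding norm_matrix_frobenius power2_norm_eq_inner
  by (simp add: nullq_def curl_of_def trace_def matrix_matrix_mult_def
      inner_vec_def sum_3 vector_3 power2_eq_square algebra_simps)

text \<open>Trades the normal derivative of the tangential component \<open>v \<bullet> e\<close>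
  for the curl and a tangential derivative of \<open>v \<bullet> n\<close>.\<close>

lemma curl_of_cross: "curl_of J \<bullet> cross3 n e = e \<bullet> (J *v n) - n \<bullet> (J *v e)"
  by (simp add: curl_of_def matrix_vector_mult_def cross3_simps)

text \<open>The integrand of \<open>null_lagrangian\<close> for \<open>a = v \<bullet> x\<close> and
  \<open>b = v \<bullet> y\<close> in the directions \<open>e = y\<close> and \<open>f = x\<close>,
  with \<open>w\<close> for the gradient of the test function. The component along \<open>x\<close>
  is the one that will carry \<alpha>.\<close>

definition pair_term :: "real^3^3 \<Rightarrow> real^3 \<Rightarrow> real \<Rightarrow> real^3 \<Rightarrow> real^3 \<Rightarrow> real^3 \<Rightarrow> real" where
  "pair_term J v \<eta> w x y =
    2 * \<eta> * ((x \<bullet> (J *v y)) * (y \<bullet> (J *v x)) - (x \<bullet> (J *v x)) * (y \<bullet> (J *v y)))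
    + (w \<bullet> y) * (v \<bullet> x) * (y \<bullet> (J *v x)) - (w \<bullet> x) * (v \<bullet> x) * (y \<bullet> (J *v y))
    + (w \<bullet> x) * (x \<bullet> (J *v y)) * (v \<bullet> y) - (w \<bullet> y) * (x \<bullet> (J *v x)) * (v \<bullet> y)"

text \<open>In \<open>nullq\<close> the squares of the diagonal entries cancel and each unordered
  pair of indices occurs twice, which matches the factor 2 in \<open>pair_term\<close>. The index 3,
  later the normal one, comes first in its pairs.\<close>

lemma pair_terms_axis:
  "pair_term J v \<eta> w (axis 1 1) (axis 2 1) + pair_term J v \<eta> w (axis 3 1) (axis 1 1) + pair_term J v \<eta> w (axis 3 1) (axis 2 1)
    = \<eta> * nullq J + flux J v \<bullet> w"
proof -
  have *: "axis i 1 \<bullet> (J *v axis k 1) = J $ i $ k" for i k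
    by (simp add: inner_axis' matrix_vector_mult_basis column_def)
  have **: "u \<bullet> axis i 1 = u $ i" for u :: "real^3" and i by (simp add: inner_axis)
  show ?thesis
    unfolding pair_term_def * ** by (simp add: nullq_def flux_def trace_def matrix_matrix_mult_def
      matrix_vector_mult_def inner_vec_def sum_3 power2_eq_square algebra_simps)
qed

text \<open>Conjugation by an orthogonal matrix preserves the traces of \<open>J\<close> and of its
  square and rotates the flux, which reduces the claim to the coordinate axes.\<close>

lemma pair_terms_basis:
  fixes M :: "real^3^3"
  assumes M: "orthogonal_matrix M"
  defines "b \<equiv> \<lambda>i. M *v axis i 1"
  shows "pair_term J v \<eta> w (b 1) (b 2) + pair_term J v \<eta> w (b 3) (b 1) + pair_term J v \<eta> w (b 3) (b 2)
    = \<eta> * nullq J + flux J v \<bullet> w"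
    and "v = (v \<bullet> b 1) *\<^sub>R b 1 + (v \<bullet> b 2) *\<^sub>R b 2 + (v \<bullet> b 3) *\<^sub>R b 3"
    and "trace J = b 1 \<bullet> (J *v b 1) + b 2 \<bullet> (J *v b 2) + b 3 \<bullet> (J *v b 3)"
    and "b i \<bullet> b k = (if i = k then 1 else 0)"
proof -
  let ?T = "transpose M"
  let ?J = "?T ** J ** M"
  have MM: "?T ** M = mat 1" "M ** ?T = mat 1" using M by (auto simp: orthogonal_matrix_def)
  have ib: "u \<bullet> b i = (?T *v u) \<bullet> axis i 1" for u i
    by (simp add: b_def dot_lmul_matrix[symmetric] inner_commute vector_transpose_matrix)
  have jb: "b i \<bullet> (J *v b k) = axis i 1 \<bullet> (?J *v axis k 1)" for i k
    by (simp add: b_def matrix_vector_mul_assoc[symmetric] inner_commute[of "M *v _"] dot_lmul_matrix[symmetric] vector_transpose_matrix)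
      (metis dot_lmul_matrix inner_commute vector_transpose_matrix transpose_transpose transpose_matrix_vector)
  have pt: "pair_term J v \<eta> w (b i) (b k) = pair_term ?J (?T *v v) \<eta> (?T *v w) (axis i 1) (axis k 1)" for i k
    unfolding pair_term_def ib jb ..
  have tr: "trace ?J = trace J"
  proof -
    have "trace ?J = trace (M ** (?T ** J))" by (rule trace_mul_sym)
    then show ?thesis by (simp add: matrix_mul_assoc MM)
  qed
  have JJ: "?J ** ?J = ?T ** (J ** J) ** M"
  proof -
    have "?J ** ?J = ?T ** J ** (M ** ?T) ** J ** M" by (simp only: matrix_mul_assoc)
    then show ?thesis by (simp add: MM matrix_mul_assoc)
  qed
  have tr2: "trace (?J ** ?J) = trace (J ** J)"
  proof -
    have "trace (?J ** ?J) = trace (M ** (?T ** (J ** J)))" unfolding JJ by (rule trace_mul_sym)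
    then show ?thesis by (simp add: matrix_mul_assoc MM)
  qed
  have iT: "(?T *v u) \<bullet> (?T *v u') = u \<bullet> u'" for u u'
  proof -
    have "(?T *v u) \<bullet> (?T *v u') = (M *v (?T *v u)) \<bullet> u'"
      by (metis dot_lmul_matrix inner_commute transpose_matrix_vector)
    then show ?thesis by (simp only: matrix_vector_mul_assoc MM matrix_vector_mul_lid)
  qed
  have fl: "flux ?J (?T *v v) = ?T *v flux J v"
  proof -
    have "?J *v (?T *v v) = ?T *v (J *v ((M ** ?T) *v v))" by (simp only: matrix_vector_mul_assoc matrix_mul_assoc)
    then show ?thesis by (simp add: flux_def tr MM matrix_vector_mult_diff_distrib matrix_vector_mult_scaleR)
  qed
  show "pair_term J v \<eta> w (b 1) (b 2) + pair_term J v \<eta> w (b 3) (b 1) + pair_term J v \<eta> w (b 3) (b 2)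
    = \<eta> * nullq J + flux J v \<bullet> w"
    unfolding pt pair_terms_axis fl iT by (simp add: nullq_def tr tr2)
  show "trace J = b 1 \<bullet> (J *v b 1) + b 2 \<bullet> (J *v b 2) + b 3 \<bullet> (J *v b 3)"
    unfolding jb using tr by (simp add: trace_def sum_3 inner_axis' matrix_vector_mult_basis column_def)
  show "b i \<bullet> b k = (if i = k then 1 else 0)"
    unfolding ib by (simp add: b_def matrix_vector_mul_assoc MM inner_axis_axis)
  have "v = M *v (?T *v v)" by (simp only: matrix_vector_mul_assoc MM matrix_vector_mul_lid)
  also have "?T *v v = (v \<bullet> b 1) *\<^sub>R axis 1 1 + (v \<bullet> b 2) *\<^sub>R axis 2 1 + (v \<bullet> b 3) *\<^sub>R axis 3 1"
    unfolding ib by (simp add: vec_eq_iff inner_axis forall_3) (simp add: axis_def)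
  finally show "v = (v \<bullet> b 1) *\<^sub>R b 1 + (v \<bullet> b 2) *\<^sub>R b 2 + (v \<bullet> b 3) *\<^sub>R b 3"
    by (simp add: b_def matrix_vector_right_distrib matrix_vector_mult_scaleR)
qed

section \<open>Directional derivatives and integrability of the flux\<close>

lemma wdiv_directional:
  assumes "\<And>i. wdiv U (\<lambda>x. (f x * V x $ i) *\<^sub>R e) (\<lambda>x. f x * (J x $ i \<bullet> e))"
  shows "wdiv U (\<lambda>x. (f x * (V x \<bullet> a)) *\<^sub>R e) (\<lambda>x. f x * (a \<bullet> (J x *v e)))"
proof -
  have "wdiv U (\<lambda>x. \<Sum>i\<in>UNIV. (a $ i) *\<^sub>R ((f x * V x $ i) *\<^sub>R e)) (\<lambda>x. \<Sum>i\<in>UNIV. a $ i * (f x * (J x $ i \<bullet> e)))"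
    by (intro wdiv_sum wdiv_scale assms) simp
  moreover have "(\<Sum>i\<in>UNIV. (a $ i) *\<^sub>R ((f x * V x $ i) *\<^sub>R e)) = (f x * (V x \<bullet> a)) *\<^sub>R e" for x
    by (simp add: inner_vec_def sum_distrib_left scaleR_sum_left mult_ac)
  moreover have "(\<Sum>i\<in>UNIV. a $ i * (f x * (J x $ i \<bullet> e))) = f x * (a \<bullet> (J x *v e))" for x
    by (simp add: inner_vec_def[of a] matrix_vector_mult_def inner_vec_def[of "J x $ _"] sum_distrib_left mult_ac)
  ultimately show ?thesis by simp
qed

lemma wdiv_congI: "wdiv U q p \<Longrightarrow> (\<And>x. q x = q' x) \<Longrightarrow> (\<And>x. p x = p' x) \<Longrightarrow> wdiv U q' p'"
proof -
  assume "wdiv U q p" "\<And>x. q x = q' x" "\<And>x. p x = p' x"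
  moreover from this have "q = q'" "p = p'" by auto
  ultimately show "wdiv U q' p'" by simp
qed

lemma l12_component_inner:
  assumes "\<And>i. l12 (\<lambda>x. V x $ i)"
  shows "l12 (\<lambda>x. V x \<bullet> a)"
proof -
  have "(\<lambda>x. V x \<bullet> a) = (\<lambda>x. \<Sum>i\<in>UNIV. a $ i * V x $ i)" by (auto simp: inner_vec_def mult.commute)
  then show ?thesis using l12_sum[of UNIV "\<lambda>i x. a $ i * V x $ i"] l12_cmult[OF assms] by simp
qed

lemma l12_matrix_inner:
  fixes J :: "real^3 \<Rightarrow> real^3^3"
  assumes "\<And>i e. l12 (\<lambda>x. J x $ i \<bullet> e)"
  shows "l12 (\<lambda>x. a \<bullet> (J x *v e))"
proof -
  have "(\<lambda>x. a \<bullet> (J x *v e)) = (\<lambda>x. \<Sum>i\<in>UNIV. a $ i * (J x $ i \<bullet> e))"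
    by (simp add: inner_vec_def[of a] matrix_vector_mult_def inner_vec_def[of "J _ $ _"])
  then show ?thesis using l12_sum[of UNIV "\<lambda>i x. a $ i * (J x $ i \<bullet> e)"] l12_cmult[OF assms] by simp
qed

lemma l12_norm:
  fixes V :: "real^3 \<Rightarrow> real^3"
  assumes "\<And>i. l12 (\<lambda>x. V x $ i)"
  shows "l12 (\<lambda>x. norm (V x))" "integrable lborel V"
proof -
  have "integrable lborel (\<lambda>x. \<Sum>i\<in>UNIV. V x $ i *\<^sub>R axis i (1::real))"
    by (intro Bochner_Integration.integrable_sum integrable_scaleR_left l12D assms)
  moreover have "(\<Sum>i\<in>UNIV. V x $ i *\<^sub>R axis i (1::real)) = V x" for x
    by (simp add: basis_expansion scalar_mult_eq_scaleR[symmetric])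
  ultimately show V: "integrable lborel V" by simp
  have "(\<lambda>x. (norm (V x))\<^sup>2) = (\<lambda>x. \<Sum>i\<in>UNIV. (V x $ i)\<^sup>2)"
    unfolding power2_norm_eq_inner by (simp add: inner_vec_def power2_eq_square)
  moreover have "integrable lborel (\<lambda>x. \<Sum>i\<in>UNIV. (V x $ i)\<^sup>2)"
    by (intro Bochner_Integration.integrable_sum l12D assms)
  ultimately show "l12 (\<lambda>x. norm (V x))" using V by (simp add: l12_def)
qed

text \<open>The factor 2 accounts for the two terms of \<open>flux\<close>, each bounded by the sum
  of the row norms times the length of the vector.\<close>

definition gradnorm :: "real^3^3 \<Rightarrow> real" where
  "gradnorm J = 2 * (\<Sum>i\<in>UNIV. norm (J $ i))"

lemma flux_bound: "norm (flux J v) \<le> gradnorm J * norm v"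
proof -
  have "norm (J *v v) \<le> (\<Sum>i\<in>UNIV. \<bar>(J *v v) $ i\<bar>)" by (rule norm_le_l1_cart)
  also have "\<dots> \<le> (\<Sum>i\<in>UNIV. norm (J $ i) * norm v)"
  proof (rule sum_mono)
    fix i
    have "(J *v v) $ i = J $ i \<bullet> v" by (simp add: matrix_vector_mult_def inner_vec_def)
    then show "\<bar>(J *v v) $ i\<bar> \<le> norm (J $ i) * norm v" using Cauchy_Schwarz_ineq2 by simp
  qed
  finally have 1: "norm (J *v v) \<le> (\<Sum>i\<in>UNIV. norm (J $ i)) * norm v" by (simp add: sum_distrib_right)
  have "\<bar>trace J\<bar> \<le> (\<Sum>i\<in>UNIV. \<bar>J $ i $ i\<bar>)" unfolding trace_def by (rule sum_abs)
  also have "\<dots> \<le> (\<Sum>i\<in>UNIV. norm (J $ i))" by (intro sum_mono component_le_norm_cart)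
  finally have "\<bar>trace J\<bar> * norm v \<le> (\<Sum>i\<in>UNIV. norm (J $ i)) * norm v" by (intro mult_right_mono) auto
  then have 2: "norm (trace J *\<^sub>R v) \<le> (\<Sum>i\<in>UNIV. norm (J $ i)) * norm v" by simp
  show ?thesis unfolding flux_def gradnorm_def using norm_triangle_ineq4[of "J *v v" "trace J *\<^sub>R v"] 1 2 by (simp add: algebra_simps)
qed

lemma l12_gradnorm:
  assumes "\<And>i e. l12 (\<lambda>x. J x $ i \<bullet> e)"
  shows "l12 (\<lambda>x. gradnorm (J x))"
proof -
  have "l12 (\<lambda>x. J x $ i $ k)" for i k using assms[of i "axis k 1"] by (simp add: inner_axis)
  then have "l12 (\<lambda>x. norm (J x $ i))" for i by (rule l12_norm(1))
  then show ?thesis unfolding gradnorm_def by (intro l12_cmult l12_sum)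
qed

lemma flux_integrable:
  assumes V: "\<And>i. l12 (\<lambda>x. V x $ i)" and J: "\<And>i e. l12 (\<lambda>x. J x $ i \<bullet> e)"
    and A: "A \<in> borel_measurable borel" "\<And>x. \<bar>A x\<bar> \<le> M"
  shows "integrable lborel (\<lambda>x. A x *\<^sub>R flux (J x) (V x))" "integrable lborel (\<lambda>x. A x * nullq (J x))"
proof -
  have Jik: "l12 (\<lambda>x. J x $ i $ k)" for i k using J[of i "axis k 1"] by (simp add: inner_axis)
  have tr: "l12 (\<lambda>x. trace (J x))" unfolding trace_def by (intro l12_sum Jik)
  have fi: "integrable lborel (\<lambda>x. flux (J x) (V x) $ i)" for i
  proof -
    have "integrable lborel (\<lambda>x. (\<Sum>k\<in>UNIV. J x $ i $ k * V x $ k) - trace (J x) * V x $ i)"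
      by (intro Bochner_Integration.integrable_diff Bochner_Integration.integrable_sum l12_mult Jik V tr)
    then show ?thesis by (simp add: flux_def matrix_vector_mult_def)
  qed
  have "integrable lborel (\<lambda>x. \<Sum>i\<in>UNIV. (flux (J x) (V x) $ i * A x) *\<^sub>R axis i (1::real))"
    by (intro Bochner_Integration.integrable_sum integrable_scaleR_left integrable_mult_bounded[OF fi _ A(2)]) (use A(1) in simp)
  moreover have "(\<Sum>i\<in>UNIV. (flux (J x) (V x) $ i * A x) *\<^sub>R axis i (1::real)) = A x *\<^sub>R flux (J x) (V x)" for x
    using basis_expansion[of "A x *\<^sub>R flux (J x) (V x)"] by (simp add: scalar_mult_eq_scaleR mult.commute)
  ultimately show "integrable lborel (\<lambda>x. A x *\<^sub>R flux (J x) (V x))" by simp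
  have "integrable lborel (\<lambda>x. (\<Sum>i\<in>UNIV. \<Sum>k\<in>UNIV. J x $ i $ k * J x $ k $ i) - (trace (J x))\<^sup>2)"
    by (intro Bochner_Integration.integrable_diff Bochner_Integration.integrable_sum l12_mult Jik l12D(2)[OF tr])
  then have "integrable lborel (\<lambda>x. nullq (J x))"
    by (simp add: nullq_def matrix_matrix_mult_def trace_def[of "\<chi> i j. _ i j"])
  from integrable_mult_bounded[OF this _ A(2)] A(1) show "integrable lborel (\<lambda>x. A x * nullq (J x))"
    by (simp add: mult.commute)
qed

lemma null_lagrangian_integrable:
  assumes l: "l12 a" "l12 ae" "l12 af" "l12 b" "l12 be" "l12 bf" and \<eta>: "\<eta> \<in> C1c B"
  shows "integrable lborel (\<lambda>x. (2 * \<eta> x * ae x + (grad \<eta> x \<bullet> e) * a x) * bf x - (2 * \<eta> x * af x + (grad \<eta> x \<bullet> f) * a x) * be x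
    + ((grad \<eta> x \<bullet> f) * ae x - (grad \<eta> x \<bullet> e) * af x) * b x)"
  unfolding mult.assoc[of 2]
  by (intro Bochner_Integration.integrable_add Bochner_Integration.integrable_diff l12_mult l12_add l12_diff l12_cmult C1c_l12_mult[OF \<eta>] l)

text \<open>The flux identity near a point of a single plane: either \<open>V\<close> satisfies the transmission conditions across
  the plane (\<open>U = B\<close>), or it lives on one side only.\<close>

lemma interface_flux:
  fixes V :: "real^3 \<Rightarrow> real^3" and J :: "real^3 \<Rightarrow> real^3^3" and A :: "real^3 \<Rightarrow> real"
  assumes V: "\<And>i. l12 (\<lambda>x. V x $ i)" and J: "\<And>i e. l12 (\<lambda>x. J x $ i \<bullet> e)"
    and A: "A \<in> borel_measurable borel" "\<And>x. \<bar>A x\<bar> \<le> M"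
    and n: "norm n = 1" and B: "open B"
    and U: "U = B \<or> U = {x \<in> B. n \<bullet> x > c}" "\<And>x. x \<in> B - U \<Longrightarrow> V x = 0"
    and grad: "\<And>i e. wdiv (B - {x. n \<bullet> x = c}) (\<lambda>x. V x $ i *\<^sub>R e) (\<lambda>x. J x $ i \<bullet> e)"
    and Agrad: "\<And>i e. wdiv (B - {x. n \<bullet> x = c}) (\<lambda>x. (A x * V x $ i) *\<^sub>R e) (\<lambda>x. A x * (J x $ i \<bullet> e))"
    and curl: "\<And>a. wdiv B (\<lambda>x. cross3 a (V x)) (\<lambda>x. - (curl_of (J x) \<bullet> a))"
    and dv: "wdiv U (\<lambda>x. A x *\<^sub>R V x) (\<lambda>x. A x * trace (J x))"
  shows "wdiv B (\<lambda>x. A x *\<^sub>R flux (J x) (V x)) (\<lambda>x. A x * nullq (J x))"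
proof (rule wdivI_tests[OF B flux_integrable(2,1)[OF V J A]])
  fix \<eta> assume \<eta>: "\<eta> \<in> tests B"
  then have \<eta>c: "\<eta> \<in> C1c B" using tests_C1c by blast
  obtain K0 where K0: "K0 \<subseteq> B" "zero_off K0 \<eta>" using \<eta> by (auto simp: tests_def)
  have K0c: "compact K0" using K0(2) by (simp add: zero_off_def)
  obtain T :: "real^3^3" where T: "orthogonal_matrix T" "T *v axis 3 1 = n"
    using orthogonal_matrix_exists_basis[OF n] by blast
  define b where "b i = T *v axis i 1" for i
  note bb = pair_terms_basis[OF T(1), folded b_def]
  have b3: "b 3 = n" using T(2) by (simp add: b_def)
  have orth: "n \<bullet> b 1 = 0" "n \<bullet> b 2 = 0" "b 1 \<bullet> n = 0" "b 2 \<bullet> n = 0" using bb(4)[of 3 1] bb(4)[of 3 2] bb(4)[of 1 3] bb(4)[of 2 3] by (auto simp: b3)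
  have UB: "U \<subseteq> B" using U(1) by auto
  have n0: "n \<noteq> 0" using n by auto
  \<comment> \<open>A flux in a tangential direction does not cross the plane, so the equations on
    its two sides combine, with \<open>h = 0\<close>.\<close>
  have tang: "wdiv B (\<lambda>x. (V x \<bullet> a) *\<^sub>R e) (\<lambda>x. a \<bullet> (J x *v e))"
      "wdiv B (\<lambda>x. (A x * (V x \<bullet> a)) *\<^sub>R e) (\<lambda>x. A x * (a \<bullet> (J x *v e)))" if e: "e \<bullet> n = 0" for a e
  proof -
    have 1: "wdiv B (\<lambda>x. V x $ i *\<^sub>R e) (\<lambda>x. J x $ i \<bullet> e)" for i
      by (rule wdiv_remove_plane[OF grad n0, of "\<lambda>x. 0"]) (simp_all add: e)
    have 2: "wdiv B (\<lambda>x. (A x * V x $ i) *\<^sub>R e) (\<lambda>x. A x * (J x $ i \<bullet> e))" for i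
      by (rule wdiv_remove_plane[OF Agrad n0, of "\<lambda>x. 0"]) (simp_all add: e)
    show "wdiv B (\<lambda>x. (V x \<bullet> a) *\<^sub>R e) (\<lambda>x. a \<bullet> (J x *v e))"
      using wdiv_directional[of B "\<lambda>x. 1" V e J a] 1 by simp
    show "wdiv B (\<lambda>x. (A x * (V x \<bullet> a)) *\<^sub>R e) (\<lambda>x. A x * (a \<bullet> (J x *v e)))"
      using wdiv_directional[of B A V e J a] 2 by simp
  qed
  \<comment> \<open>Since \<open>cross3 (cross3 n e) (V x)\<close> equals \<open>(V x \<bullet> n)
    *\<^sub>R e - (V x \<bullet> e) *\<^sub>R n\<close>, the curl equation supplies the normal
    derivative of a tangential component on all of \<open>B\<close>.\<close>
  have norml: "wdiv B (\<lambda>x. (V x \<bullet> e) *\<^sub>R n) (\<lambda>x. e \<bullet> (J x *v n))" if e: "e \<bullet> n = 0" for e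
  proof -
    have "wdiv B (\<lambda>x. cross3 (cross3 n e) (V x) + (-1) *\<^sub>R ((V x \<bullet> n) *\<^sub>R e)) (\<lambda>x. - (curl_of (J x) \<bullet> cross3 n e) + (-1) * (n \<bullet> (J x *v e)))"
      by (intro wdiv_add wdiv_scale curl tang(1) e)
    then have "wdiv B (\<lambda>x. (-1) *\<^sub>R (cross3 (cross3 n e) (V x) + (-1) *\<^sub>R ((V x \<bullet> n) *\<^sub>R e))) (\<lambda>x. (-1) * (- (curl_of (J x) \<bullet> cross3 n e) + (-1) * (n \<bullet> (J x *v e))))"
      by (rule wdiv_scale)
    then show ?thesis
    proof (rule wdiv_congI)
      show "(-1) *\<^sub>R (cross3 (cross3 n e) (V x) + (-1) *\<^sub>R ((V x \<bullet> n) *\<^sub>R e)) = (V x \<bullet> e) *\<^sub>R n" for x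
        by (simp add: cross3_simps forall_3)
      show "(-1) * (- (curl_of (J x) \<bullet> cross3 n e) + (-1) * (n \<bullet> (J x *v e))) = e \<bullet> (J x *v n)" for x
        unfolding curl_of_cross by simp
    qed
  qed
  \<comment> \<open>Subtracting the two tangential contributions from the divergence leaves the
    normal derivative of the normal component, and only on \<open>U\<close>.\<close>
  have AVn: "wdiv U (\<lambda>x. (A x * (V x \<bullet> n)) *\<^sub>R n) (\<lambda>x. A x * (n \<bullet> (J x *v n)))"
  proof -
    have "wdiv U (\<lambda>x. A x *\<^sub>R V x + (-1) *\<^sub>R ((A x * (V x \<bullet> b 1)) *\<^sub>R b 1) + (-1) *\<^sub>R ((A x * (V x \<bullet> b 2)) *\<^sub>R b 2))
      (\<lambda>x. A x * trace (J x) + (-1) * (A x * (b 1 \<bullet> (J x *v b 1))) + (-1) * (A x * (b 2 \<bullet> (J x *v b 2))))"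
      by (intro wdiv_add wdiv_scale dv wdiv_mono[OF tang(2) UB] orth)
    then show ?thesis
    proof (rule wdiv_congI)
      fix x
      have "V x = (V x \<bullet> b 1) *\<^sub>R b 1 + (V x \<bullet> b 2) *\<^sub>R b 2 + (V x \<bullet> n) *\<^sub>R n" using bb(2)[of "V x"] by (simp only: b3)
      then have "A x *\<^sub>R V x = A x *\<^sub>R ((V x \<bullet> b 1) *\<^sub>R b 1 + (V x \<bullet> b 2) *\<^sub>R b 2 + (V x \<bullet> n) *\<^sub>R n)" by presburger
      then show "A x *\<^sub>R V x + (-1) *\<^sub>R ((A x * (V x \<bullet> b 1)) *\<^sub>R b 1) + (-1) *\<^sub>R ((A x * (V x \<bullet> b 2)) *\<^sub>R b 2) = (A x * (V x \<bullet> n)) *\<^sub>R n"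
        by (simp add: scaleR_add_right)
      show "A x * trace (J x) + (-1) * (A x * (b 1 \<bullet> (J x *v b 1))) + (-1) * (A x * (b 2 \<bullet> (J x *v b 2))) = A x * (n \<bullet> (J x *v n))"
        unfolding bb(3)[of "J x"] b3 by (simp add: algebra_simps)
    qed
  qed
  have lV: "l12 (\<lambda>x. V x \<bullet> a)" for a by (rule l12_component_inner[OF V])
  have lJ: "l12 (\<lambda>x. a \<bullet> (J x *v e))" for a e by (rule l12_matrix_inner[OF J])
  have lAV: "l12 (\<lambda>x. A x * (V x \<bullet> a))" and lAJ: "l12 (\<lambda>x. A x * (a \<bullet> (J x *v e)))" for a e
    using l12_bounded_mult[OF lV A] l12_bounded_mult[OF lJ A] by auto
  \<comment> \<open>Kernels supported in \<open>H\<close> average over points \<open>x - z\<close>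
    with \<open>n \<bullet> z > 0\<close>, that is, towards the side on which \<open>V\<close>
    vanishes when \<open>U\<close> is a half of \<open>B\<close>.\<close>
  define H where "H = {z::real^3. n \<bullet> z > 0}"
  have H: "open H" unfolding H_def by (rule open_halfspace_gt)
  have H0: "H \<inter> ball 0 d \<noteq> {}" if "d > 0" for d :: real
  proof -
    have "(d / 2) *\<^sub>R n \<in> H \<inter> ball 0 d" using that n by (simp add: H_def dot_square_norm)
    then show ?thesis by blast
  qed
  obtain d0 where d0: "d0 > 0" "\<And>x y. x \<in> K0 \<Longrightarrow> dist x y < d0 \<Longrightarrow> y \<in> B"
    using compact_open_margin[OF K0c B K0(1)] by blast
  have supp: "x \<in> K0" if "\<eta> x \<noteq> 0" for x using that K0(2) by (auto simp: zero_off_def)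
  have admB: "\<exists>K. compact K \<and> K \<subseteq> B \<and> (\<forall>x z. \<eta> x \<noteq> 0 \<longrightarrow> x \<notin> K \<longrightarrow> z \<in> S \<longrightarrow> V (x - z) \<bullet> a = 0)" for S a
    using K0c K0(1) supp by blast
  have admU: "\<exists>K. compact K \<and> K \<subseteq> U \<and> (\<forall>x z. \<eta> x \<noteq> 0 \<longrightarrow> x \<notin> K \<longrightarrow> z \<in> S \<longrightarrow> V (x - z) \<bullet> a = 0)"
    if S: "compact S" "S \<subseteq> H \<inter> ball 0 d0" for S a
    using U(1)
  proof
    assume "U = B" then show ?thesis using admB by simp
  next
    assume Uh: "U = {x \<in> B. n \<bullet> x > c}"
    show ?thesis
    proof (cases "S = {}")
      case True then show ?thesis by (intro exI[of _ "{}"]) simp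
    next
      case False
      \<comment> \<open>Every shift in \<open>S\<close> lowers \<open>n \<bullet> x\<close> by at
        least \<open>n \<bullet> z0\<close>, which is positive; within this margin of the plane only
        zeros of \<open>V\<close> are averaged.\<close>
      obtain z0 where z0: "z0 \<in> S" "\<And>z. z \<in> S \<Longrightarrow> n \<bullet> z0 \<le> n \<bullet> z"
        using continuous_attains_inf[OF S(1) False continuous_on_inner[OF continuous_on_const continuous_on_id], of n] by auto
      let ?K = "K0 \<inter> {x. n \<bullet> x \<ge> c + n \<bullet> z0}"
      have "n \<bullet> z0 > 0" using z0(1) S(2) by (auto simp: H_def)
      then have "?K \<subseteq> U" using K0(1) Uh by auto
      moreover have "compact ?K" using K0c closed_halfspace_ge by (rule compact_Int_closed)
      moreover have "V (x - z) \<bullet> a = 0" if "\<eta> x \<noteq> 0" "x \<notin> ?K" "z \<in> S" for x z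
      proof -
        have "x \<in> K0" using supp that(1) by blast
        then have "n \<bullet> x < c + n \<bullet> z0" using that(2) by auto
        then have "n \<bullet> (x - z) \<le> c" using z0(2)[OF that(3)] by (simp add: inner_diff_right)
        moreover have "x - z \<in> B" using S(2) that(3) by (intro d0(2)[OF \<open>x \<in> K0\<close>]) (auto simp: dist_norm)
        ultimately have "x - z \<in> B - U" using Uh by auto
        then show ?thesis using U(2) by simp
      qed
      ultimately show ?thesis by blast
    qed
  qed
  let ?E = "\<lambda>y z x. (2 * \<eta> x * (A x * (y \<bullet> (J x *v z))) + (grad \<eta> x \<bullet> z) * (A x * (V x \<bullet> y))) * (z \<bullet> (J x *v y))
      - (2 * \<eta> x * (A x * (y \<bullet> (J x *v y))) + (grad \<eta> x \<bullet> y) * (A x * (V x \<bullet> y))) * (z \<bullet> (J x *v z))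
      + ((grad \<eta> x \<bullet> y) * (A x * (y \<bullet> (J x *v z))) - (grad \<eta> x \<bullet> z) * (A x * (y \<bullet> (J x *v y)))) * (V x \<bullet> z)"
  have E: "?E y z x = A x * pair_term (J x) (V x) (\<eta> x) (grad \<eta> x) y z" for x y z
    unfolding pair_term_def by (simp add: algebra_simps)
  have I: "integrable lborel (?E y z)" for y z
    by (rule null_lagrangian_integrable[OF lAV lAJ lAJ lV lJ lJ \<eta>c])
  \<comment> \<open>Both directions are tangential, so all equations hold on \<open>B\<close>, and
    no shift of the support is required.\<close>
  have P12: "(\<integral>x. ?E (b 1) (b 2) x \<partial>lborel) = 0"
    by (rule null_lagrangian[OF lAV lAJ lAJ lV lJ lJ B tang(2)[OF orth(4)] tang(2)[OF orth(3)] tang(1)[OF orth(4)] tang(1)[OF orth(3)] \<eta> H H0 d0(1) admB])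
  \<comment> \<open>The normal component takes the role of \<open>a\<close>, as its normal
    derivative is known on \<open>U\<close> only; the tangential one is differentiable across the
    plane and is mollified.\<close>
  have P3: "(\<integral>x. ?E n e x \<partial>lborel) = 0" if e: "e \<bullet> n = 0" for e
    by (rule null_lagrangian[OF lAV lAJ lAJ lV lJ lJ B wdiv_mono[OF tang(2)[OF e] UB] AVn tang(1)[OF e] norml[OF e] \<eta> H H0 d0(1) admU])
  have "(\<integral>x. ?E (b 1) (b 2) x + ?E n (b 1) x + ?E n (b 2) x \<partial>lborel) = 0"
    by (simp only: Bochner_Integration.integral_add[OF Bochner_Integration.integrable_add[OF I I] I] Bochner_Integration.integral_add[OF I I] P12 P3[OF orth(3)] P3[OF orth(4)])
  moreover have "?E (b 1) (b 2) x + ?E n (b 1) x + ?E n (b 2) x = A x * nullq (J x) * \<eta> x + (A x *\<^sub>R flux (J x) (V x)) \<bullet> grad \<eta> x" for x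
    unfolding E using bb(1)[of "J x" "V x" "\<eta> x" "grad \<eta> x"] unfolding b3
    by (simp add: distrib_left[symmetric]) (simp add: algebra_simps)
  ultimately show "(\<integral>x. A x * nullq (J x) * \<eta> x + (A x *\<^sub>R flux (J x) (V x)) \<bullet> grad \<eta> x \<partial>lborel) = 0" by (simp only:)
qed

section \<open>From faces to edges and vertices\<close>

lemma planes_margin:
  fixes PL :: "((real^3) \<times> real) set"
  assumes "finite PL"
  shows "\<exists>r>0. r \<le> 1/2 \<and> (\<forall>n c y. (n, c) \<in> PL \<longrightarrow> y \<in> ball x r \<longrightarrow> n \<bullet> y = c \<longrightarrow> n \<bullet> x = c)"
proof -
  let ?P = "{nc \<in> PL. fst nc \<bullet> x \<noteq> snd nc}"
  let ?S = "\<Union>nc\<in>?P. {y. fst nc \<bullet> y = snd nc}"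
  have "finite ?P" using assms by simp
  then have "closed ?S" by (rule closed_UN) (intro ballI closed_hyperplane)
  then have "open (- ?S)" by (rule open_Compl)
  moreover have "x \<in> - ?S" by blast
  ultimately obtain r where r: "r > 0" "ball x r \<subseteq> - ?S" using open_contains_ball by blast
  have "n \<bullet> x = c" if "(n, c) \<in> PL" "y \<in> ball x (min r (1/2))" "n \<bullet> y = c" for n c y
  proof (rule ccontr)
    assume "n \<bullet> x \<noteq> c"
    then have "(n, c) \<in> ?P" using that(1) by simp
    then have "y \<in> ?S" using that(3) by force
    moreover have "y \<in> ball x r" using that(2) by auto
    ultimately show False using r(2) by blast
  qed
  \<comment> \<open>The cap 1/2 is the largest radius allowed in \<open>hardy\<close>.\<close>
  then show ?thesis using r(1) by (intro exI[of _ "min r (1/2)"]) auto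
qed

text \<open>The double cross product of \<open>d\<close>, \<open>y\<close> and \<open>n\<close>
  vanishes, so \<open>n\<close> is parallel to \<open>cross3 d y\<close>.\<close>

lemma perpendicular_two:
  fixes n d y :: "real^3"
  assumes "n \<bullet> d = 0" "n \<bullet> y = 0" "cross3 d y \<noteq> 0"
  shows "\<exists>t. n = t *\<^sub>R cross3 d y"
proof -
  have "cross3 (cross3 d y) n = (d \<bullet> n) *\<^sub>R y - (y \<bullet> n) *\<^sub>R d" by (simp add: cross3_simps forall_3)
  then have "cross3 (cross3 d y) n = 0" using assms(1,2) by (simp add: inner_commute)
  then have "collinear {0, cross3 d y, n}" by (simp add: cross_eq_0)
  then have "cross3 d y = 0 \<or> n = 0 \<or> (\<exists>t. n = t *\<^sub>R cross3 d y)" by (simp only: collinear_lemma)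
  then show ?thesis using assms(3) by (metis scaleR_zero_left)
qed

lemma cross_zero_perp:
  assumes "norm d = 1" "cross3 d (y - x) = 0" shows "perp x d y = 0"
proof -
  have "collinear {0, d, y - x}" using assms(2) by (simp add: cross_eq_0)
  then have "d = 0 \<or> y - x = 0 \<or> (\<exists>t. y - x = t *\<^sub>R d)" by (simp only: collinear_lemma)
  then have "\<exists>t. y - x = t *\<^sub>R d" using assms(1) by (metis norm_zero scaleR_zero_left zero_neq_one)
  then obtain t where t: "y - x = t *\<^sub>R d" ..
  then show ?thesis using assms(1) by (simp add: perp_def dot_square_norm)
qed

text \<open>Points are sorted by what the planes through them share: a whole plane, settled by
  assumption, then a line, then just the point. At each stage the less singular points are known,
  and the remaining flat is removed by \<open>wdiv_remove_flat\<close>.\<close>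

lemma flux_global:
  assumes PL: "finite PL" "\<And>n c. (n, c) \<in> PL \<Longrightarrow> n \<noteq> 0"
    and V: "\<And>i. l12 (\<lambda>x. V x $ i)" and J: "\<And>i e. l12 (\<lambda>x. J x $ i \<bullet> e)"
    and A: "A \<in> borel_measurable borel" "\<And>x. \<bar>A x\<bar> \<le> M"
    and grad: "\<And>i e. wdiv (- (\<Union>(n, c)\<in>PL. {x. n \<bullet> x = c})) (\<lambda>x. V x $ i *\<^sub>R e) (\<lambda>x. J x $ i \<bullet> e)"
    and one: "\<And>y n. norm n = 1 \<Longrightarrow> (\<And>n' c'. (n', c') \<in> PL \<Longrightarrow> n' \<bullet> y = c' \<Longrightarrow> \<exists>t. n' = t *\<^sub>R n) \<Longrightarrow>
      \<exists>r>0. wdiv (ball y r) (\<lambda>x. A x *\<^sub>R flux (J x) (V x)) (\<lambda>x. A x * nullq (J x))"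
  shows "wdiv UNIV (\<lambda>x. A x *\<^sub>R flux (J x) (V x)) (\<lambda>x. A x * nullq (J x))"
proof -
  let ?q = "\<lambda>x. A x *\<^sub>R flux (J x) (V x)" and ?p = "\<lambda>x. A x * nullq (J x)"
  note ipq = flux_integrable(2,1)[OF V J A]
  define N where "N x = \<bar>M\<bar> * gradnorm (J x)" for x
  have gn: "gradnorm K \<ge> 0" for K by (simp add: gradnorm_def sum_nonneg)
  have N: "N x \<ge> 0" "norm (?q x) \<le> N x * norm (V x)" for x
  proof -
    show "N x \<ge> 0" using gn by (simp add: N_def)
    have "\<bar>A x\<bar> * norm (flux (J x) (V x)) \<le> \<bar>M\<bar> * (gradnorm (J x) * norm (V x))"
      using A(2)[of x] by (intro mult_mono flux_bound) auto
    then show "norm (?q x) \<le> N x * norm (V x)" by (simp add: N_def mult.assoc)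
  qed
  have "l12 N" unfolding N_def by (intro l12_cmult l12_gradnorm J)
  then have N2: "integrable lborel (\<lambda>x. (N x)\<^sup>2)" by (rule l12D)
  \<comment> \<open>Near \<open>x\<close> only planes through \<open>x\<close> matter. They all
    contain the flat through \<open>x\<close> with direction \<open>d\<close>, and
    \<open>near\<close> settles the points off this flat.\<close>
  have remove: "\<exists>r>0. wdiv (ball x r) ?q ?p"
    if d: "norm d = 1 \<or> d = 0" and dir: "\<And>n c. (n, c) \<in> PL \<Longrightarrow> n \<bullet> x = c \<Longrightarrow> n \<bullet> d = 0"
      and near: "\<And>y. perp x d y \<noteq> 0 \<Longrightarrow> (\<And>n c. (n, c) \<in> PL \<Longrightarrow> n \<bullet> y = c \<Longrightarrow> n \<bullet> x = c) \<Longrightarrow> \<exists>r>0. wdiv (ball y r) ?q ?p"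
    for x d
  proof -
    obtain r where r: "r > 0" "r \<le> 1/2" "\<And>n c y. (n, c) \<in> PL \<Longrightarrow> y \<in> ball x r \<Longrightarrow> n \<bullet> y = c \<Longrightarrow> n \<bullet> x = c"
      using planes_margin[OF PL(1), of x] by blast
    let ?P = "{(n, c). (n, c) \<in> PL \<and> n \<bullet> x = c}"
    have fP: "finite ?P" using PL(1) by (rule rev_finite_subset) auto
    have sub: "ball x r - (\<Union>(n, c)\<in>?P. {x. n \<bullet> x = c}) \<subseteq> - (\<Union>(n, c)\<in>PL. {x. n \<bullet> x = c})"
      using r(3) by fastforce
    have w0: "wdiv (ball x r - {y. perp x d y = 0}) ?q ?p"
    proof (rule wdiv_local[OF ipq])
      fix y assume y: "y \<in> ball x r - {y. perp x d y = 0}"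
      show "\<exists>r>0. wdiv (ball y r) ?q ?p"
      proof (rule near)
        show "perp x d y \<noteq> 0" using y by simp
        show "n \<bullet> x = c" if "(n, c) \<in> PL" "n \<bullet> y = c" for n c using r(3)[OF that(1) _ that(2)] y by simp
      qed
    qed
    have "wdiv (ball x r) ?q ?p"
      by (rule wdiv_remove_flat[OF d r(2) fP _ V J wdiv_mono[OF grad sub] N(1) N2 N(2) w0]) (use PL(2) dir in auto)
    then show ?thesis using r(1) by blast
  qed
  have two: "\<exists>r>0. wdiv (ball x r) ?q ?p"
    if d: "norm d = 1" and dir: "\<And>n c. (n, c) \<in> PL \<Longrightarrow> n \<bullet> x = c \<Longrightarrow> n \<bullet> d = 0" for x d
  proof (rule remove[of d x])
    show "norm d = 1 \<or> d = 0" using d by simp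
    show "n \<bullet> d = 0" if "(n, c) \<in> PL" "n \<bullet> x = c" for n c using dir that by blast
    fix y assume y: "perp x d y \<noteq> 0" "\<And>n c. (n, c) \<in> PL \<Longrightarrow> n \<bullet> y = c \<Longrightarrow> n \<bullet> x = c"
    \<comment> \<open>The planes through \<open>y\<close> that matter also pass through
      \<open>x\<close> and contain the direction \<open>d\<close>; as \<open>y\<close> is off the
      line, their normals are all parallel to this vector.\<close>
    let ?m = "cross3 d (y - x)"
    have m: "?m \<noteq> 0" using cross_zero_perp[OF d] y(1) by blast
    show "\<exists>r>0. wdiv (ball y r) ?q ?p"
    proof (rule one[of "(1 / norm ?m) *\<^sub>R ?m"])
      show "norm ((1 / norm ?m) *\<^sub>R ?m) = 1" using m by simp
      fix n c assume nc: "(n, c) \<in> PL" "n \<bullet> y = c"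
      then have "n \<bullet> x = c" "n \<bullet> d = 0" using y(2) dir by blast+
      then have "n \<bullet> d = 0" "n \<bullet> (y - x) = 0" using nc(2) by (auto simp: inner_diff_right)
      then obtain t where "n = t *\<^sub>R ?m" using perpendicular_two m by blast
      then have "n = (t * norm ?m) *\<^sub>R ((1 / norm ?m) *\<^sub>R ?m)" using m by simp
      then show "\<exists>t. n = t *\<^sub>R ((1 / norm ?m) *\<^sub>R ?m)" by blast
    qed
  qed
  have "\<exists>r>0. wdiv (ball x r) ?q ?p" for x
  proof (rule remove[of 0 x])
    fix y assume y: "perp x 0 y \<noteq> 0" "\<And>n c. (n, c) \<in> PL \<Longrightarrow> n \<bullet> y = c \<Longrightarrow> n \<bullet> x = c"
    then have yx: "y - x \<noteq> 0" by (simp add: perp_def)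
    show "\<exists>r>0. wdiv (ball y r) ?q ?p"
    \<comment> \<open>Planes through both \<open>x\<close> and \<open>y\<close> share the direction
      \<open>y - x\<close>.\<close>
    proof (rule two[of "(1 / norm (y - x)) *\<^sub>R (y - x)"])
      show "norm ((1 / norm (y - x)) *\<^sub>R (y - x)) = 1" using yx by simp
      fix n c assume nc: "(n, c) \<in> PL" "n \<bullet> y = c"
      then have "n \<bullet> x = c" using y(2) by blast
      then show "n \<bullet> ((1 / norm (y - x)) *\<^sub>R (y - x)) = 0" using nc(2) by (simp add: inner_diff_right)
    qed
  qed auto
  then show ?thesis by (intro wdiv_local[OF ipq])
qed

text \<open>Completion and restriction are dealt with here: integrals over
  \<open>lebesgue_on U\<close> become integrals over \<open>lborel\<close> of a Borel function that
  vanishes off \<open>U\<close>.\<close>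

lemma lebesgue_on_AE:
  fixes F F' :: "real^3 \<Rightarrow> 'b::euclidean_space"
  assumes U: "U \<in> sets borel" and F': "F' \<in> borel_measurable borel"
    and ae: "AE x in lborel. x \<in> U \<longrightarrow> F x = F' x" and z: "\<And>x. x \<notin> U \<Longrightarrow> F' x = 0"
  shows "(LINT x|lebesgue_on U. F x) = (\<integral>x. F' x \<partial>lborel)"
    and "integrable (lebesgue_on U) F \<longleftrightarrow> integrable lborel F'"
    and "F \<in> borel_measurable (lebesgue_on U)"
proof -
  let ?G = "\<lambda>x. indicator U x *\<^sub>R F x"
  have UL: "U \<inter> space lebesgue \<in> sets lebesgue" using U by simp
  have "AE x in lborel. F' x = ?G x" using ae by eventually_elim (auto simp: z indicator_def)
  then have aeG: "AE x in lebesgue. F' x = ?G x" by (rule AE_completion)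
  have F'l: "F' \<in> borel_measurable lebesgue" using F' by (simp add: measurable_completion)
  have Gl: "?G \<in> borel_measurable lebesgue" by (rule borel_measurable_AE[OF F'l aeG])
  show "F \<in> borel_measurable (lebesgue_on U)"
    using Gl borel_measurable_restrict_space_iff[OF UL] by blast
  have "(LINT x|lebesgue_on U. F x) = (\<integral>x. ?G x \<partial>lebesgue)" by (rule integral_restrict_space[OF UL])
  also have "\<dots> = (\<integral>x. F' x \<partial>lebesgue)"
    by (rule integral_cong_AE[OF Gl F'l]) (use aeG in eventually_elim, simp)
  also have "\<dots> = (\<integral>x. F' x \<partial>lborel)" using F' by (intro integral_completion) simp
  finally show "(LINT x|lebesgue_on U. F x) = (\<integral>x. F' x \<partial>lborel)" .
  have "integrable (lebesgue_on U) F \<longleftrightarrow> integrable lebesgue ?G" by (rule integrable_restrict_space[OF UL])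
  also have "\<dots> \<longleftrightarrow> integrable lebesgue F'" using integrable_cong_AE[OF F'l Gl aeG] by simp
  also have "\<dots> \<longleftrightarrow> integrable lborel F'" using F' by (intro integrable_completion) simp
  finally show "integrable (lebesgue_on U) F \<longleftrightarrow> integrable lborel F'" .
qed

section \<open>Weak derivatives as distributional divergences\<close>

text \<open>The values of \<open>f\<close> outside \<open>U\<close> and on null sets are arbitrary;
  the representative is Borel and extended by zero, so that it can be mollified across the
  boundary.\<close>

definition represents :: "(real^3) set \<Rightarrow> (real^3 \<Rightarrow> real^3) \<Rightarrow> (real^3 \<Rightarrow> real^3) \<Rightarrow> bool" where
  "represents U f V \<longleftrightarrow> (\<forall>i. l12 (\<lambda>x. V x $ i)) \<and> (\<forall>x. x \<notin> U \<longrightarrow> V x = 0) \<and>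
     (AE x in lborel. x \<in> U \<longrightarrow> f x = V x)"

text \<open>A Lebesgue measurable function agrees almost everywhere with a Borel one, and on a set
  of finite measure integrability follows from
  \<open>\<bar>g x\<bar> \<le> 1 + (g x)\<^sup>2\<close>.\<close>

lemma L2_real_rep:
  fixes f :: "real^3 \<Rightarrow> real"
  assumes U: "open U" "bounded U" and f: "f \<in> L2 U"
  shows "\<exists>g. l12 g \<and> (\<forall>x. x \<notin> U \<longrightarrow> g x = 0) \<and> (AE x in lborel. x \<in> U \<longrightarrow> f x = g x)"
proof -
  have Ub: "U \<in> sets borel" using U(1) by simp
  then have UL: "U \<inter> space lebesgue \<in> sets lebesgue" by simp
  have "f \<in> borel_measurable (lebesgue_on U)" using f by (simp add: L2_def)
  then have "(\<lambda>x. indicator U x *\<^sub>R f x) \<in> borel_measurable lebesgue"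
    using borel_measurable_restrict_space_iff[OF UL] by blast
  from completion_ex_borel_measurable_real[OF this]
  obtain g0 where g0: "g0 \<in> borel_measurable lborel" "AE x in lborel. indicator U x *\<^sub>R f x = g0 x" by blast
  define g where "g x = indicator U x * g0 x" for x
  have gm: "g \<in> borel_measurable borel" unfolding g_def using g0(1) Ub by simp
  have z: "g x = 0" if "x \<notin> U" for x using that by (simp add: g_def)
  have ae: "AE x in lborel. x \<in> U \<longrightarrow> f x = g x" using g0(2) by eventually_elim (auto simp: g_def)
  have "integrable (lebesgue_on U) (\<lambda>x. (f x)\<^sup>2)" using f by (simp add: L2_def)
  moreover have "integrable (lebesgue_on U) (\<lambda>x. (f x)\<^sup>2) \<longleftrightarrow> integrable lborel (\<lambda>x. (g x)\<^sup>2)"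
    by (rule lebesgue_on_AE(2)[OF Ub]) (use gm z ae in auto)
  ultimately have g2: "integrable lborel (\<lambda>x. (g x)\<^sup>2)" by simp
  have "integrable lborel (indicator U :: real^3 \<Rightarrow> real)"
    using Ub emeasure_bounded_finite[OF U(2)] by (intro integrable_real_indicator) auto
  then have i: "integrable lborel (\<lambda>x. indicator U x + (g x)\<^sup>2)" using g2 by simp
  have "integrable lborel g"
  proof (rule Bochner_Integration.integrable_bound[OF i])
    have "\<bar>g x\<bar> \<le> indicator U x + (g x)\<^sup>2" for x
    proof (cases "x \<in> U")
      case True
      have "0 \<le> (\<bar>g x\<bar> - 1)\<^sup>2 + \<bar>g x\<bar>" by simp
      then show ?thesis using True by (simp add: power2_diff)
    qed (simp add: z)
    then show "AE x in lborel. norm (g x) \<le> norm (indicator U x + (g x)\<^sup>2)" by (intro AE_I2) (auto intro: order_trans abs_ge_self)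
  qed (use gm in simp)
  then show ?thesis using g2 z ae by (intro exI[of _ g]) (auto simp: l12_def)
qed

lemma L2_component:
  fixes f :: "real^3 \<Rightarrow> real^3"
  assumes "f \<in> L2 U" shows "(\<lambda>x. f x $ i) \<in> L2 U"
proof -
  have m: "f \<in> borel_measurable (lebesgue_on U)" and n: "integrable (lebesgue_on U) (\<lambda>x. (norm (f x))\<^sup>2)"
    using assms by (auto simp: L2_def)
  have "(\<lambda>x. f x \<bullet> axis i 1) \<in> borel_measurable (lebesgue_on U)" using m by measurable
  then have mi: "(\<lambda>x. f x $ i) \<in> borel_measurable (lebesgue_on U)" by (simp add: inner_axis)
  have "\<bar>f x $ i\<bar>\<^sup>2 \<le> (norm (f x))\<^sup>2" for x by (rule power_mono[OF component_le_norm_cart]) simp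
  then have "integrable (lebesgue_on U) (\<lambda>x. (f x $ i)\<^sup>2)"
    using mi by (intro Bochner_Integration.integrable_bound[OF n]) auto
  then show ?thesis using mi by (simp add: L2_def)
qed

lemma L2_rep:
  fixes f :: "real^3 \<Rightarrow> real^3"
  assumes U: "open U" "bounded U" and f: "f \<in> L2 U"
  shows "\<exists>V. represents U f V"
proof -
  have "\<exists>g. \<forall>i. l12 (g i) \<and> (\<forall>x. x \<notin> U \<longrightarrow> g i x = 0) \<and> (AE x in lborel. x \<in> U \<longrightarrow> f x $ i = g i x)"
    by (intro choice allI L2_real_rep U L2_component f)
  then obtain g where g: "\<And>i. l12 (g i)" "\<And>i x. x \<notin> U \<Longrightarrow> g i x = 0" "\<And>i. AE x in lborel. x \<in> U \<longrightarrow> f x $ i = g i x" by blast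
  have "AE x in lborel. \<forall>i\<in>UNIV. x \<in> U \<longrightarrow> f x $ i = g i x" by (rule AE_finite_allI[OF finite g(3)])
  then have "AE x in lborel. x \<in> U \<longrightarrow> f x = (\<chi> i. g i x)" by eventually_elim (simp add: vec_eq_iff)
  then show ?thesis unfolding represents_def using g(1,2) by (intro exI[of _ "\<lambda>x. \<chi> i. g i x"]) (auto simp: vec_eq_iff)
qed

lemma represents_facts:
  assumes "represents U f V"
  shows "l12 (\<lambda>x. V x $ i)" "x \<notin> U \<Longrightarrow> V x = 0" "AE x in lborel. x \<in> U \<longrightarrow> f x = V x"
    "integrable lborel V" "V \<in> borel_measurable borel" "l12 (\<lambda>x. V x \<bullet> a)"
proof -
  show i: "l12 (\<lambda>x. V x $ i)" for i using assms by (simp add: represents_def)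
  show "x \<notin> U \<Longrightarrow> V x = 0" "AE x in lborel. x \<in> U \<longrightarrow> f x = V x" using assms by (auto simp: represents_def)
  show iV: "integrable lborel V" by (rule l12_norm(2)[OF i])
  then show "V \<in> borel_measurable borel" using borel_measurable_integrable by force
  show "l12 (\<lambda>x. V x \<bullet> a)" by (rule l12_component_inner[OF i])
qed

lemma tests_zero: "\<phi> \<in> C1c U \<Longrightarrow> x \<notin> U \<Longrightarrow> \<phi> x = 0 \<and> grad \<phi> x = 0"
  unfolding C1c_def using zero_off_grad by (auto simp: zero_off_def)

lemma weak_grad_wdiv:
  assumes U: "open U" and w: "has_weak_grad U u g"
    and u': "l12 u'" "\<And>x. x \<notin> U \<Longrightarrow> u' x = 0" "AE x in lborel. x \<in> U \<longrightarrow> u x = u' x"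
    and G: "represents U g G"
  shows "wdiv U (\<lambda>x. u' x *\<^sub>R e) (\<lambda>x. G x \<bullet> e)"
proof (rule wdivI_tests[OF U])
  note r = represents_facts[OF G]
  have Ub: "U \<in> sets borel" using U by simp
  show "integrable lborel (\<lambda>x. G x \<bullet> e)" using r(4) by simp
  show "integrable lborel (\<lambda>x. u' x *\<^sub>R e)" using l12D(1)[OF u'(1)] by simp
  fix \<phi> assume \<phi>: "\<phi> \<in> tests U"
  then have c: "\<phi> \<in> C1c U" using tests_C1c by blast
  then have C: "C1 \<phi>" by (simp add: C1c_def)
  note [measurable] = C1c_borel[OF C] l12D(3)[OF u'(1)] r(5)
  obtain B where B: "\<And>x. \<bar>\<phi> x\<bar> \<le> B" using C1c_uniform(1)[OF c] by blast
  obtain B' where B': "\<And>x. norm (grad \<phi> x) \<le> B'" using C1c_uniform(2)[OF c] by blast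
  have 1: "(LINT x|lebesgue_on U. u x *\<^sub>R grad \<phi> x) = (\<integral>x. u' x *\<^sub>R grad \<phi> x \<partial>lborel)"
    by (rule lebesgue_on_AE(1)[OF Ub]) (use u'(3) u'(2) in \<open>auto elim!: eventually_mono\<close>)
  have 2: "(LINT x|lebesgue_on U. \<phi> x *\<^sub>R g x) = (\<integral>x. \<phi> x *\<^sub>R G x \<partial>lborel)"
    by (rule lebesgue_on_AE(1)[OF Ub]) (use r(3) r(2) in \<open>auto elim!: eventually_mono\<close>)
  have i1: "integrable lborel (\<lambda>x. u' x *\<^sub>R grad \<phi> x)"
    by (rule integrable_scaleR_bounded[OF l12D(1)[OF u'(1)] _ B']) simp
  have i2: "integrable lborel (\<lambda>x. \<phi> x *\<^sub>R G x)"
  proof (rule Bochner_Integration.integrable_bound[of _ "\<lambda>x. B *\<^sub>R G x"])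
    have "\<bar>\<phi> x\<bar> * norm (G x) \<le> \<bar>B\<bar> * norm (G x)" for x by (intro mult_right_mono) (use B[of x] in auto)
    then show "AE x in lborel. norm (\<phi> x *\<^sub>R G x) \<le> norm (B *\<^sub>R G x)" by simp
  qed (use r(4) in auto)
  have "(\<integral>x. u' x *\<^sub>R grad \<phi> x \<partial>lborel) = - (\<integral>x. \<phi> x *\<^sub>R G x \<partial>lborel)"
    using w \<phi> tests_subset unfolding has_weak_grad_def 1[symmetric] 2[symmetric] by blast
  then have "(\<integral>x. u' x *\<^sub>R grad \<phi> x \<partial>lborel) \<bullet> e = - ((\<integral>x. \<phi> x *\<^sub>R G x \<partial>lborel) \<bullet> e)" by simp
  moreover have "(\<integral>x. u' x *\<^sub>R grad \<phi> x \<partial>lborel) \<bullet> e = (\<integral>x. (u' x *\<^sub>R grad \<phi> x) \<bullet> e \<partial>lborel)"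
    by (rule integral_inner_left[symmetric]) (rule i1)
  moreover have "(\<integral>x. \<phi> x *\<^sub>R G x \<partial>lborel) \<bullet> e = (\<integral>x. (\<phi> x *\<^sub>R G x) \<bullet> e \<partial>lborel)"
    by (rule integral_inner_left[symmetric]) (rule i2)
  ultimately have "(\<integral>x. (\<phi> x *\<^sub>R G x) \<bullet> e \<partial>lborel) + (\<integral>x. (u' x *\<^sub>R grad \<phi> x) \<bullet> e \<partial>lborel) = 0" by linarith
  then have "(\<integral>x. (\<phi> x *\<^sub>R G x) \<bullet> e + (u' x *\<^sub>R grad \<phi> x) \<bullet> e \<partial>lborel) = 0"
    by (simp only: Bochner_Integration.integral_add[OF integrable_inner_left[OF i2] integrable_inner_left[OF i1]])
  then show "(\<integral>x. G x \<bullet> e * \<phi> x + (u' x *\<^sub>R e) \<bullet> grad \<phi> x \<partial>lborel) = 0"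
    by (simp add: inner_commute[of e] mult.commute)
qed

lemma weak_div_wdiv:
  assumes U: "open U" and w: "has_weak_div U v d"
    and V: "integrable lborel V" "\<And>x. x \<notin> U \<Longrightarrow> V x = 0" "AE x in lborel. x \<in> U \<longrightarrow> v x = V x"
    and D: "l12 D" "\<And>x. x \<notin> U \<Longrightarrow> D x = 0" "AE x in lborel. x \<in> U \<longrightarrow> d x = D x"
  shows "wdiv U V D"
proof (rule wdivI_tests[OF U])
  have Ub: "U \<in> sets borel" using U by simp
  show iV: "integrable lborel V" using V(1) .
  show iD: "integrable lborel D" using D(1) by (rule l12D)
  fix \<phi> assume \<phi>: "\<phi> \<in> tests U"
  then have c: "\<phi> \<in> C1c U" using tests_C1c by blast
  then have C: "C1 \<phi>" by (simp add: C1c_def)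
  have [measurable]: "V \<in> borel_measurable borel" using borel_measurable_integrable[OF V(1)] by simp
  note [measurable] = C1c_borel[OF C] l12D(3)[OF D(1)]
  have 1: "(LINT x|lebesgue_on U. v x \<bullet> grad \<phi> x) = (\<integral>x. V x \<bullet> grad \<phi> x \<partial>lborel)"
    by (rule lebesgue_on_AE(1)[OF Ub]) (use V(3) V(2) in \<open>auto elim!: eventually_mono\<close>)
  have 2: "(LINT x|lebesgue_on U. d x * \<phi> x) = (\<integral>x. D x * \<phi> x \<partial>lborel)"
    by (rule lebesgue_on_AE(1)[OF Ub]) (use D(3) D(2) in \<open>auto elim!: eventually_mono\<close>)
  have "(\<integral>x. V x \<bullet> grad \<phi> x \<partial>lborel) = - (\<integral>x. D x * \<phi> x \<partial>lborel)"
    using w \<phi> tests_subset unfolding has_weak_div_def 1[symmetric] 2[symmetric] by blast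
  then show "(\<integral>x. D x * \<phi> x + V x \<bullet> grad \<phi> x \<partial>lborel) = 0"
    using Bochner_Integration.integral_add[OF C1c_integrable_mult[OF c iD] C1c_integrable_inner[OF c iV]] by linarith
qed

lemma zero_off_component: "zero_off K \<phi> \<Longrightarrow> zero_off K (\<lambda>x. (\<phi> x *\<^sub>R a) $ i)"
  by (simp add: zero_off_def)

lemma test_fields_scaleR:
  assumes "\<phi> \<in> test_functions U" shows "(\<lambda>x. \<phi> x *\<^sub>R a) \<in> test_fields U"
proof -
  have "(\<lambda>x. (\<phi> x *\<^sub>R a) $ i) \<in> test_functions U" for i
  proof -
    have \<phi>: "C_k n \<phi>" "compact (closure {x. \<phi> x \<noteq> 0})" "closure {x. \<phi> x \<noteq> 0} \<subseteq> U" for n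
      using assms unfolding test_functions_def by blast+
    have "zero_off (closure {x. \<phi> x \<noteq> 0}) (\<lambda>x. (\<phi> x *\<^sub>R a) $ i)"
      by (rule zero_off_component[OF zero_off_closureI[OF \<phi>(2)]])
    note z = zero_off_closure[OF this]
    have "C_k n (\<lambda>x. \<phi> x * a $ i)" for n by (rule C_k_mult[OF \<phi>(1) C_k_const])
    then have "C_k n (\<lambda>x. (\<phi> x *\<^sub>R a) $ i)" for n by simp
    then show ?thesis using z \<phi>(3) unfolding test_functions_def by (intro CollectI conjI allI) (auto intro: order_trans)
  qed
  then show ?thesis unfolding test_fields_def by blast
qed

lemma integral_by_parts:
  assumes \<phi>: "\<phi> \<in> C1c U" and \<psi>: "\<psi> \<in> C1c V"
  shows "(\<integral>x. \<phi> x * (grad \<psi> x \<bullet> b) \<partial>lborel) = - (\<integral>x. \<psi> x * (grad \<phi> x \<bullet> b) \<partial>lborel)"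
    and "integrable lborel (\<lambda>x. \<phi> x * (grad \<psi> x \<bullet> b))"
    and "integrable lborel (\<lambda>x. \<psi> x * (grad \<phi> x \<bullet> b))"
proof -
  have w: "wdiv V (\<lambda>x. \<phi> x *\<^sub>R b) (\<lambda>x. grad \<phi> x \<bullet> b)" by (rule wdiv_classical[OF \<phi>])
  have i1: "integrable lborel (\<lambda>x. (grad \<phi> x \<bullet> b) * \<psi> x)" by (rule C1c_integrable_mult[OF \<psi> wdivD(2)[OF w]])
  have i2: "integrable lborel (\<lambda>x. (\<phi> x *\<^sub>R b) \<bullet> grad \<psi> x)" by (rule C1c_integrable_inner[OF \<psi> wdivD(1)[OF w]])
  have "(\<integral>x. (grad \<phi> x \<bullet> b) * \<psi> x \<partial>lborel) + (\<integral>x. (\<phi> x *\<^sub>R b) \<bullet> grad \<psi> x \<partial>lborel) = 0"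
    using wdivD(3)[OF w \<psi>] by (simp only: Bochner_Integration.integral_add[OF i1 i2])
  then show "(\<integral>x. \<phi> x * (grad \<psi> x \<bullet> b) \<partial>lborel) = - (\<integral>x. \<psi> x * (grad \<phi> x \<bullet> b) \<partial>lborel)"
    by (simp add: inner_commute[of b] mult.commute)
  show "integrable lborel (\<lambda>x. \<phi> x * (grad \<psi> x \<bullet> b))" "integrable lborel (\<lambda>x. \<psi> x * (grad \<phi> x \<bullet> b))"
    using i1 i2 by (simp_all add: inner_commute[of b] mult.commute)
qed

section \<open>Smooth fields as test fields for the tangential trace\<close>

lemma L2_continuous_bounded:
  fixes F :: "real^3 \<Rightarrow> 'b::euclidean_space"
  assumes U: "open U" "bounded U" and F: "continuous_on UNIV F" "\<And>x. norm (F x) \<le> B"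
  shows "F \<in> L2 U"
proof -
  have Ub: "U \<in> sets borel" using U(1) by simp
  have Fm: "F \<in> borel_measurable borel" using F(1) by (rule borel_measurable_continuous_onI)
  have m: "F \<in> borel_measurable (lebesgue_on U)"
    by (rule lebesgue_on_AE(3)[OF Ub, of "\<lambda>x. indicator U x *\<^sub>R F x"]) (use Fm Ub in auto)
  have "integrable lborel (\<lambda>x. indicator U x * (norm (F x))\<^sup>2)"
  proof (rule integrableI_bounded_set[of U _ _ "B\<^sup>2"])
    show "emeasure lborel U < \<infinity>" by (rule emeasure_bounded_finite[OF U(2)])
    have "(norm (F x))\<^sup>2 \<le> B\<^sup>2" for x by (rule power_mono[OF F(2)]) simp
    then show "AE x in lborel. x \<in> U \<longrightarrow> norm (indicator U x * (norm (F x))\<^sup>2) \<le> B\<^sup>2" by simp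
  qed (use Fm Ub in auto)
  moreover have "integrable (lebesgue_on U) (\<lambda>x. (norm (F x))\<^sup>2) \<longleftrightarrow> integrable lborel (\<lambda>x. indicator U x * (norm (F x))\<^sup>2)"
    by (rule lebesgue_on_AE(2)[OF Ub]) (use Fm Ub in auto)
  ultimately show ?thesis using m by (simp add: L2_def)
qed

text \<open>The support of \<open>\<phi>\<close> may cross the boundary of \<open>U\<close>; it is
  with such functions that the vanishing of the tangential trace is exploited.\<close>

lemma C1c_H1:
  assumes U: "open U" "bounded U" and \<phi>: "\<phi> \<in> C1c V"
  shows "\<phi> \<in> H1 U"
proof -
  have Ub: "U \<in> sets borel" using U(1) by simp
  have C: "C1 \<phi>" using \<phi> by (simp add: C1c_def)
  obtain B where B: "\<And>x. \<bar>\<phi> x\<bar> \<le> B" using C1c_uniform(1)[OF \<phi>] by blast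
  obtain B' where B': "\<And>x. norm (grad \<phi> x) \<le> B'" using C1c_uniform(2)[OF \<phi>] by blast
  have 1: "\<phi> \<in> L2 U" by (rule L2_continuous_bounded[OF U C1_continuous[OF C], of B]) (simp add: B)
  have 2: "grad \<phi> \<in> L2 U" by (rule L2_continuous_bounded[OF U C1_continuous_grad[OF C] B'])
  have 3: "(LINT x|lebesgue_on U. \<phi> x *\<^sub>R grad \<psi> x) = - (LINT x|lebesgue_on U. \<psi> x *\<^sub>R grad \<phi> x)"
    if "\<psi> \<in> test_functions U" for \<psi>
  proof -
    have \<psi>: "\<psi> \<in> C1c U" using that test_functions_C1c by blast
    then have C': "C1 \<psi>" by (simp add: C1c_def)
    note [measurable] = C1c_borel[OF C] C1c_borel[OF C']
    obtain D where D: "\<And>x. norm (grad \<psi> x) \<le> D" using C1c_uniform(2)[OF \<psi>] by blast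
    have i1: "integrable lborel (\<lambda>x. \<phi> x *\<^sub>R grad \<psi> x)"
      by (rule integrable_scaleR_bounded[OF C1c_integrable[OF \<phi>] _ D]) simp
    have i2: "integrable lborel (\<lambda>x. \<psi> x *\<^sub>R grad \<phi> x)"
      by (rule integrable_scaleR_bounded[OF C1c_integrable[OF \<psi>] _ B']) simp
    have "(LINT x|lebesgue_on U. \<phi> x *\<^sub>R grad \<psi> x) = (\<integral>x. \<phi> x *\<^sub>R grad \<psi> x \<partial>lborel)"
      by (rule lebesgue_on_AE(1)[OF Ub]) (use tests_zero[OF \<psi>] in auto)
    moreover have "(LINT x|lebesgue_on U. \<psi> x *\<^sub>R grad \<phi> x) = (\<integral>x. \<psi> x *\<^sub>R grad \<phi> x \<partial>lborel)"
      by (rule lebesgue_on_AE(1)[OF Ub]) (use tests_zero[OF \<psi>] in auto)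
    moreover have "(\<integral>x. \<phi> x *\<^sub>R grad \<psi> x \<partial>lborel) = - (\<integral>x. \<psi> x *\<^sub>R grad \<phi> x \<partial>lborel)"
    proof (rule vector_eq_rdot[THEN iffD1], rule allI)
      fix b
      have "(\<integral>x. \<phi> x *\<^sub>R grad \<psi> x \<partial>lborel) \<bullet> b = (\<integral>x. (\<phi> x *\<^sub>R grad \<psi> x) \<bullet> b \<partial>lborel)"
        by (rule integral_inner_left[symmetric]) (rule i1)
      moreover have "(\<integral>x. \<psi> x *\<^sub>R grad \<phi> x \<partial>lborel) \<bullet> b = (\<integral>x. (\<psi> x *\<^sub>R grad \<phi> x) \<bullet> b \<partial>lborel)"
        by (rule integral_inner_left[symmetric]) (rule i2)
      ultimately show "(\<integral>x. \<phi> x *\<^sub>R grad \<psi> x \<partial>lborel) \<bullet> b = (- (\<integral>x. \<psi> x *\<^sub>R grad \<phi> x \<partial>lborel)) \<bullet> b"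
        using integral_by_parts(1)[OF \<phi> \<psi>, of b] by (simp only: inner_scaleR_left inner_minus_left)
    qed
    ultimately show ?thesis by simp
  qed
  show ?thesis unfolding H1_def has_weak_grad_def using 1 2 3 by blast
qed

text \<open>Again the support of \<open>\<phi>\<close> may cross the boundary of \<open>U\<close>;
  the test field vanishes near it, so integration by parts leaves no boundary term.\<close>

lemma has_weak_curl_smooth:
  assumes U: "open U" "bounded U" and \<phi>: "\<phi> \<in> C1c V"
  shows "has_weak_curl U (\<lambda>x. \<phi> x *\<^sub>R a) (\<lambda>x. cross3 (grad \<phi> x) a)"
proof -
  have Ub: "U \<in> sets borel" using U(1) by simp
  have C: "C1 \<phi>" using \<phi> by (simp add: C1c_def)
  obtain B where B: "\<And>x. \<bar>\<phi> x\<bar> \<le> B" using C1c_uniform(1)[OF \<phi>] by blast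
  obtain B' where B': "\<And>x. norm (grad \<phi> x) \<le> B'" using C1c_uniform(2)[OF \<phi>] by blast
  have cc: "continuous_on UNIV (\<lambda>x. cross3 (grad \<phi> x) a)"
    by (intro continuous_on_cross C1_continuous_grad[OF C] continuous_on_const)
  have nc: "norm (cross3 (grad \<phi> x) a) \<le> B' * norm a" for x
  proof -
    have "(norm (cross3 (grad \<phi> x) a))\<^sup>2 \<le> (norm (grad \<phi> x) * norm a)\<^sup>2"
      using norm_cross_dot[of "grad \<phi> x" a] by (metis le_add_same_cancel1 zero_le_power2)
    then have "norm (cross3 (grad \<phi> x) a) \<le> norm (grad \<phi> x) * norm a" by (rule power2_le_imp_le) simp
    also have "\<dots> \<le> B' * norm a" using B' by (intro mult_right_mono) auto
    finally show ?thesis .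
  qed
  have 1: "(\<lambda>x. \<phi> x *\<^sub>R a) \<in> L2 U"
  proof (rule L2_continuous_bounded[OF U])
    show "continuous_on UNIV (\<lambda>x. \<phi> x *\<^sub>R a)" by (intro continuous_intros C1_continuous[OF C])
    show "norm (\<phi> x *\<^sub>R a) \<le> B * norm a" for x using mult_right_mono[OF B[of x] norm_ge_zero[of a]] by simp
  qed
  have 2: "(\<lambda>x. cross3 (grad \<phi> x) a) \<in> L2 U" by (rule L2_continuous_bounded[OF U cc nc])
  have 3: "(LINT x|lebesgue_on U. (\<phi> x *\<^sub>R a) \<bullet> curl \<psi> x) = (LINT x|lebesgue_on U. cross3 (grad \<phi> x) a \<bullet> \<psi> x)"
    if "\<psi> \<in> test_fields U" for \<psi>
  proof -
    define f where "f l x = \<psi> x $ l" for l x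
    have f: "f l \<in> C1c U" for l using that test_functions_C1c unfolding f_def test_fields_def by blast
    let ?P = "\<lambda>x. \<Sum>l\<in>UNIV. \<phi> x * (grad (f l) x \<bullet> cross3 (axis l 1) a)"
    let ?R = "\<lambda>x. \<Sum>l\<in>UNIV. f l x * (grad \<phi> x \<bullet> cross3 (axis l 1) a)"
    have P: "(\<phi> x *\<^sub>R a) \<bullet> curl \<psi> x = ?P x" for x
    proof -
      have c: "curl \<psi> x = vector [grad (f 3) x $ 2 - grad (f 2) x $ 3, grad (f 1) x $ 3 - grad (f 3) x $ 1, grad (f 2) x $ 1 - grad (f 1) x $ 2]"
        unfolding curl_def partial_eq_grad f_def ..
      have ax: "axis 1 (1::real) = (vector [1,0,0] :: real^3)" "axis 2 (1::real) = (vector [0,1,0] :: real^3)" "axis 3 (1::real) = (vector [0,0,1] :: real^3)"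
        by (simp_all add: vec_eq_iff forall_3 axis_def)
      show ?thesis unfolding c sum_3 ax by (simp add: cross3_def inner_vec_def sum_3 vector_3 algebra_simps)
    qed
    have R: "cross3 (grad \<phi> x) a \<bullet> \<psi> x = - ?R x" for x
    proof -
      have ax: "axis 1 (1::real) = (vector [1,0,0] :: real^3)" "axis 2 (1::real) = (vector [0,1,0] :: real^3)" "axis 3 (1::real) = (vector [0,0,1] :: real^3)"
        by (simp_all add: vec_eq_iff forall_3 axis_def)
      show ?thesis unfolding sum_3 ax f_def by (simp add: cross3_def inner_vec_def sum_3 vector_3 algebra_simps)
    qed
    have iP: "integrable lborel ?P" by (intro Bochner_Integration.integrable_sum integral_by_parts(2)[OF \<phi> f])
    have iR: "integrable lborel ?R" by (intro Bochner_Integration.integrable_sum integral_by_parts(3)[OF \<phi> f])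
    have "(LINT x|lebesgue_on U. (\<phi> x *\<^sub>R a) \<bullet> curl \<psi> x) = (\<integral>x. ?P x \<partial>lborel)"
      unfolding P by (rule lebesgue_on_AE(1)[OF Ub]) (use iP tests_zero[OF f] in auto)
    moreover have "(LINT x|lebesgue_on U. cross3 (grad \<phi> x) a \<bullet> \<psi> x) = (\<integral>x. - ?R x \<partial>lborel)"
      unfolding R by (rule lebesgue_on_AE(1)[OF Ub]) (use iR tests_zero[OF f] in auto)
    moreover have "(\<integral>x. ?P x \<partial>lborel) = (\<Sum>l\<in>UNIV. \<integral>x. \<phi> x * (grad (f l) x \<bullet> cross3 (axis l 1) a) \<partial>lborel)"
      by (rule Bochner_Integration.integral_sum) (rule integral_by_parts(2)[OF \<phi> f])
    moreover have "(\<integral>x. ?R x \<partial>lborel) = (\<Sum>l\<in>UNIV. \<integral>x. f l x * (grad \<phi> x \<bullet> cross3 (axis l 1) a) \<partial>lborel)"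
      by (rule Bochner_Integration.integral_sum) (rule integral_by_parts(3)[OF \<phi> f])
    moreover have "(\<integral>x. - ?R x \<partial>lborel) = - (\<integral>x. ?R x \<partial>lborel)" by (rule Bochner_Integration.integral_minus)
    ultimately show ?thesis by (simp only: integral_by_parts(1)[OF \<phi> f] sum_negf)
  qed
  show ?thesis unfolding has_weak_curl_def using 1 2 3 by blast
qed

lemma has_weak_curlD:
  "has_weak_curl U v w \<Longrightarrow> \<psi> \<in> test_fields U \<Longrightarrow> (LINT x|lebesgue_on U. v x \<bullet> curl \<psi> x) = (LINT x|lebesgue_on U. w x \<bullet> \<psi> x)"
  by (simp add: has_weak_curl_def)

lemma has_weak_curl_weak_curl: "has_weak_curl U v w \<Longrightarrow> has_weak_curl U v (weak_curl U v)"
  unfolding weak_curl_def by (rule someI[where P="has_weak_curl U v"])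

lemma has_weak_grad_weak_grad: "has_weak_grad U u g \<Longrightarrow> has_weak_grad U u (weak_grad U u)"
  unfolding weak_grad_def by (rule someI[where P="has_weak_grad U u"])

lemma has_weak_div_weak_div: "has_weak_div U v d \<Longrightarrow> has_weak_div U v (weak_div U v)"
  unfolding weak_div_def by (rule someI[where P="has_weak_div U v"])

text \<open>As \<open>weak_curl\<close> is a choice, the curl of a smooth field inside the
  tangential trace has to be identified with the classical one.\<close>

lemma weak_curl_unique:
  assumes U: "open U" "bounded U" and w: "has_weak_curl U v w1" "has_weak_curl U v w2"
  shows "AE x in lborel. x \<in> U \<longrightarrow> w1 x = w2 x"
proof -
  have Ub: "U \<in> sets borel" using U(1) by simp
  obtain W1 where W1: "represents U w1 W1" using L2_rep[OF U] w(1) unfolding has_weak_curl_def by blast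
  obtain W2 where W2: "represents U w2 W2" using L2_rep[OF U] w(2) unfolding has_weak_curl_def by blast
  note r1 = represents_facts[OF W1] and r2 = represents_facts[OF W2]
  have "AE x in lborel. x \<in> U \<longrightarrow> W1 x $ i - W2 x $ i = 0" for i
  proof (rule weak_zero_imp_AE[OF l12_diff[OF r1(1) r2(1)] U(1)])
    fix \<phi> assume \<phi>: "\<phi> \<in> tests U"
    then have c: "\<phi> \<in> C1c U" and t: "\<phi> \<in> test_functions U" using tests_C1c tests_subset by blast+
    then have C: "C1 \<phi>" by (simp add: C1c_def)
    note [measurable] = C1c_borel[OF C] r1(5) r2(5)
    let ?\<psi> = "\<lambda>x. \<phi> x *\<^sub>R axis i 1"
    have tf: "?\<psi> \<in> test_fields U" by (rule test_fields_scaleR[OF t])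
    have 1: "(LINT x|lebesgue_on U. w1 x \<bullet> ?\<psi> x) = (\<integral>x. W1 x \<bullet> ?\<psi> x \<partial>lborel)"
      by (rule lebesgue_on_AE(1)[OF Ub]) (use r1(2,3) in \<open>auto elim!: eventually_mono\<close>)
    have 2: "(LINT x|lebesgue_on U. w2 x \<bullet> ?\<psi> x) = (\<integral>x. W2 x \<bullet> ?\<psi> x \<partial>lborel)"
      by (rule lebesgue_on_AE(1)[OF Ub]) (use r2(2,3) in \<open>auto elim!: eventually_mono\<close>)
    have e: "(\<integral>x. W1 x \<bullet> ?\<psi> x \<partial>lborel) = (\<integral>x. W2 x \<bullet> ?\<psi> x \<partial>lborel)"
      unfolding 1[symmetric] 2[symmetric] by (rule trans[OF has_weak_curlD[OF w(1) tf, symmetric] has_weak_curlD[OF w(2) tf]])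
    have i: "integrable lborel (\<lambda>x. W1 x $ i * \<phi> x)" "integrable lborel (\<lambda>x. W2 x $ i * \<phi> x)"
      by (intro C1c_integrable_mult[OF c] l12D r1 r2)+
    have "(W1 x $ i - W2 x $ i) * \<phi> x = W1 x $ i * \<phi> x - W2 x $ i * \<phi> x" for x by (rule Rings.left_diff_distrib)
    moreover have "(\<integral>x. W1 x $ i * \<phi> x - W2 x $ i * \<phi> x \<partial>lborel) = (\<integral>x. W1 x $ i * \<phi> x \<partial>lborel) - (\<integral>x. W2 x $ i * \<phi> x \<partial>lborel)"
      by (rule Bochner_Integration.integral_diff[OF i])
    ultimately show "(\<integral>x. (W1 x $ i - W2 x $ i) * \<phi> x \<partial>lborel) = 0" using e by (simp add: inner_axis mult.commute)
  qed
  then have "AE x in lborel. \<forall>i\<in>UNIV. x \<in> U \<longrightarrow> W1 x $ i - W2 x $ i = 0" by (intro AE_finite_allI) auto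
  then show ?thesis using r1(3) r2(3) by eventually_elim (auto simp: vec_eq_iff)
qed

text \<open>Since \<open>div (a \<times> v) = - a \<bullet> curl v\<close>, a vanishing tangential
  trace against \<open>\<phi> *\<^sub>R a\<close>, with \<open>\<phi>\<close> unrestricted at the
  boundary, says that extension by zero preserves the weak curl.\<close>

lemma H0_curl_wdiv:
  assumes U: "open U" "bounded U" and v: "v \<in> H0_curl U"
    and V: "represents U v V" and W: "represents U (weak_curl U v) W"
  shows "wdiv UNIV (\<lambda>x. cross3 a (V x)) (\<lambda>x. - (W x \<bullet> a))"
proof (rule wdivI_tests)
  have Ub: "U \<in> sets borel" using U(1) by simp
  note rV = represents_facts[OF V] and rW = represents_facts[OF W]
  show "integrable lborel (\<lambda>x. - (W x \<bullet> a))" using rW(4) by simp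
  have cr: "cross3 a (V x) = (\<Sum>i\<in>UNIV. V x $ i *\<^sub>R cross3 a (axis i 1))" for x
    by (simp add: sum_3 cross3_def vec_eq_iff forall_3 vector_3 axis_def algebra_simps)
  show iC: "integrable lborel (\<lambda>x. cross3 a (V x))"
    unfolding cr by (intro Bochner_Integration.integrable_sum integrable_scaleR_left l12D rV)
  fix \<phi> assume \<phi>: "\<phi> \<in> tests UNIV"
  then have c: "\<phi> \<in> C1c UNIV" using tests_C1c by blast
  then have C: "C1 \<phi>" by (simp add: C1c_def)
  note [measurable] = C1c_borel[OF C] rV(5) rW(5)
  let ?\<Phi> = "\<lambda>x. \<phi> x *\<^sub>R a"
  have "?\<Phi> \<in> H1_fields U"
  proof -
    have "(\<lambda>x. \<phi> x * a $ i) \<in> C1c UNIV" for i by (rule C1c_mult[OF c C1_const])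
    then have "(\<lambda>x. \<phi> x * a $ i) \<in> H1 U" for i by (rule C1c_H1[OF U])
    then show ?thesis by (simp add: H1_fields_def)
  qed
  then have t0: "tangential_trace U v ?\<Phi> = 0" using v by (simp add: H0_curl_def)
  have hc: "has_weak_curl U ?\<Phi> (\<lambda>x. cross3 (grad \<phi> x) a)" by (rule has_weak_curl_smooth[OF U c])
  then have "has_weak_curl U ?\<Phi> (weak_curl U ?\<Phi>)" by (rule has_weak_curl_weak_curl)
  from weak_curl_unique[OF U this hc]
  have ae: "AE x in lborel. x \<in> U \<longrightarrow> weak_curl U ?\<Phi> x = cross3 (grad \<phi> x) a" .
  have eq: "- (W x \<bullet> a) * \<phi> x + cross3 a (V x) \<bullet> grad \<phi> x = V x \<bullet> cross3 (grad \<phi> x) a - W x \<bullet> ?\<Phi> x" for x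
    by (simp add: cross3_simps)
  have m: "(\<lambda>x. - (W x \<bullet> a) * \<phi> x + cross3 a (V x) \<bullet> grad \<phi> x) \<in> borel_measurable borel"
    using borel_measurable_integrable[OF iC] by measurable
  have "(LINT x|lebesgue_on U. v x \<bullet> weak_curl U ?\<Phi> x - weak_curl U v x \<bullet> ?\<Phi> x) =
    (\<integral>x. - (W x \<bullet> a) * \<phi> x + cross3 a (V x) \<bullet> grad \<phi> x \<partial>lborel)"
  proof (rule lebesgue_on_AE(1)[OF Ub m])
    show "AE x in lborel. x \<in> U \<longrightarrow> v x \<bullet> weak_curl U ?\<Phi> x - weak_curl U v x \<bullet> ?\<Phi> x = - (W x \<bullet> a) * \<phi> x + cross3 a (V x) \<bullet> grad \<phi> x"
      using ae rV(3) rW(3)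
    proof eventually_elim
      case (elim x)
      then show ?case unfolding eq by simp
    qed
  qed (use rV(2) rW(2) in auto)
  then show "(\<integral>x. - (W x \<bullet> a) * \<phi> x + cross3 a (V x) \<bullet> grad \<phi> x \<partial>lborel) = 0"
    using t0 by (simp only: tangential_trace_def)
qed simp

text \<open>Meant for a single subdomain, where uniqueness of the weak divergence then identifies
  the weak curl with \<open>curl_of J\<close>.\<close>

lemma wdiv_cross:
  assumes "\<And>i e. wdiv U (\<lambda>x. V x $ i *\<^sub>R e) (\<lambda>x. J x $ i \<bullet> e)"
  shows "wdiv U (\<lambda>x. cross3 a (V x)) (\<lambda>x. - (curl_of (J x) \<bullet> a))"
proof (rule wdiv_congI)
  show "wdiv U (\<lambda>x. \<Sum>i\<in>UNIV. V x $ i *\<^sub>R cross3 a (axis i 1)) (\<lambda>x. \<Sum>i\<in>UNIV. J x $ i \<bullet> cross3 a (axis i 1))"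
    by (intro wdiv_sum assms) simp
  show "(\<Sum>i\<in>UNIV. V x $ i *\<^sub>R cross3 a (axis i 1)) = cross3 a (V x)" for x
    by (simp add: sum_3 cross3_def vec_eq_iff forall_3 vector_3 axis_def algebra_simps)
  show "(\<Sum>i\<in>UNIV. J x $ i \<bullet> cross3 a (axis i 1)) = - (curl_of (J x) \<bullet> a)" for x
    by (simp add: sum_3 cross3_def inner_vec_def vector_3 axis_def curl_of_def algebra_simps)
qed

lemma wdiv_trace:
  assumes "\<And>i e. wdiv U (\<lambda>x. (A x * V x $ i) *\<^sub>R e) (\<lambda>x. A x * (J x $ i \<bullet> e))"
  shows "wdiv U (\<lambda>x. A x *\<^sub>R V x) (\<lambda>x. A x * trace (J x))"
proof (rule wdiv_congI)
  show "wdiv U (\<lambda>x. \<Sum>i\<in>UNIV. (A x * V x $ i) *\<^sub>R axis i 1) (\<lambda>x. \<Sum>i\<in>UNIV. A x * (J x $ i \<bullet> axis i 1))"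
    by (intro wdiv_sum assms) simp
  show "(\<Sum>i\<in>UNIV. (A x * V x $ i) *\<^sub>R axis i 1) = A x *\<^sub>R V x" for x
    using basis_expansion[of "A x *\<^sub>R V x"] by (simp add: scalar_mult_eq_scaleR)
  show "(\<Sum>i\<in>UNIV. A x * (J x $ i \<bullet> axis i 1)) = A x * trace (J x)" for x
    by (simp add: trace_def inner_axis sum_distrib_left)
qed

section \<open>Polyhedral partitions\<close>

text \<open>Faces of affine dimension 2 are enlarged to their planes. The additional cuts inside
  subdomains do no harm, because the transmission conditions hold across them as well.\<close>

lemma polyhedral_planes:
  assumes "polyhedral_domain U"
  shows "\<exists>PL. finite PL \<and> (\<forall>n c. (n, c) \<in> PL \<longrightarrow> n \<noteq> 0) \<and> frontier U \<subseteq> (\<Union>(n, c)\<in>PL. {x. n \<bullet> x = c})"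
proof -
  obtain \<F> where F: "finite \<F>" "\<And>F. F \<in> \<F> \<Longrightarrow> aff_dim F = 2" "frontier U = \<Union>\<F>"
    using assms unfolding polyhedral_domain_def by blast
  have "\<exists>n c. n \<noteq> 0 \<and> F \<subseteq> {x. n \<bullet> x = c}" if "F \<in> \<F>" for F
  proof -
    have "aff_dim F < DIM(real^3)" using F(2)[OF that] by simp
    then show ?thesis using aff_lowdim_subset_hyperplane[of F] by metis
  qed
  then obtain n c where nc: "\<And>F. F \<in> \<F> \<Longrightarrow> n F \<noteq> 0 \<and> F \<subseteq> {x. n F \<bullet> x = c F}" by metis
  have "frontier U \<subseteq> (\<Union>(n, c)\<in>(\<lambda>F. (n F, c F)) ` \<F>. {x. n \<bullet> x = c})"
    unfolding F(3) using nc by fastforce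
  then show ?thesis using F(1) nc by (intro exI[of _ "(\<lambda>F. (n F, c F)) ` \<F>"]) auto
qed

lemma open_subset_hyperplane:
  fixes n :: "real^3"
  assumes "open S" "S \<subseteq> {x. n \<bullet> x = c}" "n \<noteq> 0"
  shows "S = {}"
  using negligible_subset[OF negligible_hyperplane assms(2)] open_not_negligible[OF assms(1)] assms(3) by blast

text \<open>If a point \<open>x\<close> of the plane were missing from \<Omega>, the part of
  \<open>B\<close> strictly above the graph near \<open>x\<close> would consist of points of the
  plane. Being open it is empty, but a small step from \<open>x\<close> along \<open>e\<close>
  enters it.\<close>

lemma lipschitz_no_crack:
  assumes \<Omega>: "open \<Omega>" "lipschitz_boundary \<Omega>" and B: "open B" "B - {x. n \<bullet> x = c} \<subseteq> \<Omega>" and n: "n \<noteq> 0"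
  shows "B \<subseteq> \<Omega>"
proof
  fix x assume x: "x \<in> B"
  show "x \<in> \<Omega>"
  proof (rule ccontr)
    assume nx: "x \<notin> \<Omega>"
    have "x \<in> closure \<Omega>"
    proof (rule ccontr)
      assume "x \<notin> closure \<Omega>"
      moreover have "open (B - closure \<Omega>)" using B(1) by (intro open_Diff) auto
      moreover have "B - closure \<Omega> \<subseteq> {x. n \<bullet> x = c}" using B(2) closure_subset[of \<Omega>] by blast
      ultimately show False using open_subset_hyperplane[OF _ _ n] x by blast
    qed
    then have "x \<in> frontier \<Omega>" using nx \<Omega>(1) by (simp add: frontier_def interior_open)
    then obtain e r L \<gamma> where l: "norm e = 1" "r > 0" "L-lipschitz_on {z. orthogonal z e} \<gamma>"
      and eq: "\<Omega> \<inter> ball x r = {y \<in> ball x r. y \<bullet> e < \<gamma> (y - (y \<bullet> e) *\<^sub>R e)}"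
      using \<Omega>(2) unfolding lipschitz_boundary_def by blast
    have ee: "e \<bullet> e = 1" using l(1) by (simp add: dot_square_norm)
    have "continuous_on UNIV (\<lambda>y. \<gamma> (y - (y \<bullet> e) *\<^sub>R e))"
    proof (rule continuous_on_compose2[OF lipschitz_on_continuous_on[OF l(3)]])
      show "continuous_on UNIV (\<lambda>y. y - (y \<bullet> e) *\<^sub>R e)" by (intro continuous_intros)
      show "(\<lambda>y. y - (y \<bullet> e) *\<^sub>R e) ` UNIV \<subseteq> {z. orthogonal z e}"
        by (auto simp: orthogonal_def inner_diff_left ee)
    qed
    then have "open {y. \<gamma> (y - (y \<bullet> e) *\<^sub>R e) < y \<bullet> e}"
      by (intro open_Collect_less continuous_intros)
    moreover have Bo: "open (B \<inter> ball x r)" using B(1) by blast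
    ultimately have W: "open (B \<inter> ball x r \<inter> {y. \<gamma> (y - (y \<bullet> e) *\<^sub>R e) < y \<bullet> e})" by blast
    have "B \<inter> ball x r \<inter> {y. \<gamma> (y - (y \<bullet> e) *\<^sub>R e) < y \<bullet> e} \<subseteq> {x. n \<bullet> x = c}"
    proof
      fix y assume y: "y \<in> B \<inter> ball x r \<inter> {y. \<gamma> (y - (y \<bullet> e) *\<^sub>R e) < y \<bullet> e}"
      then have "y \<notin> \<Omega> \<inter> ball x r" unfolding eq by simp
      then have "y \<notin> \<Omega>" using y by blast
      then show "y \<in> {x. n \<bullet> x = c}" using B(2) y by blast
    qed
    with W have empty: "B \<inter> ball x r \<inter> {y. \<gamma> (y - (y \<bullet> e) *\<^sub>R e) < y \<bullet> e} = {}"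
      using open_subset_hyperplane[OF _ _ n] by blast
    have "x \<in> B \<inter> ball x r" using x l(2) by simp
    then obtain d where d: "d > 0" "ball x d \<subseteq> B \<inter> ball x r"
      using Bo open_contains_ball by blast
    \<comment> \<open>Moving along \<open>e\<close> does not change the projection at which
      \<open>\<gamma>\<close> is evaluated.\<close>
    define z where "z = x + (d / 2) *\<^sub>R e"
    have "z \<in> ball x d" using d(1) l(1) by (simp add: z_def dist_norm)
    then have "z \<in> B \<inter> ball x r" using d(2) by blast
    moreover have "z - (z \<bullet> e) *\<^sub>R e = x - (x \<bullet> e) *\<^sub>R e"
      by (simp add: z_def inner_add_left ee algebra_simps)
    moreover have "\<not> x \<bullet> e < \<gamma> (x - (x \<bullet> e) *\<^sub>R e)"
    proof
      assume "x \<bullet> e < \<gamma> (x - (x \<bullet> e) *\<^sub>R e)"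
      then have "x \<in> \<Omega> \<inter> ball x r" unfolding eq using l(2) by simp
      then show False using nx by blast
    qed
    moreover have "z \<bullet> e = x \<bullet> e + d / 2" by (simp add: z_def inner_add_left ee)
    ultimately have "z \<in> B \<inter> ball x r \<inter> {y. \<gamma> (y - (y \<bullet> e) *\<^sub>R e) < y \<bullet> e}"
      using d(1) by simp
    then show False using empty by blast
  qed
qed

text \<open>Each open half of the ball avoids all planes and so the boundary; hence it lies inside
  \<Omega> or is disjoint from it. Both halves inside is an interior point, one inside an outer
  face, and with none inside all fields vanish.\<close>

lemma flux_at_face:
  fixes V :: "real^3 \<Rightarrow> real^3" and J :: "real^3 \<Rightarrow> real^3^3" and A :: "real^3 \<Rightarrow> real"
  assumes PL: "finite PL" "\<And>n c. (n, c) \<in> PL \<Longrightarrow> n \<noteq> 0"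
    and \<Omega>: "open \<Omega>" "lipschitz_boundary \<Omega>" "frontier \<Omega> \<subseteq> (\<Union>(n, c)\<in>PL. {x. n \<bullet> x = c})"
    and V: "\<And>i. l12 (\<lambda>x. V x $ i)" "\<And>x. x \<notin> \<Omega> \<Longrightarrow> V x = 0"
    and J: "\<And>i e. l12 (\<lambda>x. J x $ i \<bullet> e)" "\<And>x. x \<notin> \<Omega> \<Longrightarrow> J x = 0"
    and A: "A \<in> borel_measurable borel" "\<And>x. \<bar>A x\<bar> \<le> M"
    and grad: "\<And>i e. wdiv (- (\<Union>(n, c)\<in>PL. {x. n \<bullet> x = c})) (\<lambda>x. V x $ i *\<^sub>R e) (\<lambda>x. J x $ i \<bullet> e)"
    and Agrad: "\<And>i e. wdiv (- (\<Union>(n, c)\<in>PL. {x. n \<bullet> x = c})) (\<lambda>x. (A x * V x $ i) *\<^sub>R e) (\<lambda>x. A x * (J x $ i \<bullet> e))"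
    and curl: "\<And>a. wdiv UNIV (\<lambda>x. cross3 a (V x)) (\<lambda>x. - (curl_of (J x) \<bullet> a))"
    and dv: "wdiv \<Omega> (\<lambda>x. A x *\<^sub>R V x) (\<lambda>x. A x * trace (J x))"
    and n: "norm n = 1" and par: "\<And>n' c'. (n', c') \<in> PL \<Longrightarrow> n' \<bullet> y = c' \<Longrightarrow> \<exists>t. n' = t *\<^sub>R n"
  shows "\<exists>r>0. wdiv (ball y r) (\<lambda>x. A x *\<^sub>R flux (J x) (V x)) (\<lambda>x. A x * nullq (J x))"
proof -
  let ?q = "\<lambda>x. A x *\<^sub>R flux (J x) (V x)" and ?p = "\<lambda>x. A x * nullq (J x)"
  let ?H = "\<Union>(n, c)\<in>PL. {x. n \<bullet> x = c}"
  obtain r where r: "r > 0" "\<And>n c z. (n, c) \<in> PL \<Longrightarrow> z \<in> ball y r \<Longrightarrow> n \<bullet> z = c \<Longrightarrow> n \<bullet> y = c"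
    using planes_margin[OF PL(1), of y] by blast
  define B where "B = ball y r"
  have Bo: "open B" by (simp add: B_def)
  define S where "S s = {x \<in> B. s \<bullet> x > s \<bullet> y}" for s
  have sub: "B - {x. n \<bullet> x = n \<bullet> y} \<subseteq> - ?H"
  proof (rule subsetI, rule ComplI)
    fix x assume x: "x \<in> B - {x. n \<bullet> x = n \<bullet> y}" and "x \<in> ?H"
    then obtain n' c' where nc: "(n', c') \<in> PL" "n' \<bullet> x = c'" by auto
    then have y: "n' \<bullet> y = c'" using r(2) x by (auto simp: B_def)
    then obtain t where t: "n' = t *\<^sub>R n" using par nc(1) by blast
    have "t \<noteq> 0" using PL(2)[OF nc(1)] t by auto
    have "t * (n \<bullet> x) = t * (n \<bullet> y)" using nc(2) y t by simp
    with \<open>t \<noteq> 0\<close> have "n \<bullet> x = n \<bullet> y" by simp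
    then show False using x by simp
  qed
  have S0: "S s \<inter> ?H = {}" if "s = n \<or> s = - n" for s
  proof -
    have "S s \<subseteq> B - {x. n \<bullet> x = n \<bullet> y}" using that by (auto simp: S_def)
    then show ?thesis using sub by blast
  qed
  have dich: "S s \<subseteq> \<Omega> \<or> S s \<inter> \<Omega> = {}" if s: "s = n \<or> s = - n" for s
  proof -
    have "S s = ball y r \<inter> {x. s \<bullet> x > s \<bullet> y}" by (auto simp: S_def B_def)
    then have "connected (S s)" by (simp add: convex_connected convex_Int convex_halfspace_gt)
    moreover have "S s \<inter> frontier \<Omega> = {}" using S0[OF s] \<Omega>(3) by blast
    ultimately show ?thesis using connected_Int_frontier[of "S s" \<Omega>] by blast
  qed
  \<comment> \<open>Points on the plane itself are included: \<Omega> is open, so such a point in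
    \<Omega> would bring points of the opposite half with it.\<close>
  have side: "x \<notin> \<Omega>" if s: "norm s = 1" "S (- s) \<inter> \<Omega> = {}" and x: "x \<in> B" "s \<bullet> x \<le> s \<bullet> y" for s x
  proof
    assume "x \<in> \<Omega>"
    then obtain d where d: "d > 0" "ball x d \<subseteq> \<Omega> \<inter> B"
      using open_contains_ball[of "\<Omega> \<inter> B"] \<Omega>(1) Bo x(1) by blast
    let ?z = "x - (d / 2) *\<^sub>R s"
    have "?z \<in> ball x d" using d(1) s(1) by (simp add: dist_norm)
    moreover have "s \<bullet> ?z < s \<bullet> y" using x(2) d(1) s(1) by (simp add: inner_diff_right dot_square_norm)
    ultimately have "?z \<in> S (- s) \<inter> \<Omega>" using d(2) by (auto simp: S_def)
    then show False using s(2) by blast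
  qed
  have half: "wdiv B ?q ?p" if s: "s = n \<or> s = - n" and S: "S s \<subseteq> \<Omega>" for s
  proof -
    have ns: "norm s = 1" using s n by auto
    have pl: "{x. s \<bullet> x = s \<bullet> y} = {x. n \<bullet> x = n \<bullet> y}" using s by auto
    have sub': "B - {x. s \<bullet> x = s \<bullet> y} \<subseteq> - ?H" using sub by (simp only: pl)
    note int = interface_flux[OF V(1) J(1) A ns Bo _ _ wdiv_mono[OF grad sub'] wdiv_mono[OF Agrad sub'] wdiv_mono[OF curl]]
    have ms: "- s = n \<or> - s = - n" using s by auto
    from dich[OF ms] show ?thesis
    proof
      \<comment> \<open>Only points of the plane could be missing from \<Omega>, which the Lipschitz
        boundary rules out; so the divergence equation is available on the whole ball.\<close>
      assume "S (- s) \<subseteq> \<Omega>"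
      moreover have "B - {x. s \<bullet> x = s \<bullet> y} \<subseteq> S s \<union> S (- s)" by (auto simp: S_def)
      ultimately have "B - {x. s \<bullet> x = s \<bullet> y} \<subseteq> \<Omega>" using S by blast
      moreover have "s \<noteq> 0" using ns by auto
      ultimately have "B \<subseteq> \<Omega>" using lipschitz_no_crack[OF \<Omega>(1,2) Bo] by blast
      then show ?thesis by (intro int[of B] wdiv_mono[OF dv]) auto
    next
      assume e: "S (- s) \<inter> \<Omega> = {}"
      show ?thesis
      proof (rule int[of "S s"])
        show "S s = B \<or> S s = {x \<in> B. s \<bullet> y < s \<bullet> x}" by (simp add: S_def)
        show "V x = 0" if "x \<in> B - S s" for x using that by (intro V(2) side[OF ns e]) (auto simp: S_def)
        show "wdiv (S s) (\<lambda>x. A x *\<^sub>R V x) (\<lambda>x. A x * trace (J x))" by (rule wdiv_mono[OF dv S])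
      qed simp
    qed
  qed
  have "wdiv B ?q ?p"
  proof (cases "S n \<subseteq> \<Omega> \<or> S (- n) \<subseteq> \<Omega>")
    case True then show ?thesis using half by blast
  next
    case False
    then have e: "S (- n) \<inter> \<Omega> = {}" "S (- (- n)) \<inter> \<Omega> = {}" using dich[of n] dich[of "- n"] by auto
    have "x \<notin> \<Omega>" if "x \<in> B" for x
    proof (cases "n \<bullet> x \<le> n \<bullet> y")
      case True then show ?thesis using side[OF n e(1) that] by blast
    next
      case False then show ?thesis using side[of "- n" x] n e(2) that by simp
    qed
    then have "x \<in> B \<Longrightarrow> 0 = ?q x \<and> 0 = ?p x" for x
      using V(2) J(2) by (simp add: flux_def nullq_def trace_def matrix_matrix_mult_def)
    then show ?thesis by (intro wdiv_cong_AE[OF wdiv_zero flux_integrable[OF V(1) J(1) A]] AE_I2) blast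
  qed
  then show ?thesis using r(1) unfolding B_def by blast
qed

section \<open>Assembly over the partition\<close>

lemma l12_curl_of:
  assumes "\<And>i e. l12 (\<lambda>x. J x $ i \<bullet> e)"
  shows "l12 (\<lambda>x. curl_of (J x) $ k)"
proof -
  have J: "l12 (\<lambda>x. J x $ i $ j)" for i j using assms[of i "axis j 1"] by (simp add: inner_axis)
  have "k = 1 \<or> k = 2 \<or> k = 3" by (rule exhaust_3)
  then show ?thesis using l12_diff[OF J J] by (auto simp: curl_of_def vector_3)
qed

lemma sq_integrals:
  assumes J: "\<And>i e. l12 (\<lambda>x. J x $ i \<bullet> e)"
  shows "integrable lborel (\<lambda>x. (norm (J x))\<^sup>2)" "integrable lborel (\<lambda>x. (norm (curl_of (J x)))\<^sup>2)" "l12 (\<lambda>x. trace (J x))"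
proof -
  have Jik: "l12 (\<lambda>x. J x $ i $ k)" for i k using J[of i "axis k 1"] by (simp add: inner_axis)
  show "integrable lborel (\<lambda>x. (norm (J x))\<^sup>2)"
    unfolding norm_matrix_frobenius by (intro Bochner_Integration.integrable_sum l12D(2)[OF Jik])
  show "integrable lborel (\<lambda>x. (norm (curl_of (J x)))\<^sup>2)"
    by (rule l12D(2)[OF l12_norm(1)[OF l12_curl_of[OF J]]])
  show "l12 (\<lambda>x. trace (J x))" unfolding trace_def by (intro l12_sum Jik)
qed

lemma sum_disjoint_family:
  assumes "disjoint_family_on P I" "finite I" "j \<in> I" "x \<in> P j" "\<And>k. k \<in> I \<Longrightarrow> x \<notin> P k \<Longrightarrow> f k = 0"
  shows "sum f I = f j"
proof -
  have "f k = 0" if "k \<in> I - {j}" for k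
    using that assms(1,3,4) by (intro assms(5)) (auto simp: disjoint_family_on_def)
  then have "sum f (I - {j}) = 0" by (intro sum.neutral) blast
  then show ?thesis using sum.remove[OF assms(2,3), of f] by simp
qed

text \<open>A test function equal to 1 near \<open>U\<close> has no gradient where \<open>q\<close>
  lives, so testing with it leaves the integral of \<open>p\<close>.\<close>

lemma wdiv_compact_support:
  assumes w: "wdiv UNIV q p" and U: "bounded U" and z: "\<And>x. x \<notin> U \<Longrightarrow> q x = 0 \<and> p x = 0"
  shows "(\<integral>x. p x \<partial>lborel) = 0"
proof -
  have "compact (closure U)" using U by simp
  then obtain \<psi> V where \<psi>: "\<psi> \<in> tests UNIV" and V: "open V" "closure U \<subseteq> V" "\<And>x. x \<in> V \<Longrightarrow> \<psi> x = 1"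
    using smooth_urysohn[OF _ open_UNIV, of "closure U"] by blast
  have "p x = p x * \<psi> x + q x \<bullet> grad \<psi> x" for x
  proof (cases "x \<in> U")
    case True
    then have x: "x \<in> V" using V(2) closure_subset by blast
    have "(\<psi> has_derivative (\<lambda>_. 0)) (at x)"
      by (rule has_derivative_transform_within_open[OF has_derivative_const V(1) x]) (simp add: V(3))
    then have "frechet_derivative \<psi> (at x) = (\<lambda>_. 0)" by (rule frechet_derivative_at[symmetric])
    then have "grad \<psi> x = 0" by (simp add: grad_def partial_def vec_eq_iff)
    then show ?thesis using V(3)[OF x] by simp
  next
    case False then show ?thesis using z by simp
  qed
  then have "(\<integral>x. p x \<partial>lborel) = (\<integral>x. p x * \<psi> x + q x \<bullet> grad \<psi> x \<partial>lborel)" by presburger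
  also have "\<dots> = 0" using wdivD(3)[OF w] \<psi> tests_C1c by blast
  finally show ?thesis .
qed

text \<open>The weak gradients of the subdomains, each extended by zero, are added up; disjointness
  leaves a single term on each \<open>P j\<close>.\<close>

lemma broken_jacobian:
  assumes I: "finite I" "disjoint_family_on P I" and P: "\<And>j. j \<in> I \<Longrightarrow> open (P j) \<and> bounded (P j) \<and> P j \<subseteq> U"
    and v: "\<And>j. j \<in> I \<Longrightarrow> v \<in> H1_fields (P j)" and V: "represents U v V"
  shows "\<exists>J. (\<forall>i e. l12 (\<lambda>x. J x $ i \<bullet> e)) \<and> (\<forall>x. x \<notin> (\<Union>j\<in>I. P j) \<longrightarrow> J x = 0) \<and>
    (\<forall>j\<in>I. AE x in lborel. x \<in> P j \<longrightarrow> weak_jacobian (P j) v x = J x) \<and>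
    (\<forall>j\<in>I. \<forall>i e. wdiv (P j) (\<lambda>x. V x $ i *\<^sub>R e) (\<lambda>x. J x $ i \<bullet> e))"
proof -
  note rV = represents_facts[OF V]
  have w: "has_weak_grad (P j) (\<lambda>y. v y $ i) (weak_grad (P j) (\<lambda>y. v y $ i))" if j: "j \<in> I" for i j
  proof -
    obtain g where "has_weak_grad (P j) (\<lambda>y. v y $ i) g" using v[OF j] by (auto simp: H1_fields_def H1_def)
    then show ?thesis by (rule has_weak_grad_weak_grad)
  qed
  have "\<exists>g. j \<in> I \<longrightarrow> represents (P j) (weak_grad (P j) (\<lambda>y. v y $ i)) g" for i j
  proof (cases "j \<in> I")
    case True
    have "weak_grad (P j) (\<lambda>y. v y $ i) \<in> L2 (P j)" using w[OF True] by (simp add: has_weak_grad_def)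
    then show ?thesis using L2_rep P[OF True] by blast
  qed simp
  then obtain G where G: "\<And>j i. j \<in> I \<Longrightarrow> represents (P j) (weak_grad (P j) (\<lambda>y. v y $ i)) (G j i)" by metis
  note rG = represents_facts[OF G]
  define J :: "real^3 \<Rightarrow> real^3^3" where "J x = (\<chi> i. \<Sum>j\<in>I. G j i x)" for x
  have J0: "J x = 0" if "x \<notin> (\<Union>j\<in>I. P j)" for x
    using that rG(2) by (simp add: J_def vec_eq_iff)
  have JP: "J x $ i = G j i x" if j: "j \<in> I" "x \<in> P j" for j i x
    unfolding J_def using sum_disjoint_family[OF I(2,1) j, of "\<lambda>k. G k i x"] rG(2) by simp
  have Jl: "l12 (\<lambda>x. J x $ i \<bullet> e)" for i e
    by (simp add: J_def inner_sum_left) (intro l12_sum rG(6))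
  have wj: "AE x in lborel. x \<in> P j \<longrightarrow> weak_jacobian (P j) v x = J x" if j: "j \<in> I" for j
  proof -
    have "AE x in lborel. \<forall>i\<in>UNIV. x \<in> P j \<longrightarrow> weak_grad (P j) (\<lambda>y. v y $ i) x = G j i x"
      by (rule AE_finite_allI[OF finite rG(3)[OF j]])
    then show ?thesis by eventually_elim (simp add: weak_jacobian_def vec_eq_iff JP[OF j])
  qed
  have wd: "wdiv (P j) (\<lambda>x. V x $ i *\<^sub>R e) (\<lambda>x. J x $ i \<bullet> e)" if j: "j \<in> I" for j i e
  proof -
    have Pb: "P j \<in> sets borel" and PU: "P j \<subseteq> U" using P[OF j] by auto
    \<comment> \<open>\<open>weak_grad_wdiv\<close> asks for a representative that vanishes off
      \<open>P j\<close>, whereas \<open>V\<close> lives on all of \<open>U\<close>.\<close>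
    let ?u = "\<lambda>x. indicator (P j) x * V x $ i"
    have u: "l12 ?u" by (rule l12_bounded_mult[OF rV(1), of _ 1]) (use Pb in \<open>auto simp: indicator_def\<close>)
    have ae: "AE x in lborel. x \<in> P j \<longrightarrow> v x $ i = ?u x"
      using rV(3) by eventually_elim (use PU in auto)
    have "wdiv (P j) (\<lambda>x. ?u x *\<^sub>R e) (\<lambda>x. G j i x \<bullet> e)"
      by (rule weak_grad_wdiv[OF _ w[OF j] u _ ae G[OF j]]) (use P[OF j] in auto)
    then show ?thesis
    proof (rule wdiv_cong_AE)
      show "integrable lborel (\<lambda>x. V x $ i *\<^sub>R e)" using l12D(1)[OF rV(1)] by simp
      show "integrable lborel (\<lambda>x. J x $ i \<bullet> e)" by (rule l12D(1)[OF Jl])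
    qed (rule AE_I2, simp add: JP[OF j])
  qed
  show ?thesis using Jl J0 wj wd by blast
qed

text \<open>A point in the closure of \<open>P j\<close> that avoids the planes of its faces is
  interior to \<open>P j\<close>; so the subdomains cover \<open>U\<close> up to the planes.\<close>

lemma partition_planes:
  assumes "polyhedral_domain U" "polyhedral_partition U m P"
  shows "\<exists>PL. finite PL \<and> (\<forall>n c. (n, c) \<in> PL \<longrightarrow> n \<noteq> 0) \<and> frontier U \<subseteq> (\<Union>(n, c)\<in>PL. {x. n \<bullet> x = c}) \<and>
    (\<forall>x\<in>U. x \<notin> (\<Union>(n, c)\<in>PL. {x. n \<bullet> x = c}) \<longrightarrow> (\<exists>j\<in>{1..m}. x \<in> P j))"
proof -
  obtain PL0 where PL0: "finite PL0" "\<And>n c. (n, c) \<in> PL0 \<Longrightarrow> n \<noteq> 0"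
    "frontier U \<subseteq> (\<Union>(n, c)\<in>PL0. {x. n \<bullet> x = c})"
    using polyhedral_planes[OF assms(1)] by blast
  have "\<exists>PL. finite PL \<and> (\<forall>n c. (n, c) \<in> PL \<longrightarrow> n \<noteq> 0) \<and> frontier (P j) \<subseteq> (\<Union>(n, c)\<in>PL. {x. n \<bullet> x = c})"
    if "j \<in> {1..m}" for j
    using that assms(2) by (intro polyhedral_planes) (auto simp: polyhedral_partition_def)
  then obtain PL1 where PL1: "\<And>j. j \<in> {1..m} \<Longrightarrow> finite (PL1 j) \<and> (\<forall>n c. (n, c) \<in> PL1 j \<longrightarrow> n \<noteq> 0) \<and>
      frontier (P j) \<subseteq> (\<Union>(n, c)\<in>PL1 j. {x. n \<bullet> x = c})"
    by metis
  let ?PL = "PL0 \<union> (\<Union>j\<in>{1..m}. PL1 j)"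
  have "finite ?PL" using PL0(1) PL1 by blast
  moreover have "\<forall>n c. (n, c) \<in> ?PL \<longrightarrow> n \<noteq> 0" using PL0(2) PL1 by blast
  moreover have "frontier U \<subseteq> (\<Union>(n, c)\<in>?PL. {x. n \<bullet> x = c})" using PL0(3) by blast
  moreover have "\<exists>j\<in>{1..m}. x \<in> P j" if x: "x \<in> U" "x \<notin> (\<Union>(n, c)\<in>?PL. {x. n \<bullet> x = c})" for x
  proof -
    have "x \<in> closure U" using x(1) closure_subset by blast
    also have "closure U = (\<Union>j\<in>{1..m}. closure (P j))" using assms(2) by (simp add: polyhedral_partition_def)
    finally obtain j where j: "j \<in> {1..m}" "x \<in> closure (P j)" by blast
    have "x \<notin> frontier (P j)" using PL1[OF j(1)] x(2) j(1) by blast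
    then have "x \<in> P j" using j(2) interior_subset[of "P j"] unfolding frontier_def by blast
    then show ?thesis using j(1) by blast
  qed
  ultimately show ?thesis by (intro exI[of _ ?PL] conjI ballI impI) simp_all
qed

theorem lemmaA4:
  fixes \<Omega> :: "(real^3) set" and m :: nat and \<P> :: "nat \<Rightarrow> (real^3) set"
    and \<alpha> :: "real^3 \<Rightarrow> real" and v :: "real^3 \<Rightarrow> real^3"
  assumes "polyhedral_domain \<Omega>" and "lipschitz_boundary \<Omega>"
    and "polyhedral_partition \<Omega> m \<P>"
    and "\<forall>x\<in>\<Omega>. \<alpha> x > 0" and "\<forall>j\<in>{1..m}. \<alpha> constant_on \<P> j"
    and "v \<in> X_space \<Omega> \<alpha> \<inter> PH1 \<Omega> m \<P>"
  shows "(\<Sum>j=1..m. LINT x|lebesgue_on (\<P> j). \<alpha> x * (norm (weak_jacobian (\<P> j) v x))\<^sup>2) =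
    (LINT x|lebesgue_on \<Omega>. \<alpha> x * (norm (weak_curl \<Omega> v x))\<^sup>2 +
        inverse (\<alpha> x) * (weak_div \<Omega> (\<lambda>y. \<alpha> y *\<^sub>R v y) x)\<^sup>2)"
proof -
  have \<Omega>: "open \<Omega>" "bounded \<Omega>" using assms(1) by (auto simp: polyhedral_domain_def)
  have P: "open (\<P> j) \<and> bounded (\<P> j) \<and> \<P> j \<subseteq> \<Omega>" if "j \<in> {1..m}" for j
    using that assms(3) by (auto simp: polyhedral_partition_def polyhedral_domain_def)
  have disj: "disjoint_family_on \<P> {1..m}" using assms(3) by (simp add: polyhedral_partition_def)
  have vX: "v \<in> H0_curl \<Omega>" "\<exists>d. has_weak_div \<Omega> (\<lambda>x. \<alpha> x *\<^sub>R v x) d" and vP: "v \<in> L2 \<Omega>" "\<And>j. j \<in> {1..m} \<Longrightarrow> v \<in> H1_fields (\<P> j)"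
    using assms(6) by (auto simp: X_space_def PH1_def)
  obtain PL where PL: "finite PL" "\<And>n c. (n, c) \<in> PL \<Longrightarrow> n \<noteq> 0"
    "frontier \<Omega> \<subseteq> (\<Union>(n, c)\<in>PL. {x. n \<bullet> x = c})"
    "\<And>x. x \<in> \<Omega> \<Longrightarrow> x \<notin> (\<Union>(n, c)\<in>PL. {x. n \<bullet> x = c}) \<Longrightarrow> \<exists>j\<in>{1..m}. x \<in> \<P> j"
    using partition_planes[OF assms(1,3)] by blast
  let ?H = "\<Union>(n, c)\<in>PL. {x. n \<bullet> x = c}"
  have aeH: "AE x in lborel. x \<notin> ?H"
  proof -
    have "AE x in lborel. \<forall>nc\<in>PL. fst nc \<bullet> x \<noteq> snd nc"
      using PL(2) by (intro AE_finite_allI[OF PL(1)] AE_not_hyperplane) auto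
    then show ?thesis by eventually_elim auto
  qed
  \<comment> \<open>The subdomains cover \<Omega> up to a null set, so claims that hold almost
    everywhere may be checked on each of them.\<close>
  have aeI: "AE x in lborel. x \<in> \<Omega> \<longrightarrow> Q x" if "\<And>j. j \<in> {1..m} \<Longrightarrow> AE x in lborel. x \<in> \<P> j \<longrightarrow> Q x" for Q
  proof -
    have "AE x in lborel. \<forall>j\<in>{1..m}. x \<in> \<P> j \<longrightarrow> Q x" by (rule AE_finite_allI) (use that in auto)
    with aeH show ?thesis by eventually_elim (use PL(4) in blast)
  qed

  obtain V where V: "represents \<Omega> v V" using L2_rep[OF \<Omega> vP(1)] by blast
  note rV = represents_facts[OF V]
  have "has_weak_curl \<Omega> v (weak_curl \<Omega> v)"
    using vX(1) has_weak_curl_weak_curl by (auto simp: H0_curl_def H_curl_def)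
  then have "weak_curl \<Omega> v \<in> L2 \<Omega>" by (simp add: has_weak_curl_def)
  then obtain W where W: "represents \<Omega> (weak_curl \<Omega> v) W" using L2_rep[OF \<Omega>] by blast
  note rW = represents_facts[OF W]
  let ?d = "weak_div \<Omega> (\<lambda>y. \<alpha> y *\<^sub>R v y)"
  have wd: "has_weak_div \<Omega> (\<lambda>x. \<alpha> x *\<^sub>R v x) ?d" using vX(2) has_weak_div_weak_div by blast
  then have "?d \<in> L2 \<Omega>" by (simp add: has_weak_div_def)
  then obtain D where D: "l12 D" "\<And>x. x \<notin> \<Omega> \<Longrightarrow> D x = 0" "AE x in lborel. x \<in> \<Omega> \<longrightarrow> ?d x = D x"
    using L2_real_rep[OF \<Omega>] by blast
  obtain J where J: "\<And>i e. l12 (\<lambda>x. J x $ i \<bullet> e)" "\<And>x. x \<notin> (\<Union>j\<in>{1..m}. \<P> j) \<Longrightarrow> J x = 0"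
    "\<And>j. j \<in> {1..m} \<Longrightarrow> AE x in lborel. x \<in> \<P> j \<longrightarrow> weak_jacobian (\<P> j) v x = J x"
    and gradP: "\<And>j i e. j \<in> {1..m} \<Longrightarrow> wdiv (\<P> j) (\<lambda>x. V x $ i *\<^sub>R e) (\<lambda>x. J x $ i \<bullet> e)"
    using broken_jacobian[OF finite_atLeastAtMost disj P vP(2) V] by blast
  have J\<Omega>: "J x = 0" if "x \<notin> \<Omega>" for x using that J(2) P by blast

  have "\<exists>c. \<forall>x\<in>\<P> j. \<alpha> x = c" if "j \<in> {1..m}" for j using that assms(5) by (auto simp: constant_on_def)
  then obtain c where c: "\<And>j x. j \<in> {1..m} \<Longrightarrow> x \<in> \<P> j \<Longrightarrow> \<alpha> x = c j" by metis
  \<comment> \<open>A bounded Borel version of \<alpha>. Outside the subdomains \<alpha> is not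
    controlled, while \<open>A\<close> is 0 there.\<close>
  define A where "A x = (\<Sum>j\<in>{1..m}. c j * indicator (\<P> j) x)" for x
  have AP: "A x = c j" if "j \<in> {1..m}" "x \<in> \<P> j" for j x
    unfolding A_def using sum_disjoint_family[OF disj finite_atLeastAtMost that, of "\<lambda>k. c k * indicator (\<P> k) x"] that(2) by simp
  have AP': "A x = \<alpha> x" if "j \<in> {1..m}" "x \<in> \<P> j" for j x using AP[OF that] c[OF that] by simp
  have Ab: "A \<in> borel_measurable borel"
    unfolding A_def using P by (intro borel_measurable_sum borel_measurable_times borel_measurable_indicator borel_measurable_const) auto
  have AM: "\<bar>A x\<bar> \<le> (\<Sum>j\<in>{1..m}. \<bar>c j\<bar>)" for x
    unfolding A_def by (rule order_trans[OF sum_abs]) (intro sum_mono, auto simp: indicator_def abs_mult)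
  have Apos: "AE x in lborel. x \<in> \<Omega> \<longrightarrow> A x = \<alpha> x \<and> \<alpha> x > 0"
    by (rule aeI, rule AE_I2) (use AP' assms(4) P in blast)

  \<comment> \<open>Off the planes a point lies in a subdomain or outside the closure of \<Omega>,
    where all fields are 0; so the equations on the subdomains combine.\<close>
  have piece: "wdiv (- ?H) q p" if q: "integrable lborel q" "integrable lborel p" "\<And>x. x \<notin> \<Omega> \<Longrightarrow> q x = 0 \<and> p x = 0"
    and qp: "\<And>j. j \<in> {1..m} \<Longrightarrow> wdiv (\<P> j) q p" for q p
  proof (rule wdiv_local[OF q(2,1)])
    fix x assume x: "x \<in> - ?H"
    show "\<exists>r>0. wdiv (ball x r) q p"
    proof (cases "x \<in> \<Omega>")
      case True
      then obtain j where j: "j \<in> {1..m}" "x \<in> \<P> j" using PL(4) x by blast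
      then obtain r where "r > 0" "ball x r \<subseteq> \<P> j" using P[OF j(1)] open_contains_ball by blast
      then show ?thesis using wdiv_mono[OF qp[OF j(1)]] by blast
    next
      case False
      have "x \<notin> frontier \<Omega>" using PL(3) x by blast
      then have "x \<in> - closure \<Omega>" using False interior_open[OF \<Omega>(1)] by (simp add: frontier_def)
      moreover have "open (- closure \<Omega>)" by (intro open_Compl closed_closure)
      ultimately obtain r where r: "r > 0" "ball x r \<subseteq> - closure \<Omega>" using open_contains_ball by blast
      have "wdiv (ball x r) q p"
      proof (rule wdiv_cong_AE[OF wdiv_zero q(1,2)], rule AE_I2, rule impI)
        fix y assume "y \<in> ball x r"
        then have "y \<notin> \<Omega>" using r(2) closure_subset by blast
        then show "0 = q y \<and> 0 = p y" using q(3) by simp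
      qed
      then show ?thesis using r(1) by blast
    qed
  qed
  have iAV: "integrable lborel (\<lambda>x. (A x * V x $ i) *\<^sub>R e)" for i and e :: "real^3"
    using l12D(1)[OF l12_bounded_mult[OF rV(1) Ab AM]] by simp
  have iAJ: "integrable lborel (\<lambda>x. A x * (J x $ i \<bullet> e))" for i e
    by (rule l12D(1)[OF l12_bounded_mult[OF J(1) Ab AM]])
  have AgradP: "wdiv (\<P> j) (\<lambda>x. (A x * V x $ i) *\<^sub>R e) (\<lambda>x. A x * (J x $ i \<bullet> e))" if j: "j \<in> {1..m}" for j i e
  proof (rule wdiv_cong_AE[OF wdiv_scale[OF gradP[OF j], of "c j"] iAV iAJ], rule AE_I2, rule impI)
    fix x assume "x \<in> \<P> j"
    then show "c j *\<^sub>R V x $ i *\<^sub>R e = (A x * V x $ i) *\<^sub>R e \<and> c j * (J x $ i \<bullet> e) = A x * (J x $ i \<bullet> e)"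
      using AP[OF j] by simp
  qed
  have grad: "wdiv (- ?H) (\<lambda>x. V x $ i *\<^sub>R e) (\<lambda>x. J x $ i \<bullet> e)" for i e
    by (rule piece[OF _ _ _ gradP]) (use l12D(1)[OF rV(1)] l12D(1)[OF J(1)] rV(2) J\<Omega> in auto)
  have Agrad: "wdiv (- ?H) (\<lambda>x. (A x * V x $ i) *\<^sub>R e) (\<lambda>x. A x * (J x $ i \<bullet> e))" for i e
    by (rule piece[OF iAV iAJ _ AgradP]) (use rV(2) J\<Omega> in auto)

  have lc: "l12 (\<lambda>x. curl_of (J x) $ k)" for k by (rule l12_curl_of[OF J(1)])
  have curlW: "wdiv UNIV (\<lambda>x. cross3 a (V x)) (\<lambda>x. - (W x \<bullet> a))" for a
    by (rule H0_curl_wdiv[OF \<Omega> vX(1) V W])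
  \<comment> \<open>On each subdomain the weak divergence of \<open>cross3 a (V x)\<close> is given
    once by \<open>W\<close> and once by \<open>curl_of (J x)\<close>, and it is unique.\<close>
  have Wa: "AE x in lborel. x \<in> \<Omega> \<longrightarrow> W x \<bullet> a = curl_of (J x) \<bullet> a" for a
  proof (rule aeI)
    fix j assume j: "j \<in> {1..m}"
    have n: "l12 (\<lambda>x. - f x)" if "l12 f" for f using l12_cmult[OF that, of "-1"] by simp
    have "AE x in lborel. x \<in> \<P> j \<longrightarrow> - (W x \<bullet> a) = - (curl_of (J x) \<bullet> a)"
    proof (rule wdiv_unique)
      show "wdiv (\<P> j) (\<lambda>x. cross3 a (V x)) (\<lambda>x. - (W x \<bullet> a))" by (rule wdiv_mono[OF curlW]) simp
      show "wdiv (\<P> j) (\<lambda>x. cross3 a (V x)) (\<lambda>x. - (curl_of (J x) \<bullet> a))" by (rule wdiv_cross[OF gradP[OF j]])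
      show "l12 (\<lambda>x. - (curl_of (J x) \<bullet> a))" by (intro n l12_component_inner lc)
      show "l12 (\<lambda>x. - (W x \<bullet> a))" by (intro n rW(6))
    qed (use P[OF j] in blast)
    then show "AE x in lborel. x \<in> \<P> j \<longrightarrow> W x \<bullet> a = curl_of (J x) \<bullet> a" by simp
  qed
  have WJ: "AE x in lborel. x \<in> \<Omega> \<longrightarrow> W x = curl_of (J x)"
  proof -
    have "AE x in lborel. \<forall>i\<in>UNIV. x \<in> \<Omega> \<longrightarrow> W x \<bullet> axis i 1 = curl_of (J x) \<bullet> axis i 1"
      by (rule AE_finite_allI[OF finite Wa])
    then show ?thesis by eventually_elim (simp add: vec_eq_iff inner_axis)
  qed
  \<comment> \<open>The trace condition gave the equation for \<open>W\<close> in all of space;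
    there \<open>W\<close> may now be replaced by the curl of the broken gradient.\<close>
  have curl: "wdiv UNIV (\<lambda>x. cross3 a (V x)) (\<lambda>x. - (curl_of (J x) \<bullet> a))" for a
  proof (rule wdiv_cong_AE[OF curlW])
    show "integrable lborel (\<lambda>x. cross3 a (V x))" by (rule wdivD(1)[OF curlW])
    show "integrable lborel (\<lambda>x. - (curl_of (J x) \<bullet> a))"
      using l12D(1)[OF l12_component_inner[OF lc]] by simp
    show "AE x in lborel. x \<in> UNIV \<longrightarrow> cross3 a (V x) = cross3 a (V x) \<and> - (W x \<bullet> a) = - (curl_of (J x) \<bullet> a)"
      using WJ
    proof eventually_elim
      case (elim x)
      have "curl_of (0 :: real^3^3) = 0" by (simp add: curl_of_def vec_eq_iff forall_3 vector_3)
      then show ?case using elim rW(2)[of x] J\<Omega>[of x] by (cases "x \<in> \<Omega>") auto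
    qed
  qed

  note lt = l12_bounded_mult[OF sq_integrals(3)[OF J(1)] Ab AM]
  have iAVv: "integrable lborel (\<lambda>x. A x *\<^sub>R V x)"
    by (rule l12_norm(2)) (simp, rule l12_bounded_mult[OF rV(1) Ab AM])
  have divD: "wdiv \<Omega> (\<lambda>x. A x *\<^sub>R V x) D"
  proof (rule weak_div_wdiv[OF \<Omega>(1) wd iAVv _ _ D])
    show "A x *\<^sub>R V x = 0" if "x \<notin> \<Omega>" for x using rV(2)[OF that] by simp
    show "AE x in lborel. x \<in> \<Omega> \<longrightarrow> \<alpha> x *\<^sub>R v x = A x *\<^sub>R V x"
      using Apos rV(3) by eventually_elim simp
  qed
  \<comment> \<open>The same uniqueness identifies the weak divergence with \<open>A\<close> times
    the trace of \<open>J\<close>.\<close>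
  have DJ: "AE x in lborel. x \<in> \<Omega> \<longrightarrow> D x = A x * trace (J x)"
  proof (rule aeI, rule wdiv_unique[OF _ _ _ D(1) lt])
    fix j assume j: "j \<in> {1..m}"
    show "wdiv (\<P> j) (\<lambda>x. A x *\<^sub>R V x) D" using wdiv_mono[OF divD] P[OF j] by blast
    show "wdiv (\<P> j) (\<lambda>x. A x *\<^sub>R V x) (\<lambda>x. A x * trace (J x))" by (rule wdiv_trace[OF AgradP[OF j]])
    show "open (\<P> j)" using P[OF j] by blast
  qed
  have dv: "wdiv \<Omega> (\<lambda>x. A x *\<^sub>R V x) (\<lambda>x. A x * trace (J x))"
    by (rule wdiv_cong_AE[OF divD iAVv l12D(1)[OF lt]]) (use DJ in simp)

  have nul0: "nullq (0 :: real^3^3) = 0" by (simp add: nullq_def trace_def matrix_matrix_mult_def)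
  have "wdiv UNIV (\<lambda>x. A x *\<^sub>R flux (J x) (V x)) (\<lambda>x. A x * nullq (J x))"
    by (rule flux_global[OF PL(1,2) rV(1) J(1) Ab AM grad
          flux_at_face[OF PL(1,2) \<Omega>(1) assms(2) PL(3) rV(1,2) J(1) J\<Omega> Ab AM grad Agrad curl dv]])
  \<comment> \<open>The flux vanishes off the bounded set \<Omega>, so the null Lagrangian has
    integral 0 and can be added to the right-hand side below.\<close>
  then have null: "(\<integral>x. A x * nullq (J x) \<partial>lborel) = 0"
    by (rule wdiv_compact_support[OF _ \<Omega>(2)]) (simp add: rV(2) J\<Omega> nul0 flux_def)

  have iA: "integrable lborel (\<lambda>x. A x * f x)" if "integrable lborel f" for f
  proof -
    have "A \<in> borel_measurable lborel" using Ab by simp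
    from integrable_mult_bounded[OF that this AM] show ?thesis by (simp add: mult.commute)
  qed
  let ?F1 = "\<lambda>x. A x * (norm (curl_of (J x)))\<^sup>2" and ?F2 = "\<lambda>x. A x * (trace (J x))\<^sup>2"
  note i1 = iA[OF sq_integrals(2)[OF J(1)]] and i2 = iA[OF l12D(2)[OF sq_integrals(3)[OF J(1)]]]
    and i3 = flux_integrable(2)[OF rV(1) J(1) Ab AM] and i0 = iA[OF sq_integrals(1)[OF J(1)]]
  have "(LINT x|lebesgue_on \<Omega>. \<alpha> x * (norm (weak_curl \<Omega> v x))\<^sup>2 + inverse (\<alpha> x) * (?d x)\<^sup>2)
      = (\<integral>x. ?F1 x + ?F2 x \<partial>lborel)"
  proof (rule lebesgue_on_AE(1))
    show "(\<lambda>x. ?F1 x + ?F2 x) \<in> borel_measurable borel"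
      using borel_measurable_integrable[OF Bochner_Integration.integrable_add[OF i1 i2]] by simp
    show "AE x in lborel. x \<in> \<Omega> \<longrightarrow> \<alpha> x * (norm (weak_curl \<Omega> v x))\<^sup>2 + inverse (\<alpha> x) * (?d x)\<^sup>2 = ?F1 x + ?F2 x"
      using Apos rW(3) WJ D(3) DJ
    proof eventually_elim
      case (elim x)
      show ?case
      proof
        assume "x \<in> \<Omega>"
        then have e: "A x = \<alpha> x" "\<alpha> x > 0" "weak_curl \<Omega> v x = curl_of (J x)" "?d x = \<alpha> x * trace (J x)" using elim by auto
        \<comment> \<open>The inverse cancels one of the two factors \<alpha> in the square of the
          divergence of \<alpha> v.\<close>
        have "inverse (\<alpha> x) * (\<alpha> x * trace (J x))\<^sup>2 = \<alpha> x * (trace (J x))\<^sup>2"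
          using e(2) by (simp add: power2_eq_square)
        then show "\<alpha> x * (norm (weak_curl \<Omega> v x))\<^sup>2 + inverse (\<alpha> x) * (?d x)\<^sup>2 = ?F1 x + ?F2 x"
          by (simp only: e(1,3,4))
      qed
    qed
    show "?F1 x + ?F2 x = 0" if "x \<notin> \<Omega>" for x
      using J\<Omega>[OF that] by (simp add: curl_of_def trace_def norm_vec_def L2_set_def sum_3 vector_3)
  qed (use \<Omega> in simp)
  also have "\<dots> = (\<integral>x. ?F1 x + ?F2 x \<partial>lborel) + (\<integral>x. A x * nullq (J x) \<partial>lborel)" using null by simp
  also have "\<dots> = (\<integral>x. (?F1 x + ?F2 x) + A x * nullq (J x) \<partial>lborel)"
    by (rule Bochner_Integration.integral_add[OF Bochner_Integration.integrable_add[OF i1 i2] i3, symmetric])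
  also have "\<dots> = (\<integral>x. A x * (norm (J x))\<^sup>2 \<partial>lborel)"
    by (rule Bochner_Integration.integral_cong) (simp_all add: frobenius_split algebra_simps)
  also have "\<dots> = (\<integral>x. (\<Sum>j=1..m. indicator (\<P> j) x * (A x * (norm (J x))\<^sup>2)) \<partial>lborel)"
  proof (rule Bochner_Integration.integral_cong[OF refl])
    fix x
    show "A x * (norm (J x))\<^sup>2 = (\<Sum>j=1..m. indicator (\<P> j) x * (A x * (norm (J x))\<^sup>2))"
    proof (cases "\<exists>j\<in>{1..m}. x \<in> \<P> j")
      case True
      then obtain j where j: "j \<in> {1..m}" "x \<in> \<P> j" by blast
      show ?thesis
        using sum_disjoint_family[OF disj finite_atLeastAtMost j, of "\<lambda>k. indicator (\<P> k) x * (A x * (norm (J x))\<^sup>2)"] j(2) by simp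
    next
      case False
      then have "J x = 0" by (intro J(2)) blast
      then show ?thesis by simp
    qed
  qed
  also have "\<dots> = (\<Sum>j=1..m. \<integral>x. indicator (\<P> j) x * (A x * (norm (J x))\<^sup>2) \<partial>lborel)"
  proof (rule Bochner_Integration.integral_sum)
    fix j assume "j \<in> {1..m}"
    then have "\<P> j \<in> sets lborel" using P by auto
    then show "integrable lborel (\<lambda>x. indicator (\<P> j) x * (A x * (norm (J x))\<^sup>2))"
      using integrable_mult_indicator[OF _ i0] by simp
  qed
  also have "\<dots> = (\<Sum>j=1..m. LINT x|lebesgue_on (\<P> j). \<alpha> x * (norm (weak_jacobian (\<P> j) v x))\<^sup>2)"
  proof (rule sum.cong[OF refl])
    fix j assume j: "j \<in> {1..m}"
    then have Pb: "\<P> j \<in> sets borel" using P by auto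
    have "(\<lambda>x. A x * (norm (J x))\<^sup>2) \<in> borel_measurable borel" using borel_measurable_integrable[OF i0] by simp
    from borel_measurable_times[OF borel_measurable_indicator[OF Pb] this]
    have m: "(\<lambda>x. indicator (\<P> j) x * (A x * (norm (J x))\<^sup>2)) \<in> borel_measurable borel" .
    have "AE x in lborel. x \<in> \<P> j \<longrightarrow> \<alpha> x * (norm (weak_jacobian (\<P> j) v x))\<^sup>2 = indicator (\<P> j) x * (A x * (norm (J x))\<^sup>2)"
      using J(3)[OF j] by eventually_elim (use AP'[OF j] in simp)
    from lebesgue_on_AE(1)[OF Pb m this]
    show "(\<integral>x. indicator (\<P> j) x * (A x * (norm (J x))\<^sup>2) \<partial>lborel) =
        (LINT x|lebesgue_on (\<P> j). \<alpha> x * (norm (weak_jacobian (\<P> j) v x))\<^sup>2)" by simp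
  qed
  finally show ?thesis by (rule sym)
qed

end
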